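(* Let $(\mathbf K,\mathbf V,\mathbf P)$ be an ordered valued subfield of a real closed valued field $(\mathbf R,\mathbf V_{\mathbf R},\mathbf P_{\mathbf R})$. Let $L=(F_1,\ldots,F_k)$ be a list of parametrized univariate polynomials of degrees $d_1,\ldots,d_k$ in some variable $X$ (i.e. polynomials in $X$ whose coefficients are polynomials over $\mathbf K$ in parameters). Let $M$ be a positive integer. Run the algorithm RCVF2, opening two branches in the computation any time one has to know whether a given element is zero or nonzero when computing a remainder, and replacing remainders by pseudoremainders in order to avoid denominators. Let $(c_j)$ be the family of all "constants" in all the families $L'$ that appear at the leaves of the tree (these constants are $\mathbf K$-polynomials in the parameters). Finally, when applying the description of $v(P(x))$ on intervals given by generalized Taylor formulae in order to get the output of RCVF3 from the one of RCVF2, open three branches any time one has to know the sign of some $\mathbb Z$-linear combination of the $v(c_j)$'s. Then this global parametrized algorithm is finite and therefore gives a finite number of possibilities for its output: the $M$-complete tableau of vsc's for $L'$. Moreover, these outputs depend on the following data: - the signs of the "constants" $c_j$; - the sign tests inside a finite subset of the subgroup generated by the $v(c_j)$'s (which are exactly divisibility tests between monomials in the $c_j$'s).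
   Context: An ordered valued field is a triple $(\mathbf K,\mathbf V,\mathbf P)$ where $\mathbf K$ is an ordered field with set of nonnegative elements $\mathbf P$ and $\mathbf V\subsetneq\mathbf K$ is a valuation ring that is convex (if $x,y\in\mathbf P$ and $x+y\in\mathbf V$ then $x\in\mathbf V$). The valuation is $v$, $v(0)=+\infty$. A real closed valued field is an ordered valued field whose underlying field is real closed. $\mathbf K^{\mathrm{rc}}$ is the real closure of $\mathbf K$, valued by the convex hull of $\mathbf V$. The complete tableau of signs of a finite family $(F_j)$ of univariate polynomials consists of the ordered list $(x_k)_{k=1,\ldots,r}$ of all roots of all $F_j$'s in the real closure and the signs of all $F_j$'s at the $x_k$'s and on the intervals they delimit; the complete tableau of vsc's (valued sign conditions) consists of this together with all valuations $v(x_{k+1}-x_k)$ and $v(F_j(x_k))$. For a finite family $(y_j)$, the $M$-complete system of vsc's gives all signs $\operatorname{sign}(y_j)$ and all signs $\operatorname{sign}(\sum_{y_j\ne0}\ell_jv(y_j))$ for $\ell\in\{-M,\ldots,M\}^{\{j:y_j\neq0\}}$. For $a<b$: $\mathbb J^{+}(a,b,\alpha)=\{a+t(b-a):0<t,v(t)=\alpha\}$ ($\alpha>0$), $\mathbb J^{+}(a,b,\alpha,\beta)=\{a+t(b-a):0<t,\alpha<v(t)<\beta\}$ ($0\le\alpha<\beta\le\infty$); $\mathbb J^-$ likewise with $b-t(b-a)$; $\mathbb J(a,b)=\{a+t(b-a):0<t<1,v(t)=v(1-t)=0\}$; $\mathbb I^{\pm}(a,\alpha)=\{a\pm t:0<t,v(t)=\alpha\}$,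 $\mathbb I^{\pm}(a,\alpha,\beta)=\{a\pm t:0<t,\alpha<v(t)<\beta\}$. For a finite family $(F_j)_{j\in J}$ of univariate polynomials stable under derivation, the $M$-complete tableau of vsc's is the discrete data: (i) the ordered list $(x_k)_{k=1,\ldots,r}$ of all roots of the $F_j$'s (as names); (ii) for each $k$, the $M$-complete system of vsc's for $(F_j(x_k))_j$; (iii) for each $k<r$, the $M$-complete system of vsc's for $(F_j(x))_j$, $x\in\mathbb J(x_k,x_{k+1})$, a partition of $\mathbb J^+(x_k,x_{k+1},0,\infty)$ into intervals $\mathbb J^+(x_k,x_{k+1},\alpha_{k,i},\alpha_{k,i+1})$ ($0\le i\le n_k$) and $\mathbb J^+(x_k,x_{k+1},\alpha_{k,i})$ ($1\le i\le n_k$), with $\alpha_{k,0}=0$, $\alpha_{k,n_k+1}=\infty$, with on each interval of the partition the $M$-complete system of vsc's for $(F_j(x))_j$, which is constant there, and similar data for $\mathbb J^-(x_k,x_{k+1},0,\infty)$; (iv) similar data for $\mathbb I^-(x_1,-\infty,\infty)$ and $\mathbb I^+(x_r,-\infty,\infty)$. The $\alpha_{k,i}$ are purely formal, only $n_k$ is relevant. Description of $v(P(x))$ by generalized Taylor formulae: if $P$ and all its derivatives have constant sign on $]a,b[$, then for $x=a+t_1(b-a)\in[a,b]$, $v(P(x))=\min(\nu_0,\nu_1+\delta+\tau',\nu_2+2\delta+k_2\tau',\ldots,\nu_d+d\delta+k_d\tau')$, where $d=\deg P$, $\delta=v(b-a)$, $\tau'$ is $v(t_1)$ or $v(1-t_1)$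 according to whether the signs of $P,P'$ on $]a,b[$ agree or not, $\nu_j$ is the valuation of $P^{(j)}/j!$ at $a$ or at $b$ (depending on signs), and $1\le k_j\le j$ are integers depending only on the signs. On unbounded intervals the ordinary Taylor formula is used. Algorithm RCVF2 (unparametrized). Given a finite list $L$ of univariate polynomials, form the finite family $L'$ generated by $L$ under $P\mapsto P'$ and $(P,Q)\mapsto\mathrm{Rem}(P,Q)$ for $\deg P\ge\deg Q\ge1$; number its elements $P_1,P_2,\ldots$ with nondecreasing degrees and compute successively the complete tableau of vsc's of $(P_1,\ldots,P_m)$ for increasing $m$. To pass to $m+1$, with $P=P_{m+1}$: at a root $a$ of $Q=P_\ell$, $\ell\le m$, use $P(a)=R(a)$ with $R=\mathrm{Rem}(P,Q)$ for the sign and valuation; new roots of $P$ are located by sign changes (as $P$ is strictly monotonic on each interval of the tableau); for a new root $x=a+t_1(b-a)$, $v(t_1)$ and $v(1-t_1)$ are obtained by solving the piecewise linear equation coming from generalized Taylor formulae, and then the $v(P_j(x))$, $j\le m$, are given by the displayed description. The "constants" are the elements of $L'$ of degree $\le0$. All valuations obtained are $\mathbb Q$-semilinear functions of the valuations of the constants (built by $\mathbb Q$-linear combinations, $\min$, $\max$). Algorithm RCVF3: run RCVF2, then use the displayed description on each interval to get the $M$-complete tableau (the functions $v(P_j(x))$ are piecewise linear in $v(t)$, where $t$ is $(x-x_h)/(x_{h+1}-x_h)$, $(x_{h+1}-x)/(x_{h+1}-x_h)$, or, on the unbounded intervals, the distance to the extreme root; the break points and the points where $\mathbb Z$-linear combinations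 of the $v(P_j(x))$ change sign are computed). In the parametrized version the branching produces a tree with a family $L'$ at each leaf. *)

theory Defs
  imports
    "HOL-Computational_Algebra.Polynomial"
    "HOL-Library.Poly_Mapping"
    "HOL-Library.Extended"
    "HOL-Library.Product_Plus"
    "HOL-Library.Monad_Syntax"
begin

section \<open>Ordered valued fields\<close>

text \<open>An ordered valued field is given as a subfield of an ambient ordered field with the induced
  order (the ambient field itself being the case \<open>UNIV\<close>); the nonnegative cone is then
  \<open>{x \<in> K. 0 \<le> x}\<close>.\<close>

definition is_subfield :: "'r::field set \<Rightarrow> bool" where
  "is_subfield K \<longleftrightarrow> 0 \<in> K \<and> 1 \<in> K \<and>
     (\<forall>x\<in>K. \<forall>y\<in>K. x - y \<in> K \<and> x * y \<in> K) \<and> (\<forall>x\<in>K. inverse x \<in> K)"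

definition is_valuation_ring :: "'r::field set \<Rightarrow> 'r set \<Rightarrow> bool" where
  "is_valuation_ring K V \<longleftrightarrow> V \<subseteq> K \<and> 0 \<in> V \<and> 1 \<in> V \<and>
     (\<forall>x\<in>V. \<forall>y\<in>V. x - y \<in> V \<and> x * y \<in> V) \<and>
     (\<forall>x\<in>K. x \<noteq> 0 \<longrightarrow> x \<in> V \<or> inverse x \<in> V)"

definition ordered_valued_field :: "'r::linordered_field set \<Rightarrow> 'r set \<Rightarrow> bool" where
  "ordered_valued_field K V \<longleftrightarrow> is_subfield K \<and> is_valuation_ring K V \<and> V \<noteq> K \<and>
     (\<forall>x\<in>K. \<forall>y\<in>K. 0 \<le> x \<longrightarrow> 0 \<le> y \<longrightarrow> x + y \<in> V \<longrightarrow> x \<in> V)"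

text \<open>Real closed: ordered and with the intermediate value property for polynomials.\<close>

definition real_closed :: "'r::linordered_field itself \<Rightarrow> bool" where
  "real_closed _ \<longleftrightarrow> (\<forall>(p::'r poly) a b. a \<le> b \<longrightarrow> poly p a \<le> 0 \<longrightarrow> 0 \<le> poly p b \<longrightarrow>
     (\<exists>x. a \<le> x \<and> x \<le> b \<and> poly p x = 0))"

definition real_closed_valued_field :: "'r::linordered_field set \<Rightarrow> bool" where
  "real_closed_valued_field V \<longleftrightarrow> real_closed TYPE('r) \<and> ordered_valued_field UNIV V"

definition ordered_valued_subfield ::
    "'r::linordered_field set \<Rightarrow> 'r set \<Rightarrow> 'r set \<Rightarrow> bool" where
  "ordered_valued_subfield K V V\<^sub>R \<longleftrightarrow> ordered_valued_field K V \<and> V = V\<^sub>R \<inter> K"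

text \<open>The valuation attached to a valuation ring of the ambient field. Surjectivity makes \<open>'g\<close> the
  value group, and \<open>\<infinity>\<close> (\<^const>\<open>Pinf\<close>) is the value at 0 only.\<close>

definition is_valuation ::
    "('r::field \<Rightarrow> 'g::linordered_ab_group_add extended) \<Rightarrow> 'r set \<Rightarrow> bool" where
  "is_valuation v V \<longleftrightarrow> v 0 = \<infinity> \<and> v ` (- {0}) = range Fin \<and>
     (\<forall>x y. v (x * y) = v x + v y) \<and> (\<forall>x y. min (v x) (v y) \<le> v (x + y)) \<and> V = {x. 0 \<le> v x}"

definition finite_value :: "('r::zero \<Rightarrow> 'g::zero extended) \<Rightarrow> 'r \<Rightarrow> 'g" where
  "finite_value v x = (case v x of Fin g \<Rightarrow> g | _ \<Rightarrow> 0)"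

definition zmult :: "int \<Rightarrow> 'g::ab_group_add \<Rightarrow> 'g" where
  "zmult k g = (if 0 \<le> k then \<Sum>i<nat k. g else - (\<Sum>i<nat (- k). g))"

definition sign :: "'b::{zero,ord} \<Rightarrow> int" where
  "sign x = (if x = 0 then 0 else if 0 < x then 1 else - 1)"


section \<open>Complete systems and tableaux of valued sign conditions\<close>

text \<open>A system lists the signs of the \<open>y\<^sub>j\<close> and the signs of \<open>\<Sum> \<mu>\<^sub>j v(y\<^sub>j)\<close> over the nonzero \<open>y\<^sub>j\<close>, the
  exponent vectors \<open>\<mu>\<close> being enumerated in the fixed order of \<^const>\<open>List.n_lists\<close>.\<close>

type_synonym vsc = "int list \<times> int list"

definition exponent_vectors :: "nat \<Rightarrow> nat \<Rightarrow> int list list" where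
  "exponent_vectors M n = List.n_lists n [- int M..int M]"

definition vsc_system ::
    "('r::linordered_field \<Rightarrow> 'g::linordered_ab_group_add extended) \<Rightarrow> nat \<Rightarrow> 'r list \<Rightarrow> vsc" where
  "vsc_system v M ys = (map sign ys,
     let zs = filter (\<lambda>y. y \<noteq> 0) ys
     in map (\<lambda>\<mu>. sign (\<Sum>(l, y)\<leftarrow>zip \<mu> zs. zmult l (finite_value v y)))
          (exponent_vectors M (length zs)))"

context
  fixes v :: "'r::linordered_field \<Rightarrow> 'g::linordered_ab_group_add extended"
begin

definition J_mid :: "'r \<Rightarrow> 'r \<Rightarrow> 'r set" where
  "J_mid a b = {a + t * (b - a) | t. 0 < t \<and> t < 1 \<and> v t = 0 \<and> v (1 - t) = 0}"

definition Jplus_at :: "'r \<Rightarrow> 'r \<Rightarrow> 'g extended \<Rightarrow> 'r set" where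
  "Jplus_at a b \<alpha> = {a + t * (b - a) | t. 0 < t \<and> v t = \<alpha>}"

definition Jplus_between :: "'r \<Rightarrow> 'r \<Rightarrow> 'g extended \<Rightarrow> 'g extended \<Rightarrow> 'r set" where
  "Jplus_between a b \<alpha> \<beta> = {a + t * (b - a) | t. 0 < t \<and> \<alpha> < v t \<and> v t < \<beta>}"

definition Jminus_at :: "'r \<Rightarrow> 'r \<Rightarrow> 'g extended \<Rightarrow> 'r set" where
  "Jminus_at a b \<alpha> = {b - t * (b - a) | t. 0 < t \<and> v t = \<alpha>}"

definition Jminus_between :: "'r \<Rightarrow> 'r \<Rightarrow> 'g extended \<Rightarrow> 'g extended \<Rightarrow> 'r set" where
  "Jminus_between a b \<alpha> \<beta> = {b - t * (b - a) | t. 0 < t \<and> \<alpha> < v t \<and> v t < \<beta>}"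

definition Iplus_at :: "'r \<Rightarrow> 'g extended \<Rightarrow> 'r set" where
  "Iplus_at a \<alpha> = {a + t | t. 0 < t \<and> v t = \<alpha>}"

definition Iplus_between :: "'r \<Rightarrow> 'g extended \<Rightarrow> 'g extended \<Rightarrow> 'r set" where
  "Iplus_between a \<alpha> \<beta> = {a + t | t. 0 < t \<and> \<alpha> < v t \<and> v t < \<beta>}"

definition Iminus_at :: "'r \<Rightarrow> 'g extended \<Rightarrow> 'r set" where
  "Iminus_at a \<alpha> = {a - t | t. 0 < t \<and> v t = \<alpha>}"

definition Iminus_between :: "'r \<Rightarrow> 'g extended \<Rightarrow> 'g extended \<Rightarrow> 'r set" where
  "Iminus_between a \<alpha> \<beta> = {a - t | t. 0 < t \<and> \<alpha> < v t \<and> v t < \<beta>}"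

end

text \<open>The data of a partition with \<open>n\<close> formal break points are the \<open>2 n + 1\<close> systems on the successive
  pieces (open, point, open, \<dots>, open). A tableau consists of: the systems at the roots
  \<open>x\<^sub>1 < \<dots> < x\<^sub>r\<close>; for each \<open>k < r\<close> the system on \<open>\<J>(x\<^sub>k, x\<^sub>k\<^sub>+\<^sub>1)\<close> and the partitions of \<open>\<J>\<^sup>+\<close> and
  \<open>\<J>\<^sup>-\<close>; the partitions of the two unbounded intervals. If no nonzero member of the family has a
  root (so all members are constant) there is no extreme root to measure distances from, and the
  tableau is the system of these constants.\<close>

datatype tableau =
    Rootless vsc
  | Tableau "vsc list" "(vsc \<times> vsc list \<times> vsc list) list" "vsc list" "vsc list"

definition partition_data ::
    "('r \<Rightarrow> vsc) \<Rightarrow> ('g::linorder extended \<Rightarrow> 'r set) \<Rightarrow> ('g extended \<Rightarrow> 'g extended \<Rightarrow> 'r set) \<Rightarrow>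
     'g extended \<Rightarrow> vsc list \<Rightarrow> bool" where
  "partition_data sys piece_at piece_between lo systems \<longleftrightarrow>
     (\<exists>\<alpha>s. let bs = lo # map Fin \<alpha>s @ [\<infinity>]; n = length \<alpha>s in
        sorted_wrt (<) bs \<and> length systems = 2 * n + 1 \<and>
        (\<forall>i\<le>n. \<forall>x\<in>piece_between (bs ! i) (bs ! Suc i). sys x = systems ! (2 * i)) \<and>
        (\<forall>i. 1 \<le> i \<and> i \<le> n \<longrightarrow> (\<forall>x\<in>piece_at (bs ! i). sys x = systems ! (2 * i - 1))))"

definition all_roots :: "'r::linordered_idom poly list \<Rightarrow> 'r list" where
  "all_roots Fs = sorted_list_of_set {x. \<exists>F\<in>set Fs. F \<noteq> 0 \<and> poly F x = 0}"

definition is_complete_tableau ::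
    "('r::linordered_field \<Rightarrow> 'g::linordered_ab_group_add extended) \<Rightarrow> nat \<Rightarrow>
     'r poly list \<Rightarrow> tableau \<Rightarrow> bool" where
  "is_complete_tableau v M Fs tab \<longleftrightarrow>
     (let xs = all_roots Fs; r = length xs; sys = (\<lambda>x. vsc_system v M (map (\<lambda>F. poly F x) Fs))
      in case tab of
        Rootless s \<Rightarrow> r = 0 \<and> (\<forall>x. sys x = s)
      | Tableau at_roots gaps left right \<Rightarrow>
          0 < r \<and> at_roots = map sys xs \<and> length gaps = r - 1 \<and>
          (\<forall>k<r - 1. case gaps ! k of (mid, near_left, near_right) \<Rightarrow>
             (let a = xs ! k; b = xs ! Suc k in
               (\<forall>x\<in>J_mid v a b. sys x = mid) \<and>
               partition_data sys (Jplus_at v a b) (Jplus_between v a b) 0 near_left \<and>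
               partition_data sys (Jminus_at v a b) (Jminus_between v a b) 0 near_right)) \<and>
          partition_data sys (Iminus_at v (hd xs)) (Iminus_between v (hd xs)) (-\<infinity>) left \<and>
          partition_data sys (Iplus_at v (last xs)) (Iplus_between v (last xs)) (-\<infinity>) right)"


section \<open>Parametrized polynomials\<close>

text \<open>Polynomials in parameters \<open>Y\<^sub>0, Y\<^sub>1, \<dots>\<close>; each involves finitely many of them.\<close>

type_synonym 'r coef = "(nat \<Rightarrow>\<^sub>0 nat) \<Rightarrow>\<^sub>0 'r"

definition coef_over :: "'r::zero set \<Rightarrow> 'r coef \<Rightarrow> bool" where
  "coef_over K c \<longleftrightarrow> range (Poly_Mapping.lookup c) \<subseteq> K"

definition eval_coef :: "(nat \<Rightarrow> 'r::comm_semiring_1) \<Rightarrow> 'r coef \<Rightarrow> 'r" where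
  "eval_coef \<rho> c = (\<Sum>m\<in>Poly_Mapping.keys c.
     Poly_Mapping.lookup c m * (\<Prod>i\<in>Poly_Mapping.keys m. \<rho> i ^ Poly_Mapping.lookup m i))"

definition specialize :: "(nat \<Rightarrow> 'r::comm_semiring_1) \<Rightarrow> 'r coef poly \<Rightarrow> 'r poly" where
  "specialize \<rho> = map_poly (eval_coef \<rho>)"

text \<open>A formal \<open>\<int>\<close>-linear combination \<open>\<Sum> \<mu>\<^sub>c v(c)\<close> evaluated at a parameter point, and the two
  monomials whose quotient has this valuation.\<close>

definition value_comb ::
    "('r::comm_semiring_1 \<Rightarrow> 'g::ab_group_add extended) \<Rightarrow> (nat \<Rightarrow> 'r) \<Rightarrow> ('r coef \<Rightarrow>\<^sub>0 int) \<Rightarrow> 'g" where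
  "value_comb v \<rho> \<mu> = (\<Sum>c\<in>Poly_Mapping.keys \<mu>.
     zmult (Poly_Mapping.lookup \<mu> c) (finite_value v (eval_coef \<rho> c)))"

definition pos_monomial :: "(nat \<Rightarrow> 'r::comm_semiring_1) \<Rightarrow> ('r coef \<Rightarrow>\<^sub>0 int) \<Rightarrow> 'r" where
  "pos_monomial \<rho> \<mu> =
     (\<Prod>c\<in>Poly_Mapping.keys \<mu>. eval_coef \<rho> c ^ nat (Poly_Mapping.lookup \<mu> c))"

definition neg_monomial :: "(nat \<Rightarrow> 'r::comm_semiring_1) \<Rightarrow> ('r coef \<Rightarrow>\<^sub>0 int) \<Rightarrow> 'r" where
  "neg_monomial \<rho> \<mu> =
     (\<Prod>c\<in>Poly_Mapping.keys \<mu>. eval_coef \<rho> c ^ nat (- Poly_Mapping.lookup \<mu> c))"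


section \<open>Branching computations\<close>

text \<open>A branching computation over elements of type \<open>'c\<close>: two branches for a zero test (zero, nonzero),
  three branches (negative, zero, positive) for a sign test and for a test of the sign of a
  \<open>\<int>\<close>-linear combination of valuations.\<close>

datatype (dead 'c, results: 'a) dtree =
    Result 'a
  | IfZero 'c "('c, 'a) dtree" "('c, 'a) dtree"
  | CaseSign 'c "('c, 'a) dtree" "('c, 'a) dtree" "('c, 'a) dtree"
  | CaseVal "'c \<Rightarrow>\<^sub>0 int" "('c, 'a) dtree" "('c, 'a) dtree" "('c, 'a) dtree"

primrec bind_dtree :: "('c, 'a) dtree \<Rightarrow> ('a \<Rightarrow> ('c, 'b) dtree) \<Rightarrow> ('c, 'b) dtree" where
  "bind_dtree (Result x) f = f x"
| "bind_dtree (IfZero c t u) f = IfZero c (bind_dtree t f) (bind_dtree u f)"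
| "bind_dtree (CaseSign c t u w) f = CaseSign c (bind_dtree t f) (bind_dtree u f) (bind_dtree w f)"
| "bind_dtree (CaseVal \<mu> t u w) f = CaseVal \<mu> (bind_dtree t f) (bind_dtree u f) (bind_dtree w f)"

adhoc_overloading Monad_Syntax.bind \<rightleftharpoons> bind_dtree

primrec mapT :: "('a \<Rightarrow> ('c, 'b) dtree) \<Rightarrow> 'a list \<Rightarrow> ('c, 'b list) dtree" where
  "mapT f [] = Result []"
| "mapT f (x # xs) = do {y \<leftarrow> f x; ys \<leftarrow> mapT f xs; Result (y # ys)}"

primrec val_tests :: "('c, 'a) dtree \<Rightarrow> ('c \<Rightarrow>\<^sub>0 int) set" where
  "val_tests (Result x) = {}"
| "val_tests (IfZero c t u) = val_tests t \<union> val_tests u"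
| "val_tests (CaseSign c t u w) = val_tests t \<union> val_tests u \<union> val_tests w"
| "val_tests (CaseVal \<mu> t u w) = insert \<mu> (val_tests t \<union> val_tests u \<union> val_tests w)"

text \<open>The branch followed at a parameter point.\<close>

primrec run ::
    "('r::linordered_field \<Rightarrow> 'g::linordered_ab_group_add extended) \<Rightarrow> (nat \<Rightarrow> 'r) \<Rightarrow>
     ('r coef, 'a) dtree \<Rightarrow> 'a" where
  "run v \<rho> (Result x) = x"
| "run v \<rho> (IfZero c t u) = (if eval_coef \<rho> c = 0 then run v \<rho> t else run v \<rho> u)"
| "run v \<rho> (CaseSign c t u w) =
     (if eval_coef \<rho> c < 0 then run v \<rho> t else if eval_coef \<rho> c = 0 then run v \<rho> u else run v \<rho> w)"
| "run v \<rho> (CaseVal \<mu> t u w) =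
     (if value_comb v \<rho> \<mu> < 0 then run v \<rho> t
      else if value_comb v \<rho> \<mu> = 0 then run v \<rho> u else run v \<rho> w)"


section \<open>The families generated by derivation and pseudoremainders\<close>

text \<open>In a state, \<open>Z\<close> and \<open>N\<close> contain the elements assumed zero, resp. nonzero, on the current
  branch. An element is not tested if its answer is known: it is 0, or a nonzero scalar, or a nonzero
  scalar multiple of an element tested before.\<close>

definition proportional :: "'r::field coef \<Rightarrow> 'r coef \<Rightarrow> bool" where
  "proportional c c' \<longleftrightarrow> (\<exists>a. a \<noteq> 0 \<and> c = Poly_Mapping.single 0 a * c')"

definition known_zero :: "'r::field coef set \<Rightarrow> 'r coef \<Rightarrow> bool" where
  "known_zero Z c \<longleftrightarrow> (\<exists>z\<in>insert 0 Z. proportional c z)"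

definition known_nonzero :: "'r::field coef set \<Rightarrow> 'r coef \<Rightarrow> bool" where
  "known_nonzero N c \<longleftrightarrow> (\<exists>n\<in>insert 1 N. proportional c n)"

text \<open>Deletion of the leading terms (of degree \<open>\<ge> 1\<close>) known to be zero. Coefficients of degree 0 are
  left alone, since only the degrees \<open>\<ge> 1\<close> matter for remainders.\<close>

definition reduce :: "'r::field coef set \<Rightarrow> 'r coef poly \<Rightarrow> 'r coef poly" where
  "reduce Z P =
     poly_cutoff (Suc (Max (insert 0 {i. i \<le> degree P \<and> \<not> known_zero Z (coeff P i)}))) P"

definition undecided :: "'r::field coef set \<Rightarrow> 'r coef poly \<Rightarrow> bool" where
  "undecided N P \<longleftrightarrow> 1 \<le> degree P \<and> \<not> known_nonzero N (lead_coeff P)"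

definition generated :: "'r::linordered_field coef poly list \<Rightarrow> 'r coef poly list" where
  "generated Fs = map pderiv Fs @
     [pseudo_mod P Q. P \<leftarrow> Fs, Q \<leftarrow> Fs, degree Q \<le> degree P \<and> 1 \<le> degree Q]"

text \<open>\<open>rem_tree Z N Fs T\<close>: the computation started in the state \<open>(Z, N, Fs)\<close> terminates on every
  branch and has tree \<open>T\<close>; exactly one rule applies to each state. At a leaf the family is
  numbered with nondecreasing degrees.\<close>

inductive rem_tree ::
    "'r::linordered_field coef set \<Rightarrow> 'r coef set \<Rightarrow> 'r coef poly list \<Rightarrow>
     ('r coef, 'r coef set \<times> 'r coef poly list) dtree \<Rightarrow> bool" where
  decide: "rem_tree Z N Fs (IfZero c T\<^sub>0 T\<^sub>1)"
    if "find (undecided N) Fs = Some P" "c = lead_coeff P"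
       "rem_tree (insert c Z) N (remdups (map (reduce (insert c Z)) Fs)) T\<^sub>0"
       "rem_tree Z (insert c N) Fs T\<^sub>1"
| adjoin: "rem_tree Z N Fs T"
    if "find (undecided N) Fs = None"
       "find (\<lambda>R. R \<notin> set Fs) (map (reduce Z) (generated Fs)) = Some R"
       "rem_tree Z N (Fs @ [R]) T"
| leaf: "rem_tree Z N Fs (Result (Z, sort_key degree Fs))"
    if "find (undecided N) Fs = None"
       "find (\<lambda>R. R \<notin> set Fs) (map (reduce Z) (generated Fs)) = None"

text \<open>The constants of all families at the leaves. (The polynomial 0 counts as a constant.)\<close>

definition constants :: "('c::zero, 'c set \<times> 'c poly list) dtree \<Rightarrow> 'c set" where
  "constants T = {coeff P 0 | P. degree P = 0 \<and> (\<exists>(Z, Fs)\<in>results T. P \<in> set Fs)}"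


section \<open>Algorithm RCVF2: the complete tableau of valued sign conditions\<close>

text \<open>Semilinear functions of the valuations of the constants: \<open>Lin l\<close> is the \<open>\<rat>\<close>-linear combination
  \<open>\<Sum> l\<^sub>c v(c)\<close>.\<close>

datatype 'c vexp =
    Lin "'c \<Rightarrow>\<^sub>0 rat"
  | VAdd "'c vexp" "'c vexp"
  | VScale rat "'c vexp"
  | VMin "'c vexp" "'c vexp"
  | VMax "'c vexp" "'c vexp"

abbreviation Val :: "'c \<Rightarrow> 'c vexp" where
  "Val c \<equiv> Lin (Poly_Mapping.single c 1)"

fun vmin_list :: "'c vexp list \<Rightarrow> 'c vexp" where
  "vmin_list [] = Lin 0"
| "vmin_list [e] = e"
| "vmin_list (e # es) = VMin e (vmin_list es)"

fun vmax_list :: "'c vexp list \<Rightarrow> 'c vexp" where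
  "vmax_list [] = Lin 0"
| "vmax_list [e] = e"
| "vmax_list (e # es) = VMax e (vmax_list es)"

text \<open>Sign and valuation of a polynomial at a point; \<^const>\<open>None\<close> is the valuation \<open>\<infinity>\<close> of 0.\<close>

type_synonym 'c sval = "int \<times> 'c vexp option"

definition sval :: "int \<Rightarrow> 'c vexp \<Rightarrow> 'c sval" where
  "sval s e = (s, if s = 0 then None else Some e)"

text \<open>The tableau of a family \<open>(P\<^sub>1, \<dots>, P\<^sub>m)\<close> with roots \<open>x\<^sub>1 < \<dots> < x\<^sub>r\<close>: the signs on the \<open>r + 1\<close> open
  intervals, the signs and valuations at the \<open>r\<close> roots, and the \<open>v(x\<^sub>k\<^sub>+\<^sub>1 - x\<^sub>k)\<close>.\<close>

datatype 'c vtab =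
  VTab (cells: "int list list") (points: "'c sval list list") (gaps: "'c vexp list")

text \<open>The data attached to \<open>P, P', \<dots>, P\<^sup>(\<^sup>d\<^sup>)\<close>, where \<open>d\<close> is the degree of \<open>P\<close>, in a list \<open>xs\<close> of data for
  the family \<open>Ps\<close>.\<close>

definition derivs_data :: "'c::idom poly list \<Rightarrow> 'a list \<Rightarrow> 'c poly \<Rightarrow> 'a list" where
  "derivs_data Ps xs P = map (\<lambda>j. the (map_of (zip Ps xs) ((pderiv ^^ j) P))) [0..<Suc (degree P)]"

text \<open>The constant \<open>P\<^sup>(\<^sup>d\<^sup>)\<close> is \<open>d!\<close> times the leading coefficient, hence has the same sign and the same
  valuation (a convex valuation ring contains \<open>\<rat>\<close>); for the same reason the factorials in Taylor
  formulae do not contribute to the valuations.\<close>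

definition top_constant :: "'c::idom poly \<Rightarrow> 'c" where
  "top_constant P = coeff ((pderiv ^^ degree P) P) 0"

text \<open>Generalized Taylor formula on \<open>]a, b[\<close>. Let \<open>\<sigma>\<close> be the signs of \<open>P, P', \<dots>, P\<^sup>(\<^sup>d\<^sup>)\<close> on the interval,
  and call \<open>j < d\<close> left if \<open>\<sigma>\<^sub>j = \<sigma>\<^sub>j\<^sub>+\<^sub>1\<close> (so that \<open>|P\<^sup>(\<^sup>j\<^sup>)|\<close> increases) and right otherwise. Iterating
  \<open>|P\<^sup>(\<^sup>j\<^sup>)(x)| = |P\<^sup>(\<^sup>j\<^sup>)(a)| + \<integral>\<^sub>a\<^sup>x |P\<^sup>(\<^sup>j\<^sup>+\<^sup>1\<^sup>)|\<close> for left \<open>j\<close> and the mirror formula from \<open>b\<close> for right \<open>j\<close>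
  gives \<open>|P(x)| = \<Sum> |P\<^sup>(\<^sup>j\<^sup>)(e\<^sub>j)| \<delta>x\<^sup>j h\<^sub>j\<close> with \<open>e\<^sub>j\<close> the corresponding end point, \<open>\<delta>x = b - a\<close>, and
  \<open>v(h\<^sub>j) = k\<^sub>j \<tau>'\<close>, where \<open>k\<^sub>j = min j q\<close> and \<open>q\<close> is the length of the initial run of indices on the
  side of index 0: the first integration starting from the other end yields a function which is a
  unit near the first end.\<close>

definition sides :: "int list \<Rightarrow> bool list" where
  "sides \<sigma> = map2 (=) (butlast \<sigma>) (tl \<sigma>)"

definition left_based :: "int list \<Rightarrow> bool" where
  "left_based \<sigma> \<longleftrightarrow> (sides \<sigma> \<noteq> [] \<longrightarrow> hd (sides \<sigma>))"

definition run_length :: "int list \<Rightarrow> nat" where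
  "run_length \<sigma> = length (takeWhile (\<lambda>s. s = hd (sides \<sigma>)) (sides \<sigma>))"

text \<open>A term \<open>(e, k)\<close> stands for \<open>e + k \<tau>'\<close>; infinite terms are omitted.\<close>

definition taylor_terms ::
    "int list \<Rightarrow> 'c sval list \<Rightarrow> 'c sval list \<Rightarrow> 'c vexp \<Rightarrow> ('c vexp \<times> nat) list" where
  "taylor_terms \<sigma> at_a at_b \<delta> =
     concat (map (\<lambda>j.
       case snd (if j < length (sides \<sigma>) \<and> \<not> sides \<sigma> ! j then at_b ! j else at_a ! j) of
         None \<Rightarrow> []
       | Some \<nu> \<Rightarrow> [(VAdd \<nu> (VScale (of_nat j) \<delta>), min j (run_length \<sigma>))])
     [0..<length \<sigma>])"

text \<open>Ordinary Taylor formula on an unbounded interval, at distance of valuation \<open>\<tau>\<close> from its end;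
  all terms have the same sign.\<close>

definition unbounded_terms :: "'c sval list \<Rightarrow> ('c vexp \<times> nat) list" where
  "unbounded_terms at_a =
     concat (map (\<lambda>j. case snd (at_a ! j) of None \<Rightarrow> [] | Some \<nu> \<Rightarrow> [(\<nu>, j)]) [0..<length at_a])"

definition min_terms :: "'c vexp \<Rightarrow> ('c vexp \<times> nat) list \<Rightarrow> 'c vexp" where
  "min_terms \<tau> ts = vmin_list (map (\<lambda>(e, k). VAdd e (VScale (of_nat k) \<tau>)) ts)"

text \<open>The solution \<open>\<tau>\<close> of \<open>\<gamma> = min (e + k \<tau>)\<close> over terms with \<open>k \<ge> 1\<close>.\<close>

definition solve_terms :: "'c vexp \<Rightarrow> ('c vexp \<times> nat) list \<Rightarrow> 'c vexp" where
  "solve_terms \<gamma> ts =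
     vmax_list (map (\<lambda>(e, k). VScale (1 / of_nat k) (VAdd \<gamma> (VScale (- 1) e))) ts)"

text \<open>Sign and valuation of \<open>P\<close> at an old root, which is a root of some \<open>Q\<close> in \<open>Ps\<close>: the
  pseudoremainder \<open>R\<close> satisfies \<open>lc(Q)\<^sup>e P(a) = R(a)\<close>.\<close>

definition sval_at_root ::
    "'r::linordered_field coef set \<Rightarrow> ('r coef \<Rightarrow> int) \<Rightarrow> 'r coef poly list \<Rightarrow> 'r coef poly \<Rightarrow>
     'r coef sval list \<Rightarrow> 'r coef sval" where
  "sval_at_root Z sg Ps P at_a =
     (let Q = fst (the (find (\<lambda>(Q, s, _). 1 \<le> degree Q \<and> s = 0) (zip Ps at_a)));
          (s, w) = the (map_of (zip Ps at_a) (reduce Z (pseudo_mod P Q)));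
          e = Suc (degree P) - degree Q;
          c = top_constant Q
      in sval (s * sg c ^ e) (VAdd (the w) (VScale (- of_nat e) (Val c))))"

text \<open>The signs and valuations of \<open>Ps\<close> at a new root of \<open>P\<close> in an interval, and the position of this
  root. On a bounded interval \<open>v(t\<^sub>1)\<close> is obtained by applying the generalized Taylor formula to
  \<open>P - P(a)\<close>, which has the sign of \<open>P'\<close> and vanishes at \<open>a\<close>, and \<open>v(1 - t\<^sub>1)\<close> by applying it to
  \<open>P - P(b)\<close>.\<close>

definition root_in_gap ::
    "'c::idom poly list \<Rightarrow> 'c poly \<Rightarrow> 'c sval list \<Rightarrow> 'c sval list \<Rightarrow> 'c sval \<Rightarrow> 'c sval \<Rightarrow>
     int list \<Rightarrow> 'c vexp \<Rightarrow> 'c vexp \<times> 'c vexp \<times> 'c sval list" where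
  "root_in_gap Ps P at_a at_b P_a P_b cell \<delta> =
     (let \<sigma> = derivs_data Ps cell (pderiv P);
          A = (0, None) # derivs_data Ps at_a (pderiv P);
          B = (0, None) # derivs_data Ps at_b (pderiv P);
          \<tau>\<^sub>a = solve_terms (the (snd P_a)) (taylor_terms (hd \<sigma> # \<sigma>) A B \<delta>);
          \<tau>\<^sub>b = solve_terms (the (snd P_b)) (taylor_terms (- hd \<sigma> # \<sigma>) A B \<delta>)
      in (\<tau>\<^sub>a, \<tau>\<^sub>b,
          map (\<lambda>F. let \<sigma> = derivs_data Ps cell F in
                 sval (hd \<sigma>) (min_terms (if left_based \<sigma> then \<tau>\<^sub>a else \<tau>\<^sub>b)
                   (taylor_terms \<sigma> (derivs_data Ps at_a F) (derivs_data Ps at_b F) \<delta>)))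
            Ps))"

definition root_unbounded ::
    "'c::idom poly list \<Rightarrow> 'c poly \<Rightarrow> 'c sval list \<Rightarrow> 'c sval \<Rightarrow> int list \<Rightarrow>
     'c vexp \<times> 'c sval list" where
  "root_unbounded Ps P at_a P_a cell =
     (let \<tau> = solve_terms (the (snd P_a))
                (unbounded_terms ((0, None) # derivs_data Ps at_a (pderiv P)))
      in (\<tau>, map2 (\<lambda>F s. sval s (min_terms \<tau> (unbounded_terms (derivs_data Ps at_a F)))) Ps cell))"

definition svals_of_constants :: "('c::idom \<Rightarrow> int) \<Rightarrow> 'c poly list \<Rightarrow> 'c sval list" where
  "svals_of_constants sg Ps =
     map (\<lambda>F. if degree F = 0 then sval (sg (coeff F 0)) (Val (coeff F 0)) else (0, None)) Ps"

text \<open>Refinement of the \<open>k\<close>-th open interval (\<open>0 \<le> k \<le> r\<close>) by the possible new root of \<open>P\<close>, which is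
  strictly monotonic there: the new cells, points and gaps inside this interval. If \<open>r = 0\<close>, all
  members of \<open>Ps\<close> are constant.\<close>

definition refine_interval ::
    "('c::idom \<Rightarrow> int) \<Rightarrow> 'c poly list \<Rightarrow> 'c vtab \<Rightarrow> 'c poly \<Rightarrow> 'c sval list \<Rightarrow> nat \<Rightarrow>
     int list list \<times> 'c sval list list \<times> 'c vexp list" where
  "refine_interval sg Ps tab P P_at k =
     (let r = length (points tab); cell = cells tab ! k; lc = sg (top_constant P);
          sl = (if k = 0 then lc * (- 1) ^ degree P else fst (P_at ! (k - 1)));
          sr = (if k = r then lc else fst (P_at ! k));
          new_cells = [cell @ [sl], cell @ [sr]]
      in if sl * sr < 0 then
           (if r = 0 then (new_cells, [svals_of_constants sg Ps @ [(0, None)]], [])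
            else if k = 0 then
              (let (\<tau>, es) = root_unbounded Ps P (points tab ! 0) (P_at ! 0) cell
               in (new_cells, [es @ [(0, None)]], [\<tau>]))
            else if k = r then
              (let (\<tau>, es) = root_unbounded Ps P (points tab ! (r - 1)) (P_at ! (r - 1)) cell
               in (new_cells, [es @ [(0, None)]], [\<tau>]))
            else
              (let \<delta> = gaps tab ! (k - 1);
                   (\<tau>\<^sub>a, \<tau>\<^sub>b, es) = root_in_gap Ps P (points tab ! (k - 1)) (points tab ! k)
                                    (P_at ! (k - 1)) (P_at ! k) cell \<delta>
               in (new_cells, [es @ [(0, None)]], [VAdd \<delta> \<tau>\<^sub>a, VAdd \<delta> \<tau>\<^sub>b])))
         else
           ([cell @ [if sl \<noteq> 0 then sl else sr]], [],
            if 0 < k \<and> k < r then [gaps tab ! (k - 1)] else []))"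

definition add_poly ::
    "'r::linordered_field coef set \<Rightarrow> ('r coef \<Rightarrow> int) \<Rightarrow> 'r coef poly list \<Rightarrow> 'r coef vtab \<Rightarrow>
     'r coef poly \<Rightarrow> 'r coef vtab" where
  "add_poly Z sg Ps tab P =
     (if degree P = 0 then
        (let c = coeff P 0 in
         VTab (map (\<lambda>cell. cell @ [sg c]) (cells tab))
              (map (\<lambda>pt. pt @ [sval (sg c) (Val c)]) (points tab)) (gaps tab))
      else
        (let r = length (points tab);
             P_at = map (sval_at_root Z sg Ps P) (points tab);
             old = map2 (\<lambda>pt e. [pt @ [e]]) (points tab) P_at;
             parts = map (refine_interval sg Ps tab P P_at) [0..<Suc r]
         in VTab (concat (map fst parts))
              (concat (map2 (@) ([] # old) (map (fst \<circ> snd) parts)))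
              (concat (map (snd \<circ> snd) parts))))"

text \<open>The tableaux of \<open>(P\<^sub>1, \<dots>, P\<^sub>m)\<close> for increasing \<open>m\<close>; \<open>sg\<close> gives the signs of the constants.\<close>

definition rcvf2 ::
    "'r::linordered_field coef set \<Rightarrow> ('r coef \<Rightarrow> int) \<Rightarrow> 'r coef poly list \<Rightarrow> 'r coef vtab" where
  "rcvf2 Z sg Ps = snd (foldl (\<lambda>(Qs, tab) P. (Qs @ [P], add_poly Z sg Qs tab P))
     ([], VTab [[]] [] []) Ps)"


section \<open>Algorithm RCVF3: the M-complete tableau\<close>

type_synonym 'c lin = "'c \<Rightarrow>\<^sub>0 rat"

abbreviation scale_lin :: "rat \<Rightarrow> 'c lin \<Rightarrow> 'c lin" where
  "scale_lin q \<equiv> Poly_Mapping.map ((*) q)"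

text \<open>The sign of a \<open>\<rat>\<close>-linear combination is found by testing the \<open>\<int>\<close>-linear combination obtained by
  clearing denominators.\<close>

definition clear_denominators :: "'c lin \<Rightarrow> ('c \<Rightarrow>\<^sub>0 int)" where
  "clear_denominators l =
     (let D = (\<Prod>c\<in>Poly_Mapping.keys l. snd (quotient_of (Poly_Mapping.lookup l c)))
      in Poly_Mapping.map (\<lambda>q. \<lfloor>of_int D * q\<rfloor>) l)"

definition ask :: "'c lin \<Rightarrow> ('c, int) dtree" where
  "ask l = (if l = 0 then Result 0
     else CaseVal (clear_denominators l) (Result (- 1)) (Result 0) (Result 1))"

primrec resolve :: "'c vexp \<Rightarrow> ('c, 'c lin) dtree" where
  "resolve (Lin l) = Result l"
| "resolve (VAdd e f) = do {l \<leftarrow> resolve e; m \<leftarrow> resolve f; Result (l + m)}"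
| "resolve (VScale q e) = do {l \<leftarrow> resolve e; Result (scale_lin q l)}"
| "resolve (VMin e f) =
     do {l \<leftarrow> resolve e; m \<leftarrow> resolve f; s \<leftarrow> ask (l - m); Result (if s \<le> 0 then l else m)}"
| "resolve (VMax e f) =
     do {l \<leftarrow> resolve e; m \<leftarrow> resolve f; s \<leftarrow> ask (l - m); Result (if s \<le> 0 then m else l)}"

text \<open>Values \<open>(l, w)\<close> stand for \<open>l + w \<Omega>\<close> with a formal infinitely large \<open>\<Omega> > 0\<close>, used to sample unbounded
  pieces. Affine functions \<open>(l, k)\<close> stand for \<open>\<tau> \<mapsto> l + k \<tau>\<close>, and a piecewise linear function is
  given by the nonempty list of the affine functions of which it is the minimum.\<close>

type_synonym 'c xlin = "'c lin \<times> rat"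

abbreviation scale_xlin :: "rat \<Rightarrow> 'c xlin \<Rightarrow> 'c xlin" where
  "scale_xlin q x \<equiv> (scale_lin q (fst x), q * snd x)"

definition ask_ext :: "'c xlin \<Rightarrow> ('c, int) dtree" where
  "ask_ext x = (if snd x \<noteq> 0 then Result (sign (snd x)) else ask (fst x))"

definition apply_affine :: "'c lin \<times> rat \<Rightarrow> 'c xlin \<Rightarrow> 'c xlin" where
  "apply_affine f \<tau> = (fst f, 0) + scale_xlin (snd f) \<tau>"

fun active_piece :: "'c xlin \<Rightarrow> ('c lin \<times> rat) list \<Rightarrow> ('c, 'c lin \<times> rat) dtree" where
  "active_piece \<tau> [] = Result (0, 0)"
| "active_piece \<tau> [f] = Result f"
| "active_piece \<tau> (f # fs) =
     do {g \<leftarrow> active_piece \<tau> fs;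
         s \<leftarrow> ask_ext (apply_affine f \<tau> - apply_affine g \<tau>);
         Result (if s \<le> 0 then f else g)}"

definition system_of :: "nat \<Rightarrow> int list \<Rightarrow> 'c xlin list \<Rightarrow> ('c, vsc) dtree" where
  "system_of M signs xs =
     do {vs \<leftarrow> mapT (\<lambda>\<mu>. ask_ext (\<Sum>(l, x)\<leftarrow>zip \<mu> xs. scale_xlin (of_int l) x))
                (exponent_vectors M (length xs));
         Result (signs, vs)}"

definition system_at_point :: "nat \<Rightarrow> 'c sval list \<Rightarrow> ('c, vsc) dtree" where
  "system_at_point M svs =
     do {ls \<leftarrow> mapT resolve (List.map_filter snd svs);
         system_of M (map fst svs) (map (\<lambda>l. (l, 0)) ls)}"

definition system_at_sample ::
    "nat \<Rightarrow> int list \<Rightarrow> ('c lin \<times> rat) list list \<Rightarrow> 'c xlin \<Rightarrow> ('c, vsc) dtree" where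
  "system_at_sample M signs fs \<tau> =
     do {gs \<leftarrow> mapT (active_piece \<tau>) fs; system_of M signs (map (\<lambda>g. apply_affine g \<tau>) gs)}"

text \<open>The break points of a piecewise linear function: crossings of two of its affine functions of
  different slopes at which the minimum is attained.\<close>

definition break_points :: "('c lin \<times> rat) list \<Rightarrow> ('c, 'c lin list) dtree" where
  "break_points fs =
     do {bss \<leftarrow> mapT (\<lambda>(f, g).
           let \<beta> = scale_lin (1 / (snd g - snd f)) (fst f - fst g) in
           do {h \<leftarrow> active_piece (\<beta>, 0) fs;
               s \<leftarrow> ask_ext (apply_affine f (\<beta>, 0) - apply_affine h (\<beta>, 0));
               Result (if s = 0 then [\<beta>] else [])})
         [(f, g). f \<leftarrow> fs, g \<leftarrow> fs, snd f < snd g];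
         Result (concat bss)}"

text \<open>The zeros of the combinations \<open>\<Sum> \<mu>\<^sub>j f\<^sub>j\<close> of nonzero slope of affine functions \<open>f\<^sub>j\<close>.\<close>

definition zeros_of_combinations :: "nat \<Rightarrow> ('c lin \<times> rat) list \<Rightarrow> 'c lin list" where
  "zeros_of_combinations M fs =
     [scale_lin (- 1 / snd h) (fst h).
       h \<leftarrow> map (\<lambda>\<mu>. \<Sum>(l, f)\<leftarrow>zip \<mu> fs. scale_xlin (of_int l) f) (exponent_vectors M (length fs)),
       snd h \<noteq> 0]"

primrec insert_point :: "'c lin \<Rightarrow> 'c lin list \<Rightarrow> ('c, 'c lin list) dtree" where
  "insert_point b [] = Result [b]"
| "insert_point b (c # cs) =
     do {s \<leftarrow> ask (b - c);
         if s < 0 then Result (b # c # cs)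
         else if s = 0 then Result (c # cs)
         else do {cs' \<leftarrow> insert_point b cs; Result (c # cs')}}"

text \<open>The strictly increasing list of the points strictly between two bounds, where \<^const>\<open>None\<close> is the
  absence of a bound.\<close>

primrec sort_between ::
    "'c lin option \<Rightarrow> 'c lin option \<Rightarrow> 'c lin list \<Rightarrow> ('c, 'c lin list) dtree" where
  "sort_between lo hi [] = Result []"
| "sort_between lo hi (b # bs) =
     do {cs \<leftarrow> sort_between lo hi bs;
         s \<leftarrow> (case lo of None \<Rightarrow> Result 1 | Some a \<Rightarrow> ask (b - a));
         t \<leftarrow> (case hi of None \<Rightarrow> Result 1 | Some c \<Rightarrow> ask (c - b));
         if 0 < s \<and> 0 < t then insert_point b cs else Result cs}"

fun sample_between :: "'c lin option \<Rightarrow> 'c lin option \<Rightarrow> 'c xlin" where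
  "sample_between None None = (0, 0)"
| "sample_between (Some a) None = (a, 1)"
| "sample_between None (Some b) = (b, - 1)"
| "sample_between (Some a) (Some b) = (scale_lin (1 / 2) (a + b), 0)"

definition open_pieces :: "'c lin option \<Rightarrow> 'c lin list \<Rightarrow> ('c lin option \<times> 'c lin option) list" where
  "open_pieces lo bs = zip (lo # map Some bs) (map Some bs @ [None])"

fun samples :: "'c lin option \<Rightarrow> 'c lin list \<Rightarrow> 'c xlin list" where
  "samples lo [] = [sample_between lo None]"
| "samples lo (b # bs) = sample_between lo (Some b) # (b, 0) # samples (Some b) bs"

text \<open>The partition of \<open>]lo, \<infinity>[\<close> for piecewise linear functions \<open>fs\<close>: first their break points, then,
  on each piece, the points where an integer combination changes sign.\<close>

definition partition_of ::
    "nat \<Rightarrow> 'c lin option \<Rightarrow> int list \<Rightarrow> ('c lin \<times> rat) list list \<Rightarrow> ('c, vsc list) dtree" where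
  "partition_of M lo signs fs =
     do {cands \<leftarrow> mapT break_points fs;
         bs \<leftarrow> sort_between lo None (concat cands);
         zs \<leftarrow> mapT (\<lambda>(l, h).
                 do {gs \<leftarrow> mapT (active_piece (sample_between l h)) fs;
                     sort_between l h (zeros_of_combinations M gs)})
               (open_pieces lo bs);
         let bs' = concat (map2 (\<lambda>z b. z @ b) zs (map (\<lambda>b. [b]) bs @ [[]]));
         mapT (system_at_sample M signs fs) (samples lo bs')}"

definition resolve_terms ::
    "('c vexp \<times> nat) list list \<Rightarrow> ('c, ('c lin \<times> rat) list list) dtree" where
  "resolve_terms = mapT (mapT (\<lambda>(e, k). do {l \<leftarrow> resolve e; Result (l, of_nat k)}))"

text \<open>On \<open>\<J>\<^sup>+\<close> one has \<open>v(t) > 0\<close> and \<open>v(1 - t) = 0\<close>, so only the functions based at the left end depend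
  on \<open>\<tau> = v(t)\<close>; on \<open>\<J>\<^sup>-\<close> only those based at the right end depend on \<open>\<tau> = v(1 - t)\<close>; on \<open>\<J>\<close> all are
  evaluated at \<open>\<tau>' = 0\<close>.\<close>

definition bounded_interval ::
    "nat \<Rightarrow> 'c::idom poly list \<Rightarrow> int list \<Rightarrow> 'c sval list \<Rightarrow> 'c sval list \<Rightarrow> 'c vexp \<Rightarrow>
     ('c, vsc \<times> vsc list \<times> vsc list) dtree" where
  "bounded_interval M Ps cell at_a at_b \<delta> =
     (let Fs = filter (\<lambda>F. hd (derivs_data Ps cell F) \<noteq> 0) Ps;
          terms = (\<lambda>F. taylor_terms (derivs_data Ps cell F)
                         (derivs_data Ps at_a F) (derivs_data Ps at_b F) \<delta>);
          based = map (\<lambda>F. left_based (derivs_data Ps cell F)) Fs;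
          flat = map (\<lambda>(e, k). (e, 0))
      in do {fs \<leftarrow> resolve_terms (map terms Fs);
             mid \<leftarrow> system_at_sample M cell fs (0, 0);
             near_a \<leftarrow> partition_of M (Some 0) cell (map2 (\<lambda>l f. if l then f else flat f) based fs);
             near_b \<leftarrow> partition_of M (Some 0) cell (map2 (\<lambda>l f. if l then flat f else f) based fs);
             Result (mid, near_a, near_b)})"

definition unbounded_interval ::
    "nat \<Rightarrow> 'c::idom poly list \<Rightarrow> int list \<Rightarrow> 'c sval list \<Rightarrow> ('c, vsc list) dtree" where
  "unbounded_interval M Ps cell at_a =
     (let Fs = filter (\<lambda>F. hd (derivs_data Ps cell F) \<noteq> 0) Ps
      in do {fs \<leftarrow> resolve_terms (map (\<lambda>F. unbounded_terms (derivs_data Ps at_a F)) Fs);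
             partition_of M None cell fs})"

definition complete_tableau_tree ::
    "nat \<Rightarrow> ('c::idom \<Rightarrow> int) \<Rightarrow> 'c poly list \<Rightarrow> 'c vtab \<Rightarrow> ('c, tableau) dtree" where
  "complete_tableau_tree M sg Ps tab =
     (let pts = points tab; cs = cells tab; r = length pts
      in if r = 0 then
           do {s \<leftarrow> system_at_point M (svals_of_constants sg Ps); Result (Rootless s)}
         else
           do {at_roots \<leftarrow> mapT (system_at_point M) pts;
               bounded \<leftarrow> mapT (\<lambda>k. bounded_interval M Ps (cs ! Suc k) (pts ! k) (pts ! Suc k)
                                     (gaps tab ! k)) [0..<r - 1];
               left \<leftarrow> unbounded_interval M Ps (hd cs) (hd pts);
               right \<leftarrow> unbounded_interval M Ps (last cs) (last pts);
               Result (Tableau at_roots bounded left right)})"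

primrec ask_signs :: "'c list \<Rightarrow> ('c, 'c \<Rightarrow> int) dtree" where
  "ask_signs [] = Result (\<lambda>_. 0)"
| "ask_signs (c # cs) =
     do {sg \<leftarrow> ask_signs cs;
         CaseSign c (Result (sg(c := - 1))) (Result (sg(c := 0))) (Result (sg(c := 1)))}"

definition rcvf3 ::
    "nat \<Rightarrow> 'r::linordered_field coef set \<Rightarrow> 'r coef poly list \<Rightarrow>
     ('r coef, 'r coef poly list \<times> tableau) dtree" where
  "rcvf3 M Z Ps =
     do {sg \<leftarrow> ask_signs (map (\<lambda>P. coeff P 0) (filter (\<lambda>P. degree P = 0) Ps));
         tab \<leftarrow> complete_tableau_tree M sg Ps (rcvf2 Z sg Ps);
         Result (Ps, tab)}"

text \<open>The global parametrized algorithm, run after the branching computation of the families.\<close>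

definition global_tree ::
    "nat \<Rightarrow> ('r::linordered_field coef, 'r coef set \<times> 'r coef poly list) dtree \<Rightarrow>
     ('r coef, 'r coef poly list \<times> tableau) dtree" where
  "global_tree M T = do {(Z, Ps) \<leftarrow> T; rcvf3 M Z Ps}"

end

theory Submission
  imports Defs "HOL-Library.Multiset_Order"
begin

text \<open>Along a branch the decided leading coefficients make the specialized family stable under derivation
  and, up to powers of leading coefficients, under remainders. So a new polynomial \<open>P\<close> is strictly
  monotonic between consecutive roots of the previous ones, its new roots are detected by sign changes,
  and its signs and values at the old roots are those of earlier members of the family.

  Where all derivatives of \<open>P\<close> have constant sign, \<open>|P(a + t (b - a))|\<close> lies between positive rational
  multiples of a sum of nonnegative monomials in \<open>t\<close> or in \<open>1 - t\<close>. Positive integers have value 0 because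
  the valuation ring is convex, and the value of a sum of nonnegative elements is the minimum of their values,
  so \<open>v(P(x))\<close> is a minimum of affine functions of \<open>v(t)\<close> or \<open>v(1 - t)\<close>. Applied to \<open>P - P(a)\<close>, which has
  value \<open>v(P(a))\<close> at a root of \<open>P\<close>, this also determines the position of a new root. All values are thus
  semilinear in the values of the constants that do not vanish on the branch, and the system of valued sign
  conditions is constant between consecutive break points of these functions and zeros of their
  integer combinations.

  The computation of the families terminates because a generator of level \<open>d\<close>, once treated, is replaced by
  generators of lower level, and the multiset order on levels is well-founded.\<close>

section \<open>Rational multiples in a divisible ordered group\<close>

text \<open>Only the order and the intermediate value property for polynomials are at hand, so
  Rolle's theorem and the mean value theorem are derived algebraically, and the integrals of the
  generalized Taylor formula are replaced by two-sided estimates up to positive integer factors.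
  Roots of positive elements make the value group divisible, which gives a meaning to the rational
  coefficients of the computed values; nontriviality of the valuation provides arbitrarily large
  values, which realize the formal infinite \<open>\<Omega>\<close>. The outputs must depend on the
  constants alone, while the zero tests concern leading coefficients. A polynomial of degree
  \<open>d\<close> whose leading coefficient \<open>c\<close> has been declared nonzero is never
  altered afterwards, so its derivative of order \<open>d\<close>, the constant \<open>d! c\<close>,
  occurs at every leaf below. Two invariants of the tableau are carried side by side:
  \<open>tab_ok\<close> states correctness at a parameter point, and \<open>tab_wf\<close> controls
  which constants occur, also on branches that no parameter point follows.\<close>

lemma zmult_zero_left [simp]: "zmult 0 g = 0"
  by (simp add: zmult_def)

lemma zmult_plus_one: "zmult (k + 1) g = zmult k g + (g::'g::ab_group_add)"
proof -
  consider "0 \<le> k" | "k = -1" | "k < -1" by linarith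
  then show ?thesis
  proof cases
    case 1
    then have "nat (k + 1) = Suc (nat k)" by simp
    then show ?thesis using 1 by (simp add: zmult_def add.commute)
  next
    case 3
    then have "nat (- k) = Suc (nat (- (k + 1)))" by simp
    then show ?thesis using 3 by (simp add: zmult_def)
  qed (simp add: zmult_def)
qed

lemma zmult_one [simp]: "zmult 1 g = (g::'g::ab_group_add)"
  using zmult_plus_one[of 0 g] by simp

lemma zmult_minus_one_step: "zmult (k - 1) g = zmult k g - (g::'g::ab_group_add)"
  using zmult_plus_one[of "k - 1" g] by (simp add: algebra_simps)

lemma zmult_add_left: "zmult (k + l) g = zmult k g + zmult l (g::'g::ab_group_add)"
proof (induction l rule: int_induct[of _ 0])
  case (step1 i)
  then show ?case by (simp add: zmult_plus_one flip: add.assoc)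
next
  case (step2 i)
  have "k + (i - 1) = (k + i) - 1" by simp
  then show ?case using step2 by (simp only: zmult_minus_one_step) (simp add: algebra_simps)
qed simp

lemma zmult_zero_right [simp]: "zmult k (0::'g::ab_group_add) = 0"
  by (simp add: zmult_def)

lemma zmult_add_right: "zmult k (g + h) = zmult k g + zmult k (h::'g::ab_group_add)"
  by (simp add: zmult_def sum.distrib)

lemma zmult_minus_right: "zmult k (- g) = - zmult k (g::'g::ab_group_add)"
  by (metis add.right_inverse add_eq_0_iff zmult_add_right zmult_zero_right)

lemma zmult_diff_right: "zmult k (g - h) = zmult k g - zmult k (h::'g::ab_group_add)"
  using zmult_add_right[of k g "- h"] by (simp add: zmult_minus_right)

lemma zmult_minus_left: "zmult (- k) g = - zmult k (g::'g::ab_group_add)"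
  using zmult_add_left[of k "- k" g] by (simp add: eq_neg_iff_add_eq_0 add.commute)

lemma zmult_diff_left: "zmult (k - l) g = zmult k g - zmult l (g::'g::ab_group_add)"
  using zmult_add_left[of k "- l" g] by (simp add: zmult_minus_left)

lemma zmult_mult: "zmult (k * l) g = zmult k (zmult l (g::'g::ab_group_add))"
proof (induction k rule: int_induct[of _ 0])
  case (step1 i)
  have "(i + 1) * l = i * l + l" by (simp add: algebra_simps)
  then show ?case using step1 by (simp add: zmult_add_left)
next
  case (step2 i)
  have "(i - 1) * l = i * l - l" by (simp add: algebra_simps)
  then show ?case using step2 by (simp add: zmult_diff_left)
qed simp

lemma zmult_commute: "zmult k (zmult l g) = zmult l (zmult k (g::'g::ab_group_add))"
  by (simp add: mult.commute flip: zmult_mult)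

lemma zmult_sum: "zmult k (\<Sum>x\<in>A. f x) = (\<Sum>x\<in>A. zmult k (f x :: 'g::ab_group_add))"
  by (induction A rule: infinite_finite_induct) (simp_all add: zmult_add_right)

lemma zmult_pos: "0 < k \<Longrightarrow> 0 < g \<Longrightarrow> 0 < zmult k (g::'g::linordered_ab_group_add)"
  unfolding zmult_def by (auto intro!: sum_pos simp: lessThan_empty_iff)

lemma zmult_neg: "0 < k \<Longrightarrow> g < 0 \<Longrightarrow> zmult k (g::'g::linordered_ab_group_add) < 0"
  using zmult_pos[of k "- g"] by (simp add: zmult_minus_right)

lemma sign_zmult: "0 < k \<Longrightarrow> sign (zmult k g) = sign (g::'g::linordered_ab_group_add)"
  using zmult_pos[of k g] zmult_neg[of k g] by (cases g "0::'g" rule: linorder_cases) (auto simp: sign_def)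

lemma zmult_cancel: "0 < k \<Longrightarrow> zmult k g = zmult k h \<longleftrightarrow> g = (h::'g::linordered_ab_group_add)"
  using sign_zmult[of k "g - h"] by (auto simp: sign_def zmult_diff_right split: if_splits)

lemma sign_minus: "sign (- x) = - sign (x::'g::linordered_ab_group_add)"
  by (auto simp: sign_def)

lemma sign_eq_0_iff [simp]: "sign x = 0 \<longleftrightarrow> x = 0"
  by (simp add: sign_def)

lemma sign_eq_iffs:
  fixes x :: "'a::{zero,linorder}"
  shows "sign x = 1 \<longleftrightarrow> 0 < x" "sign x = -1 \<longleftrightarrow> x < 0" "sign x \<le> 0 \<longleftrightarrow> x \<le> 0" "0 \<le> sign x \<longleftrightarrow> 0 \<le> x"
    "sign x < 0 \<longleftrightarrow> x < 0" "0 < sign x \<longleftrightarrow> 0 < x"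
  by (auto simp: sign_def)

text \<open>The description denotes an element where the group is divisible; uniqueness holds in
  every ordered abelian group, which has no torsion.\<close>

definition qmult :: "rat \<Rightarrow> 'g::linordered_ab_group_add \<Rightarrow> 'g" where
  "qmult q g = (THE h. zmult (snd (quotient_of q)) h = zmult (fst (quotient_of q)) g)"

text \<open>The value group is an instance by \<open>group_divisible\<close>; the locale keeps the
  rational linear algebra apart from valuations.\<close>

locale divisible_group =
  fixes ty :: "'g::linordered_ab_group_add itself"
  assumes divisible: "0 < k \<Longrightarrow> \<exists>h. zmult k h = (g::'g)"
begin

text \<open>Any fraction \<open>a / b\<close> representing \<open>q\<close> characterizes the
  multiple, not only the reduced one of \<open>quotient_of\<close>: cross-multiply and cancel, using
  the absence of torsion.\<close>

lemma qmultI: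
  assumes "0 < b" "q = of_int a / of_int b" "zmult b h = zmult a (g::'g)"
  shows "qmult q g = h"
proof -
  obtain a' b' where q: "quotient_of q = (a', b')" by (cases "quotient_of q")
  then have b': "0 < b'" "q = of_int a' / of_int b'"
    using quotient_of_denom_pos[OF q] quotient_of_div[OF q] by simp_all
  with assms have "of_int a * of_int b' = (of_int a' * of_int b :: rat)"
    by (simp add: field_simps)
  then have ab: "a * b' = a' * b" by (metis of_int_eq_iff of_int_mult)
  have "zmult b (zmult b' h) = zmult b (zmult a' g)"
    using assms(3) ab zmult_commute[of b b' h] by (simp add: mult.commute flip: zmult_mult)
  then have h: "zmult b' h = zmult a' g" using assms(1) by (simp add: zmult_cancel)
  have "h' = h" if "zmult b' h' = zmult a' g" for h'
  proof -
    have "zmult b' h' = zmult b' h" by (simp only: that h)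
    then show ?thesis by (rule iffD1[OF zmult_cancel[OF b'(1)]])
  qed
  with h show ?thesis unfolding qmult_def q fst_conv snd_conv by (rule the_equality)
qed

lemma zmult_qmult:
  assumes "0 < b" "q = of_int a / of_int b"
  shows "zmult b (qmult q g) = zmult a (g::'g)"
proof -
  obtain h where "zmult b h = zmult a g" using divisible[OF assms(1)] by blast
  then show ?thesis using qmultI[OF assms] by simp
qed

lemma rat_fraction: obtains a b where "0 < b" "q = of_int a / (of_int b :: rat)"
  by (cases "quotient_of q") (use that quotient_of_denom_pos quotient_of_div in blast)

lemma qmult_add_right: "qmult q (g + h) = qmult q g + qmult q (h::'g)"
proof -
  obtain a b where ab: "0 < b" "q = of_int a / (of_int b :: rat)" by (rule rat_fraction)
  show ?thesis by (rule qmultI[OF ab]) (simp add: zmult_add_right zmult_qmult[OF ab])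
qed

lemma qmult_add_left: "qmult (q + r) (g::'g) = qmult q g + qmult r g"
proof -
  obtain a b where ab: "0 < b" "q = of_int a / (of_int b :: rat)" by (rule rat_fraction)
  obtain c d where cd: "0 < d" "r = of_int c / (of_int d :: rat)" by (rule rat_fraction)
  have q: "q = of_int (a * d) / of_int (b * d)" and r: "r = of_int (b * c) / of_int (b * d)"
    and bd: "0 < b * d" using ab cd by auto
  have qr: "q + r = of_int (a * d + b * c) / of_int (b * d)"
    unfolding q r by (simp add: add_divide_distrib)
  show ?thesis
    by (rule qmultI[OF bd qr]) (simp only: zmult_add_right zmult_qmult[OF bd q] zmult_qmult[OF bd r] zmult_add_left)
qed

lemma qmult_mult: "qmult (q * r) (g::'g) = qmult q (qmult r g)"
proof -
  obtain a b where ab: "0 < b" "q = of_int a / (of_int b :: rat)" by (rule rat_fraction)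
  obtain c d where cd: "0 < d" "r = of_int c / (of_int d :: rat)" by (rule rat_fraction)
  have bd: "0 < b * d" and qr: "q * r = of_int (a * c) / of_int (b * d)" using ab cd by auto
  have "zmult (b * d) (qmult q (qmult r g)) = zmult d (zmult b (qmult q (qmult r g)))"
    by (simp add: mult.commute flip: zmult_mult)
  also have "\<dots> = zmult a (zmult d (qmult r g))"
    by (simp add: zmult_qmult[OF ab] zmult_commute[of d a])
  also have "\<dots> = zmult (a * c) g" by (simp add: zmult_qmult[OF cd] zmult_mult)
  finally show ?thesis by (rule qmultI[OF bd qr])
qed

lemma qmult_of_int: "qmult (of_int k) (g::'g) = zmult k g"
  by (rule qmultI[of 1 _ k]) auto

text \<open>Makes the \<open>scale_\<close> laws of vector spaces available for
  \<open>qmult\<close>.\<close>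

sublocale vector_space "qmult :: rat \<Rightarrow> 'g \<Rightarrow> 'g"
  using qmult_of_int[of 1] by unfold_locales (simp_all add: qmult_add_right qmult_add_left qmult_mult)

lemma sign_qmult: "0 < q \<Longrightarrow> sign (qmult q (g::'g)) = sign g"
proof -
  assume q: "0 < q"
  obtain a b where ab: "0 < b" "q = of_int a / (of_int b :: rat)" by (rule rat_fraction)
  then have "0 < a" using q by (simp add: zero_less_divide_iff)
  then show ?thesis using zmult_qmult[OF ab, of g] sign_zmult[OF ab(1), of "qmult q g"] by (simp add: sign_zmult)
qed

lemma qmult_le_cancel: "0 < q \<Longrightarrow> qmult q g \<le> qmult q h \<longleftrightarrow> g \<le> (h::'g)"
  using sign_qmult[of q "g - h"] sign_eq_iffs(3)[of "g - h"] sign_eq_iffs(3)[of "qmult q (g - h)"]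
  by (simp add: scale_right_diff_distrib)

lemma qmult_less_cancel: "0 < q \<Longrightarrow> qmult q g < qmult q h \<longleftrightarrow> g < (h::'g)"
  using qmult_le_cancel[of q h g] by (simp flip: not_le)

lemma qmult_pos: "0 < q \<Longrightarrow> 0 < g \<Longrightarrow> 0 < qmult q (g::'g)"
  using qmult_less_cancel[of q 0 g] by simp

lemma qmult_mono_left: "q \<le> r \<Longrightarrow> 0 \<le> g \<Longrightarrow> qmult q g \<le> qmult r (g::'g)"
  using qmult_pos[of "r - q" g] by (cases "q = r \<or> g = 0") (auto simp: scale_left_diff_distrib order.order_iff_strict)

section \<open>Linear forms in the values of the constants\<close>

definition lval :: "('c \<Rightarrow> 'g) \<Rightarrow> 'c lin \<Rightarrow> 'g" where
  "lval \<nu> l = (\<Sum>c\<in>Poly_Mapping.keys l. qmult (Poly_Mapping.lookup l c) (\<nu> c))"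

lemma lval_superset:
  "finite A \<Longrightarrow> Poly_Mapping.keys l \<subseteq> A \<Longrightarrow> lval \<nu> l = (\<Sum>c\<in>A. qmult (Poly_Mapping.lookup l c) (\<nu> c))"
  unfolding lval_def by (rule sum.mono_neutral_left) (auto simp: in_keys_iff)

lemma lval_0 [simp]: "lval \<nu> 0 = 0"
  by (simp add: lval_def)

lemma lval_single [simp]: "lval \<nu> (Poly_Mapping.single c q) = qmult q (\<nu> c)"
  by (simp add: lval_def)

lemma lval_add: "lval \<nu> (l + m) = lval \<nu> l + lval \<nu> m"
proof -
  let ?A = "Poly_Mapping.keys l \<union> Poly_Mapping.keys m"
  have "Poly_Mapping.keys (l + m) \<subseteq> ?A" by (rule keys_add)
  then show ?thesis
    by (simp add: lval_superset[of ?A] lookup_add qmult_add_left sum.distrib)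
qed

lemma lookup_scale_lin: "Poly_Mapping.lookup (scale_lin q l) c = q * Poly_Mapping.lookup l c"
  by (simp add: Poly_Mapping.map.rep_eq when_def)

lemma keys_scale_lin: "Poly_Mapping.keys (scale_lin q l) \<subseteq> Poly_Mapping.keys l"
  by (auto simp: in_keys_iff lookup_scale_lin)

lemma lval_scale: "lval \<nu> (scale_lin q l) = qmult q (lval \<nu> l)"
proof -
  have "lval \<nu> (scale_lin q l) = (\<Sum>c\<in>Poly_Mapping.keys l. qmult (Poly_Mapping.lookup (scale_lin q l) c) (\<nu> c))"
    by (rule lval_superset[OF finite_keys keys_scale_lin])
  then show ?thesis by (simp only: lookup_scale_lin lval_def qmult_mult scale_sum_right)
qed

lemma lval_diff: "lval \<nu> (l - m) = lval \<nu> l - lval \<nu> m"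
  using lval_add[of \<nu> "l - m" m] by (simp add: algebra_simps)

primrec veval :: "('c \<Rightarrow> 'g) \<Rightarrow> 'c vexp \<Rightarrow> 'g" where
  "veval \<nu> (Lin l) = lval \<nu> l"
| "veval \<nu> (VAdd e f) = veval \<nu> e + veval \<nu> f"
| "veval \<nu> (VScale q e) = qmult q (veval \<nu> e)"
| "veval \<nu> (VMin e f) = min (veval \<nu> e) (veval \<nu> f)"
| "veval \<nu> (VMax e f) = max (veval \<nu> e) (veval \<nu> f)"

lemma veval_vmin_list: "es \<noteq> [] \<Longrightarrow> veval \<nu> (vmin_list es) = Min (veval \<nu> ` set es)"
  by (induction es rule: vmin_list.induct) auto

lemma veval_vmax_list: "es \<noteq> [] \<Longrightarrow> veval \<nu> (vmax_list es) = Max (veval \<nu> ` set es)"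
  by (induction es rule: vmax_list.induct) auto

text \<open>\<open>D\<close>, the product of all denominators, makes each coefficient an integer, so
  the floor in \<open>clear_denominators\<close> loses nothing. By the equality of the keys a test
  mentions the same constants as the linear form.\<close>

lemma clear_denominators_facts:
  obtains D where "0 < D"
    "\<And>c. of_int (Poly_Mapping.lookup (clear_denominators l) c) = of_int D * Poly_Mapping.lookup l c"
    "Poly_Mapping.keys (clear_denominators l) = Poly_Mapping.keys l"
proof -
  define D where "D = (\<Prod>c\<in>Poly_Mapping.keys l. snd (quotient_of (Poly_Mapping.lookup l c)))"
  have D: "0 < D" unfolding D_def by (rule prod_pos) (simp add: quotient_of_denom_pos')
  have eq: "of_int (Poly_Mapping.lookup (clear_denominators l) c) = of_int D * Poly_Mapping.lookup l c" for c
  proof (cases "c \<in> Poly_Mapping.keys l")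
    case True
    let ?q = "Poly_Mapping.lookup l c"
    have "snd (quotient_of ?q) dvd D" unfolding D_def using True by (intro dvd_prodI) auto
    then obtain k where k: "D = snd (quotient_of ?q) * k" by blast
    have "?q = of_int (fst (quotient_of ?q)) / of_int (snd (quotient_of ?q))"
      by (simp add: quotient_of_div)
    moreover have "0 < snd (quotient_of ?q)" by (simp add: quotient_of_denom_pos')
    ultimately have "of_int D * ?q = of_int (k * fst (quotient_of ?q))"
      by (simp add: k field_simps)
    then show ?thesis
      using True unfolding clear_denominators_def Let_def D_def[symmetric] Poly_Mapping.map.rep_eq
      by (simp only: in_keys_iff when_simps simp_thms floor_of_int HOL.True_implies_equals HOL.not_False_eq_True when_def if_True)
  next
    case False
    then show ?thesis by (simp add: clear_denominators_def Poly_Mapping.map.rep_eq when_def in_keys_iff)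
  qed
  have keys: "Poly_Mapping.keys (clear_denominators l) = Poly_Mapping.keys l"
  proof -
    have "Poly_Mapping.lookup (clear_denominators l) c = 0 \<longleftrightarrow> Poly_Mapping.lookup l c = 0" for c
      using eq[of c] D by (metis mult_eq_0_iff of_int_0_eq_iff order_less_irrefl)
    then show ?thesis by (intro set_eqI) (simp only: in_keys_iff)
  qed
  show thesis by (rule that[OF D eq keys])
qed

lemma sign_clear_denominators:
  "sign (\<Sum>c\<in>Poly_Mapping.keys (clear_denominators l).
     zmult (Poly_Mapping.lookup (clear_denominators l) c) (\<nu> c)) = sign (lval \<nu> l)"
proof -
  obtain D where D: "0 < D"
    "\<And>c. of_int (Poly_Mapping.lookup (clear_denominators l) c) = of_int D * Poly_Mapping.lookup l c"
    "Poly_Mapping.keys (clear_denominators l) = Poly_Mapping.keys l"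
    by (rule clear_denominators_facts[of l]) (rule that)
  have "zmult (Poly_Mapping.lookup (clear_denominators l) c) (\<nu> c)
      = zmult D (qmult (Poly_Mapping.lookup l c) (\<nu> c))" for c
    by (simp add: D(2) flip: qmult_of_int)
  then have "(\<Sum>c\<in>Poly_Mapping.keys (clear_denominators l).
     zmult (Poly_Mapping.lookup (clear_denominators l) c) (\<nu> c)) = zmult D (lval \<nu> l)"
    by (simp add: D(3) lval_def zmult_sum)
  then show ?thesis using D(1) by (simp add: sign_zmult)
qed

end

section \<open>Polynomials over real closed fields\<close>

lemma rcf_ivt:
  fixes p :: "'r::linordered_field poly"
  assumes "real_closed TYPE('r)" "a \<le> b" "poly p a * poly p b \<le> 0"
  shows "\<exists>x. a \<le> x \<and> x \<le> b \<and> poly p x = 0"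
proof (cases "poly p a \<le> 0 \<and> 0 \<le> poly p b")
  case True
  then show ?thesis using assms(1,2) unfolding real_closed_def by blast
next
  case False
  then have "poly (- p) a \<le> 0 \<and> 0 \<le> poly (- p) b"
    using assms(3) by (auto simp: mult_le_0_iff)
  then have "\<exists>x. a \<le> x \<and> x \<le> b \<and> poly (- p) x = 0"
    using assms(1,2) unfolding real_closed_def by blast
  then show ?thesis by simp
qed

lemma rcf_ivt_strict:
  fixes p :: "'r::linordered_field poly"
  assumes "real_closed TYPE('r)" "a < b" "poly p a * poly p b < 0"
  shows "\<exists>x. a < x \<and> x < b \<and> poly p x = 0"
proof -
  obtain x where "a \<le> x" "x \<le> b" "poly p x = 0"
    using rcf_ivt[of a b p] assms by (meson less_imp_le)
  moreover have "x \<noteq> a" "x \<noteq> b" using assms(3) \<open>poly p x = 0\<close> by auto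
  ultimately show ?thesis by (metis order_le_less)
qed

text \<open>Between consecutive roots, \<open>p = (x - a)\<^sup>m (x - b)\<^sup>n q\<close> where \<open>q\<close> has constant sign, and the cofactor
  of \<open>(x - a)\<^sup>m\<^sup>-\<^sup>1 (x - b)\<^sup>n\<^sup>-\<^sup>1\<close> in \<open>p'\<close> changes sign.\<close>

lemma rcf_rolle_consecutive:
  fixes p :: "'r::linordered_field poly"
  assumes rc: "real_closed TYPE('r)" and ab: "a < b" and p: "poly p a = 0" "poly p b = 0" "p \<noteq> 0"
    and no: "\<And>x. a < x \<Longrightarrow> x < b \<Longrightarrow> poly p x \<noteq> 0"
  shows "\<exists>c. a < c \<and> c < b \<and> poly (pderiv p) c = 0"
proof -
  obtain q1 where q1: "p = [:- a, 1:] ^ order a p * q1" "\<not> [:- a, 1:] dvd q1"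
    using order_decomp[OF p(3)] by blast
  have q1a: "poly q1 a \<noteq> 0" using q1(2) by (simp add: poly_eq_0_iff_dvd)
  have q1_0: "q1 \<noteq> 0" using q1a by auto
  obtain q where q: "q1 = [:- b, 1:] ^ order b q1 * q" "\<not> [:- b, 1:] dvd q"
    using order_decomp[OF q1_0] by blast
  have qb: "poly q b \<noteq> 0" using q(2) by (simp add: poly_eq_0_iff_dvd)
  have qa: "poly q a \<noteq> 0" using q1a q(1) by (metis mult_zero_right poly_mult)
  have "order a p \<noteq> 0" using p(1,3) order_root by blast
  then obtain m where m: "order a p = Suc m" using not0_implies_Suc by blast
  have "poly p b = (b - a) ^ order a p * poly q1 b" by (subst q1(1)) simp
  then have "poly q1 b = 0" using p(2) ab by auto
  then have "order b q1 \<noteq> 0" using q1_0 order_root by blast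
  then obtain n where n: "order b q1 = Suc n" using not0_implies_Suc by blast
  have pe: "p = [:- a, 1:] ^ Suc m * ([:- b, 1:] ^ Suc n * q)" using q1(1) q(1) m n by metis
  have sgn: "0 < poly q a * poly q b"
  proof (rule ccontr)
    assume "\<not> 0 < poly q a * poly q b"
    then have "poly q a * poly q b < 0" using qa qb by (meson mult_eq_0_iff not_less_iff_gr_or_eq)
    then obtain x where "a < x" "x < b" "poly q x = 0" using rcf_ivt_strict[OF rc ab] by blast
    moreover have "poly p x = 0" unfolding pe using \<open>poly q x = 0\<close> by simp
    ultimately show False using no by blast
  qed
  define g where "g = smult (of_nat (Suc m)) ([:- b, 1:] * q) + smult (of_nat (Suc n)) ([:- a, 1:] * q)
     + [:- a, 1:] * [:- b, 1:] * pderiv q"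
  have linear: "pderiv [:- c, 1:] = 1" for c :: 'r by (simp add: pderiv_pCons one_pCons)
  \<comment> \<open>Abstract \<open>A\<close> and \<open>B\<close> of derivative 1 keep this a ring
    identity instead of an expansion of linear factors.\<close>
  have "pderiv (A ^ Suc m * (B ^ Suc n * q)) = A ^ m * B ^ n *
      (smult (of_nat (Suc m)) (B * q) + smult (of_nat (Suc n)) (A * q) + A * B * pderiv q)"
    if "pderiv A = 1" "pderiv B = 1" for A B :: "'r poly"
    unfolding pderiv_mult pderiv_power_Suc that by (simp add: algebra_simps)
  then have "pderiv p = [:- a, 1:] ^ m * [:- b, 1:] ^ n * g"
    unfolding pe g_def using linear by blast
  moreover have "poly g a * poly g b < 0"
  proof -
    have "poly g a = of_nat (Suc m) * (a - b) * poly q a" by (simp add: g_def algebra_simps)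
    moreover have "poly g b = of_nat (Suc n) * (b - a) * poly q b" by (simp add: g_def algebra_simps)
    ultimately have "poly g a * poly g b
        = (of_nat (Suc m) * of_nat (Suc n) * (b - a)) * ((a - b) * (poly q a * poly q b))"
      by (simp only: mult.assoc mult.left_commute mult.commute)
    moreover have "(a - b) * (poly q a * poly q b) < 0"
      using ab sgn by (simp add: mult_neg_pos)
    moreover have "0 < of_nat (Suc m) * of_nat (Suc n) * (b - a)"
      using ab by (intro mult_pos_pos) (simp_all only: of_nat_0_less_iff diff_gt_0_iff_gt zero_less_Suc)
    ultimately show ?thesis by (simp only: mult_pos_neg)
  qed
  ultimately show ?thesis using rcf_ivt_strict[OF rc ab] by fastforce
qed

text \<open>Replacing \<open>b\<close> by the first root \<open>c\<close> after \<open>a\<close>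
  makes the two roots consecutive; it exists because a nonzero polynomial has finitely many
  roots.\<close>

lemma rcf_rolle:
  fixes p :: "'r::linordered_field poly"
  assumes rc: "real_closed TYPE('r)" and ab: "a < b" and p: "poly p a = 0" "poly p b = 0"
  shows "\<exists>c. a < c \<and> c < b \<and> poly (pderiv p) c = 0"
proof (cases "p = 0")
  case True
  then show ?thesis using dense[OF ab] by auto
next
  case False
  let ?S = "{x. poly p x = 0} \<inter> {a<..b}"
  have fin: "finite ?S" using poly_roots_finite[OF False] by blast
  have ne: "b \<in> ?S" using ab p by simp
  define c where "c = Min ?S"
  have c: "c \<in> ?S" unfolding c_def using Min_in[OF fin] ne by blast
  have "poly p x \<noteq> 0" if "a < x" "x < c" for x
    using that c Min_le[OF fin, of x] unfolding c_def[symmetric] by auto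
  then obtain d where "a < d" "d < c" "poly (pderiv p) d = 0"
    using rcf_rolle_consecutive[OF rc _ p(1) _ False, of c] c by auto
  then show ?thesis using c by auto
qed

text \<open>Rolle's theorem for the difference of \<open>p\<close> and its secant line, whose slope
  is \<open>s\<close>.\<close>

lemma rcf_mvt:
  fixes p :: "'r::linordered_field poly"
  assumes rc: "real_closed TYPE('r)" and ab: "a < b"
  shows "\<exists>c. a < c \<and> c < b \<and> poly p b - poly p a = (b - a) * poly (pderiv p) c"
proof -
  define s where "s = (poly p b - poly p a) / (b - a)"
  define q where "q = p - [:poly p a - s * a, s:]"
  have "poly q a = 0" by (simp add: q_def algebra_simps)
  moreover have "s * (b - a) = poly p b - poly p a" using ab by (simp add: s_def)
  then have "poly q b = 0" by (simp add: q_def algebra_simps)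
  ultimately obtain c where c: "a < c" "c < b" "poly (pderiv q) c = 0"
    using rcf_rolle[OF rc ab] by blast
  have "poly (pderiv q) c = poly (pderiv p) c - s"
    by (simp add: q_def pderiv_diff pderiv_pCons)
  then show ?thesis using c ab by (auto simp: s_def field_simps)
qed

lemma rcf_constant_sign:
  fixes p :: "'r::linordered_field poly"
  assumes rc: "real_closed TYPE('r)"
    and no: "\<And>x. x \<in> I \<Longrightarrow> poly p x \<noteq> 0"
    and I: "\<And>x y z. x \<in> I \<Longrightarrow> z \<in> I \<Longrightarrow> x < y \<Longrightarrow> y < z \<Longrightarrow> y \<in> I"
    and xy: "x \<in> I" "y \<in> I"
  shows "sign (poly p x) = sign (poly p y)"
proof -
  have *: "sign (poly p x) = sign (poly p y)" if "x \<in> I" "y \<in> I" "x < y" for x y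
  proof (rule ccontr)
    assume "sign (poly p x) \<noteq> sign (poly p y)"
    then have "poly p x * poly p y < 0"
      using no[OF that(1)] no[OF that(2)] by (auto simp: sign_def mult_less_0_iff split: if_splits)
    then show False using rcf_ivt_strict[OF rc that(3)] no I that by blast
  qed
  show ?thesis
  proof (cases x y rule: linorder_cases)
    case less
    then show ?thesis by (rule *[OF xy])
  next
    case greater
    then show ?thesis by (rule *[OF xy(2,1), symmetric])
  qed simp
qed

lemma mult_sign_self: "of_int (sign x) * x = \<bar>x::'r::linordered_idom\<bar>"
  by (simp add: sign_def abs_if)

text \<open>A constant sign persists weakly at the ends: the strictly opposite sign at an end would
  force a root inside, and the sign 0 forces \<open>p = 0\<close> because an open interval is
  infinite.\<close>

lemma rcf_abs_at_closure:
  fixes p :: "'r::linordered_field poly"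
  assumes rc: "real_closed TYPE('r)" and ab: "a < b"
    and s: "\<And>x. a < x \<Longrightarrow> x < b \<Longrightarrow> sign (poly p x) = s"
    and x: "a \<le> x" "x \<le> b"
  shows "of_int s * poly p x = \<bar>poly p x\<bar>"
proof -
  consider "a < x" "x < b" | "x = a" "x < b" | "x = b" "a < x" using x ab by fastforce
  then show ?thesis
  proof cases
    case 1
    then show ?thesis using s[of x] mult_sign_self[of "poly p x"] by simp
  next
    case 2
    obtain m where m: "a < m" "m < b" using dense[OF ab] by blast
    have "0 \<le> poly p a * poly p m"
    proof (rule ccontr)
      assume "\<not> 0 \<le> poly p a * poly p m"
      then obtain y where "a < y" "y < m" "poly p y = 0"
        using rcf_ivt_strict[OF rc m(1), of p] by (auto simp: not_le)
      then have "s = 0" "poly p m = 0" using s[of y] s[OF m] m by (auto simp: sign_def split: if_splits)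
      then show False using \<open>\<not> 0 \<le> poly p a * poly p m\<close> by simp
    qed
    moreover have "poly p a = 0" if "poly p m = 0"
    proof (rule ccontr)
      assume a0: "poly p a \<noteq> 0"
      have "poly p y = 0" if "a < y" "y < b" for y
        using s[OF that] s[OF m] \<open>poly p m = 0\<close> by (auto simp: sign_def split: if_splits)
      then have "{a<..<b} \<subseteq> {x. poly p x = 0}" by auto
      moreover have "infinite {a<..<b}" using ab infinite_Ioo by blast
      ultimately have "p = 0" using poly_roots_finite finite_subset by blast
      then show False using a0 by simp
    qed
    ultimately show ?thesis unfolding 2(1) using s[OF m]
      by (auto simp: sign_def abs_if zero_le_mult_iff split: if_splits)
  next
    case 3
    obtain m where m: "a < m" "m < b" using dense[OF ab] by blast
    have "0 \<le> poly p m * poly p b"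
    proof (rule ccontr)
      assume "\<not> 0 \<le> poly p m * poly p b"
      then obtain y where "m < y" "y < b" "poly p y = 0"
        using rcf_ivt_strict[OF rc m(2), of p] by (auto simp: not_le)
      then have "s = 0" "poly p m = 0" using s[of y] s[OF m] m by (auto simp: sign_def split: if_splits)
      then show False using \<open>\<not> 0 \<le> poly p m * poly p b\<close> by simp
    qed
    moreover have "poly p b = 0" if "poly p m = 0"
    proof (rule ccontr)
      assume a0: "poly p b \<noteq> 0"
      have "poly p y = 0" if "a < y" "y < b" for y
        using s[OF that] s[OF m] \<open>poly p m = 0\<close> by (auto simp: sign_def split: if_splits)
      then have "{a<..<b} \<subseteq> {x. poly p x = 0}" by auto
      moreover have "infinite {a<..<b}" using ab infinite_Ioo by blast
      ultimately have "p = 0" using poly_roots_finite finite_subset by blast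
      then show False using a0 by simp
    qed
    ultimately show ?thesis unfolding 3(1) using s[OF m]
      by (auto simp: sign_def abs_if zero_le_mult_iff split: if_splits)
  qed
qed

lemma pderiv_funpow_Suc: "(pderiv ^^ Suc j) p = (pderiv ^^ j) (pderiv p)"
  by (simp add: funpow_swap1)

section \<open>Archimedean domination\<close>

text \<open>Comparison of nonnegative elements up to a positive integer factor. Positive integers
  have value 0, so elements related by \<open>\<simeq>\<close> have the same value
  (\<open>w_dom_eq\<close>). This is all the precision required of the generalized Taylor
  formula.\<close>

definition dom_le :: "'r::linordered_field \<Rightarrow> 'r \<Rightarrow> bool" (infix \<open>\<lesssim>\<close> 50) where
  "x \<lesssim> y \<longleftrightarrow> 0 \<le> x \<and> 0 \<le> y \<and> (\<exists>n. x \<le> of_nat n * y)"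

definition dom_eq :: "'r::linordered_field \<Rightarrow> 'r \<Rightarrow> bool" (infix \<open>\<simeq>\<close> 50) where
  "x \<simeq> y \<longleftrightarrow> x \<lesssim> y \<and> y \<lesssim> x"

lemma dom_leI: "0 \<le> x \<Longrightarrow> 0 \<le> y \<Longrightarrow> x \<le> of_nat n * y \<Longrightarrow> x \<lesssim> y"
  by (auto simp: dom_le_def)

lemma dom_le_of_le: "0 \<le> x \<Longrightarrow> x \<le> y \<Longrightarrow> x \<lesssim> y"
  by (rule dom_leI[of _ _ 1]) auto

lemma dom_le_refl: "0 \<le> x \<Longrightarrow> x \<lesssim> x"
  by (rule dom_le_of_le) auto

lemma dom_le_trans [trans]: "x \<lesssim> y \<Longrightarrow> y \<lesssim> z \<Longrightarrow> x \<lesssim> z"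
proof -
  assume "x \<lesssim> y" "y \<lesssim> z"
  then obtain m n where *: "0 \<le> x" "0 \<le> z" "x \<le> of_nat m * y" "y \<le> of_nat n * z"
    by (auto simp: dom_le_def)
  have "x \<le> of_nat m * (of_nat n * z)" using *(3) mult_left_mono[OF *(4), of "of_nat m"] by simp
  then show ?thesis using * by (intro dom_leI[of _ _ "m * n"]) (auto simp: mult.assoc)
qed

lemma dom_le_add: "x \<lesssim> z \<Longrightarrow> y \<lesssim> z \<Longrightarrow> x + y \<lesssim> z"
proof -
  assume "x \<lesssim> z" "y \<lesssim> z"
  then obtain m n where *: "0 \<le> x" "0 \<le> y" "0 \<le> z" "x \<le> of_nat m * z" "y \<le> of_nat n * z"
    by (auto simp: dom_le_def)
  then show ?thesis by (intro dom_leI[of _ _ "m + n"]) (auto simp: distrib_right intro: add_mono)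
qed

lemma dom_le_add_mono: "x \<lesssim> x' \<Longrightarrow> y \<lesssim> y' \<Longrightarrow> x + y \<lesssim> x' + y'"
  by (intro dom_le_add; rule dom_le_trans, assumption, rule dom_le_of_le) (auto simp: dom_le_def)

lemma dom_le_mult: "x \<lesssim> x' \<Longrightarrow> y \<lesssim> y' \<Longrightarrow> x * y \<lesssim> x' * y'"
proof -
  assume "x \<lesssim> x'" "y \<lesssim> y'"
  then obtain m n where *: "0 \<le> x" "0 \<le> y" "0 \<le> x'" "0 \<le> y'" "x \<le> of_nat m * x'" "y \<le> of_nat n * y'"
    by (auto simp: dom_le_def)
  have "x * y \<le> (of_nat m * x') * (of_nat n * y')" using * by (intro mult_mono) auto
  then show ?thesis using * by (intro dom_leI[of _ _ "m * n"]) (auto simp: algebra_simps)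
qed

lemma dom_le_sum: "(\<And>i. i \<in> A \<Longrightarrow> f i \<lesssim> g i) \<Longrightarrow> sum f A \<lesssim> sum g A"
  by (induction A rule: infinite_finite_induct) (auto intro: dom_le_refl dom_le_add_mono)

lemma dom_eq_refl: "0 \<le> x \<Longrightarrow> x \<simeq> x"
  by (simp add: dom_eq_def dom_le_refl)

lemma dom_eq_add: "x \<simeq> x' \<Longrightarrow> y \<simeq> y' \<Longrightarrow> x + y \<simeq> x' + y'"
  by (simp add: dom_eq_def dom_le_add_mono)

section \<open>Generalized Taylor formula\<close>

lemma sides_Cons: "sides (s # t # \<sigma>) = (s = t) # sides (t # \<sigma>)"
  by (simp add: sides_def)

lemma sides_singleton [simp]: "sides [s] = []"
  by (simp add: sides_def)

lemma length_sides [simp]: "length (sides \<sigma>) = length \<sigma> - 1"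
  by (simp add: sides_def)

lemma run_length_singleton [simp]: "run_length [s] = 0"
  by (simp add: run_length_def)

lemma run_length_Cons:
  "run_length (s # t # \<sigma>) =
     (if sides (t # \<sigma>) \<noteq> [] \<and> hd (sides (t # \<sigma>)) \<noteq> (s = t) then 1 else Suc (run_length (t # \<sigma>)))"
  by (cases "sides (t # \<sigma>)") (auto simp: run_length_def sides_Cons)

text \<open>The derivative of highest order is constant and belongs to no side; it is read at
  \<open>a\<close>.\<close>

definition base_end :: "int list \<Rightarrow> 'r \<Rightarrow> 'r \<Rightarrow> nat \<Rightarrow> 'r" where
  "base_end \<sigma> a b j = (if j < length (sides \<sigma>) \<and> \<not> sides \<sigma> ! j then b else a)"

text \<open>The right side of the generalized Taylor formula, with each factor \<open>h_j\<close>
  replaced by the power of \<open>s\<close> to which it is comparable.\<close>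

definition taylor_sum :: "int list \<Rightarrow> 'r::linordered_field poly \<Rightarrow> 'r \<Rightarrow> 'r \<Rightarrow> 'r \<Rightarrow> 'r" where
  "taylor_sum \<sigma> P a b s = (\<Sum>j<length \<sigma>.
     \<bar>poly ((pderiv ^^ j) P) (base_end \<sigma> a b j)\<bar> * (b - a) ^ j * s ^ min j (run_length \<sigma>))"

definition from_end :: "'r::linordered_field \<Rightarrow> 'r \<Rightarrow> bool \<Rightarrow> 'r \<Rightarrow> 'r" where
  "from_end a b L s = (if L then a + s * (b - a) else b - s * (b - a))"

definition signs_on :: "'r::linordered_field \<Rightarrow> 'r \<Rightarrow> 'r poly \<Rightarrow> int list \<Rightarrow> bool" where
  "signs_on a b P \<sigma> \<longleftrightarrow> length \<sigma> = Suc (degree P) \<and>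
     (\<forall>j<length \<sigma>. \<sigma> ! j \<noteq> 0 \<and> (\<forall>x. a < x \<longrightarrow> x < b \<longrightarrow> sign (poly ((pderiv ^^ j) P) x) = \<sigma> ! j))"

lemma from_end_bounds:
  assumes "a < b" "0 \<le> s" "s \<le> 1"
  shows "a \<le> from_end a b L s" "from_end a b L s \<le> b"
proof -
  have "s * (b - a) \<le> 1 * (b - a)" using assms by (intro mult_right_mono) auto
  moreover have "0 \<le> s * (b - a)" using assms by simp
  ultimately show "a \<le> from_end a b L s" "from_end a b L s \<le> b"
    by (auto simp: from_end_def algebra_simps)
qed

lemma from_end_flip: "from_end a b (\<not> L) s = from_end a b L (1 - s)"
  by (simp add: from_end_def algebra_simps)

lemma sign_ne_0_cases: "sign x \<noteq> 0 \<Longrightarrow> sign x = 1 \<or> sign x = -1"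
  by (auto simp: sign_def split: if_splits)

lemma poly_degree_0_eq: "degree P = 0 \<Longrightarrow> poly P x = poly P y"
  by (auto elim!: degree_eq_zeroE)

lemma signs_on_pderiv:
  assumes "signs_on a b P (s # t # \<sigma>)" shows "signs_on a b (pderiv P) (t # \<sigma>)"
proof -
  have len: "Suc (length \<sigma>) = degree P"
    and st: "\<And>j. j < Suc (Suc (length \<sigma>)) \<Longrightarrow> (s # t # \<sigma>) ! j \<noteq> 0 \<and>
      (\<forall>x. a < x \<longrightarrow> x < b \<longrightarrow> sign (poly ((pderiv ^^ j) P) x) = (s # t # \<sigma>) ! j)"
    using assms by (auto simp: signs_on_def)
  have "(t # \<sigma>) ! j \<noteq> 0 \<and> (\<forall>x. a < x \<longrightarrow> x < b \<longrightarrow> sign (poly ((pderiv ^^ j) (pderiv P)) x) = (t # \<sigma>) ! j)"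
    if "j < Suc (length \<sigma>)" for j
    using st[of "Suc j"] that by (simp add: pderiv_funpow_Suc del: funpow.simps)
  then show ?thesis using len by (simp add: signs_on_def degree_pderiv)
qed

context
  fixes a b :: "'r::linordered_field"
  assumes rc: "real_closed TYPE('r)" and ab: "a < b"
begin

text \<open>From the end where it is smaller, \<open>|P|\<close> grows at rate \<open>|P'|\<close>.\<close>

lemma abs_increment:
  assumes P: "\<And>x. a < x \<Longrightarrow> x < b \<Longrightarrow> sign (poly P x) = s" "s \<noteq> 0"
    and P': "\<And>x. a < x \<Longrightarrow> x < b \<Longrightarrow> sign (poly (pderiv P) x) = t" "t \<noteq> 0"
    and u: "0 \<le> u" "u \<le> w" "w \<le> 1"
  shows "\<exists>\<theta>. u \<le> \<theta> \<and> \<theta> \<le> w \<and> \<bar>poly P (from_end a b (s = t) w)\<bar> =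
    \<bar>poly P (from_end a b (s = t) u)\<bar> + (w - u) * (b - a) * \<bar>poly (pderiv P) (from_end a b (s = t) \<theta>)\<bar>"
proof (cases "u = w")
  case True
  then show ?thesis by auto
next
  case False
  then have uw: "u < w" using u by simp
  let ?L = "s = t"
  let ?f = "from_end a b ?L"
  have h: "0 < b - a" using ab by simp
  define x y where "x = min (?f u) (?f w)" and "y = max (?f u) (?f w)"
  have lt: "u * (b - a) < w * (b - a)" using uw h by simp
  then have xy: "x < y" by (auto simp: x_def y_def from_end_def)
  have xy_eq: "x = (if ?L then ?f u else ?f w)" "y = (if ?L then ?f w else ?f u)"
    using lt by (auto simp: x_def y_def from_end_def)
  have diff: "y - x = (w - u) * (b - a)"
    using lt by (auto simp: x_def y_def from_end_def algebra_simps min_def max_def)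
  obtain c where c: "x < c" "c < y" "poly P y - poly P x = (y - x) * poly (pderiv P) c"
    using rcf_mvt[OF rc xy] by blast
  \<comment> \<open>The relative position of the mean value point \<open>c\<close>, measured from
    the base end.\<close>
  define \<theta> where "\<theta> = (if ?L then (c - a) / (b - a) else (b - c) / (b - a))"
  have f\<theta>: "?f \<theta> = c" using h by (simp add: from_end_def \<theta>_def)
  have th: "u \<le> \<theta>" "\<theta> \<le> w"
    using c(1,2) h by (auto simp: \<theta>_def xy_eq from_end_def pos_le_divide_eq pos_divide_le_eq split: if_splits)
  have in_ab: "a \<le> ?f v" "?f v \<le> b" if "0 \<le> v" "v \<le> 1" for v
    using from_end_bounds[OF ab that] by auto
  have abs_P: "of_int s * poly P (?f v) = \<bar>poly P (?f v)\<bar>" if "0 \<le> v" "v \<le> 1" for v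
    by (rule rcf_abs_at_closure[OF rc ab P(1)]) (use in_ab that in auto)
  have abs_P': "of_int t * poly (pderiv P) c = \<bar>poly (pderiv P) c\<bar>"
    by (rule rcf_abs_at_closure[OF rc ab P'(1)]) (use in_ab[of \<theta>] th u f\<theta> in auto)
  obtain m where m: "a < m" "m < b" using dense[OF ab] by blast
  have st: "s = 1 \<or> s = -1" "t = 1 \<or> t = -1"
    using sign_ne_0_cases P(1)[OF m] P'(1)[OF m] P(2) P'(2) by metis+
  have "\<bar>poly P (?f w)\<bar> - \<bar>poly P (?f u)\<bar> = of_int s * (poly P (?f w) - poly P (?f u))"
    using abs_P[of u] abs_P[of w] u by (simp add: algebra_simps)
  \<comment> \<open>If \<open>s = t\<close> the two points keep their order; otherwise
    \<open>s = - t\<close> and the order is reversed too.\<close>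
  also have "\<dots> = of_int t * (poly P y - poly P x)"
    using st lt by (auto simp: x_def y_def from_end_def min_def max_def)
  also have "\<dots> = (w - u) * (b - a) * \<bar>poly (pderiv P) c\<bar>"
    by (simp only: c(3) diff flip: abs_P') (simp only: mult.left_commute mult.commute)
  finally show ?thesis using f\<theta> th by (intro exI[of _ \<theta>]) (simp add: algebra_simps)
qed

text \<open>The factor 2 serves to compare position \<open>u\<close> with \<open>u / 2\<close>, and
  position \<open>1\<close> with \<open>1 - u / 2\<close>.\<close>

lemma taylor_sum_dom:
  assumes "0 \<le> s" "0 \<le> u" "s \<le> 2 * u"
  shows "taylor_sum \<sigma> P a b s \<lesssim> taylor_sum \<sigma> P a b u"
  unfolding taylor_sum_def
proof (rule dom_le_sum)
  fix j assume "j \<in> {..<length \<sigma>}"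
  let ?k = "min j (run_length \<sigma>)"
  have "s ^ ?k \<le> (2 * u) ^ ?k" using assms by (intro power_mono) auto
  then have "s ^ ?k \<lesssim> u ^ ?k"
    using assms by (intro dom_leI[of _ _ "2 ^ ?k"]) (auto simp: power_mult_distrib)
  then show "\<bar>poly ((pderiv ^^ j) P) (base_end \<sigma> a b j)\<bar> * (b - a) ^ j * s ^ ?k
      \<lesssim> \<bar>poly ((pderiv ^^ j) P) (base_end \<sigma> a b j)\<bar> * (b - a) ^ j * u ^ ?k"
    by (intro dom_le_mult dom_le_refl) (use ab in auto)
qed

text \<open>If the side changes right after index 0, the initial run has length 1 and all exponents
  of \<open>w\<close> beyond the first term are 1; this is expressed by taking the inner sum at
  position 1. Otherwise the run of the derivative is prolonged by one.\<close>

lemma taylor_sum_Cons: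
  "taylor_sum (s # t # \<sigma>) P a b w = \<bar>poly P (if s = t then a else b)\<bar> +
     w * (b - a) * taylor_sum (t # \<sigma>) (pderiv P) a b
       (if sides (t # \<sigma>) \<noteq> [] \<and> hd (sides (t # \<sigma>)) \<noteq> (s = t) then 1 else w)"
proof -
  have base: "base_end (s # t # \<sigma>) a b (Suc j) = base_end (t # \<sigma>) a b j" for j
    by (simp add: base_end_def sides_Cons)
  have pw: "w ^ min (Suc j) (run_length (s # t # \<sigma>)) =
      w * (if sides (t # \<sigma>) \<noteq> [] \<and> hd (sides (t # \<sigma>)) \<noteq> (s = t) then 1 else w) ^ min j (run_length (t # \<sigma>))" for j
    by (simp add: run_length_Cons)
  have "taylor_sum (s # t # \<sigma>) P a b w = \<bar>poly P (base_end (s # t # \<sigma>) a b 0)\<bar> +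
     (\<Sum>j<length (t # \<sigma>). \<bar>poly ((pderiv ^^ Suc j) P) (base_end (s # t # \<sigma>) a b (Suc j))\<bar>
        * (b - a) ^ Suc j * w ^ min (Suc j) (run_length (s # t # \<sigma>)))"
    unfolding taylor_sum_def by (simp only: length_Cons sum.lessThan_Suc_shift) simp
  also have "base_end (s # t # \<sigma>) a b 0 = (if s = t then a else b)"
    by (simp add: base_end_def sides_Cons)
  finally show ?thesis
    unfolding taylor_sum_def sum_distrib_left pderiv_funpow_Suc base pw
    by (simp only: power_Suc mult_ac)
qed

text \<open>Induction along the derivatives. The increment \<open>D\<close> of \<open>|P|\<close>
  from its base end is \<open>u (b - a)\<close> times a value of \<open>|P'|\<close> at an
  intermediate point. Since \<open>|P'|\<close> is monotonic, that value can be bounded above by one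
  to which the induction hypothesis applies. A lower bound needs an intermediate point away from the
  place where \<open>|P'|\<close> may be small, and is obtained from one half of the way.\<close>

theorem generalized_taylor:
  assumes "signs_on a b P \<sigma>" "0 \<le> u" "u \<le> 1"
  shows "\<bar>poly P (from_end a b (left_based \<sigma>) u)\<bar> \<simeq> taylor_sum \<sigma> P a b u"
  using assms
proof (induction \<sigma> arbitrary: P u rule: induct_list012)
  case 1
  then show ?case by (simp add: signs_on_def)
next
  case (2 s)
  then have "degree P = 0" by (simp add: signs_on_def)
  then have "poly P x = poly P y" for x y by (metis poly_degree_0_eq)
  then have "taylor_sum [s] P a b u = \<bar>poly P (from_end a b (left_based [s]) u)\<bar>"
    unfolding taylor_sum_def by simp metis
  then show ?case by (simp add: dom_eq_refl)
next
  case (3 s t \<sigma>)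
  let ?\<sigma> = "t # \<sigma>" and ?L = "s = t" and ?P' = "pderiv P"
  let ?f = "from_end a b ?L"
  have S: "signs_on a b ?P' ?\<sigma>" by (rule signs_on_pderiv[OF 3(3)])
  have IH: "\<bar>poly ?P' (from_end a b (left_based ?\<sigma>) w)\<bar> \<simeq> taylor_sum ?\<sigma> ?P' a b w"
    if "0 \<le> w" "w \<le> 1" for w
    using 3(2)[OF S that] .
  have sP: "sign (poly P x) = s" "s \<noteq> 0" and sP': "sign (poly ?P' x) = t" "t \<noteq> 0"
    if "a < x" "x < b" for x
    using 3(3) that unfolding signs_on_def by (metis nth_Cons_0 nth_Cons_Suc One_nat_def funpow.simps comp_apply id_apply length_Cons zero_less_Suc Suc_less_eq)+
  obtain m where m: "a < m" "m < b" using dense[OF ab] by blast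
  have inc: "\<exists>\<theta>. v \<le> \<theta> \<and> \<theta> \<le> w \<and> \<bar>poly P (?f w)\<bar> =
    \<bar>poly P (?f v)\<bar> + (w - v) * (b - a) * \<bar>poly ?P' (?f \<theta>)\<bar>"
    if "0 \<le> v" "v \<le> w" "w \<le> 1" for v w
    by (rule abs_increment) (use sP sP' m that in blast)+
  have lb: "left_based (s # ?\<sigma>) = ?L" by (simp add: left_based_def sides_Cons)
  \<comment> \<open>\<open>P'\<close> is based at the end opposite to that of \<open>P\<close>. A
    constant \<open>P'\<close> has no side and counts as not opposite.\<close>
  define opp where "opp \<longleftrightarrow> sides ?\<sigma> \<noteq> [] \<and> hd (sides ?\<sigma>) \<noteq> ?L"
  have mono': "\<bar>poly ?P' (from_end a b (left_based ?\<sigma>) v)\<bar> \<le> \<bar>poly ?P' (from_end a b (left_based ?\<sigma>) w)\<bar>"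
    if "0 \<le> v" "v \<le> w" "w \<le> 1" for v w
  proof (cases \<sigma>)
    case Nil
    then have "degree ?P' = 0" using S by (simp add: signs_on_def)
    then show ?thesis by (metis poly_degree_0_eq order_refl)
  next
    case (Cons r \<tau>)
    have sP'': "sign (poly (pderiv ?P') x) = r" "r \<noteq> 0" if "a < x" "x < b" for x
      using S that unfolding signs_on_def Cons by (metis nth_Cons_0 nth_Cons_Suc One_nat_def funpow.simps comp_apply id_apply length_Cons zero_less_Suc Suc_less_eq)+
    have "left_based ?\<sigma> = (t = r)" by (simp add: left_based_def sides_Cons Cons)
    moreover have "\<exists>\<theta>. v \<le> \<theta> \<and> \<theta> \<le> w \<and> \<bar>poly ?P' (from_end a b (t = r) w)\<bar> =
      \<bar>poly ?P' (from_end a b (t = r) v)\<bar> + (w - v) * (b - a) * \<bar>poly (pderiv ?P') (from_end a b (t = r) \<theta>)\<bar>"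
      by (rule abs_increment) (use sP' sP'' m that in blast)+
    ultimately obtain \<theta> where "\<bar>poly ?P' (from_end a b (left_based ?\<sigma>) w)\<bar> =
      \<bar>poly ?P' (from_end a b (left_based ?\<sigma>) v)\<bar> + (w - v) * (b - a) * \<bar>poly (pderiv ?P') (from_end a b (left_based ?\<sigma>) \<theta>)\<bar>"
      by auto
    moreover have "0 \<le> (w - v) * (b - a) * \<bar>poly (pderiv ?P') (from_end a b (left_based ?\<sigma>) \<theta>)\<bar>"
      using that ab by (intro mult_nonneg_nonneg) auto
    ultimately show ?thesis by linarith
  qed
  define D where "D = \<bar>poly P (?f u)\<bar> - \<bar>poly P (?f 0)\<bar>"
  \<comment> \<open>The position at which the sum for \<open>P'\<close> is comparable with
    \<open>D / (u (b - a))\<close>. If \<open>P'\<close> is based at the other end, the half of the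
    way next to the base end of \<open>P\<close> is at relative distance at least \<open>1/2\<close>
    from the base of \<open>P'\<close>, whence the position 1.\<close>
  define w where "w = (if opp then 1 else u)"
  have u: "0 \<le> u" "u \<le> 1" using 3 by auto
  have w0: "0 \<le> w" "w \<le> 1" using u by (auto simp: w_def)
  have uh: "0 \<le> u * (b - a)" using u ab by simp
  obtain \<theta> where \<theta>: "0 \<le> \<theta>" "\<theta> \<le> u" and D: "D = u * (b - a) * \<bar>poly ?P' (?f \<theta>)\<bar>"
    using inc[of 0 u] u unfolding D_def by auto
  have D0: "0 \<le> D" unfolding D by (rule mult_nonneg_nonneg[OF uh abs_ge_zero])
  \<comment> \<open>The split at \<open>u / 2\<close> is for the lower bound: if \<open>opp\<close>
    holds \<open>|P'|\<close> is large on the first half, otherwise on the second one.\<close>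
  obtain \<theta>1 where \<theta>1: "0 \<le> \<theta>1" "\<theta>1 \<le> u / 2" and D1:
    "\<bar>poly P (?f (u/2))\<bar> = \<bar>poly P (?f 0)\<bar> + (u/2) * (b - a) * \<bar>poly ?P' (?f \<theta>1)\<bar>"
    using inc[of 0 "u/2"] u by auto
  obtain \<theta>2 where \<theta>2: "u / 2 \<le> \<theta>2" "\<theta>2 \<le> u" and D2:
    "\<bar>poly P (?f u)\<bar> = \<bar>poly P (?f (u/2))\<bar> + (u - u/2) * (b - a) * \<bar>poly ?P' (?f \<theta>2)\<bar>"
    using inc[of "u/2" u] u by auto
  have half: "u - u / 2 = u / 2" by simp
  have parts0: "0 \<le> (u/2) * (b - a) * \<bar>poly ?P' (?f \<theta>1)\<bar>" "0 \<le> (u/2) * (b - a) * \<bar>poly ?P' (?f \<theta>2)\<bar>"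
    using u ab by (auto intro!: mult_nonneg_nonneg)
  have D12: "(u/2) * (b - a) * \<bar>poly ?P' (?f \<theta>1)\<bar> \<le> D" "(u/2) * (b - a) * \<bar>poly ?P' (?f \<theta>2)\<bar> \<le> D"
    unfolding D_def D2 D1 half using parts0 by linarith+
  have "\<exists>x. \<bar>poly ?P' (?f \<theta>)\<bar> \<le> x \<and> x \<lesssim> taylor_sum ?\<sigma> ?P' a b w"
  proof (cases opp)
    case True
    then have L: "left_based ?\<sigma> = (\<not> ?L)" by (auto simp: opp_def left_based_def)
    have "\<bar>poly ?P' (?f \<theta>)\<bar> \<le> \<bar>poly ?P' (from_end a b (left_based ?\<sigma>) 1)\<bar>"
      using mono'[of "1 - \<theta>" 1] \<theta> u unfolding L from_end_flip by simp
    then show ?thesis using IH[of 1] True unfolding dom_eq_def w_def by auto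
  next
    case False
    show ?thesis
    proof (cases "left_based ?\<sigma> = ?L")
      case True
      have "\<bar>poly ?P' (?f \<theta>)\<bar> \<le> \<bar>poly ?P' (from_end a b (left_based ?\<sigma>) u)\<bar>"
        using mono'[of \<theta> u] \<theta> u unfolding True by simp
      then show ?thesis using IH[of u] u False unfolding dom_eq_def w_def by auto
    next
      case neq: False
      then have "sides ?\<sigma> = []" using False by (auto simp: opp_def left_based_def)
      then have "degree ?P' = 0" using S length_sides[of ?\<sigma>] by (simp add: signs_on_def)
      then have "\<bar>poly ?P' (?f \<theta>)\<bar> = \<bar>poly ?P' (from_end a b (left_based ?\<sigma>) u)\<bar>"
        by (metis poly_degree_0_eq)
      then show ?thesis using IH[of u] u False unfolding dom_eq_def w_def by auto
    qed
  qed
  then obtain z where z: "\<bar>poly ?P' (?f \<theta>)\<bar> \<le> z" "z \<lesssim> taylor_sum ?\<sigma> ?P' a b w" by blast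
  have up: "D \<lesssim> u * (b - a) * taylor_sum ?\<sigma> ?P' a b w"
    unfolding D by (rule dom_le_mult[OF dom_le_refl[OF uh] dom_le_trans[OF dom_le_of_le[OF abs_ge_zero z(1)] z(2)]])
  have "\<exists>x. taylor_sum ?\<sigma> ?P' a b w \<lesssim> x \<and> (u/2) * (b - a) * x \<le> D"
  proof (cases opp)
    case True
    then have L: "left_based ?\<sigma> = (\<not> ?L)" by (auto simp: opp_def left_based_def)
    \<comment> \<open>On the first half the distance to the base of \<open>P'\<close> is at least
      \<open>1 - u / 2\<close>, and \<open>1 <= 2 (1 - u / 2)\<close> allows a comparison with
      position 1.\<close>
    let ?x = "\<bar>poly ?P' (from_end a b (left_based ?\<sigma>) (1 - u/2))\<bar>"
    have "?x \<le> \<bar>poly ?P' (?f \<theta>1)\<bar>"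
      using mono'[of "1 - u/2" "1 - \<theta>1"] \<theta>1 u unfolding L from_end_flip by simp
    then have "(u/2) * (b - a) * ?x \<le> (u/2) * (b - a) * \<bar>poly ?P' (?f \<theta>1)\<bar>"
      using u ab by (intro mult_left_mono) auto
    moreover have "taylor_sum ?\<sigma> ?P' a b w \<lesssim> taylor_sum ?\<sigma> ?P' a b (1 - u/2)"
      using u True by (intro taylor_sum_dom) (auto simp: w_def)
    moreover have "taylor_sum ?\<sigma> ?P' a b (1 - u/2) \<lesssim> ?x"
      using IH[of "1 - u/2"] u by (auto simp: dom_eq_def)
    ultimately show ?thesis using D12(1) by (meson dom_le_trans order_trans)
  next
    case False
    let ?x = "\<bar>poly ?P' (from_end a b (left_based ?\<sigma>) (u/2))\<bar>"
    have "?x \<le> \<bar>poly ?P' (?f \<theta>2)\<bar>"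
    proof (cases "left_based ?\<sigma> = ?L")
      case True
      show ?thesis using mono'[of "u/2" \<theta>2] \<theta>2 u unfolding True by simp
    next
      case neq: False
      then have "sides ?\<sigma> = []" using False by (auto simp: opp_def left_based_def)
      then have "degree ?P' = 0" using S length_sides[of ?\<sigma>] by (simp add: signs_on_def)
      then show ?thesis by (metis poly_degree_0_eq order_refl)
    qed
    then have "(u/2) * (b - a) * ?x \<le> (u/2) * (b - a) * \<bar>poly ?P' (?f \<theta>2)\<bar>"
      using u ab by (intro mult_left_mono) auto
    moreover have "taylor_sum ?\<sigma> ?P' a b w \<lesssim> taylor_sum ?\<sigma> ?P' a b (u/2)"
      using u False by (intro taylor_sum_dom) (auto simp: w_def)
    moreover have "taylor_sum ?\<sigma> ?P' a b (u/2) \<lesssim> ?x"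
      using IH[of "u/2"] u by (auto simp: dom_eq_def)
    ultimately show ?thesis using D12(2) by (meson dom_le_trans order_trans)
  qed
  then obtain x where x: "taylor_sum ?\<sigma> ?P' a b w \<lesssim> x" "(u/2) * (b - a) * x \<le> D" by blast
  have "u * (b - a) * taylor_sum ?\<sigma> ?P' a b w \<lesssim> u * (b - a) * x"
    using dom_le_mult[OF dom_le_refl[OF uh] x(1)] .
  also have "u * (b - a) * x \<lesssim> D"
  proof (rule dom_leI[of _ _ 2])
    show "0 \<le> u * (b - a) * x" using x(1) by (intro mult_nonneg_nonneg[OF uh]) (auto simp: dom_le_def)
    have "u * (b - a) * x = 2 * ((u/2) * (b - a) * x)" by simp
    then show "u * (b - a) * x \<le> of_nat 2 * D" using x(2) by simp
  qed (rule D0)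
  finally have "D \<simeq> u * (b - a) * taylor_sum ?\<sigma> ?P' a b w" using up by (simp add: dom_eq_def)
  then have "\<bar>poly P (?f 0)\<bar> + D \<simeq> \<bar>poly P (?f 0)\<bar> + u * (b - a) * taylor_sum ?\<sigma> ?P' a b w"
    by (intro dom_eq_add dom_eq_refl) auto
  moreover have "\<bar>poly P (?f 0)\<bar> + u * (b - a) * taylor_sum ?\<sigma> ?P' a b w = taylor_sum (s # ?\<sigma>) P a b u"
    unfolding taylor_sum_Cons w_def opp_def by (simp add: from_end_def)
  ultimately show ?case unfolding lb by (simp add: D_def)
qed

end

section \<open>Valuations of real closed fields\<close>

locale rcvf =
  fixes v :: "'r::linordered_field \<Rightarrow> 'g::linordered_ab_group_add extended" and V :: "'r set"
  assumes real_closed_valued: "real_closed_valued_field V" and valuation: "is_valuation v V"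
begin

text \<open>\<open>w 0\<close> is the default 0 and not infinity, so zero arguments and zero
  summands have to be excluded below.\<close>

abbreviation w :: "'r \<Rightarrow> 'g" where "w \<equiv> finite_value v"

lemma rc: "real_closed TYPE('r)"
  using real_closed_valued by (simp add: real_closed_valued_field_def)

lemma v_zero [simp]: "v 0 = \<infinity>"
  using valuation by (simp add: is_valuation_def)

lemma v_nonzero: "x \<noteq> 0 \<Longrightarrow> v x = Fin (w x)"
proof -
  assume "x \<noteq> 0"
  then have "v x \<in> range Fin" using valuation unfolding is_valuation_def by blast
  then show ?thesis by (auto simp: finite_value_def)
qed

lemma in_V_iff: "x \<in> V \<longleftrightarrow> x = 0 \<or> 0 \<le> w x"
proof -
  have "V = {x. 0 \<le> v x}" using valuation by (simp add: is_valuation_def)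
  then show ?thesis by (cases "x = 0") (auto simp: v_nonzero zero_extended_def)
qed

lemma w_mult: "x \<noteq> 0 \<Longrightarrow> y \<noteq> 0 \<Longrightarrow> w (x * y) = w x + w y"
proof -
  assume xy: "x \<noteq> 0" "y \<noteq> 0"
  have "v (x * y) = v x + v y" using valuation by (simp add: is_valuation_def)
  then show ?thesis using xy by (simp add: v_nonzero)
qed

lemma w_one [simp]: "w 1 = 0"
  using w_mult[of 1 1] by simp

lemma w_minus [simp]: "w (- x) = w x"
proof (cases "x = 0")
  case False
  have "w (-1) + w (-1) = 0" using w_mult[of "-1" "-1"] by simp
  then have "w (-1) = 0" by simp
  then show ?thesis using w_mult[of "-1" x] False by simp
qed simp

lemma w_abs [simp]: "w \<bar>x\<bar> = w x"
  by (simp add: abs_if)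

lemma w_inverse: "x \<noteq> 0 \<Longrightarrow> w (inverse x) = - w x"
  using w_mult[of x "inverse x"] by (simp add: eq_neg_iff_add_eq_0 add.commute)

lemma w_divide: "x \<noteq> 0 \<Longrightarrow> y \<noteq> 0 \<Longrightarrow> w (x / y) = w x - w y"
  by (simp add: divide_inverse w_mult w_inverse)

lemma w_power: "x \<noteq> 0 \<Longrightarrow> w (x ^ n) = zmult (int n) (w x)"
proof (induction n)
  case (Suc n)
  have "int (Suc n) = int n + 1" by simp
  then show ?case using Suc by (simp only: zmult_plus_one) (simp add: w_mult add.commute)
qed simp

text \<open>Convexity applied to \<open>1 = x / y + (1 - x / y)\<close> puts \<open>x / y\<close>
  into \<open>V\<close>.\<close>

lemma w_antimono: "0 < x \<Longrightarrow> x \<le> y \<Longrightarrow> w y \<le> w x"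
proof -
  assume xy: "0 < x" "x \<le> y"
  have conv: "a \<in> V" if "0 \<le> a" "0 \<le> b" "a + b \<in> V" for a b
    using real_closed_valued that unfolding real_closed_valued_field_def ordered_valued_field_def by blast
  have "x / y \<in> V" by (rule conv[of _ "1 - x / y"]) (use xy in \<open>auto simp: in_V_iff\<close>)
  then show ?thesis using xy by (simp add: in_V_iff w_divide)
qed

lemma w_add_ge: "x \<noteq> 0 \<Longrightarrow> y \<noteq> 0 \<Longrightarrow> x + y \<noteq> 0 \<Longrightarrow> min (w x) (w y) \<le> w (x + y)"
proof -
  assume "x \<noteq> 0" "y \<noteq> 0" "x + y \<noteq> 0"
  moreover have "min (v x) (v y) \<le> v (x + y)" using valuation by (simp add: is_valuation_def)
  ultimately show ?thesis by (simp add: v_nonzero)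
qed

text \<open>The sum of positive elements exceeds both summands, so by antimonotonicity its value
  cannot be larger than the minimum.\<close>

lemma w_add: "0 < x \<Longrightarrow> 0 < y \<Longrightarrow> w (x + y) = min (w x) (w y)"
  using w_add_ge[of x y] w_antimono[of x "x + y"] w_antimono[of y "x + y"]
  by (intro antisym) auto

lemma w_of_nat [simp]: "0 < n \<Longrightarrow> w (of_nat n) = 0"
proof (induction n rule: nat_induct_non_zero)
  case (Suc n)
  then show ?case using w_add[of "of_nat n" 1] by (simp add: add.commute)
qed simp

lemma w_dom_le: "0 < x \<Longrightarrow> x \<lesssim> y \<Longrightarrow> 0 < y \<and> w y \<le> w x"
proof -
  assume x: "0 < x" "x \<lesssim> y"
  then obtain n where n: "0 \<le> y" "x \<le> of_nat n * y" by (auto simp: dom_le_def)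
  then have ny: "0 < of_nat n * y" using x by linarith
  then have "0 < n" "0 < y" using n(1) by (auto simp: zero_less_mult_iff)
  then show ?thesis using w_antimono[OF x(1) n(2)] by (simp add: w_mult)
qed

lemma w_dom_eq: "x \<simeq> y \<Longrightarrow> w x = w y"
proof (cases "x = 0")
  case True
  assume "x \<simeq> y"
  then show ?thesis using True by (auto simp: dom_eq_def dom_le_def)
next
  case False
  assume xy: "x \<simeq> y"
  then have "0 < x" using False by (auto simp: dom_eq_def dom_le_def)
  then show ?thesis using xy w_dom_le[of x y] w_dom_le[of y x] by (auto simp: dom_eq_def)
qed

text \<open>The minimum runs over the nonzero summands only, because of the default
  \<open>w 0 = 0\<close>.\<close>

lemma w_sum:
  assumes "finite A" "\<And>i. i \<in> A \<Longrightarrow> 0 \<le> f i" "\<exists>i\<in>A. f i \<noteq> 0"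
  shows "w (sum f A) = Min ((\<lambda>i. w (f i)) ` {i\<in>A. f i \<noteq> 0})"
  using assms
proof (induction A rule: finite_induct)
  case (insert i A)
  show ?case
  proof (cases "\<exists>i\<in>A. f i \<noteq> 0")
    case False
    then have "sum f A = 0" by (intro sum.neutral) auto
    moreover have "{j \<in> insert i A. f j \<noteq> 0} = {i}" using False insert.prems by auto
    ultimately show ?thesis using insert.hyps by simp
  next
    case True
    then have IH: "w (sum f A) = Min ((\<lambda>i. w (f i)) ` {i\<in>A. f i \<noteq> 0})" using insert by simp
    have pos: "0 < sum f A"
      using True insert.prems(1) insert.hyps(1) by (metis insertCI order_le_less sum_nonneg sum_nonneg_eq_0_iff)
    show ?thesis
    proof (cases "f i = 0")
      case True
      then have "{j \<in> insert i A. f j \<noteq> 0} = {j \<in> A. f j \<noteq> 0}" by auto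
      then show ?thesis using insert.hyps True IH by simp
    next
      case False
      then have "0 < f i" using insert.prems(1) by (metis insertI1 order_le_less)
      moreover have "{j \<in> insert i A. f j \<noteq> 0} = insert i {j \<in> A. f j \<noteq> 0}" using False by auto
      moreover have "(\<lambda>i. w (f i)) ` {i\<in>A. f i \<noteq> 0} \<noteq> {}" using \<open>\<exists>i\<in>A. f i \<noteq> 0\<close> by auto
      ultimately show ?thesis using insert.hyps pos IH by (simp add: w_add)
    qed
  qed
qed simp

lemma w_surj: "\<exists>x>0. w x = g"
proof -
  have "Fin g \<in> v ` (- {0})" using valuation by (simp add: is_valuation_def)
  then obtain x where "x \<noteq> 0" "v x = Fin g" by (metis ComplD image_iff singletonI)
  then have "0 < \<bar>x\<bar>" "w \<bar>x\<bar> = g" by (auto simp: v_nonzero)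
  then show ?thesis by blast
qed

text \<open>A positive \<open>x\<close> of value \<open>g\<close> has an \<open>n\<close>-th root:
  \<open>X^n - x\<close> changes sign between 0 and \<open>1 + x\<close>, as
  \<open>x <= 1 + x <= (1 + x)^n\<close>.\<close>

lemma group_divisible: "0 < k \<Longrightarrow> \<exists>h. zmult k h = (g::'g)"
proof -
  assume k: "0 < k"
  obtain x where x: "0 < x" "w x = g" using w_surj by blast
  define n where "n = nat k"
  have n: "0 < n" "int n = k" using k by (auto simp: n_def)
  let ?p = "monom 1 n - [:x:]"
  have "0 \<le> poly ?p (1 + x)"
  proof -
    have "x \<le> 1 + x" by simp
    also have "1 + x \<le> (1 + x) ^ n" using x n(1) by (intro self_le_power) auto
    finally show ?thesis by (simp add: poly_monom)
  qed
  moreover have "poly ?p 0 \<le> 0" using x n(1) by (simp add: poly_monom power_0_left)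
  ultimately obtain y where y: "0 \<le> y" "poly ?p y = 0"
    using rc x unfolding real_closed_def by (metis add_nonneg_nonneg less_imp_le zero_le_one)
  then have "y ^ n = x" by (simp add: poly_monom)
  moreover have "y \<noteq> 0" using calculation x n(1) by (auto simp: power_0_left)
  ultimately show ?thesis using w_power[of y n] n x by auto
qed

sublocale divisible_group "TYPE('g)"
  by unfold_locales (rule group_divisible)

text \<open>This is where \<open>V \<noteq> UNIV\<close> enters. A nontrivial value group is
  unbounded, so samples on unbounded pieces exist.\<close>

lemma ex_pos: "\<exists>g::'g. 0 < g"
proof -
  have "V \<noteq> UNIV" using real_closed_valued by (simp add: real_closed_valued_field_def ordered_valued_field_def)
  then obtain x where "x \<notin> V" by blast
  then have "w x < 0" by (auto simp: in_V_iff)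
  then show ?thesis by (metis neg_0_less_iff_less)
qed

lemma w_fact_mult [simp]: "w (fact n * x) = w x"
proof (cases "x = 0")
  case False
  have "w (fact n) = 0" using w_of_nat[of "fact n"] by (simp add: of_nat_fact)
  then show ?thesis using False by (simp add: w_mult)
qed simp

end

section \<open>Specialization of the parameters\<close>

text \<open>Expansion into monomials, which reduces multiplicativity of \<open>eval_coef\<close> and
  closure of \<open>coef_over\<close> under products to the case of monomials.\<close>

lemma sum_single_lookup: "c = (\<Sum>m\<in>Poly_Mapping.keys c. Poly_Mapping.single m (Poly_Mapping.lookup c m))"
  by (rule poly_mapping_eqI)
    (simp add: lookup_sum lookup_single when_def sum.delta' in_keys_iff)

definition eval_monom :: "(nat \<Rightarrow> 'r::comm_semiring_1) \<Rightarrow> (nat \<Rightarrow>\<^sub>0 nat) \<Rightarrow> 'r" where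
  "eval_monom \<rho> m = (\<Prod>i\<in>Poly_Mapping.keys m. \<rho> i ^ Poly_Mapping.lookup m i)"

lemma eval_monom_superset:
  "finite A \<Longrightarrow> Poly_Mapping.keys m \<subseteq> A \<Longrightarrow> eval_monom \<rho> m = (\<Prod>i\<in>A. \<rho> i ^ Poly_Mapping.lookup m i)"
  unfolding eval_monom_def by (rule prod.mono_neutral_left) (auto simp: in_keys_iff)

lemma eval_monom_add: "eval_monom \<rho> (m + n) = eval_monom \<rho> m * eval_monom \<rho> n"
proof -
  let ?A = "Poly_Mapping.keys m \<union> Poly_Mapping.keys n"
  have "Poly_Mapping.keys (m + n) \<subseteq> ?A" by (rule keys_add)
  then show ?thesis
    by (simp add: eval_monom_superset[of ?A] lookup_add power_add prod.distrib)
qed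

lemma eval_coef_superset:
  "finite A \<Longrightarrow> Poly_Mapping.keys c \<subseteq> A \<Longrightarrow>
    eval_coef \<rho> c = (\<Sum>m\<in>A. Poly_Mapping.lookup c m * eval_monom \<rho> m)"
  unfolding eval_coef_def eval_monom_def by (rule sum.mono_neutral_left) (auto simp: in_keys_iff)

lemma eval_coef_zero [simp]: "eval_coef \<rho> 0 = 0"
  by (simp add: eval_coef_def)

lemma eval_coef_add: "eval_coef \<rho> (c + d) = eval_coef \<rho> c + eval_coef \<rho> d"
proof -
  let ?A = "Poly_Mapping.keys c \<union> Poly_Mapping.keys d"
  have "Poly_Mapping.keys (c + d) \<subseteq> ?A" by (rule keys_add)
  then show ?thesis
    by (simp add: eval_coef_superset[of ?A] lookup_add distrib_right sum.distrib)
qed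

lemma eval_coef_sum: "eval_coef \<rho> (\<Sum>i\<in>A. f i) = (\<Sum>i\<in>A. eval_coef \<rho> (f i))"
  by (induction A rule: infinite_finite_induct) (simp_all add: eval_coef_add)

lemma eval_coef_single: "eval_coef \<rho> (Poly_Mapping.single m a) = a * eval_monom \<rho> m"
  using eval_coef_superset[of "{m}" "Poly_Mapping.single m a" \<rho>] by (simp add: keys_single)

lemma eval_coef_mult: "eval_coef \<rho> (c * d) = eval_coef \<rho> c * eval_coef \<rho> d"
proof -
  let ?s = "\<lambda>c m. Poly_Mapping.single m (Poly_Mapping.lookup c m)"
  have "eval_coef \<rho> (c * d) =
      eval_coef \<rho> ((\<Sum>m\<in>Poly_Mapping.keys c. ?s c m) * (\<Sum>n\<in>Poly_Mapping.keys d. ?s d n))"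
    by (simp flip: sum_single_lookup)
  also have "\<dots> = (\<Sum>m\<in>Poly_Mapping.keys c. \<Sum>n\<in>Poly_Mapping.keys d. eval_coef \<rho> (?s c m) * eval_coef \<rho> (?s d n))"
    by (simp add: sum_product eval_coef_sum mult_single eval_coef_single eval_monom_add ac_simps)
  also have "\<dots> = eval_coef \<rho> (\<Sum>m\<in>Poly_Mapping.keys c. ?s c m) * eval_coef \<rho> (\<Sum>n\<in>Poly_Mapping.keys d. ?s d n)"
    by (simp add: sum_product eval_coef_sum)
  finally show ?thesis by (simp flip: sum_single_lookup)
qed

lemma eval_coef_const [simp]: "eval_coef \<rho> (Poly_Mapping.single 0 a) = a"
  by (simp add: eval_coef_single eval_monom_def)

lemma eval_coef_of_nat [simp]: "eval_coef \<rho> (of_nat n) = of_nat n"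
  using eval_coef_const[of \<rho> "of_nat n"] by simp

lemma eval_coef_one [simp]: "eval_coef \<rho> 1 = 1"
  using eval_coef_const[of \<rho> 1] by simp

lemma eval_coef_power: "eval_coef \<rho> (c ^ n) = eval_coef \<rho> c ^ n"
  by (induction n) (simp_all add: eval_coef_mult)

lemma coeff_specialize [simp]: "coeff (specialize \<rho> P) i = eval_coef \<rho> (coeff P i)"
  by (simp add: specialize_def coeff_map_poly)

lemma specialize_add: "specialize \<rho> (P + Q) = specialize \<rho> P + specialize \<rho> Q"
  by (rule poly_eqI) (simp add: eval_coef_add)

lemma specialize_mult: "specialize \<rho> (P * Q) = specialize \<rho> P * specialize \<rho> Q"
  by (rule poly_eqI) (simp add: coeff_mult eval_coef_sum eval_coef_mult)

lemma specialize_smult: "specialize \<rho> (smult c P) = smult (eval_coef \<rho> c) (specialize \<rho> P)"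
  by (rule poly_eqI) (simp add: eval_coef_mult)

lemma specialize_pderiv:
  "specialize \<rho> (pderiv P) = pderiv (specialize \<rho> (P :: 'r::linordered_field coef poly))"
  by (rule poly_eqI) (simp add: coeff_pderiv eval_coef_mult eval_coef_add)

lemma specialize_pderiv_funpow:
  "specialize \<rho> ((pderiv ^^ j) P) = (pderiv ^^ j) (specialize \<rho> (P :: 'r::linordered_field coef poly))"
  by (induction j) (simp_all add: specialize_pderiv)

lemma degree_pderiv_funpow:
  "degree ((pderiv ^^ j) P) = degree (P :: 'a::{comm_semiring_1,semiring_no_zero_divisors,semiring_char_0} poly) - j"
  by (induction j) (simp_all add: degree_pderiv)

lemma lead_coeff_pderiv:
  "lead_coeff (pderiv P) = of_nat (degree P) * lead_coeff (P :: 'a::{idom,semiring_char_0} poly)"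
proof (cases "degree P = 0")
  case True
  then show ?thesis by (metis mult_zero_left of_nat_0 pderiv_eq_0_iff leading_coeff_0_iff)
next
  case False
  then show ?thesis by (simp add: coeff_pderiv degree_pderiv del: of_nat_Suc)
qed

text \<open>In a family stable under derivation each leading coefficient is thus visible, up to a
  factorial, in a member of degree 0.\<close>

lemma top_constant_eq: "top_constant P = fact (degree P) * lead_coeff (P :: 'a::{idom,semiring_char_0} poly)"
proof -
  have "lead_coeff ((pderiv ^^ j) P) = (\<Prod>i<j. of_nat (degree P - i)) * lead_coeff P" for j
  proof (induction j)
    case (Suc j)
    have "lead_coeff ((pderiv ^^ Suc j) P) = of_nat (degree P - j) * lead_coeff ((pderiv ^^ j) P)"
      by (simp add: lead_coeff_pderiv degree_pderiv_funpow)
    then show ?case using Suc by (simp add: algebra_simps)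
  qed simp
  from this[of "degree P"] have "top_constant P = (\<Prod>i<degree P. of_nat (degree P - i)) * lead_coeff P"
    by (simp add: top_constant_def degree_pderiv_funpow)
  also have "(\<Prod>i<degree P. of_nat (degree P - i)) = (fact (degree P) :: 'a)"
    by (simp add: fact_prod_rev atLeast0LessThan)
  finally show ?thesis .
qed

section \<open>Coefficients over a subfield\<close>

definition poly_over :: "'r::zero set \<Rightarrow> 'r coef poly \<Rightarrow> bool" where
  "poly_over K P \<longleftrightarrow> (\<forall>i. coef_over K (coeff P i))"

context
  fixes K :: "'r::field set"
  assumes K: "is_subfield K"
begin

lemma subfield_closed:
  "0 \<in> K" "1 \<in> K" "x \<in> K \<Longrightarrow> y \<in> K \<Longrightarrow> x - y \<in> K" "x \<in> K \<Longrightarrow> y \<in> K \<Longrightarrow> x * y \<in> K"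
  "x \<in> K \<Longrightarrow> y \<in> K \<Longrightarrow> x + y \<in> K"
proof -
  have *: "0 \<in> K" "1 \<in> K" "\<And>x y. x \<in> K \<Longrightarrow> y \<in> K \<Longrightarrow> x - y \<in> K"
    "\<And>x y. x \<in> K \<Longrightarrow> y \<in> K \<Longrightarrow> x * y \<in> K"
    using K by (auto simp: is_subfield_def)
  show "0 \<in> K" "1 \<in> K" by (fact *)+
  show "x - y \<in> K" if "x \<in> K" "y \<in> K" by (rule *(3)[OF that])
  show "x * y \<in> K" if "x \<in> K" "y \<in> K" by (rule *(4)[OF that])
  show "x + y \<in> K" if "x \<in> K" "y \<in> K"
    using *(3)[OF that(1) *(3)[OF *(1) that(2)]] by simp
qed

lemma coef_over_iff: "coef_over K c \<longleftrightarrow> (\<forall>m. Poly_Mapping.lookup c m \<in> K)"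
  by (auto simp: coef_over_def)

lemma coef_over_add: "coef_over K c \<Longrightarrow> coef_over K d \<Longrightarrow> coef_over K (c + d)"
  by (simp add: coef_over_iff lookup_add subfield_closed)

lemma coef_over_diff: "coef_over K c \<Longrightarrow> coef_over K d \<Longrightarrow> coef_over K (c - d)"
  by (simp add: coef_over_iff lookup_minus subfield_closed)

lemma coef_over_0 [simp]: "coef_over K 0"
  by (simp add: coef_over_iff subfield_closed)

lemma coef_over_single: "a \<in> K \<Longrightarrow> coef_over K (Poly_Mapping.single m a)"
  by (simp add: coef_over_iff lookup_single when_def subfield_closed)

lemma coef_over_sum: "(\<And>i. i \<in> A \<Longrightarrow> coef_over K (f i)) \<Longrightarrow> coef_over K (sum f A)"
  by (induction A rule: infinite_finite_induct) (simp_all add: coef_over_add)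

lemma coef_over_mult: "coef_over K c \<Longrightarrow> coef_over K d \<Longrightarrow> coef_over K (c * d)"
proof -
  let ?s = "\<lambda>c m. Poly_Mapping.single m (Poly_Mapping.lookup c m)"
  assume "coef_over K c" "coef_over K d"
  then have "coef_over K ((\<Sum>m\<in>Poly_Mapping.keys c. ?s c m) * (\<Sum>n\<in>Poly_Mapping.keys d. ?s d n))"
    unfolding sum_product mult_single coef_over_iff
    by (intro coef_over_sum[unfolded coef_over_iff] coef_over_single[unfolded coef_over_iff]) (simp add: subfield_closed)
  then show ?thesis by (simp flip: sum_single_lookup)
qed

lemma coef_over_of_nat: "coef_over K (of_nat n)"
proof -
  have "of_nat n \<in> K" by (induction n) (simp_all add: subfield_closed)
  then show ?thesis using coef_over_single[of "of_nat n" 0] by simp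
qed

lemma poly_over_pderiv: "poly_over K P \<Longrightarrow> poly_over K (pderiv P)" for P :: "'r coef poly"
  unfolding poly_over_def coeff_pderiv using coef_over_mult[OF coef_over_of_nat] by blast

lemma poly_over_pseudo_mod:
  assumes P: "poly_over K P" and Q: "poly_over K Q"
  shows "poly_over K (pseudo_mod P (Q :: 'r coef poly))"
proof -
  \<comment> \<open>Invariant of the division loop. It concerns the running remainder alone;
    quotient, degree and counter stay arbitrary.\<close>
  have *: "poly_over K (snd (pseudo_divmod_main lc q r Q dr n))"
    if "coef_over K lc" "poly_over K r" for lc q r dr n
    using that(2)
  proof (induction n arbitrary: q r dr)
    case (Suc n)
    have "poly_over K (smult lc r - monom (coeff r dr) n * Q)"
      using Suc.prems that(1) Q unfolding poly_over_def
      by (auto simp: coeff_monom_mult intro!: coef_over_diff coef_over_mult)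
    then show ?case using Suc.IH by (simp add: Let_def)
  qed simp
  show ?thesis unfolding pseudo_mod_def pseudo_divmod_def
    using P Q * by (auto simp: poly_over_def)
qed

lemma poly_over_reduce: "poly_over K P \<Longrightarrow> poly_over K (reduce Z P)"
  by (simp add: poly_over_def reduce_def coeff_poly_cutoff)

end

section \<open>The computation of the families terminates\<close>

lemma proportional_refl: "proportional c c"
  unfolding proportional_def by (rule exI[of _ 1]) simp

lemma proportional_sym: "proportional c d \<Longrightarrow> proportional d c"
proof -
  assume "proportional c d"
  then obtain a where a: "a \<noteq> 0" "c = Poly_Mapping.single 0 a * d" by (auto simp: proportional_def)
  have "Poly_Mapping.single 0 (1 / a) * c = d"
    unfolding a(2) mult.assoc[symmetric] mult_single using a(1) by simp
  then show ?thesis using a(1) by (auto simp: proportional_def intro!: exI[of _ "1 / a"])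
qed

lemma proportional_trans: "proportional c d \<Longrightarrow> proportional d e \<Longrightarrow> proportional c e"
proof -
  assume "proportional c d" "proportional d e"
  then obtain a b where "a \<noteq> 0" "c = Poly_Mapping.single 0 a * d" "b \<noteq> 0" "d = Poly_Mapping.single 0 b * e"
    by (auto simp: proportional_def)
  then show ?thesis
    by (auto simp: proportional_def mult_single mult.assoc[symmetric] intro!: exI[of _ "a * b"])
qed

lemma eval_coef_proportional:
  "proportional c d \<Longrightarrow> eval_coef \<rho> c = 0 \<longleftrightarrow> eval_coef \<rho> (d :: 'r::field coef) = 0"
  by (auto simp: proportional_def eval_coef_mult)

lemma known_zero_0 [simp]: "known_zero Z 0"
  using proportional_refl by (auto simp: known_zero_def)

lemma known_zero_mono: "known_zero Z c \<Longrightarrow> Z \<subseteq> Z' \<Longrightarrow> known_zero Z' c"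
  by (auto simp: known_zero_def)

text \<open>\<open>0\<close> and \<open>1\<close> are adjoined since their status is always known.
  By consistency, a leading coefficient declared nonzero is never deleted by a later reduction
  (\<open>consistent_known\<close>).\<close>

definition consistent :: "'r::field coef set \<Rightarrow> 'r coef set \<Rightarrow> bool" where
  "consistent Z N \<longleftrightarrow> (\<forall>z\<in>insert 0 Z. \<forall>n\<in>insert 1 N. \<not> proportional z n)"

lemma consistent_known: "consistent Z N \<Longrightarrow> known_nonzero N c \<Longrightarrow> \<not> known_zero Z c"
  unfolding consistent_def known_zero_def known_nonzero_def
  using proportional_sym proportional_trans by blast

lemma consistent_insert_zero: "consistent Z N \<Longrightarrow> \<not> known_nonzero N c \<Longrightarrow> consistent (insert c Z) N"
  unfolding consistent_def known_nonzero_def by blast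

lemma consistent_insert_nonzero: "consistent Z N \<Longrightarrow> \<not> known_zero Z c \<Longrightarrow> consistent Z (insert c N)"
  unfolding consistent_def known_zero_def using proportional_sym by blast

text \<open>The cutoff used by \<open>reduce\<close>, without the bound
  \<open>i \<le> degree P\<close>: the higher coefficients are 0 and hence known to be zero.\<close>

definition kept_degree :: "'r::field coef set \<Rightarrow> 'r coef poly \<Rightarrow> nat" where
  "kept_degree Z P = Max (insert 0 {i. \<not> known_zero Z (coeff P i)})"

lemma kept_coeffs_bounded: "{i. \<not> known_zero Z (coeff P i)} \<subseteq> {..degree P}"
  using known_zero_0[of Z] by (auto simp: coeff_eq_0 intro!: le_degree) 

lemma kept_degree_ge: "\<not> known_zero Z (coeff P i) \<Longrightarrow> i \<le> kept_degree Z P"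
  unfolding kept_degree_def using finite_subset[OF kept_coeffs_bounded] by (intro Max_ge) auto

lemma kept_degree_cases: "kept_degree Z P = 0 \<or> \<not> known_zero Z (coeff P (kept_degree Z P))"
proof -
  have "finite (insert 0 {i. \<not> known_zero Z (coeff P i)})"
    using finite_subset[OF kept_coeffs_bounded] by auto
  then have "kept_degree Z P \<in> insert 0 {i. \<not> known_zero Z (coeff P i)}"
    unfolding kept_degree_def by (rule Max_in) simp
  then show ?thesis by auto
qed

lemma kept_degree_le: "kept_degree Z P \<le> degree P"
  using kept_degree_cases[of Z P] known_zero_0[of Z] le_degree[of P "kept_degree Z P"] by force

lemma coeff_reduce: "coeff (reduce Z P) i = (if i \<le> kept_degree Z P then coeff P i else 0)"
proof -
  have "{i. i \<le> degree P \<and> \<not> known_zero Z (coeff P i)} = {i. \<not> known_zero Z (coeff P i)}"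
    using kept_coeffs_bounded[of Z P] by auto
  then show ?thesis by (simp add: reduce_def kept_degree_def coeff_poly_cutoff less_Suc_eq_le)
qed

lemma degree_reduce: "degree (reduce Z P) = kept_degree Z P"
proof (rule antisym)
  show "degree (reduce Z P) \<le> kept_degree Z P" by (rule degree_le) (simp add: coeff_reduce)
  show "kept_degree Z P \<le> degree (reduce Z P)"
    using kept_degree_cases[of Z P] known_zero_0[of Z] by (force intro: le_degree simp: coeff_reduce)
qed

definition reduced :: "'r::field coef set \<Rightarrow> 'r coef poly \<Rightarrow> bool" where
  "reduced Z P \<longleftrightarrow> (1 \<le> degree P \<longrightarrow> \<not> known_zero Z (lead_coeff P))"

lemma reduced_kept_degree: "reduced Z P \<longleftrightarrow> kept_degree Z P = degree P"
proof
  assume "reduced Z P"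
  then have "degree P \<le> kept_degree Z P"
    using kept_degree_ge[of Z P "degree P"] by (cases "degree P = 0") (auto simp: reduced_def)
  then show "kept_degree Z P = degree P" using kept_degree_le[of Z P] by simp
next
  assume "kept_degree Z P = degree P"
  then show "reduced Z P" using kept_degree_cases[of Z P] by (auto simp: reduced_def)
qed

lemma reduce_eq_self: "reduced Z P \<Longrightarrow> reduce Z P = P"
  by (rule poly_eqI) (simp add: coeff_reduce reduced_kept_degree coeff_eq_0)

lemma reduced_reduce: "reduced Z (reduce Z P)"
  using kept_degree_cases[of Z P] by (auto simp: reduced_def degree_reduce coeff_reduce)

lemma degree_reduce_less: "\<not> reduced Z P \<Longrightarrow> degree (reduce Z P) < degree P"
  using kept_degree_le[of Z P] by (simp add: degree_reduce reduced_kept_degree)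

text \<open>Reducing with more knowledge absorbs an earlier reduction. Hence a generator settled
  before a zero decision does not become pending through the reduction of its product.\<close>

lemma reduce_reduce: "Z \<subseteq> Z' \<Longrightarrow> reduce Z' (reduce Z P) = reduce Z' P"
proof -
  assume Z: "Z \<subseteq> Z'"
  have "{i. \<not> known_zero Z' (coeff (reduce Z P) i)} = {i. \<not> known_zero Z' (coeff P i)}"
    using known_zero_mono[OF _ Z] kept_degree_ge[of Z P] by (auto simp: coeff_reduce split: if_splits)
  then have *: "kept_degree Z' (reduce Z P) = kept_degree Z' P" by (simp add: kept_degree_def)
  have "kept_degree Z' P \<le> kept_degree Z P"
    using kept_degree_cases[of Z' P] known_zero_mono[OF _ Z] kept_degree_ge by fastforce
  then show ?thesis by (intro poly_eqI) (auto simp: coeff_reduce *)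
qed

lemma reduce_0 [simp]: "reduce Z 0 = 0"
  by (simp add: reduce_def)

lemma specialize_reduce:
  assumes "\<forall>z\<in>Z. eval_coef \<rho> z = 0"
  shows "specialize \<rho> (reduce Z P) = specialize \<rho> P"
proof (rule poly_eqI)
  fix i
  show "coeff (specialize \<rho> (reduce Z P)) i = coeff (specialize \<rho> P) i"
  proof (cases "i \<le> kept_degree Z P")
    case False
    then have "known_zero Z (coeff P i)" using kept_degree_ge by blast
    then have "eval_coef \<rho> (coeff P i) = 0"
      unfolding known_zero_def using assms eval_coef_proportional[of "coeff P i" _ \<rho>] by auto
    then show ?thesis using False by (simp add: coeff_reduce)
  qed (simp add: coeff_reduce)
qed

lemma degree_pseudo_mod_less: "1 \<le> degree Q \<Longrightarrow> degree (pseudo_mod P Q) < degree Q"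
  using pseudo_mod(2)[of Q P] by (cases "Q = 0"; cases "pseudo_mod P Q = 0") auto

text \<open>The leading coefficient of \<open>P'\<close> is a nonzero integer multiple of that of
  \<open>P\<close>, which has been declared nonzero. So \<open>P'\<close> is adjoined unaltered and
  the families are stable under genuine derivation.\<close>

lemma reduced_pderiv:
  fixes P :: "'r::linordered_field coef poly"
  assumes "consistent Z N" "known_nonzero N (lead_coeff P)"
  shows "reduced Z (pderiv P)"
  unfolding reduced_def
proof
  assume d: "1 \<le> degree (pderiv P)"
  have "proportional (of_nat (degree P) * lead_coeff P) (lead_coeff P)"
    unfolding proportional_def by (rule exI[of _ "of_nat (degree P)"]) (use d in \<open>simp add: degree_pderiv\<close>)
  then have "known_nonzero N (lead_coeff (pderiv P))"
    using assms(2) unfolding known_nonzero_def lead_coeff_pderiv by (meson proportional_trans)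
  then show "\<not> known_zero Z (lead_coeff (pderiv P))" by (rule consistent_known[OF assms(1)])
qed

text \<open>A generator \<open>(P, None)\<close> stands for \<open>P'\<close> and \<open>(P, Some Q)\<close> for the pseudoremainder of \<open>P\<close> by \<open>Q\<close>. A
  generator of level \<open>d \<ge> 1\<close> produces a polynomial of degree \<open>< d\<close>, which enters only generators of
  level \<open>< d\<close>.\<close>

type_synonym 'c generator = "'c poly \<times> 'c poly option"

definition generators :: "'c::zero poly set \<Rightarrow> 'c generator set" where
  "generators F = {(P, q). P \<in> F \<and> (case q of None \<Rightarrow> True
     | Some Q \<Rightarrow> Q \<in> F \<and> degree Q \<le> degree P \<and> 1 \<le> degree Q)}"

definition product :: "'r::linordered_field coef generator \<Rightarrow> 'r coef poly" where
  "product x = (case x of (P, None) \<Rightarrow> pderiv P | (P, Some Q) \<Rightarrow> pseudo_mod P Q)"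

definition level :: "'c::zero generator \<Rightarrow> nat" where
  "level x = (case x of (P, None) \<Rightarrow> degree P | (P, Some Q) \<Rightarrow> degree Q)"

lemma set_generated: "set (generated Fs) = product ` generators (set Fs)"
  unfolding generated_def generators_def product_def
  by (auto simp: image_iff split: option.splits) (force+)

lemma finite_generators: "finite F \<Longrightarrow> finite (generators F)"
proof (rule finite_subset[of _ "F \<times> insert None (Some ` F)"])
  show "generators F \<subseteq> F \<times> insert None (Some ` F)"
  proof
    fix x assume "x \<in> generators F"
    then show "x \<in> F \<times> insert None (Some ` F)"
      by (cases x; cases "snd x") (auto simp: generators_def)
  qed
qed simp

text \<open>The exceptional case is the derivative of a constant: its level is 0 and no degree lies
  below 0.\<close>

lemma degree_product: "x \<in> generators F \<Longrightarrow> level x = 0 \<and> product x = 0 \<or> degree (product x) < level x"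
  by (auto simp: generators_def product_def level_def degree_pderiv pderiv_eq_0_iff degree_pseudo_mod_less split: option.splits)

text \<open>The polynomials of a generator have degree at least its level, so only members of degree
  at least \<open>d\<close> matter.\<close>

lemma generators_high: "x \<in> generators F \<Longrightarrow> d \<le> level x \<Longrightarrow> (\<And>P. P \<in> F \<Longrightarrow> d \<le> degree P \<Longrightarrow> P \<in> F') \<Longrightarrow> x \<in> generators F'"
  unfolding generators_def level_def by (auto split: option.splits)

definition pending :: "'r::linordered_field coef set \<Rightarrow> 'r coef poly set \<Rightarrow> 'r coef generator set" where
  "pending Z F = {x \<in> generators F. reduce Z (product x) \<notin> F}"

text \<open>Deciding that the leading coefficient of a member of degree \<open>d\<close> vanishes lowers an odd weight
  \<open>2 d + 1\<close>, which outweighs all generators of level \<open>\<le> d\<close> that become pending again.\<close>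

definition weight :: "'r::linordered_field coef set \<Rightarrow> 'r coef poly set \<Rightarrow> nat multiset" where
  "weight Z F = image_mset (\<lambda>P. 2 * degree P + 1) (mset_set {P \<in> F. 1 \<le> degree P}) +
     image_mset (\<lambda>x. 2 * level x) (mset_set (pending Z F))"

lemma count_image_mset_set: "finite A \<Longrightarrow> count (image_mset f (mset_set A)) y = card {x \<in> A. f x = y}"
proof -
  assume "finite A"
  have "(\<Sum>x | x \<in># mset_set A \<and> y = f x. count (mset_set A) x) = (\<Sum>x\<in>{x \<in> A. f x = y}. 1)"
    by (rule sum.cong) (use \<open>finite A\<close> in \<open>auto simp: count_mset_set\<close>)
  then show ?thesis by (simp add: count_image_mset')
qed

lemma finite_pending: "finite F \<Longrightarrow> finite (pending Z F)"
  by (rule finite_subset[OF _ finite_generators]) (auto simp: pending_def)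

lemma count_weight_even:
  "finite F \<Longrightarrow> count (weight Z F) (2 * e) = card {x \<in> pending Z F. level x = e}"
proof -
  assume F: "finite F"
  have "{P \<in> {P \<in> F. 1 \<le> degree P}. 2 * degree P + 1 = 2 * e} = {}" by (auto, presburger)
  then show ?thesis using F by (simp add: weight_def count_image_mset_set finite_pending)
qed

lemma count_weight_odd:
  "finite F \<Longrightarrow> count (weight Z F) (2 * e + 1) = card {P \<in> F. 1 \<le> degree P \<and> degree P = e}"
proof -
  assume F: "finite F"
  have "{x \<in> pending Z F. 2 * level x = 2 * e + 1} = {}" by (auto, presburger)
  moreover have "{P \<in> {P \<in> F. 1 \<le> degree P}. 2 * degree P + 1 = 2 * e + 1} = {P \<in> F. 1 \<le> degree P \<and> degree P = e}" by auto
  ultimately show ?thesis using F unfolding weight_def count_union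
    by (subst (1 2) count_image_mset_set) (auto simp: finite_pending)
qed

text \<open>In the multiset order an excess of \<open>M\<close> at some value is compensated by a
  deficit at a larger one. Here the deficit at \<open>y0\<close> pays for everything below.\<close>

lemma multiset_less_at:
  fixes M N :: "nat multiset"
  assumes "count M y0 < count N y0" "\<And>y. y0 < y \<Longrightarrow> count M y \<le> count N y"
  shows "M < N"
  unfolding less_multiset\<^sub>H\<^sub>O
proof (intro conjI allI impI)
  show "M \<noteq> N" using assms(1) by auto
  fix y assume y: "count N y < count M y"
  then have "y \<noteq> y0" "\<not> y0 < y" using assms(1) assms(2)[of y] by auto
  then show "\<exists>x>y. count M x < count N x" using assms(1) by (intro exI[of _ y0]) simp
qed

text \<open>The new member can only create pending generators of a level below that of
  \<open>x\<close>, while \<open>x\<close> itself is settled.\<close>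

lemma weight_adjoin:
  fixes F :: "'r::linordered_field coef poly set"
  assumes F: "finite F" and x: "x \<in> pending Z F"
  shows "weight Z (insert (reduce Z (product x)) F) < weight Z F"
proof -
  define R where "R = reduce Z (product x)"
  have xg: "x \<in> generators F" "R \<notin> F" using x by (auto simp: pending_def R_def)
  have deg: "degree R \<le> degree (product x)" unfolding R_def by (simp add: degree_reduce kept_degree_le)
  have R: "level x = 0 \<and> R = 0 \<or> degree R < level x"
    using degree_product[OF xg(1)] deg by (auto simp: R_def)
  have fin: "finite (insert R F)" using F by simp
  \<comment> \<open>\<open>R\<close> has degree below the level of \<open>x\<close>, or is 0; so a
    generator of positive level at least that of \<open>x\<close> does not involve it.\<close>
  have high: "y \<in> pending Z F" if "y \<in> pending Z (insert R F)" "level x \<le> level y" "1 \<le> level y" for y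
  proof -
    have "y \<in> generators F"
    proof (rule generators_high[of y "insert R F" "level y"])
      fix P assume P: "P \<in> insert R F" "level y \<le> degree P"
      have "P \<noteq> R" using P(2) R that(2,3) by auto
      then show "P \<in> F" using P by simp
    qed (use that in \<open>auto simp: pending_def\<close>)
    then show ?thesis using that(1) by (simp add: pending_def)
  qed
  have x': "x \<notin> pending Z (insert R F)" by (simp add: pending_def R_def)
  have "weight Z (insert R F) < weight Z F"
  proof (rule multiset_less_at[of _ "2 * level x"])
    have "{y \<in> pending Z (insert R F). level y = level x} \<subset> {y \<in> pending Z F. level y = level x}"
    proof (cases "level x = 0")
      case False
      then have "{y \<in> pending Z (insert R F). level y = level x} \<subseteq> {y \<in> pending Z F. level y = level x}"
        using high by auto
      then show ?thesis using x x' by blast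
    next
      case True
      \<comment> \<open>Every generator of level 0 produces 0, now a member, so none of them stays
        pending.\<close>
      then have R0: "R = 0" using R by simp
      have "{y \<in> pending Z (insert R F). level y = level x} = {}"
      proof -
        have "product y = 0" if "y \<in> generators (insert R F)" "level y = 0" for y
          using degree_product[OF that(1)] that(2) by simp
        then have "reduce Z (product y) = R" if "y \<in> generators (insert R F)" "level y = 0" for y
          using that R0 by simp
        then show ?thesis using True by (auto simp: pending_def)
      qed
      then show ?thesis using x by blast
    qed
    then show "count (weight Z (insert R F)) (2 * level x) < count (weight Z F) (2 * level x)"
      using F fin finite_pending[OF F, of Z] by (simp add: count_weight_even psubset_card_mono)
    fix y assume y: "2 * level x < y"
    show "count (weight Z (insert R F)) y \<le> count (weight Z F) y"
    proof (cases "even y")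
      case True
      then obtain e where e: "y = 2 * e" by blast
      then have "{z \<in> pending Z (insert R F). level z = e} \<subseteq> {z \<in> pending Z F. level z = e}"
        using y high by auto
      then show ?thesis unfolding e using F fin finite_pending[OF F, of Z] by (simp add: count_weight_even card_mono)
    next
      case False
      then obtain e where e: "y = 2 * e + 1" using oddE by blast
      then have "{P \<in> insert R F. 1 \<le> degree P \<and> degree P = e} \<subseteq> {P \<in> F. 1 \<le> degree P \<and> degree P = e}"
        using y R by auto
      then show ?thesis unfolding e count_weight_odd[OF F] count_weight_odd[OF fin] using F by (intro card_mono) auto
    qed
  qed
  then show ?thesis by (simp add: R_def)
qed

text \<open>\<open>d\<close> is the largest degree of a member that loses its leading term, so the
  members of higher degree, and with them the generators of higher level, are untouched.\<close>

lemma weight_reduce: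
  fixes F :: "'r::linordered_field coef poly set"
  assumes F: "finite F" and P: "P \<in> F" "\<not> reduced Z' P" and Z: "Z \<subseteq> Z'"
  shows "weight Z' (reduce Z' ` F) < weight Z F"
proof -
  define d where "d = Max (degree ` {P \<in> F. \<not> reduced Z' P})"
  have fin: "finite (degree ` {P \<in> F. \<not> reduced Z' P})" using F by simp
  have max: "degree Q \<le> d" if "Q \<in> F" "\<not> reduced Z' Q" for Q
    unfolding d_def using that by (intro Max_ge[OF fin]) auto
  have "d \<in> degree ` {P \<in> F. \<not> reduced Z' P}" unfolding d_def using P by (intro Max_in[OF fin]) auto
  then obtain Q where Q: "Q \<in> F" "\<not> reduced Z' Q" "degree Q = d" by auto
  have d1: "1 \<le> d" using Q by (simp add: reduced_def)
  have fin': "finite (reduce Z' ` F)" using F by simp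
  \<comment> \<open>A member altered by the reduction had degree at most \<open>d\<close> and drops
    below it.\<close>
  have high: "X \<in> F \<and> reduced Z' X" if X: "X \<in> reduce Z' ` F" "d \<le> degree X" for X
  proof -
    obtain Y where Y: "Y \<in> F" "X = reduce Z' Y" using X(1) by blast
    have "reduced Z' Y"
    proof (rule ccontr)
      assume "\<not> reduced Z' Y"
      then show False using degree_reduce_less[of Z' Y] max[of Y] Y X(2) by simp
    qed
    then show ?thesis using Y reduce_eq_self by metis
  qed
  show ?thesis
  proof (rule multiset_less_at[of _ "2 * d + 1"])
    have "{P \<in> reduce Z' ` F. 1 \<le> degree P \<and> degree P = d} \<subset> {P \<in> F. 1 \<le> degree P \<and> degree P = d}"
    proof -
      have "{P \<in> reduce Z' ` F. 1 \<le> degree P \<and> degree P = d} \<subseteq> {P \<in> F. 1 \<le> degree P \<and> degree P = d} - {Q}"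
        using high Q by auto
      then show ?thesis using Q d1 by blast
    qed
    then show "count (weight Z' (reduce Z' ` F)) (2 * d + 1) < count (weight Z F) (2 * d + 1)"
      unfolding count_weight_odd[OF F] count_weight_odd[OF fin'] using F by (intro psubset_card_mono) auto
    fix y assume y: "2 * d + 1 < y"
    show "count (weight Z' (reduce Z' ` F)) y \<le> count (weight Z F) y"
    proof (cases "even y")
      case True
      then obtain e where e: "y = 2 * e" by blast
      have "z \<in> pending Z F" if z: "z \<in> pending Z' (reduce Z' ` F)" "level z = e" for z
      proof -
        have zg: "z \<in> generators F"
          by (rule generators_high[of z "reduce Z' ` F" e]) (use z high y e in \<open>auto simp: pending_def\<close>)
        have "reduce Z (product z) \<notin> F"
        proof
          assume "reduce Z (product z) \<in> F"
          then have "reduce Z' (product z) \<in> reduce Z' ` F"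
            using reduce_reduce[OF Z, of "product z"] by (metis image_eqI)
          then show False using z by (simp add: pending_def)
        qed
        then show ?thesis using zg by (simp add: pending_def)
      qed
      then have "{z \<in> pending Z' (reduce Z' ` F). level z = e} \<subseteq> {z \<in> pending Z F. level z = e}" by auto
      then show ?thesis unfolding e using F fin' finite_pending[OF F, of Z] by (simp add: count_weight_even card_mono)
    next
      case False
      then obtain e where e: "y = 2 * e + 1" using oddE by blast
      then have "{P \<in> reduce Z' ` F. 1 \<le> degree P \<and> degree P = e} \<subseteq> {P \<in> F. 1 \<le> degree P \<and> degree P = e}"
        using y high by auto
      then show ?thesis unfolding e count_weight_odd[OF F] count_weight_odd[OF fin'] using F by (intro card_mono) auto
    qed
  qed
qed

definition state_ok :: "'r::linordered_field coef set \<Rightarrow> 'r coef set \<Rightarrow> 'r coef poly list \<Rightarrow> bool" where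
  "state_ok Z N Fs \<longleftrightarrow> consistent Z N \<and> distinct Fs \<and> (\<forall>P\<in>set Fs. reduced Z P)"

lemma state_ok_zero:
  assumes "state_ok Z N Fs" "\<not> known_nonzero N c"
  shows "state_ok (insert c Z) N (remdups (map (reduce (insert c Z)) Fs))"
  using assms by (auto simp: state_ok_def consistent_insert_zero reduced_reduce)

lemma state_ok_nonzero:
  assumes "state_ok Z N Fs" "P \<in> set Fs" "1 \<le> degree P"
  shows "state_ok Z (insert (lead_coeff P) N) Fs"
  using assms by (auto simp: state_ok_def reduced_def intro: consistent_insert_nonzero)

lemma state_ok_adjoin:
  assumes "state_ok Z N Fs" "find (\<lambda>R. R \<notin> set Fs) (map (reduce Z) xs) = Some R"
  shows "state_ok Z N (Fs @ [R])"
  using assms by (auto simp: state_ok_def find_Some_iff reduced_reduce)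

lemma find_undecided:
  "find (undecided N) Fs = Some P \<Longrightarrow> P \<in> set Fs \<and> 1 \<le> degree P \<and> \<not> known_nonzero N (lead_coeff P)"
  by (auto simp: find_Some_iff undecided_def)

text \<open>Two nested inductions. The zero branch and the adjunction of a polynomial lower the
  weight. The nonzero branch leaves the family, and so the weight, unchanged, but lowers the number
  of undecided members.\<close>

lemma rem_tree_exists:
  fixes Fs :: "'r::linordered_field coef poly list"
  shows "state_ok Z N Fs \<Longrightarrow> \<exists>T. rem_tree Z N Fs T"
proof (induction "weight Z (set Fs)" arbitrary: Z N Fs rule: less_induct)
  case less
  note outer = less.hyps
  show ?case using less.prems
  proof (induction "length (filter (undecided N) Fs)" arbitrary: N rule: less_induct)
    case less
    show ?case
    proof (cases "find (undecided N) Fs")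
      case None
      show ?thesis
      proof (cases "find (\<lambda>R. R \<notin> set Fs) (map (reduce Z) (generated Fs))")
        case None2: None
        then show ?thesis using None rem_tree.leaf by blast
      next
        case (Some R)
        then have "R \<notin> set Fs" "R \<in> reduce Z ` set (generated Fs)" by (auto simp: find_Some_iff set_conv_nth)
        then obtain x where x: "x \<in> pending Z (set Fs)" "R = reduce Z (product x)"
          unfolding set_generated by (auto simp: pending_def)
        have "weight Z (set (Fs @ [R])) < weight Z (set Fs)"
          using weight_adjoin[OF _ x(1)] x(2) by simp
        then obtain T where "rem_tree Z N (Fs @ [R]) T"
          using outer state_ok_adjoin[OF less.prems Some] by blast
        then show ?thesis using None Some rem_tree.adjoin by blast
      qed
    next
      case (Some P)
      note P = find_undecided[OF Some]
      let ?c = "lead_coeff P"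
      have "\<not> reduced (insert ?c Z) P"
        using P proportional_refl[of ?c] by (auto simp: reduced_def known_zero_def)
      then have "weight (insert ?c Z) (reduce (insert ?c Z) ` set Fs) < weight Z (set Fs)"
        using P by (intro weight_reduce[of _ P]) auto
      then obtain T0 where T0: "rem_tree (insert ?c Z) N (remdups (map (reduce (insert ?c Z)) Fs)) T0"
        using outer[of "insert ?c Z" "remdups (map (reduce (insert ?c Z)) Fs)"] state_ok_zero[OF less.prems] P by auto
      have imp: "undecided (insert ?c N) Q \<Longrightarrow> undecided N Q" for Q
        by (auto simp: undecided_def known_nonzero_def)
      have P2: "undecided N P" "\<not> undecided (insert ?c N) P"
        using P proportional_refl[of ?c] by (auto simp: undecided_def known_nonzero_def)
      have "length (filter (undecided (insert ?c N)) Fs) < length (filter (undecided N) Fs)"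
      proof -
        have "filter (undecided (insert ?c N)) Fs = filter (undecided (insert ?c N)) (filter (undecided N) Fs)"
          using imp by (auto simp: filter_filter intro!: filter_cong)
        also have "length \<dots> < length (filter (undecided N) Fs)"
          by (rule length_filter_less[of P]) (use P P2 in auto)
        finally show ?thesis .
      qed
      then obtain T1 where "rem_tree Z (insert ?c N) Fs T1"
        using less.hyps state_ok_nonzero[OF less.prems] P by blast
      then show ?thesis using rem_tree.decide[OF Some refl T0] by blast
    qed
  qed
qed

section \<open>The families at the leaves\<close>

text \<open>Derivatives are present unaltered, remainders only up to the deletion of leading terms
  known to be zero. Sorting by degree makes every prefix closed as well.\<close>

definition closed_family :: "'r::linordered_field coef set \<Rightarrow> 'r coef poly list \<Rightarrow> bool" where
  "closed_family Z Ps \<longleftrightarrow> distinct Ps \<and> sorted (map degree Ps) \<and>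
     (\<forall>P\<in>set Ps. 1 \<le> degree P \<longrightarrow> pderiv P \<in> set Ps) \<and>
     (\<forall>P\<in>set Ps. \<forall>Q\<in>set Ps. 1 \<le> degree Q \<longrightarrow> degree Q \<le> degree P \<longrightarrow> reduce Z (pseudo_mod P Q) \<in> set Ps)"

lemma closed_family_leaf:
  assumes ok: "state_ok Z N Fs" and n: "find (undecided N) Fs = None"
    "find (\<lambda>R. R \<notin> set Fs) (map (reduce Z) (generated Fs)) = None"
  shows "closed_family Z (sort_key degree Fs)"
proof -
  have gen: "reduce Z (product x) \<in> set Fs" if "x \<in> generators (set Fs)" for x
    using n(2) that set_generated[of Fs] by (auto simp: find_None_iff)
  have "pderiv P \<in> set Fs" if P: "P \<in> set Fs" "1 \<le> degree P" for P
  proof -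
    have "known_nonzero N (lead_coeff P)" using n(1) P by (auto simp: find_None_iff undecided_def)
    then have "reduced Z (pderiv P)" using reduced_pderiv ok by (auto simp: state_ok_def)
    then show ?thesis using gen[of "(P, None)"] P by (simp add: generators_def product_def reduce_eq_self)
  qed
  moreover have "reduce Z (pseudo_mod P Q) \<in> set Fs"
    if "P \<in> set Fs" "Q \<in> set Fs" "1 \<le> degree Q" "degree Q \<le> degree P" for P Q
    using gen[of "(P, Some Q)"] that by (simp add: generators_def product_def)
  ultimately show ?thesis using ok by (auto simp: closed_family_def state_ok_def)
qed

lemma rem_tree_closed_family:
  "rem_tree Z N Fs T \<Longrightarrow> state_ok Z N Fs \<Longrightarrow> (Z', Ps) \<in> results T \<Longrightarrow> closed_family Z' Ps"
proof (induction arbitrary: Z' Ps rule: rem_tree.induct)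
  case (decide N Fs P c Z T\<^sub>0 T\<^sub>1)
  then show ?case using find_undecided[OF decide.hyps(1)] state_ok_zero[OF decide.prems(1)] state_ok_nonzero[OF decide.prems(1)]
    by auto
next
  case (adjoin N Fs Z R T)
  then show ?case using state_ok_adjoin by blast
next
  case (leaf N Fs Z)
  then show ?case using closed_family_leaf by auto
qed

text \<open>Once the leading coefficient of \<open>P\<close> is declared nonzero, consistency
  prevents every later reduction from altering \<open>P\<close>, which therefore survives down to
  each leaf.\<close>

lemma rem_tree_persistent:
  "rem_tree Z N Fs T \<Longrightarrow> state_ok Z N Fs \<Longrightarrow> P \<in> set Fs \<Longrightarrow> known_nonzero N (lead_coeff P) \<Longrightarrow>
    (Z', Ps) \<in> results T \<Longrightarrow> P \<in> set Ps"
proof (induction arbitrary: Z' Ps rule: rem_tree.induct)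
  case (decide N Fs Q c Z T\<^sub>0 T\<^sub>1)
  note Q = find_undecided[OF decide.hyps(1)]
  have ok: "state_ok (insert c Z) N (remdups (map (reduce (insert c Z)) Fs))"
    using state_ok_zero[OF decide.prems(1)] Q decide.hyps(2) by blast
  then have "reduced (insert c Z) P"
    using consistent_known[OF _ decide.prems(3)] by (auto simp: state_ok_def reduced_def)
  then have "P \<in> set (remdups (map (reduce (insert c Z)) Fs))"
    using reduce_eq_self decide.prems(2) by force
  moreover have "known_nonzero (insert c N) (lead_coeff P)"
    using decide.prems(3) by (auto simp: known_nonzero_def)
  moreover have "state_ok Z (insert c N) Fs"
    using state_ok_nonzero[OF decide.prems(1)] Q decide.hyps(2) by blast
  ultimately show ?case using decide ok by auto
next
  case (adjoin N Fs Z R T)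
  show ?case
    by (rule adjoin.IH[OF state_ok_adjoin[OF adjoin.prems(1) adjoin.hyps(2)] _ adjoin.prems(3,4)])
      (use adjoin.prems(2) in simp)
qed auto

lemma results_nonempty: "results T \<noteq> {}"
  by (induction T) auto

lemma finite_results: "finite (results T)"
  by (induction T) auto

lemma run_in_results: "run v \<rho> T \<in> results T"
  by (induction T) auto

lemma pderiv_funpow_in_family:
  "closed_family Z Ps \<Longrightarrow> P \<in> set Ps \<Longrightarrow> j \<le> degree P \<Longrightarrow> (pderiv ^^ j) P \<in> set Ps"
proof (induction j)
  case (Suc j)
  then have "(pderiv ^^ j) P \<in> set Ps" "1 \<le> degree ((pderiv ^^ j) P)" by (auto simp: degree_pderiv_funpow)
  then show ?case using Suc.prems(1) by (simp add: closed_family_def)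
qed simp

lemma top_constant_in_constants:
  assumes "closed_family Z Ps" "P \<in> set Ps" "(Z, Ps) \<in> results T"
  shows "top_constant P \<in> constants T"
  using pderiv_funpow_in_family[OF assms(1,2) order_refl] assms(3)
  unfolding constants_def top_constant_def by (force simp: degree_pderiv_funpow)

definition nondegenerate :: "(nat \<Rightarrow> 'r::linordered_field) \<Rightarrow> 'r coef poly list \<Rightarrow> bool" where
  "nondegenerate \<rho> Ps \<longleftrightarrow> (\<forall>P\<in>set Ps. 1 \<le> degree P \<longrightarrow> eval_coef \<rho> (lead_coeff P) \<noteq> 0)"

lemma rem_tree_run:
  "rem_tree Z N Fs T \<Longrightarrow> \<forall>z\<in>Z. eval_coef \<rho> z = 0 \<Longrightarrow> \<forall>n\<in>N. eval_coef \<rho> n \<noteq> 0 \<Longrightarrow>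
    run v \<rho> T = (Z', Ps) \<Longrightarrow> (\<forall>z\<in>Z'. eval_coef \<rho> z = 0) \<and> nondegenerate \<rho> Ps"
proof (induction arbitrary: Z' Ps rule: rem_tree.induct)
  case (decide N Fs P c Z T\<^sub>0 T\<^sub>1)
  show ?case
  proof (cases "eval_coef \<rho> c = 0")
    case True
    show ?thesis by (rule decide.IH(1)) (use True decide.prems in simp_all)
  next
    case False
    show ?thesis by (rule decide.IH(2)) (use False decide.prems in simp_all)
  qed
next
  case (leaf N Fs Z)
  have "eval_coef \<rho> (lead_coeff P) \<noteq> 0" if P: "P \<in> set Fs" "1 \<le> degree P" for P
  proof -
    have "known_nonzero N (lead_coeff P)" using leaf(1) P by (auto simp: find_None_iff undecided_def)
    then obtain n where n: "n \<in> insert 1 N" "proportional (lead_coeff P) n" by (auto simp: known_nonzero_def)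
    have "eval_coef \<rho> n \<noteq> 0" using n(1) leaf.prems(2) by auto
    then show ?thesis using eval_coef_proportional[OF n(2)] by blast
  qed
  then show ?case using leaf by (auto simp: nondegenerate_def)
qed blast

text \<open>The tested \<open>c\<close> is the leading coefficient of a member \<open>P\<close>. On
  the nonzero branch \<open>P\<close> persists to the leaves, which by closure contain its last
  derivative \<open>d! c\<close>; so the outcome of the test is determined by the vanishing of a
  constant.\<close>

lemma rem_tree_run_cong:
  "rem_tree Z N Fs T \<Longrightarrow> state_ok Z N Fs \<Longrightarrow>
    (\<And>c. c \<in> constants T \<Longrightarrow> eval_coef \<rho> c = 0 \<longleftrightarrow> eval_coef \<rho>' c = 0) \<Longrightarrow> run v \<rho> T = run v \<rho>' T"
proof (induction rule: rem_tree.induct)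
  case (decide N Fs P c Z T\<^sub>0 T\<^sub>1)
  note P = find_undecided[OF decide.hyps(1)]
  have ok1: "state_ok Z (insert c N) Fs"
    using state_ok_nonzero[OF decide.prems(1)] P decide.hyps(2) by blast
  \<comment> \<open>Any leaf of the nonzero branch will do, since \<open>P\<close> survives to all
    of them.\<close>
  obtain Z' Ps where leaf: "(Z', Ps) \<in> results T\<^sub>1" using results_nonempty[of T\<^sub>1] by auto
  have "known_nonzero (insert c N) (lead_coeff P)"
    using decide.hyps(2) proportional_refl[of c] by (auto simp: known_nonzero_def)
  then have "P \<in> set Ps" using rem_tree_persistent[OF decide.hyps(4) ok1 _ _ leaf] P by blast
  then have "top_constant P \<in> constants T\<^sub>1"
    using top_constant_in_constants[OF rem_tree_closed_family[OF decide.hyps(4) ok1 leaf] _ leaf] by blast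
  moreover have sub: "constants T\<^sub>0 \<union> constants T\<^sub>1 \<subseteq> constants (IfZero c T\<^sub>0 T\<^sub>1)"
    by (auto simp: constants_def)
  ultimately have "eval_coef \<rho> (top_constant P) = 0 \<longleftrightarrow> eval_coef \<rho>' (top_constant P) = 0"
    using decide.prems(2) by blast
  moreover have fact: "eval_coef r (top_constant P) = 0 \<longleftrightarrow> eval_coef r c = 0" for r :: "nat \<Rightarrow> 'a"
  proof -
    have "top_constant P = of_nat (fact (degree P)) * c" using decide.hyps(2) by (simp add: top_constant_eq of_nat_fact)
    then have "eval_coef r (top_constant P) = of_nat (fact (degree P)) * eval_coef r c"
      by (simp only: eval_coef_mult eval_coef_of_nat)
    then show ?thesis by (simp del: of_nat_fact)
  qed
  ultimately have "eval_coef \<rho> c = 0 \<longleftrightarrow> eval_coef \<rho>' c = 0" by blast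
  moreover have "run v \<rho> T\<^sub>0 = run v \<rho>' T\<^sub>0"
    by (rule decide.IH(1)) (use state_ok_zero[OF decide.prems(1)] P decide.hyps(2) decide.prems(2) sub in auto)
  moreover have "run v \<rho> T\<^sub>1 = run v \<rho>' T\<^sub>1"
    by (rule decide.IH(2)[OF ok1]) (use decide.prems(2) sub in auto)
  ultimately show ?case by simp
next
  case (adjoin N Fs Z R T)
  then show ?case using state_ok_adjoin by blast
qed simp

lemma rem_tree_poly_over:
  assumes K: "is_subfield K"
  shows "rem_tree Z N Fs T \<Longrightarrow> \<forall>P\<in>set Fs. poly_over K P \<Longrightarrow> (Z', Ps) \<in> results T \<Longrightarrow>
    \<forall>P\<in>set Ps. poly_over K P"
proof (induction arbitrary: Z' Ps rule: rem_tree.induct)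
  case (decide N Fs P c Z T\<^sub>0 T\<^sub>1)
  then show ?case using poly_over_reduce[OF K] by auto
next
  case (adjoin N Fs Z R T)
  have "R \<in> reduce Z ` set (generated Fs)" using adjoin.hyps(2) by (auto simp: find_Some_iff set_conv_nth)
  then have "poly_over K R"
    unfolding generated_def using adjoin.prems(1) poly_over_reduce[OF K] poly_over_pderiv[OF K] poly_over_pseudo_mod[OF K]
    by auto
  then show ?case using adjoin.prems(1) by (intro adjoin.IH[OF _ adjoin.prems(2)]) simp
next
  case (leaf N Fs Z)
  then show ?case by simp
qed

section \<open>Signs of a polynomial near infinity\<close>

lemma poly_ge_lead_coeff:
  fixes p :: "'r::linordered_field poly"
  assumes "0 < lead_coeff p"
  shows "\<exists>n. \<forall>x\<ge>n. lead_coeff p \<le> poly p x"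
  using assms
proof (induction p)
  case (pCons c p)
  show ?case
  proof (cases "p = 0")
    case False
    let ?l = "lead_coeff p"
    have l: "lead_coeff (pCons c p) = ?l" "0 < ?l" using False pCons.prems by auto
    then obtain n where n: "\<And>x. n \<le> x \<Longrightarrow> ?l \<le> poly p x" using pCons.IH by blast
    \<comment> \<open>The last bound gives \<open>c + x l >= l\<close>, the other two allow
      replacing \<open>l\<close> by the larger \<open>poly p x\<close> after multiplication by
      \<open>x >= 0\<close>.\<close>
    have "?l \<le> poly (pCons c p) x" if x: "max (max n 0) ((?l - c) / ?l) \<le> x" for x
    proof -
      have "?l - c \<le> x * ?l" using x l(2) by (simp add: pos_divide_le_eq)
      also have "\<dots> \<le> x * poly p x" using x n[of x] by (intro mult_left_mono) auto
      finally show ?thesis by simp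
    qed
    then show ?thesis unfolding l(1) by blast
  qed simp
qed simp

lemma sign_mult: "sign (x * y) = sign x * sign (y :: 'r::linordered_idom)"
  by (auto simp: sign_def zero_less_mult_iff not_less mult_less_0_iff)

lemma sign_minus_field: "sign (- x) = - sign (x :: 'r::linordered_idom)"
  by (auto simp: sign_def)

lemma sign_power: "sign (x ^ n) = sign (x :: 'r::linordered_idom) ^ n"
  by (induction n) (auto simp: sign_mult, simp add: sign_def)

lemma sign_at_top:
  fixes p :: "'r::linordered_field poly"
  shows "\<exists>n. \<forall>x\<ge>n. sign (poly p x) = sign (lead_coeff p)"
proof (cases "lead_coeff p" "0 :: 'r" rule: linorder_cases)
  case less
  then have "0 < lead_coeff (- p)" by simp
  then obtain n where n: "\<And>x. n \<le> x \<Longrightarrow> lead_coeff (- p) \<le> poly (- p) x"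
    using poly_ge_lead_coeff by blast
  have "sign (poly p x) = sign (lead_coeff p)" if "n \<le> x" for x
  proof -
    have "poly p x < 0" using n[OF that] less by simp
    then show ?thesis using less by (auto simp: sign_def)
  qed
  then show ?thesis by blast
next
  case greater
  then obtain n where n: "\<And>x. n \<le> x \<Longrightarrow> lead_coeff p \<le> poly p x" using poly_ge_lead_coeff by blast
  have "sign (poly p x) = sign (lead_coeff p)" if "n \<le> x" for x
  proof -
    have "0 < poly p x" using n[OF that] greater by simp
    then show ?thesis using greater by (auto simp: sign_def)
  qed
  then show ?thesis by blast
qed simp

text \<open>The substitution of \<open>-X\<close> for \<open>X\<close> exchanges the two infinite
  ends and multiplies the leading coefficient by \<open>(-1)^d\<close>.\<close>

lemma sign_at_bot:
  fixes p :: "'r::linordered_field poly"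
  shows "\<exists>n. \<forall>x\<le>n. sign (poly p x) = sign (lead_coeff p) * (- 1) ^ degree p"
proof -
  let ?q = "pcompose p [:0, - 1:]"
  obtain n where n: "\<And>x. n \<le> x \<Longrightarrow> sign (poly ?q x) = sign (lead_coeff ?q)"
    using sign_at_top[of ?q] by blast
  have lc: "lead_coeff ?q = lead_coeff p * (- 1) ^ degree p" by (subst lead_coeff_comp) auto
  have m1: "sign ((- 1 :: 'r) ^ k) = (- 1) ^ k" for k by (simp add: sign_power) (simp add: sign_def)
  have "sign (poly p x) = sign (lead_coeff p) * (- 1) ^ degree p" if "x \<le> - n" for x
    using n[of "- x"] that by (simp add: poly_pcompose lc sign_mult m1)
  then show ?thesis by blast
qed

lemma lead_coeff_pderiv_funpow_sign:
  fixes p :: "'r::linordered_field poly"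
  shows "j \<le> degree p \<Longrightarrow> sign (lead_coeff ((pderiv ^^ j) p)) = sign (lead_coeff p)"
proof (induction j)
  case (Suc j)
  have "sign (of_nat (degree p - j) :: 'r) = 1" using Suc.prems by (simp add: sign_def)
  then show ?case using Suc by (simp add: lead_coeff_pderiv degree_pderiv_funpow sign_mult)
qed simp

lemma coeff_pderiv_funpow_0:
  fixes p :: "'r::linordered_field poly"
  shows "coeff ((pderiv ^^ j) p) 0 = fact j * coeff p j"
proof (induction j arbitrary: p)
  case (Suc j)
  have "coeff ((pderiv ^^ Suc j) p) 0 = fact j * coeff (pderiv p) j"
    unfolding pderiv_funpow_Suc by (rule Suc)
  then show ?case by (simp add: coeff_pderiv algebra_simps)
qed simp

text \<open>The coefficients are those of the polynomial \<open>p(a + X)\<close>, whose derivatives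
  at 0 are those of \<open>p\<close> at \<open>a\<close>.\<close>

lemma taylor_expansion:
  fixes p :: "'r::linordered_field poly"
  shows "poly p (a + h) = (\<Sum>j\<le>degree p. poly ((pderiv ^^ j) p) a * h ^ j / fact j)"
proof -
  let ?q = "pcompose p [:a, 1:]"
  have "(pderiv ^^ j) ?q = pcompose ((pderiv ^^ j) p) [:a, 1:]" for j
    by (induction j) (simp_all add: pderiv_pcompose pderiv_pCons one_pCons[symmetric])
  then have "coeff ?q j * fact j = poly ((pderiv ^^ j) p) a" for j
    using coeff_pderiv_funpow_0[of j ?q] by (simp add: poly_pcompose mult.commute flip: poly_0_coeff_0)
  then have c: "coeff ?q j = poly ((pderiv ^^ j) p) a / fact j" for j
    by (metis fact_nonzero nonzero_eq_divide_eq)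
  have "poly p (a + h) = poly ?q h" by (simp add: poly_pcompose)
  also have "\<dots> = (\<Sum>j\<le>degree p. coeff ?q j * h ^ j)" by (simp add: poly_altdef degree_pcompose)
  finally show ?thesis by (simp add: c)
qed

section \<open>Subdivided lines\<close>

text \<open>A chain from \<open>lo\<close> to \<open>hi\<close> (with \<^const>\<open>None\<close> for the absence of a bound) has points \<open>xs\<close> between
  its ends, one cell datum per open interval, one datum per point, and one gap datum per bounded
  interval.\<close>

definition gap_list :: "('p \<Rightarrow> 'p \<Rightarrow> 'e \<Rightarrow> bool) \<Rightarrow> 'p option \<Rightarrow> 'p option \<Rightarrow> 'e list \<Rightarrow> bool" where
  "gap_list G lo hi gs = (case (lo, hi) of (Some a, Some b) \<Rightarrow> \<exists>g. gs = [g] \<and> G a b g | _ \<Rightarrow> gs = [])"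

primrec chain :: "('p option \<Rightarrow> 'p option \<Rightarrow> 'c \<Rightarrow> bool) \<Rightarrow> ('p \<Rightarrow> 'q \<Rightarrow> bool) \<Rightarrow> ('p \<Rightarrow> 'p \<Rightarrow> 'e \<Rightarrow> bool) \<Rightarrow>
    'p list \<Rightarrow> 'p option \<Rightarrow> 'p option \<Rightarrow> 'c list \<Rightarrow> 'q list \<Rightarrow> 'e list \<Rightarrow> bool" where
  "chain C P G [] lo hi cs ps gs \<longleftrightarrow> (\<exists>c. cs = [c] \<and> C lo hi c) \<and> ps = [] \<and> gap_list G lo hi gs"
| "chain C P G (x # xs) lo hi cs ps gs \<longleftrightarrow> (\<exists>c cs' p ps' g gs'. cs = c # cs' \<and> ps = p # ps' \<and> gs = g @ gs' \<and>
     C lo (Some x) c \<and> gap_list G lo (Some x) g \<and> P x p \<and> chain C P G xs (Some x) hi cs' ps' gs')"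

definition lower :: "'p option \<Rightarrow> 'p list \<Rightarrow> nat \<Rightarrow> 'p option" where
  "lower lo xs k = (if k = 0 then lo else Some (xs ! (k - 1)))"

definition upper :: "'p list \<Rightarrow> 'p option \<Rightarrow> nat \<Rightarrow> 'p option" where
  "upper xs hi k = (if k = length xs then hi else Some (xs ! k))"

lemma lower_simps [simp]: "lower lo xs 0 = lo" "lower lo (x # xs) (Suc k) = lower (Some x) xs k"
  by (auto simp: lower_def nth_Cons split: nat.split)

lemma upper_simps [simp]: "upper (x # xs) hi 0 = Some x" "upper (x # xs) hi (Suc k) = upper xs hi k"
  "upper [] hi 0 = hi"
  by (auto simp: upper_def)

text \<open>The recursive form of \<open>chain\<close> turns the refinement of a tableau into
  concatenation at an old point.\<close>

lemma chain_append:
  "chain C P G xs lo (Some x) cs ps gs \<Longrightarrow> P x p \<Longrightarrow> chain C P G xs' (Some x) hi cs' ps' gs' \<Longrightarrow>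
   chain C P G (xs @ x # xs') lo hi (cs @ cs') (ps @ p # ps') (gs @ gs')"
proof (induction xs arbitrary: lo cs ps gs)
  case (Cons y xs)
  then obtain c cs1 q ps1 g gs1 where *: "cs = c # cs1" "ps = q # ps1" "gs = g @ gs1"
     "C lo (Some y) c" "gap_list G lo (Some y) g" "P y q" "chain C P G xs (Some y) (Some x) cs1 ps1 gs1"
    by auto
  have "chain C P G (xs @ x # xs') (Some y) hi (cs1 @ cs') (ps1 @ p # ps') (gs1 @ gs')"
    by (rule Cons.IH[OF *(7) Cons.prems(2,3)])
  then show ?case using * by auto
next
  case Nil
  then obtain c where "cs = [c]" "C lo (Some x) c" "ps = []" "gap_list G lo (Some x) gs" by auto
  then show ?case using Nil.prems(2,3)
    by (simp, intro exI[of _ gs] exI[of _ gs'] conjI) simp_all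
qed

lemma chain_lengths: "chain C P G xs lo hi cs ps gs \<Longrightarrow> length cs = Suc (length xs) \<and> length ps = length xs"
proof (induction xs arbitrary: lo cs ps gs)
  case (Cons x xs)
  then obtain c cs1 p ps1 gs1 where *: "cs = c # cs1" "ps = p # ps1" "chain C P G xs (Some x) hi cs1 ps1 gs1"
    by auto
  show ?case using Cons.IH[OF *(3)] * by simp
qed auto

lemma chain_cell: "chain C P G xs lo hi cs ps gs \<Longrightarrow> k \<le> length xs \<Longrightarrow> C (lower lo xs k) (upper xs hi k) (cs ! k)"
proof (induction xs arbitrary: lo cs ps gs k)
  case (Cons x xs)
  then show ?case by (cases k) auto
qed auto

lemma chain_point: "chain C P G xs lo hi cs ps gs \<Longrightarrow> k < length xs \<Longrightarrow> P (xs ! k) (ps ! k)"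
proof (induction xs arbitrary: lo cs ps gs k)
  case (Cons x xs)
  then show ?case by (cases k) auto
qed auto

lemma chain_gap_Some:
  "chain C P G xs (Some a) None cs ps gs \<Longrightarrow>
    length gs = length xs \<and> (\<forall>k<length xs. G ((a # xs) ! k) (xs ! k) (gs ! k))"
proof (induction xs arbitrary: a cs ps gs)
  case (Cons x xs)
  then obtain c cs1 q ps1 g gs1 where *: "gs = g # gs1" "G a x g" "chain C P G xs (Some x) None cs1 ps1 gs1"
    by (auto simp: gap_list_def)
  show ?case using Cons.IH[OF *(3)] * by (auto simp: less_Suc_eq_0_disj)
qed (simp add: gap_list_def)

lemma chain_gap:
  assumes "chain C P G xs None None cs ps gs"
  shows "length gs = length xs - 1 \<and> (\<forall>k<length xs - 1. G (xs ! k) (xs ! Suc k) (gs ! k))"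
proof (cases xs)
  case (Cons x ys)
  then obtain cs1 ps1 where "chain C P G ys (Some x) None cs1 ps1 gs"
    using assms by (auto simp: gap_list_def)
  then show ?thesis using chain_gap_Some Cons by fastforce
qed (use assms in \<open>simp add: gap_list_def\<close>)

lemma chain_map:
  assumes "chain C P G xs lo hi cs ps gs"
    "\<And>lo hi c. C lo hi c \<Longrightarrow> C' lo hi (f c)" "\<And>x p. P x p \<Longrightarrow> x \<in> set xs \<Longrightarrow> P' x (h p)"
  shows "chain C' P' G xs lo hi (map f cs) (map h ps) gs"
  using assms(1,3)
proof (induction xs arbitrary: lo cs ps gs)
  case (Cons x xs)
  then obtain c cs1 q ps1 g gs1 where *: "cs = c # cs1" "ps = q # ps1" "gs = g @ gs1"
     "C lo (Some x) c" "gap_list G lo (Some x) g" "P x q" "chain C P G xs (Some x) hi cs1 ps1 gs1"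
    by auto
  have "chain C' P' G xs (Some x) hi (map f cs1) (map h ps1) gs1"
    by (rule Cons.IH[OF *(7)]) (use Cons.prems in auto)
  then show ?case using * assms(2) Cons.prems(2) by auto
qed (use assms(2) in auto)

lemma map_upt_shift:
  "map f [0..<Suc (length (x # xs))] = f 0 # map (\<lambda>k. f (Suc k)) [0..<Suc (length xs)]"
  using map_upt_Suc[of f "Suc (length xs)"] by simp

lemma chain_concat:
  assumes "\<And>k. k \<le> length xs \<Longrightarrow> chain C P G (ns k) (lower lo xs k) (upper xs hi k) (cs k) (ps k) (gs k)"
    "\<And>k. k < length xs \<Longrightarrow> P (xs ! k) (olds ! k)" "length olds = length xs"
  shows "\<exists>ys. chain C P G ys lo hi (concat (map cs [0..<Suc (length xs)]))
      (concat (map2 (@) ([] # map (\<lambda>p. [p]) olds) (map ps [0..<Suc (length xs)])))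
      (concat (map gs [0..<Suc (length xs)])) \<and>
    set ys = set xs \<union> (\<Union>k\<le>length xs. set (ns k))"
  using assms
proof (induction xs arbitrary: lo olds ns cs ps gs)
  case Nil
  then show ?case using Nil(1)[of 0] by auto
next
  case (Cons x xs)
  obtain q olds' where olds: "olds = q # olds'" "length olds' = length xs"
    using Cons.prems(3) by (cases olds) auto
  have "\<exists>ys. chain C P G ys (Some x) hi (concat (map (\<lambda>k. cs (Suc k)) [0..<Suc (length xs)]))
      (concat (map2 (@) ([] # map (\<lambda>p. [p]) olds') (map (\<lambda>k. ps (Suc k)) [0..<Suc (length xs)])))
      (concat (map (\<lambda>k. gs (Suc k)) [0..<Suc (length xs)])) \<and>
    set ys = set xs \<union> (\<Union>k\<le>length xs. set (ns (Suc k)))"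
  proof (rule Cons.IH)
    show "chain C P G (ns (Suc k)) (lower (Some x) xs k) (upper xs hi k) (cs (Suc k)) (ps (Suc k)) (gs (Suc k))"
      if "k \<le> length xs" for k
      using Cons.prems(1)[of "Suc k"] that by simp
    show "P (xs ! k) (olds' ! k)" if "k < length xs" for k
      using Cons.prems(2)[of "Suc k"] that by (simp add: olds)
  qed (rule olds(2))
  then obtain ys where ys: "chain C P G ys (Some x) hi (concat (map (\<lambda>k. cs (Suc k)) [0..<Suc (length xs)]))
      (concat (map2 (@) ([] # map (\<lambda>p. [p]) olds') (map (\<lambda>k. ps (Suc k)) [0..<Suc (length xs)])))
      (concat (map (\<lambda>k. gs (Suc k)) [0..<Suc (length xs)]))"
    "set ys = set xs \<union> (\<Union>k\<le>length xs. set (ns (Suc k)))" by blast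
  have "chain C P G (ns 0) lo (Some x) (cs 0) (ps 0) (gs 0)" using Cons.prems(1)[of 0] by simp
  moreover have "P x q" using Cons.prems(2)[of 0] by (simp add: olds)
  ultimately have "chain C P G (ns 0 @ x # ys) lo hi
      (cs 0 @ concat (map (\<lambda>k. cs (Suc k)) [0..<Suc (length xs)]))
      (ps 0 @ q # concat (map2 (@) ([] # map (\<lambda>p. [p]) olds') (map (\<lambda>k. ps (Suc k)) [0..<Suc (length xs)])))
      (gs 0 @ concat (map (\<lambda>k. gs (Suc k)) [0..<Suc (length xs)]))"
    using ys(1) by (rule chain_append)
  moreover have "concat (map2 (@) ([] # map (\<lambda>p. [p]) olds) (ps 0 # map (\<lambda>k. ps (Suc k)) [0..<Suc (length xs)])) =
      ps 0 @ q # concat (map2 (@) ([] # map (\<lambda>p. [p]) olds') (map (\<lambda>k. ps (Suc k)) [0..<Suc (length xs)]))"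
  proof -
    obtain y zs where "map (\<lambda>k. ps (Suc k)) [0..<Suc (length xs)] = y # zs"
      by (metis list.exhaust list.map_disc_iff upt_rec zero_less_Suc list.distinct(1))
    then show ?thesis by (simp add: olds del: upt_Suc)
  qed
  moreover have "set (ns 0 @ x # ys) = set (x # xs) \<union> (\<Union>k\<le>length (x # xs). set (ns k))"
  proof -
    have "(\<Union>k\<le>Suc n. set (ns k)) = set (ns 0) \<union> (\<Union>k\<le>n. set (ns (Suc k)))" for n
      by (auto simp: atMost_Suc_eq_insert_0)
    then show ?thesis using ys(2) by auto
  qed
  ultimately show ?case unfolding map_upt_shift concat.simps
    by (intro exI[of _ "ns 0 @ x # ys"]) (simp only: simp_thms)
qed

section \<open>Open intervals of a subdivided line\<close>

definition ival :: "'r::linorder option \<Rightarrow> 'r option \<Rightarrow> 'r set" where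
  "ival lo hi = {x. (\<forall>a. lo = Some a \<longrightarrow> a < x) \<and> (\<forall>b. hi = Some b \<longrightarrow> x < b)}"

definition bounds_ok :: "'r::linorder option \<Rightarrow> 'r option \<Rightarrow> bool" where
  "bounds_ok lo hi \<longleftrightarrow> (\<forall>a b. lo = Some a \<longrightarrow> hi = Some b \<longrightarrow> a < b)"

lemma ival_convex: "x \<in> ival lo hi \<Longrightarrow> z \<in> ival lo hi \<Longrightarrow> x < y \<Longrightarrow> y < z \<Longrightarrow> y \<in> ival lo hi"
  by (auto simp: ival_def)

lemma ival_contains_Ioo:
  fixes lo hi :: "'r::linordered_field option"
  assumes "bounds_ok lo hi" shows "\<exists>p q. p < q \<and> {p<..<q} \<subseteq> ival lo hi"
proof (cases lo; cases hi)
  fix a b assume "lo = Some a" "hi = Some b"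
  then show ?thesis using assms by (intro exI[of _ a] exI[of _ b]) (auto simp: ival_def bounds_ok_def)
next
  fix a assume "lo = Some a" "hi = None"
  then show ?thesis by (intro exI[of _ a] exI[of _ "a + 1"]) (auto simp: ival_def)
next
  fix b assume "lo = None" "hi = Some b"
  then show ?thesis by (intro exI[of _ "b - 1"] exI[of _ b]) (auto simp: ival_def)
next
  assume "lo = None" "hi = None"
  then show ?thesis by (intro exI[of _ 0] exI[of _ 1]) (auto simp: ival_def)
qed

lemma ival_nonempty: "bounds_ok lo hi \<Longrightarrow> \<exists>x. x \<in> ival lo (hi :: 'r::linordered_field option)"
  using ival_contains_Ioo[of lo hi] dense by fastforce

lemma zero_on_ival:
  fixes p :: "'r::linordered_field poly"
  assumes "bounds_ok lo hi" "\<And>x. x \<in> ival lo hi \<Longrightarrow> poly p x = 0"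
  shows "p = 0"
proof -
  obtain a b where ab: "a < b" "{a<..<b} \<subseteq> ival lo hi" using ival_contains_Ioo[OF assms(1)] by blast
  have "{a<..<b} \<subseteq> {x. poly p x = 0}" using ab(2) assms(2) by blast
  then have "infinite {x. poly p x = 0}" using infinite_Ioo[OF ab(1)] finite_subset by blast
  then show ?thesis using poly_roots_finite by blast
qed

text \<open>The sign at the end if there is one, otherwise the sign near minus infinity. With
  \<open>right_sign\<close> it lets bounded and unbounded intervals be treated together.\<close>

definition left_sign :: "'r::linordered_field poly \<Rightarrow> 'r option \<Rightarrow> int \<Rightarrow> bool" where
  "left_sign P lo s \<longleftrightarrow> (case lo of Some a \<Rightarrow> sign (poly P a) = s | None \<Rightarrow> \<exists>n. \<forall>x\<le>n. sign (poly P x) = s)"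

definition right_sign :: "'r::linordered_field poly \<Rightarrow> 'r option \<Rightarrow> int \<Rightarrow> bool" where
  "right_sign P hi s \<longleftrightarrow> (case hi of Some b \<Rightarrow> sign (poly P b) = s | None \<Rightarrow> \<exists>n. \<forall>x\<ge>n. sign (poly P x) = s)"

lemma left_sign_witness:
  assumes "left_sign P lo s" "x \<in> ival lo hi"
  shows "\<exists>y<x. sign (poly P y) = s \<and> (\<forall>z. y < z \<longrightarrow> z < x \<longrightarrow> z \<in> ival lo hi)"
proof (cases lo)
  case (Some a)
  then show ?thesis using assms by (intro exI[of _ a]) (auto simp: left_sign_def ival_def)
next
  case None
  then obtain n where "\<And>x. x \<le> n \<Longrightarrow> sign (poly P x) = s" using assms(1) by (auto simp: left_sign_def)
  then show ?thesis using assms(2) None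
    by (intro exI[of _ "min n (x - 1)"]) (auto simp: ival_def min_less_iff_disj)
qed

lemma right_sign_witness:
  assumes "right_sign P hi s" "x \<in> ival lo hi"
  shows "\<exists>y>x. sign (poly P y) = s \<and> (\<forall>z. x < z \<longrightarrow> z < y \<longrightarrow> z \<in> ival lo hi)"
proof (cases hi)
  case (Some b)
  then show ?thesis using assms by (intro exI[of _ b]) (auto simp: right_sign_def ival_def)
next
  case None
  then obtain n where "\<And>x. n \<le> x \<Longrightarrow> sign (poly P x) = s" using assms(1) by (auto simp: right_sign_def)
  then show ?thesis using assms(2) None
    by (intro exI[of _ "max n (x + 1)"]) (auto simp: ival_def less_max_iff_disj)
qed

section \<open>New roots of a monotonic polynomial\<close>

lemma rcf_strict_mono:
  fixes P :: "'r::linordered_field poly"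
  assumes rc: "real_closed TYPE('r)" and "x < y"
    and P': "\<And>z. x < z \<Longrightarrow> z < y \<Longrightarrow> sign (poly (pderiv P) z) = 1"
  shows "poly P x < poly P y"
proof -
  obtain c where c: "x < c" "c < y" "poly P y - poly P x = (y - x) * poly (pderiv P) c"
    using rcf_mvt[OF rc assms(2)] by blast
  have "0 < poly (pderiv P) c" using P'[OF c(1,2)] by (simp add: sign_eq_iffs)
  then have "0 < poly P y - poly P x" unfolding c(3) using assms(2) by simp
  then show ?thesis by simp
qed

text \<open>Each point of the interval lies strictly between witnesses of the two end signs, and
  \<open>P\<close> increases strictly from one to the other. If there is no strict sign change, the
  sign inside is the end sign that is not 0; the end signs cannot both be 0.\<close>

lemma monotonic_on_ival_pos:
  fixes P :: "'r::linordered_field poly"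
  assumes rc: "real_closed TYPE('r)" and bd: "bounds_ok lo hi"
    and P': "\<And>x. x \<in> ival lo hi \<Longrightarrow> sign (poly (pderiv P) x) = 1"
    and sl: "left_sign P lo sl" and sr: "right_sign P hi sr"
  shows "sl * sr < 0 \<Longrightarrow> \<exists>y\<in>ival lo hi. poly P y = 0 \<and>
      (\<forall>x\<in>ival lo hi. (x < y \<longrightarrow> sign (poly P x) = sl) \<and> (y < x \<longrightarrow> sign (poly P x) = sr))"
    and "\<not> sl * sr < 0 \<Longrightarrow> \<forall>x\<in>ival lo hi. poly P x \<noteq> 0 \<and> sign (poly P x) = (if sl \<noteq> 0 then sl else sr)"
proof -
  have wit: "\<exists>x0 x1. x0 < x \<and> x < x1 \<and> poly P x0 < poly P x \<and> poly P x < poly P x1 \<and>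
      sign (poly P x0) = sl \<and> sign (poly P x1) = sr \<and> (\<forall>z. x0 < z \<longrightarrow> z < x1 \<longrightarrow> z \<in> ival lo hi)"
    if x: "x \<in> ival lo hi" for x
  proof -
    obtain x0 where x0: "x0 < x" "sign (poly P x0) = sl" "\<And>z. x0 < z \<Longrightarrow> z < x \<Longrightarrow> z \<in> ival lo hi"
      using left_sign_witness[OF sl x] by blast
    obtain x1 where x1: "x < x1" "sign (poly P x1) = sr" "\<And>z. x < z \<Longrightarrow> z < x1 \<Longrightarrow> z \<in> ival lo hi"
      using right_sign_witness[OF sr x] by blast
    have "poly P x0 < poly P x" by (rule rcf_strict_mono[OF rc x0(1)]) (use x0 P' in auto)
    moreover have "poly P x < poly P x1" by (rule rcf_strict_mono[OF rc x1(1)]) (use x1 P' in auto)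
    moreover have "z \<in> ival lo hi" if "x0 < z" "z < x1" for z
      using x0(3) x1(3) x that by (cases z x rule: linorder_cases) auto
    ultimately show ?thesis using x0 x1 by blast
  qed
  have mono: "poly P x < poly P y" if "x \<in> ival lo hi" "y \<in> ival lo hi" "x < y" for x y
    by (rule rcf_strict_mono[OF rc that(3)]) (use ival_convex that P' in blast)
  {
    assume neg: "sl * sr < 0"
    obtain x where "x \<in> ival lo hi" using ival_nonempty[OF bd] by blast
    then obtain x0 x1 where x: "x0 < x" "x < x1" "poly P x0 < poly P x" "poly P x < poly P x1"
      "sign (poly P x0) = sl" "sign (poly P x1) = sr" "\<And>z. x0 < z \<Longrightarrow> z < x1 \<Longrightarrow> z \<in> ival lo hi"
      using wit by metis
    have s: "poly P x0 < 0" "0 < poly P x1" "sl = -1" "sr = 1"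
      using neg x(3,4) unfolding x(5)[symmetric] x(6)[symmetric]
      by (auto simp: sign_def split: if_splits)
    then have "poly P x0 * poly P x1 < 0" by (simp add: mult_neg_pos)
    then obtain y where y: "x0 < y" "y < x1" "poly P y = 0"
      using rcf_ivt_strict[OF rc less_trans[OF x(1,2)]] by blast
    have yi: "y \<in> ival lo hi" using x(7) y by blast
    have "\<forall>x\<in>ival lo hi. (x < y \<longrightarrow> sign (poly P x) = sl) \<and> (y < x \<longrightarrow> sign (poly P x) = sr)"
      using mono yi y(3) by (auto simp: s sign_eq_iffs) (metis, metis)
    then show "\<exists>y\<in>ival lo hi. poly P y = 0 \<and>
      (\<forall>x\<in>ival lo hi. (x < y \<longrightarrow> sign (poly P x) = sl) \<and> (y < x \<longrightarrow> sign (poly P x) = sr))"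
      using yi y(3) by blast
  }
  {
    assume nneg: "\<not> sl * sr < 0"
    show "\<forall>x\<in>ival lo hi. poly P x \<noteq> 0 \<and> sign (poly P x) = (if sl \<noteq> 0 then sl else sr)"
    proof
      fix x assume "x \<in> ival lo hi"
      then obtain x0 x1 where x: "poly P x0 < poly P x" "poly P x < poly P x1"
        "sign (poly P x0) = sl" "sign (poly P x1) = sr" using wit by metis
      show "poly P x \<noteq> 0 \<and> sign (poly P x) = (if sl \<noteq> 0 then sl else sr)"
        using nneg x(1,2) unfolding x(3)[symmetric] x(4)[symmetric]
        by (auto simp: sign_def split: if_splits)
    qed
  }
qed

lemma monotonic_on_ival:
  fixes P :: "'r::linordered_field poly"
  assumes rc: "real_closed TYPE('r)" and bd: "bounds_ok lo hi"
    and P': "\<And>x. x \<in> ival lo hi \<Longrightarrow> sign (poly (pderiv P) x) = t" "t \<noteq> 0"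
    and sl: "left_sign P lo sl" and sr: "right_sign P hi sr"
  shows "sl * sr < 0 \<Longrightarrow> \<exists>y\<in>ival lo hi. poly P y = 0 \<and>
      (\<forall>x\<in>ival lo hi. (x < y \<longrightarrow> sign (poly P x) = sl) \<and> (y < x \<longrightarrow> sign (poly P x) = sr))"
    and "\<not> sl * sr < 0 \<Longrightarrow> \<forall>x\<in>ival lo hi. poly P x \<noteq> 0 \<and> sign (poly P x) = (if sl \<noteq> 0 then sl else sr)"
proof -
  obtain x where "x \<in> ival lo hi" using ival_nonempty[OF bd] by blast
  then consider "t = 1" | "t = -1" using P' sign_ne_0_cases by metis
  then show "sl * sr < 0 \<Longrightarrow> \<exists>y\<in>ival lo hi. poly P y = 0 \<and>
      (\<forall>x\<in>ival lo hi. (x < y \<longrightarrow> sign (poly P x) = sl) \<and> (y < x \<longrightarrow> sign (poly P x) = sr))"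
    "\<not> sl * sr < 0 \<Longrightarrow> \<forall>x\<in>ival lo hi. poly P x \<noteq> 0 \<and> sign (poly P x) = (if sl \<noteq> 0 then sl else sr)"
  proof (atomize (full), cases)
    case 1
    have "sign (poly (pderiv P) x) = 1" if "x \<in> ival lo hi" for x using P'(1)[OF that] 1 by simp
    from monotonic_on_ival_pos[OF rc bd this sl sr]
    show "(sl * sr < 0 \<longrightarrow> (\<exists>y\<in>ival lo hi. poly P y = 0 \<and>
      (\<forall>x\<in>ival lo hi. (x < y \<longrightarrow> sign (poly P x) = sl) \<and> (y < x \<longrightarrow> sign (poly P x) = sr)))) \<and>
      (\<not> sl * sr < 0 \<longrightarrow> (\<forall>x\<in>ival lo hi. poly P x \<noteq> 0 \<and> sign (poly P x) = (if sl \<noteq> 0 then sl else sr)))"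
      by blast
  next
    case 2
    have s: "sign (poly (pderiv (- P)) x) = 1" if "x \<in> ival lo hi" for x
      using P'(1)[OF that] 2 by (simp add: pderiv_minus sign_minus_field)
    have l: "left_sign (- P) lo (- sl)" "right_sign (- P) hi (- sr)"
      using sl sr by (auto simp: left_sign_def right_sign_def sign_minus_field split: option.splits)
    note m = monotonic_on_ival_pos[OF rc bd s l, simplified sign_minus_field poly_minus minus_mult_minus neg_equal_0_iff_equal neg_equal_iff_equal if_distrib[symmetric]]
    show "(sl * sr < 0 \<longrightarrow> (\<exists>y\<in>ival lo hi. poly P y = 0 \<and>
      (\<forall>x\<in>ival lo hi. (x < y \<longrightarrow> sign (poly P x) = sl) \<and> (y < x \<longrightarrow> sign (poly P x) = sr)))) \<and>
      (\<not> sl * sr < 0 \<longrightarrow> (\<forall>x\<in>ival lo hi. poly P x \<noteq> 0 \<and> sign (poly P x) = (if sl \<noteq> 0 then sl else sr)))"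
      using m by (auto simp: split: if_splits)
  qed
qed

section \<open>Data of the derivatives, and prefixes of a closed family\<close>

lemma map_of_zip_list_all2:
  "list_all2 R xs ys \<Longrightarrow> x \<in> set xs \<Longrightarrow> \<exists>y. map_of (zip xs ys) x = Some y \<and> R x y"
  by (induction rule: list_all2_induct) auto

lemma length_derivs_data [simp]: "length (derivs_data Qs xs F) = Suc (degree F)"
  by (simp add: derivs_data_def)

lemma derivs_data_nth:
  assumes "closed_family Z Qs" "F \<in> set Qs" "list_all2 R Qs xs" "j \<le> degree F"
  shows "R ((pderiv ^^ j) F) (derivs_data Qs xs F ! j)"
proof -
  have "(pderiv ^^ j) F \<in> set Qs" by (rule pderiv_funpow_in_family[OF assms(1,2,4)])
  then obtain y where "map_of (zip Qs xs) ((pderiv ^^ j) F) = Some y" "R ((pderiv ^^ j) F) y"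
    using map_of_zip_list_all2[OF assms(3)] by blast
  then show ?thesis using assms(4) by (simp add: derivs_data_def del: upt_Suc)
qed

text \<open>Derivatives and remainders have strictly smaller degree than a member of the prefix, and
  members of smaller degree come earlier in the list.\<close>

lemma closed_family_prefix:
  assumes "closed_family Z (Qs @ Rs)" shows "closed_family Z Qs"
proof -
  have "degree Y \<le> degree X" if "Y \<in> set Qs" "X \<in> set Rs" for X Y
    using assms that by (auto simp: closed_family_def sorted_append)
  then have low: "X \<in> set Qs" if "X \<in> set (Qs @ Rs)" "Y \<in> set Qs" "degree X < degree Y" for X Y
    using that by (metis UnE not_le set_append)
  have dist: "distinct Qs" "sorted (map degree Qs)"
    using assms by (auto simp: closed_family_def sorted_append)
  have der: "pderiv P \<in> set Qs" if P: "P \<in> set Qs" "1 \<le> degree P" for P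
  proof (rule low[OF _ P(1)])
    show "pderiv P \<in> set (Qs @ Rs)" using assms P by (auto simp: closed_family_def)
    show "degree (pderiv P) < degree P" using P(2) by (simp add: degree_pderiv)
  qed
  have "reduce Z (pseudo_mod P Q) \<in> set Qs"
    if PQ: "P \<in> set Qs" "Q \<in> set Qs" "1 \<le> degree Q" "degree Q \<le> degree P" for P Q
  proof (rule low[OF _ PQ(2)])
    show "reduce Z (pseudo_mod P Q) \<in> set (Qs @ Rs)" using assms PQ by (auto simp: closed_family_def)
    show "degree (reduce Z (pseudo_mod P Q)) < degree Q"
      using degree_pseudo_mod_less[OF PQ(3), of P] kept_degree_le[of Z "pseudo_mod P Q"] by (simp add: degree_reduce)
  qed
  then show ?thesis using dist der by (simp add: closed_family_def)
qed

text \<open>What \<open>add_poly\<close> requires of the next polynomial: its derivative and its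
  remainders already belong to the tableau.\<close>

lemma closed_family_snoc:
  assumes "closed_family Z (Qs @ [P])"
  shows "1 \<le> degree P \<Longrightarrow> pderiv P \<in> set Qs"
    "Q \<in> set Qs \<Longrightarrow> 1 \<le> degree Q \<Longrightarrow> degree Q \<le> degree P"
    "Q \<in> set Qs \<Longrightarrow> 1 \<le> degree Q \<Longrightarrow> reduce Z (pseudo_mod P Q) \<in> set Qs"
proof -
  show "pderiv P \<in> set Qs" if "1 \<le> degree P"
  proof -
    have "pderiv P \<in> set (Qs @ [P])" using assms that by (simp add: closed_family_def)
    moreover have "pderiv P \<noteq> P" using that degree_pderiv[of P] by force
    ultimately show ?thesis by auto
  qed
  show deg: "degree Q \<le> degree P" if "Q \<in> set Qs" for Q
    using assms that by (auto simp: closed_family_def sorted_append)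
  show "reduce Z (pseudo_mod P Q) \<in> set Qs" if Q: "Q \<in> set Qs" "1 \<le> degree Q"
  proof -
    have "reduce Z (pseudo_mod P Q) \<in> set (Qs @ [P])" using assms Q deg[OF Q(1)] by (simp add: closed_family_def)
    moreover have "degree (reduce Z (pseudo_mod P Q)) < degree P"
      using degree_pseudo_mod_less[OF Q(2), of P] kept_degree_le[of Z "pseudo_mod P Q"] deg[OF Q(1)] by (simp add: degree_reduce)
    ultimately show ?thesis by auto
  qed
qed

text \<open>Without roots to the right of \<open>a\<close>, the \<open>j\<close>-th derivative keeps
  there its sign at infinity, which is that of the leading coefficient for every \<open>j\<close>.
  Hence all terms of the Taylor formula at \<open>a\<close> have the same sign.\<close>

lemma no_roots_at_right:
  fixes P :: "'r::linordered_field poly"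
  assumes rc: "real_closed TYPE('r)" and j: "j \<le> degree P"
    and nz: "\<And>x. a < x \<Longrightarrow> poly ((pderiv ^^ j) P) x \<noteq> 0"
  shows "0 \<le> of_int (sign (lead_coeff P)) * poly ((pderiv ^^ j) P) a"
proof -
  let ?Q = "(pderiv ^^ j) P"
  obtain n where n: "\<And>x. n \<le> x \<Longrightarrow> sign (poly ?Q x) = sign (lead_coeff ?Q)" using sign_at_top by blast
  have "sign (poly ?Q x) = sign (lead_coeff P)" if x: "a < x" for x
  proof -
    have "sign (poly ?Q x) = sign (poly ?Q (max n x))"
      by (rule rcf_constant_sign[OF rc, of "{a<..}"]) (use nz x in auto)
    then show ?thesis using n[of "max n x"] lead_coeff_pderiv_funpow_sign[OF j] by simp
  qed
  then have "of_int (sign (lead_coeff P)) * poly ?Q a = \<bar>poly ?Q a\<bar>"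
    by (intro rcf_abs_at_closure[OF rc, of a "a + 1"]) auto
  then show ?thesis by simp
qed

lemma no_roots_at_left:
  fixes P :: "'r::linordered_field poly"
  assumes rc: "real_closed TYPE('r)" and j: "j \<le> degree P"
    and nz: "\<And>x. x < a \<Longrightarrow> poly ((pderiv ^^ j) P) x \<noteq> 0"
  shows "0 \<le> of_int (sign (lead_coeff P) * (- 1) ^ degree P) * (- 1) ^ j * poly ((pderiv ^^ j) P) a"
proof -
  let ?Q = "(pderiv ^^ j) P"
  let ?s = "sign (lead_coeff P) * (- 1) ^ (degree P - j)"
  obtain n where n: "\<And>x. x \<le> n \<Longrightarrow> sign (poly ?Q x) = sign (lead_coeff ?Q) * (- 1) ^ degree ?Q"
    using sign_at_bot by blast
  have "sign (poly ?Q x) = ?s" if x: "x < a" for x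
  proof -
    have "sign (poly ?Q x) = sign (poly ?Q (min n x))"
      by (rule rcf_constant_sign[OF rc, of "{..<a}"]) (use nz x in auto)
    then show ?thesis using n[of "min n x"] lead_coeff_pderiv_funpow_sign[OF j] by (simp add: degree_pderiv_funpow)
  qed
  then have eq: "of_int ?s * poly ?Q a = \<bar>poly ?Q a\<bar>"
    by (intro rcf_abs_at_closure[OF rc, of "a - 1" a]) auto
  \<comment> \<open>The exponents \<open>degree P + j\<close> and \<open>degree P - j\<close> have
    the same parity. The factor \<open>(-1)^j\<close> will come from the \<open>j\<close>-th power
    of a negative displacement.\<close>
  have "(of_int ((- 1) ^ degree P) :: 'r) * (- 1) ^ j = of_int ((- 1) ^ (degree P - j))"
  proof -
    have "(- 1 :: 'r) ^ degree P * (- 1) ^ j = (- 1) ^ (degree P - j + (j + j))"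
      using j by (simp flip: power_add)
    then show ?thesis by (simp add: power_add flip: power_mult_distrib)
  qed
  then have "of_int (sign (lead_coeff P) * (- 1) ^ degree P) * (- 1) ^ j = (of_int ?s :: 'r)"
    by (simp only: of_int_mult mult.assoc)
  then show ?thesis by (simp only: eq abs_ge_zero)
qed

lemma set_concat_option:
  "set (concat (map (\<lambda>j. case g j of None \<Rightarrow> [] | Some t \<Rightarrow> [t]) [0..<n])) = {t. \<exists>j<n. g j = Some t}"
  by (force split: option.splits)

section \<open>Values at a point of the parameter space\<close>

locale rcvf_point = rcvf v V for v :: "'r::linordered_field \<Rightarrow> 'g::linordered_ab_group_add extended" and V +
  fixes \<rho> :: "nat \<Rightarrow> 'r"
begin

abbreviation \<nu> :: "'r coef \<Rightarrow> 'g" where "\<nu> c \<equiv> w (eval_coef \<rho> c)"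

abbreviation ev :: "'r coef poly \<Rightarrow> 'r \<Rightarrow> 'r" where "ev F x \<equiv> poly (specialize \<rho> F) x"

section \<open>Values of Taylor sums\<close>

definition sval_ok :: "'r coef sval \<Rightarrow> 'r \<Rightarrow> bool" where
  "sval_ok s y \<longleftrightarrow> fst s = sign y \<and> (if y = 0 then snd s = None else \<exists>e. snd s = Some e \<and> veval \<nu> e = w y)"

lemma sval_okI: "s = sign y \<Longrightarrow> (y \<noteq> 0 \<Longrightarrow> veval \<nu> e = w y) \<Longrightarrow> sval_ok (sval s e) y"
  by (auto simp: sval_ok_def sval_def)

lemma sval_ok_zero [simp]: "sval_ok (0, None) 0"
  by (simp add: sval_ok_def sign_def)

lemma sval_ok_the: "sval_ok s y \<Longrightarrow> y \<noteq> 0 \<Longrightarrow> snd s = Some (the (snd s)) \<and> veval \<nu> (the (snd s)) = w y"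
  by (auto simp: sval_ok_def)

text \<open>The minimum over an empty list would be meaningless, so nonemptiness of the terms is
  always proved along with the value.\<close>

definition pl :: "('r coef vexp \<times> nat) list \<Rightarrow> 'g \<Rightarrow> 'g" where
  "pl ts \<tau> = Min ((\<lambda>(e, k). veval \<nu> e + qmult (of_nat k) \<tau>) ` set ts)"

lemma veval_min_terms: "ts \<noteq> [] \<Longrightarrow> veval \<nu> (min_terms \<tau> ts) = pl ts (veval \<nu> \<tau>)"
proof -
  assume "ts \<noteq> []"
  then have "veval \<nu> (min_terms \<tau> ts) = Min (veval \<nu> ` set (map (\<lambda>(e, k). VAdd e (VScale (of_nat k) \<tau>)) ts))"
    unfolding min_terms_def by (intro veval_vmin_list) simp
  also have "veval \<nu> ` set (map (\<lambda>(e, k). VAdd e (VScale (of_nat k) \<tau>)) ts)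
      = (\<lambda>(e, k). veval \<nu> e + qmult (of_nat k) (veval \<nu> \<tau>)) ` set ts"
    unfolding set_map image_image by (rule image_cong) auto
  finally show ?thesis by (simp add: pl_def)
qed

text \<open>Each term \<open>(e, k)\<close> satisfies \<open>\<gamma> \<le> e + k \<tau>\<close>,
  that is \<open>\<tau> \<ge> (\<gamma> - e) / k\<close>, with equality for a term attaining the
  minimum. So \<open>\<tau>\<close> is the maximum of these quotients.\<close>

lemma veval_solve_terms:
  assumes "ts \<noteq> []" and k: "\<And>e k. (e, k) \<in> set ts \<Longrightarrow> 1 \<le> k" and \<gamma>: "pl ts \<tau> = veval \<nu> \<gamma>"
  shows "veval \<nu> (solve_terms \<gamma> ts) = \<tau>"
proof -
  let ?f = "\<lambda>(e, k). qmult (1 / of_nat k) (veval \<nu> \<gamma> - veval \<nu> e)"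
  have "veval \<nu> (solve_terms \<gamma> ts) =
      Max (veval \<nu> ` set (map (\<lambda>(e, k). VScale (1 / of_nat k) (VAdd \<gamma> (VScale (- 1) e))) ts))"
    unfolding solve_terms_def using assms(1) by (intro veval_vmax_list) simp
  also have "veval \<nu> ` set (map (\<lambda>(e, k). VScale (1 / of_nat k) (VAdd \<gamma> (VScale (- 1) e))) ts) = ?f ` set ts"
    unfolding set_map image_image by (rule image_cong) auto
  also have "Max (?f ` set ts) = \<tau>"
  proof (rule Max_eqI)
    fix y assume "y \<in> ?f ` set ts"
    then obtain e k where ek: "(e, k) \<in> set ts" "y = qmult (1 / of_nat k) (veval \<nu> \<gamma> - veval \<nu> e)" by auto
    have "pl ts \<tau> \<le> veval \<nu> e + qmult (of_nat k) \<tau>"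
      unfolding pl_def using ek(1) by (intro Min_le) force+
    then have "veval \<nu> \<gamma> - veval \<nu> e \<le> qmult (of_nat k) \<tau>" by (simp add: \<gamma> algebra_simps)
    then have "y \<le> qmult (1 / of_nat k) (qmult (of_nat k) \<tau>)"
      unfolding ek(2) using k[OF ek(1)] by (subst qmult_le_cancel) auto
    then show "y \<le> \<tau>" using k[OF ek(1)] by simp
  next
    have "pl ts \<tau> \<in> (\<lambda>(e, k). veval \<nu> e + qmult (of_nat k) \<tau>) ` set ts"
      unfolding pl_def using assms(1) by (intro Min_in) auto
    then obtain e k where ek: "(e, k) \<in> set ts" "pl ts \<tau> = veval \<nu> e + qmult (of_nat k) \<tau>" by auto
    have "veval \<nu> \<gamma> - veval \<nu> e = qmult (of_nat k) \<tau>" using ek(2) \<gamma> by (simp add: algebra_simps)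
    then have "\<tau> = ?f (e, k)" using k[OF ek(1)] by simp
    then show "\<tau> \<in> ?f ` set ts" using ek(1) by (rule image_eqI)
  qed simp
  finally show ?thesis .
qed

text \<open>Common to both Taylor formulae: indices of vanishing summands carry no term, and
  \<open>w_sum\<close> is applied to the other ones.\<close>

lemma pl_w_sum:
  fixes f :: "nat \<Rightarrow> 'r"
  assumes ts: "set ts = {t. \<exists>j<n. g j = Some t}"
    and f: "\<And>j. j < n \<Longrightarrow> 0 \<le> f j"
    and z: "\<And>j. j < n \<Longrightarrow> f j = 0 \<Longrightarrow> g j = None"
    and nz: "\<And>j. j < n \<Longrightarrow> f j \<noteq> 0 \<Longrightarrow> \<exists>e k. g j = Some (e, k) \<and> veval \<nu> e + qmult (of_nat k) \<tau> = w (f j)"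
    and s: "(\<Sum>j<n. f j) \<noteq> 0"
  shows "ts \<noteq> [] \<and> w (\<Sum>j<n. f j) = pl ts \<tau>"
proof -
  obtain i where i: "i < n" "f i \<noteq> 0" using s by (metis lessThan_iff sum.neutral)
  have "(\<lambda>(e, k). veval \<nu> e + qmult (of_nat k) \<tau>) ` set ts = (\<lambda>j. w (f j)) ` {j\<in>{..<n}. f j \<noteq> 0}"
  proof (intro equalityI subsetI)
    fix y assume "y \<in> (\<lambda>(e, k). veval \<nu> e + qmult (of_nat k) \<tau>) ` set ts"
    then obtain e k j where *: "j < n" "g j = Some (e, k)" "y = veval \<nu> e + qmult (of_nat k) \<tau>" using ts by auto
    then have "f j \<noteq> 0" using z[of j] by auto
    then show "y \<in> (\<lambda>j. w (f j)) ` {j\<in>{..<n}. f j \<noteq> 0}" using nz[of j] * by force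
  next
    fix y assume "y \<in> (\<lambda>j. w (f j)) ` {j\<in>{..<n}. f j \<noteq> 0}"
    then obtain j where j: "j < n" "f j \<noteq> 0" "y = w (f j)" by auto
    then obtain e k where "g j = Some (e, k)" "veval \<nu> e + qmult (of_nat k) \<tau> = y" using nz[of j] by auto
    then show "y \<in> (\<lambda>(e, k). veval \<nu> e + qmult (of_nat k) \<tau>) ` set ts" using j(1) ts by force
  qed
  moreover have "w (\<Sum>j<n. f j) = Min ((\<lambda>j. w (f j)) ` {j\<in>{..<n}. f j \<noteq> 0})"
    by (rule w_sum) (use f i in auto)
  moreover have "ts \<noteq> []"
  proof
    assume "ts = []"
    then have "g i = None" using ts i(1) by (cases "g i") auto
    then show False using nz[OF i] by simp
  qed
  ultimately show ?thesis by (simp add: pl_def)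
qed

lemma zmult_of_nat: "zmult (int n) g = qmult (of_nat n) (g :: 'g)"
  using qmult_of_int[of "int n" g] by simp

lemma taylor_value:
  assumes ab: "a < b" and S: "signs_on a b P \<sigma>"
    and base: "\<And>j. j < length \<sigma> \<Longrightarrow>
      sval_ok (if j < length (sides \<sigma>) \<and> \<not> sides \<sigma> ! j then at_b ! j else at_a ! j)
        (poly ((pderiv ^^ j) P) (base_end \<sigma> a b j))"
    and \<delta>: "veval \<nu> \<delta> = w (b - a)" and s: "0 < s" "s < 1"
  shows "taylor_terms \<sigma> at_a at_b \<delta> \<noteq> [] \<and>
    w (poly P (from_end a b (left_based \<sigma>) s)) = pl (taylor_terms \<sigma> at_a at_b \<delta>) (w s)"
proof -
  let ?x = "from_end a b (left_based \<sigma>) s"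
  let ?at = "\<lambda>j. if j < length (sides \<sigma>) \<and> \<not> sides \<sigma> ! j then at_b ! j else at_a ! j"
  let ?f = "\<lambda>j. \<bar>poly ((pderiv ^^ j) P) (base_end \<sigma> a b j)\<bar> * (b - a) ^ j * s ^ min j (run_length \<sigma>)"
  let ?g = "\<lambda>j. map_option (\<lambda>e. (VAdd e (VScale (of_nat j) \<delta>), min j (run_length \<sigma>))) (snd (?at j))"
  have h: "0 < b - a" using ab by simp
  have "a < ?x" "?x < b"
  proof -
    have "0 < s * (b - a)" "s * (b - a) < 1 * (b - a)" using s h by (auto intro: mult_strict_right_mono)
    then show "a < ?x" "?x < b" by (auto simp: from_end_def algebra_simps)
  qed
  then have "sign (poly P ?x) \<noteq> 0" using S unfolding signs_on_def by (metis funpow_0 zero_less_Suc)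
  then have Px: "poly P ?x \<noteq> 0" by simp
  have eq: "\<bar>poly P ?x\<bar> \<simeq> (\<Sum>j<length \<sigma>. ?f j)"
    using generalized_taylor[OF rc ab S, of s] s by (simp add: taylor_sum_def)
  have "taylor_terms \<sigma> at_a at_b \<delta> \<noteq> [] \<and> w (\<Sum>j<length \<sigma>. ?f j) = pl (taylor_terms \<sigma> at_a at_b \<delta>) (w s)"
  proof (rule pl_w_sum[where g = ?g])
    show "set (taylor_terms \<sigma> at_a at_b \<delta>) = {t. \<exists>j<length \<sigma>. ?g j = Some t}"
      unfolding set_concat_option[symmetric] taylor_terms_def by (simp only: case_map_option comp_def)
    show "0 \<le> ?f j" for j using h s by (intro mult_nonneg_nonneg) auto
    show "?g j = None" if "j < length \<sigma>" "?f j = 0" for j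
    proof -
      have "poly ((pderiv ^^ j) P) (base_end \<sigma> a b j) = 0" using that(2) h s by simp
      then show ?thesis using base[OF that(1)] by (simp add: sval_ok_def)
    qed
    show "\<exists>e k. ?g j = Some (e, k) \<and> veval \<nu> e + qmult (of_nat k) (w s) = w (?f j)"
      if j: "j < length \<sigma>" "?f j \<noteq> 0" for j
    proof -
      have nz: "poly ((pderiv ^^ j) P) (base_end \<sigma> a b j) \<noteq> 0" using j(2) by auto
      then obtain e where "snd (?at j) = Some e" "veval \<nu> e = w (poly ((pderiv ^^ j) P) (base_end \<sigma> a b j))"
        using base[OF j(1)] by (auto simp: sval_ok_def)
      moreover have "w (?f j) = w (poly ((pderiv ^^ j) P) (base_end \<sigma> a b j)) + zmult (int j) (w (b - a)) +
          zmult (int (min j (run_length \<sigma>))) (w s)"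
        using nz h s by (simp add: w_mult w_power)
      ultimately show ?thesis by (simp add: \<delta> zmult_of_nat)
    qed
    show "(\<Sum>j<length \<sigma>. ?f j) \<noteq> 0" using eq Px by (auto simp: dom_eq_def dom_le_def)
  qed
  moreover have "w (poly P ?x) = w (\<Sum>j<length \<sigma>. ?f j)" using w_dom_eq[OF eq] by simp
  ultimately show ?thesis by simp
qed

text \<open>The signs \<open>s\<close> and \<open>d\<close> make all terms of the ordinary Taylor
  formula nonnegative, so the value of the sum is a minimum; the factorials have value 0.\<close>

lemma unbounded_value:
  assumes P: "P \<noteq> 0" and len: "length at_a = Suc (degree P)"
    and at: "\<And>j. j \<le> degree P \<Longrightarrow> sval_ok (at_a ! j) (poly ((pderiv ^^ j) P) a)"
    and sg: "\<And>j. j \<le> degree P \<Longrightarrow> 0 \<le> of_int s * d ^ j * poly ((pderiv ^^ j) P) a"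
    and s: "s = 1 \<or> s = -1" and d: "d = 1 \<or> d = -1" and t: "0 < t"
  shows "unbounded_terms at_a \<noteq> [] \<and> w (poly P (a + d * t)) = pl (unbounded_terms at_a) (w t)"
proof -
  let ?f = "\<lambda>j. of_int s * d ^ j * poly ((pderiv ^^ j) P) a * t ^ j / fact j"
  let ?g = "\<lambda>j. map_option (\<lambda>e. (e, j)) (snd (at_a ! j))"
  have sd: "(of_int s :: 'r) = 1 \<or> (of_int s :: 'r) = -1"
    using s by auto
  have d0: "d \<noteq> 0" "s \<noteq> 0" using d s by auto
  have sd2: "d ^ j = 1 \<or> d ^ j = -1" for j
    using d by (cases "even j") (auto simp: minus_one_power_iff)
  have "of_int s * poly P (a + d * t) = (\<Sum>j\<le>degree P. ?f j)"
    unfolding taylor_expansion sum_distrib_left by (simp add: power_mult_distrib ac_simps)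
  also have "\<dots> = (\<Sum>j<length at_a. ?f j)" by (simp add: len lessThan_Suc_atMost)
  finally have sum: "of_int s * poly P (a + d * t) = (\<Sum>j<length at_a. ?f j)" .
  have nonneg: "0 \<le> ?f j" if "j < length at_a" for j
  proof -
    have "0 \<le> of_int s * d ^ j * poly ((pderiv ^^ j) P) a" using sg[of j] that len by simp
    from mult_nonneg_nonneg[OF this, of "t ^ j"] show ?thesis using t by simp
  qed
  have w_f: "w (?f j) = w (poly ((pderiv ^^ j) P) a) + qmult (of_nat j) (w t)"
    if "poly ((pderiv ^^ j) P) a \<noteq> 0" for j
  proof -
    have "?f j = (poly ((pderiv ^^ j) P) a * t ^ j / fact j) \<or> ?f j = - (poly ((pderiv ^^ j) P) a * t ^ j / fact j)"
      using sd sd2[of j] by auto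
    moreover have "w (fact j) = 0" using w_fact_mult[of j 1] by simp
    ultimately show ?thesis using that t by (auto simp: w_divide w_mult w_power zmult_of_nat)
  qed
  \<comment> \<open>The last derivative is a nonzero constant, so the nonnegative terms do not all
    vanish.\<close>
  have "(pderiv ^^ degree P) P \<noteq> 0"
    using coeff_pderiv_funpow_0[of "degree P" P] P by (metis coeff_0 fact_nonzero leading_coeff_0_iff mult_eq_0_iff)
  moreover have "degree ((pderiv ^^ degree P) P) = 0" by (simp add: degree_pderiv_funpow)
  ultimately have top: "poly ((pderiv ^^ degree P) P) a \<noteq> 0" by (metis degree_eq_zeroE mult_zero_right add.right_neutral poly_0 poly_pCons pCons_0_0)
  have "unbounded_terms at_a \<noteq> [] \<and> w (\<Sum>j<length at_a. ?f j) = pl (unbounded_terms at_a) (w t)"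
  proof (rule pl_w_sum[where g = ?g])
    show "set (unbounded_terms at_a) = {u. \<exists>j<length at_a. ?g j = Some u}"
      unfolding set_concat_option[symmetric] unbounded_terms_def by (simp only: case_map_option comp_def)
    show "?g j = None" if "j < length at_a" "?f j = 0" for j
    proof -
      have "poly ((pderiv ^^ j) P) a = 0" using that(2) d0 t by simp
      then show ?thesis using at[of j] that(1) len by (simp add: sval_ok_def)
    qed
    show "\<exists>e k. ?g j = Some (e, k) \<and> veval \<nu> e + qmult (of_nat k) (w t) = w (?f j)"
      if j: "j < length at_a" "?f j \<noteq> 0" for j
    proof -
      have nz: "poly ((pderiv ^^ j) P) a \<noteq> 0" using j(2) by auto
      then obtain e where "snd (at_a ! j) = Some e" "veval \<nu> e = w (poly ((pderiv ^^ j) P) a)"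
        using at[of j] j(1) len by (auto simp: sval_ok_def)
      then show ?thesis using w_f[OF nz] by simp
    qed
    have "?f (degree P) \<noteq> 0" using top d0 t by simp
    then show "(\<Sum>j<length at_a. ?f j) \<noteq> 0"
      using nonneg len sum_nonneg_eq_0_iff[of "{..<length at_a}" ?f] by auto
  qed (rule nonneg)
  moreover have "w (poly P (a + d * t)) = w (\<Sum>j<length at_a. ?f j)" unfolding sum[symmetric] using s by auto
  ultimately show ?thesis by simp
qed

section \<open>Correctness of a tableau at a parameter point\<close>

definition roots :: "'r coef poly list \<Rightarrow> 'r set" where
  "roots Qs = {x. \<exists>F\<in>set Qs. specialize \<rho> F \<noteq> 0 \<and> ev F x = 0}"

text \<open>\<open>bounds_ok\<close> keeps the points in increasing order;
  \<open>tab_ok_sorted\<close> recovers the order from it.\<close>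

definition cell_ok :: "'r coef poly list \<Rightarrow> 'r option \<Rightarrow> 'r option \<Rightarrow> int list \<Rightarrow> bool" where
  "cell_ok Qs lo hi cell \<longleftrightarrow> bounds_ok lo hi \<and> (\<forall>x\<in>ival lo hi. cell = map (\<lambda>F. sign (ev F x)) Qs)"

definition point_ok :: "'r coef poly list \<Rightarrow> 'r \<Rightarrow> 'r coef sval list \<Rightarrow> bool" where
  "point_ok Qs x p \<longleftrightarrow> list_all2 (\<lambda>F s. sval_ok s (ev F x)) Qs p"

definition gap_ok :: "'r \<Rightarrow> 'r \<Rightarrow> 'r coef vexp \<Rightarrow> bool" where
  "gap_ok a b g \<longleftrightarrow> veval \<nu> g = w (b - a)"

definition tab_ok :: "'r coef poly list \<Rightarrow> 'r coef vtab \<Rightarrow> 'r list \<Rightarrow> bool" where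
  "tab_ok Qs tab xs \<longleftrightarrow> chain (cell_ok Qs) (point_ok Qs) gap_ok xs None None (cells tab) (points tab) (gaps tab) \<and>
     set xs = roots Qs"

lemma cell_list_all2:
  "cell_ok Qs lo hi cell \<Longrightarrow> x \<in> ival lo hi \<Longrightarrow> list_all2 (\<lambda>F s. s = sign (ev F x)) Qs cell"
  by (auto simp: cell_ok_def list_all2_map2 list_all2_refl)

lemma cell_bounds: "cell_ok Qs lo hi cell \<Longrightarrow> bounds_ok lo hi"
  by (simp add: cell_ok_def)

lemma cell_ok_snoc:
  assumes "cell_ok Qs lo hi cell" "bounds_ok lo' hi'" "ival lo' hi' \<subseteq> ival lo hi"
    "\<And>x. x \<in> ival lo' hi' \<Longrightarrow> sign (ev P x) = s"
  shows "cell_ok (Qs @ [P]) lo' hi' (cell @ [s])"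
  using assms unfolding cell_ok_def by auto

lemma point_ok_snoc: "point_ok Qs x p \<Longrightarrow> sval_ok s (ev P x) \<Longrightarrow> point_ok (Qs @ [P]) x (p @ [s])"
  by (simp add: point_ok_def list_all2_appendI)

definition family_ok :: "'r coef set \<Rightarrow> ('r coef \<Rightarrow> int) \<Rightarrow> 'r coef poly list \<Rightarrow> bool" where
  "family_ok Z sg Qs \<longleftrightarrow> (\<forall>z\<in>Z. eval_coef \<rho> z = 0) \<and> closed_family Z Qs \<and> nondegenerate \<rho> Qs \<and>
     (\<forall>F\<in>set Qs. degree F = 0 \<longrightarrow> sg (coeff F 0) = sign (eval_coef \<rho> (coeff F 0)))"

lemma family_ok_prefix: "family_ok Z sg (Qs @ Rs) \<Longrightarrow> family_ok Z sg Qs"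
  using closed_family_prefix by (auto simp: family_ok_def nondegenerate_def)

lemma degree_specialize_le: "degree (specialize \<rho> F) \<le> degree F"
  by (rule degree_le) (simp add: coeff_eq_0)

lemma degree_specialize:
  assumes "family_ok Z sg Qs" "F \<in> set Qs" shows "degree (specialize \<rho> F) = degree F"
proof (cases "degree F = 0")
  case True
  then show ?thesis using degree_specialize_le[of F] by simp
next
  case False
  then have "coeff (specialize \<rho> F) (degree F) \<noteq> 0" using assms by (auto simp: family_ok_def nondegenerate_def)
  then show ?thesis using degree_specialize_le[of F] le_degree by (metis antisym)
qed

lemma specialize_nonzero: "family_ok Z sg Qs \<Longrightarrow> F \<in> set Qs \<Longrightarrow> 1 \<le> degree F \<Longrightarrow> specialize \<rho> F \<noteq> 0"
  using degree_specialize[of Z sg Qs F] by auto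

lemma ev_degree_0: "degree F = 0 \<Longrightarrow> ev F x = eval_coef \<rho> (coeff F 0)"
  using poly_degree_0_eq[of "specialize \<rho> F" x 0] degree_specialize_le[of F] by (simp add: poly_0_coeff_0)

lemma top_constant_facts:
  assumes "family_ok Z sg Qs" "F \<in> set Qs" "1 \<le> degree F"
  shows "sg (top_constant F) = sign (eval_coef \<rho> (lead_coeff F))" "\<nu> (top_constant F) = \<nu> (lead_coeff F)"
    "lead_coeff (specialize \<rho> F) = eval_coef \<rho> (lead_coeff F)" "eval_coef \<rho> (lead_coeff F) \<noteq> 0"
proof -
  have eq: "eval_coef \<rho> (top_constant F) = fact (degree F) * eval_coef \<rho> (lead_coeff F)"
  proof -
    have "top_constant F = of_nat (fact (degree F)) * lead_coeff F" by (simp add: top_constant_eq of_nat_fact)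
    then show ?thesis by (simp add: eval_coef_mult del: of_nat_fact) (simp add: of_nat_fact)
  qed
  have "(pderiv ^^ degree F) F \<in> set Qs"
    using assms by (auto simp: family_ok_def intro: pderiv_funpow_in_family)
  then have "sg (top_constant F) = sign (eval_coef \<rho> (top_constant F))"
    using assms(1) unfolding family_ok_def top_constant_def by (simp add: degree_pderiv_funpow)
  moreover have "sign (fact (degree F) :: 'r) = 1" by (simp add: sign_def)
  ultimately show "sg (top_constant F) = sign (eval_coef \<rho> (lead_coeff F))" by (simp add: eq sign_mult)
  show "\<nu> (top_constant F) = \<nu> (lead_coeff F)" by (simp add: eq)
  show "lead_coeff (specialize \<rho> F) = eval_coef \<rho> (lead_coeff F)" using degree_specialize[OF assms(1,2)] by simp
  show "eval_coef \<rho> (lead_coeff F) \<noteq> 0" using assms by (auto simp: family_ok_def nondegenerate_def)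
qed

text \<open>A derivative of order at most the degree whose recorded sign is 0 vanishes on an
  infinite set, hence identically, and so would the leading coefficient of the specialized
  polynomial.\<close>

lemma cell_derivs:
  assumes fam: "family_ok Z sg Qs" and F: "F \<in> set Qs" and cell: "cell_ok Qs lo hi cell"
  shows "\<And>j x. j \<le> degree F \<Longrightarrow> x \<in> ival lo hi \<Longrightarrow>
      sign (poly ((pderiv ^^ j) (specialize \<rho> F)) x) = derivs_data Qs cell F ! j"
    and "\<And>j. j \<le> degree F \<Longrightarrow> specialize \<rho> F \<noteq> 0 \<Longrightarrow> derivs_data Qs cell F ! j \<noteq> 0"
proof -
  have cl: "closed_family Z Qs" using fam by (simp add: family_ok_def)
  show *: "sign (poly ((pderiv ^^ j) (specialize \<rho> F)) x) = derivs_data Qs cell F ! j"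
    if "j \<le> degree F" "x \<in> ival lo hi" for j x
    using derivs_data_nth[OF cl F cell_list_all2[OF cell that(2)] that(1)] by (simp add: specialize_pderiv_funpow)
  show "derivs_data Qs cell F ! j \<noteq> 0" if j: "j \<le> degree F" and nz: "specialize \<rho> F \<noteq> 0" for j
  proof
    assume "derivs_data Qs cell F ! j = 0"
    then have "poly ((pderiv ^^ j) (specialize \<rho> F)) x = 0" if "x \<in> ival lo hi" for x
      using *[OF j that] by simp
    then have "(pderiv ^^ j) (specialize \<rho> F) = 0" by (rule zero_on_ival[OF cell_bounds[OF cell]])
    then have "sign (lead_coeff (specialize \<rho> F)) = 0"
      using lead_coeff_pderiv_funpow_sign[of j "specialize \<rho> F"] j degree_specialize[OF fam F] by (simp add: sign_def)
    then have "lead_coeff (specialize \<rho> F) = 0" by (simp only: sign_eq_0_iff)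
    then show False using nz by (simp only: leading_coeff_0_iff)
  qed
qed

text \<open>The filter used in RCVF3 thus removes exactly the members that specialize to 0; the
  value of every other member is finite on the whole interval.\<close>

lemma cell_hd_zero:
  assumes "family_ok Z sg Qs" "F \<in> set Qs" "cell_ok Qs lo hi cell"
  shows "hd (derivs_data Qs cell F) \<noteq> 0 \<longleftrightarrow> specialize \<rho> F \<noteq> 0"
proof
  have hd: "hd (derivs_data Qs cell F) = derivs_data Qs cell F ! 0" by (rule hd_conv_nth) (metis length_derivs_data length_0_conv nat.distinct(1))
  show "specialize \<rho> F \<noteq> 0 \<Longrightarrow> hd (derivs_data Qs cell F) \<noteq> 0" using cell_derivs(2)[OF assms, of 0] hd by simp
  obtain x where "x \<in> ival lo hi" using ival_nonempty[OF cell_bounds[OF assms(3)]] by blast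
  then show "hd (derivs_data Qs cell F) \<noteq> 0 \<Longrightarrow> specialize \<rho> F \<noteq> 0"
    using cell_derivs(1)[OF assms, of 0 x] hd by (auto simp: sign_def)
qed

lemma signs_on_cell:
  assumes fam: "family_ok Z sg Qs" and F: "F \<in> set Qs" "specialize \<rho> F \<noteq> 0" and cell: "cell_ok Qs (Some a) (Some b) cell"
  shows "signs_on a b (specialize \<rho> F) (derivs_data Qs cell F)"
  using cell_derivs[OF fam F(1) cell] F(2) degree_specialize[OF fam F(1)]
  by (simp add: signs_on_def ival_def less_Suc_eq_le)

lemma point_derivs:
  assumes "family_ok Z sg Qs" "F \<in> set Qs" "point_ok Qs a p" "j \<le> degree F"
  shows "sval_ok (derivs_data Qs p F ! j) (poly ((pderiv ^^ j) (specialize \<rho> F)) a)"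
proof -
  have "closed_family Z Qs" using assms(1) by (simp add: family_ok_def)
  then show ?thesis
    using derivs_data_nth[OF _ assms(2) assms(3)[unfolded point_ok_def] assms(4)] by (simp add: specialize_pderiv_funpow)
qed

lemma hd_derivs_data:
  assumes "family_ok Z sg Qs" "F \<in> set Qs" "cell_ok Qs lo hi cell" "x \<in> ival lo hi"
  shows "hd (derivs_data Qs cell F) = sign (ev F x)"
  using cell_derivs(1)[OF assms(1-3), of 0 x] assms(4)
  by (metis funpow_0 hd_conv_nth le0 length_0_conv length_derivs_data nat.distinct(1))

lemma gap_value:
  assumes fam: "family_ok Z sg Qs" and F: "F \<in> set Qs" "specialize \<rho> F \<noteq> 0"
    and cell: "cell_ok Qs (Some a) (Some b) cell" and p: "point_ok Qs a pa" "point_ok Qs b pb"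
    and \<delta>: "veval \<nu> \<delta> = w (b - a)" and s: "0 < s" "s < 1"
  defines "\<sigma> \<equiv> derivs_data Qs cell F"
  shows "taylor_terms \<sigma> (derivs_data Qs pa F) (derivs_data Qs pb F) \<delta> \<noteq> [] \<and>
    w (ev F (from_end a b (left_based \<sigma>) s)) =
      pl (taylor_terms \<sigma> (derivs_data Qs pa F) (derivs_data Qs pb F) \<delta>) (w s)"
proof (rule taylor_value)
  show "a < b" using cell_bounds[OF cell] by (simp add: bounds_ok_def)
  show "signs_on a b (specialize \<rho> F) \<sigma>" unfolding \<sigma>_def by (rule signs_on_cell[OF fam F cell])
  show "sval_ok (if j < length (sides \<sigma>) \<and> \<not> sides \<sigma> ! j then derivs_data Qs pb F ! j else derivs_data Qs pa F ! j)
      (poly ((pderiv ^^ j) (specialize \<rho> F)) (base_end \<sigma> a b j))" if "j < length \<sigma>" for j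
    using point_derivs[OF fam F(1) p(1), of j] point_derivs[OF fam F(1) p(2), of j] that
    by (auto simp: base_end_def \<sigma>_def less_Suc_eq_le)
qed (use \<delta> s in auto)

end

section \<open>Position of a new root and values of the family there\<close>

lemma left_based_Cons: "left_based (s # t # \<sigma>) = (s = t)"
  by (simp add: left_based_def sides_Cons)

lemma signs_on_extend:
  assumes "signs_on a b (pderiv D) \<sigma>" "1 \<le> degree D" "s \<noteq> 0"
    "\<And>x. a < x \<Longrightarrow> x < b \<Longrightarrow> sign (poly D x) = s"
  shows "signs_on a b D (s # \<sigma>)"
  unfolding signs_on_def
proof (intro conjI allI impI)
  show "length (s # \<sigma>) = Suc (degree D)" using assms(1,2) by (simp add: signs_on_def degree_pderiv)
  fix j assume j: "j < length (s # \<sigma>)"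
  show "(s # \<sigma>) ! j \<noteq> 0" using j assms(1,3) by (cases j) (auto simp: signs_on_def)
  fix x assume x: "a < x" "x < b"
  show "sign (poly ((pderiv ^^ j) D) x) = (s # \<sigma>) ! j"
  proof (cases j)
    case 0
    then show ?thesis using assms(4)[OF x] by simp
  next
    case (Suc i)
    then have "i < length \<sigma>" using j by simp
    then have "sign (poly ((pderiv ^^ i) (pderiv D)) x) = \<sigma> ! i" using assms(1) x unfolding signs_on_def by blast
    then show ?thesis unfolding Suc pderiv_funpow_Suc by simp
  qed
qed

lemma set_taylor_terms:
  "set (taylor_terms \<sigma> A B \<delta>) = {t. \<exists>j<length \<sigma>. map_option (\<lambda>e. (VAdd e (VScale (of_nat j) \<delta>), min j (run_length \<sigma>)))
     (snd (if j < length (sides \<sigma>) \<and> \<not> sides \<sigma> ! j then B ! j else A ! j)) = Some t}"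
  unfolding set_concat_option[symmetric] taylor_terms_def by (simp only: case_map_option comp_def)

lemma ival_cover: "x \<in> ival lo hi \<Longrightarrow> x \<in> set xs \<or> (\<exists>k\<le>length xs. x \<in> ival (lower lo xs k) (upper xs hi k))"
proof (induction xs arbitrary: lo)
  case (Cons y xs)
  consider "x < y" | "x = y" | "y < x" by (rule linorder_cases)
  then show ?case
  proof cases
    case 1
    then have "x \<in> ival (lower lo (y # xs) 0) (upper (y # xs) hi 0)" using Cons.prems by (simp add: ival_def)
    then show ?thesis by blast
  next
    case 3
    then have "x \<in> ival (Some y) hi" using Cons.prems by (simp add: ival_def)
    then consider "x \<in> set xs" | k where "k \<le> length xs" "x \<in> ival (lower (Some y) xs k) (upper xs hi k)"
      using Cons.IH by blast
    then show ?thesis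
    proof cases
      case (2 k)
      then have "x \<in> ival (lower lo (y # xs) (Suc k)) (upper (y # xs) hi (Suc k))" "Suc k \<le> length (y # xs)" by simp_all
      then show ?thesis by blast
    qed simp
  qed simp
qed simp

lemma foldl_add_poly_fst:
  "fst (foldl (\<lambda>(Qs, tab) P. (Qs @ [P], add_poly Z sg Qs tab P)) (Qs0, tab0) Ps) = Qs0 @ Ps"
  by (induction Ps arbitrary: Qs0 tab0) auto

lemma rcvf2_snoc: "rcvf2 Z sg (Ps @ [P]) = add_poly Z sg Ps (rcvf2 Z sg Ps) P"
  using foldl_add_poly_fst[of Z sg "[]" "VTab [[]] [] []" Ps]
  by (simp add: rcvf2_def case_prod_unfold)

context rcvf_point
begin

text \<open>The direction \<open>d\<close> allows one treatment of both unbounded intervals, a point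
  being \<open>a + d t\<close> with \<open>t > 0\<close>.\<close>

definition half_line :: "'r \<Rightarrow> 'r \<Rightarrow> 'r option \<Rightarrow> 'r option \<Rightarrow> bool" where
  "half_line d a lo hi \<longleftrightarrow> (d = 1 \<and> lo = Some a \<and> hi = None) \<or> (d = -1 \<and> lo = None \<and> hi = Some a)"

text \<open>The sign \<open>s\<close> does not depend on \<open>j\<close>, and the absence of roots
  is asked separately for each derivative. So the result also applies to \<open>P - P(a)\<close>,
  whose own sign on the half-line is not yet known.\<close>

lemma no_roots_half_line:
  assumes h: "half_line d a lo hi" and P: "P \<noteq> 0"
  shows "\<exists>s. (s = 1 \<or> s = -1) \<and> (\<forall>j\<le>degree P. (\<forall>x\<in>ival lo hi. poly ((pderiv ^^ j) P) x \<noteq> 0) \<longrightarrow>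
    0 \<le> of_int s * d ^ j * poly ((pderiv ^^ j) P) a)"
proof (cases "d = 1")
  case True
  then have I: "ival lo hi = {x. a < x}" using h by (auto simp: half_line_def ival_def)
  show ?thesis
    using no_roots_at_right[OF rc, of _ P a] P sign_ne_0_cases[of "lead_coeff P"] True unfolding I
    by (intro exI[of _ "sign (lead_coeff P)"]) auto
next
  case False
  then have d: "d = -1" and I: "ival lo hi = {x. x < a}" using h by (auto simp: half_line_def ival_def)
  have "sign (lead_coeff P) * (- 1) ^ degree P = 1 \<or> sign (lead_coeff P) * (- 1) ^ degree P = -1"
    using P sign_ne_0_cases[of "lead_coeff P"] by (cases "even (degree P)") auto
  then show ?thesis
    using no_roots_at_left[OF rc, of _ P a] unfolding I d
    by (intro exI[of _ "sign (lead_coeff P) * (- 1) ^ degree P"]) auto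
qed

lemma unbounded_member_value:
  assumes fam: "family_ok Z sg Qs" and F: "F \<in> set Qs" "specialize \<rho> F \<noteq> 0"
    and h: "half_line d a lo hi" and cell: "cell_ok Qs lo hi cell" and p: "point_ok Qs a p" and t: "0 < t"
  shows "unbounded_terms (derivs_data Qs p F) \<noteq> [] \<and>
    w (ev F (a + d * t)) = pl (unbounded_terms (derivs_data Qs p F)) (w t)"
proof -
  obtain s where s: "s = 1 \<or> s = -1" "\<And>j. j \<le> degree (specialize \<rho> F) \<Longrightarrow>
      (\<forall>x\<in>ival lo hi. poly ((pderiv ^^ j) (specialize \<rho> F)) x \<noteq> 0) \<Longrightarrow>
      0 \<le> of_int s * d ^ j * poly ((pderiv ^^ j) (specialize \<rho> F)) a"
    using no_roots_half_line[OF h F(2)] by blast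
  have nz: "poly ((pderiv ^^ j) (specialize \<rho> F)) x \<noteq> 0" if "j \<le> degree F" "x \<in> ival lo hi" for j x
    using cell_derivs[OF fam F(1) cell] that F(2) by (metis sign_eq_0_iff)
  show ?thesis
  proof (rule unbounded_value[OF F(2) _ _ _ s(1) _ t])
    show "length (derivs_data Qs p F) = Suc (degree (specialize \<rho> F))"
      using degree_specialize[OF fam F(1)] by simp
    show "sval_ok (derivs_data Qs p F ! j) (poly ((pderiv ^^ j) (specialize \<rho> F)) a)"
      if "j \<le> degree (specialize \<rho> F)" for j
      using point_derivs[OF fam F(1) p] that degree_specialize[OF fam F(1)] by simp
    show "0 \<le> of_int s * d ^ j * poly ((pderiv ^^ j) (specialize \<rho> F)) a"
      if "j \<le> degree (specialize \<rho> F)" for j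
      using s(2)[OF that] nz that degree_specialize[OF fam F(1)] by simp
    show "d = 1 \<or> d = -1" using h by (auto simp: half_line_def)
  qed
qed

text \<open>Subtracting a constant changes no derivative, so the data of \<open>D\<close> beyond
  order 0 are those of \<open>P'\<close>, already in the tableau.\<close>

lemma difference_derivs:
  fixes c :: 'r
  assumes fam: "family_ok Z sg (Qs @ [P])" and P: "1 \<le> degree P"
  defines "D \<equiv> specialize \<rho> P - [:c:]"
  shows "degree D = degree P" "pderiv D = specialize \<rho> (pderiv P)" "pderiv P \<in> set Qs"
    "specialize \<rho> (pderiv P) \<noteq> 0" "degree (pderiv P) = degree P - 1"
proof -
  have deg: "degree (specialize \<rho> P) = degree P" using degree_specialize[OF fam, of P] by simp
  show "degree D = degree P"
  proof -
    have "D = specialize \<rho> P + [:- c:]"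
      unfolding D_def by (rule poly_eqI) (simp add: coeff_pCons split: nat.split)
    then have "degree D = degree (specialize \<rho> P + [:- c:])" by simp
    also have "\<dots> = degree (specialize \<rho> P)" using P deg by (intro degree_add_eq_left) simp
    finally show ?thesis by (simp add: deg)
  qed
  show "pderiv D = specialize \<rho> (pderiv P)" by (simp add: D_def pderiv_diff specialize_pderiv)
  show "pderiv P \<in> set Qs" using fam closed_family_snoc(1)[OF _ P] by (auto simp: family_ok_def)
  show "degree (pderiv P) = degree P - 1" by (rule degree_pderiv)
  have "pderiv (specialize \<rho> P) \<noteq> 0" using P deg by (simp add: pderiv_eq_0_iff)
  then show "specialize \<rho> (pderiv P) \<noteq> 0" by (simp add: specialize_pderiv)
qed

text \<open>At the root, \<open>D = P - P(a)\<close> takes the value \<open>- P(a)\<close>, of known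
  valuation; the Taylor formula for \<open>D\<close> at \<open>a\<close> is an equation for the
  valuation of the distance \<open>t\<close>. With \<open>t\<close> known, the same formula gives
  the values of all members at the root.\<close>

lemma root_unbounded_ok:
  assumes fam: "family_ok Z sg (Qs @ [P])" and P: "1 \<le> degree P"
    and h: "half_line d a lo hi" and cell: "cell_ok Qs lo hi cell" and p: "point_ok Qs a p"
    and Pa: "sval_ok Pa (ev P a)" "ev P a \<noteq> 0" and t: "0 < t" and y: "ev P (a + d * t) = 0"
    and R: "root_unbounded Qs P p Pa cell = (\<tau>, es)"
  shows "veval \<nu> \<tau> = w t \<and> point_ok Qs (a + d * t) es"
proof -
  note famQ = family_ok_prefix[OF fam]
  define D where "D = specialize \<rho> P - [:ev P a:]"
  note D = difference_derivs(1,2)[OF fam P, of "ev P a", folded D_def] difference_derivs(3-5)[OF fam P]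
  let ?A = "(0, None) # derivs_data Qs p (pderiv P)"
  have \<tau>: "\<tau> = solve_terms (the (snd Pa)) (unbounded_terms ?A)"
    using R by (simp add: root_unbounded_def Let_def)
  have es: "es = map2 (\<lambda>F s. sval s (min_terms \<tau> (unbounded_terms (derivs_data Qs p F)))) Qs cell"
    using R unfolding \<tau> by (simp add: root_unbounded_def Let_def)
  have D0: "D \<noteq> 0" using D(1) P by auto
  have Da: "poly D a = 0" by (simp add: D_def)
  obtain s where s: "s = 1 \<or> s = -1" "\<And>j. j \<le> degree D \<Longrightarrow>
      (\<forall>x\<in>ival lo hi. poly ((pderiv ^^ j) D) x \<noteq> 0) \<Longrightarrow> 0 \<le> of_int s * d ^ j * poly ((pderiv ^^ j) D) a"
    using no_roots_half_line[OF h D0] by blast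
  have val: "unbounded_terms ?A \<noteq> [] \<and> w (poly D (a + d * t)) = pl (unbounded_terms ?A) (w t)"
  proof (rule unbounded_value[OF D0 _ _ _ s(1) _ t])
    show "length ?A = Suc (degree D)" using D(1,5) P by simp
    show "d = 1 \<or> d = -1" using h by (auto simp: half_line_def)
    fix j assume j: "j \<le> degree D"
    show "sval_ok (?A ! j) (poly ((pderiv ^^ j) D) a)"
    proof (cases j)
      case (Suc i)
      then have "i \<le> degree (pderiv P)" using j D(1,5) by simp
      then show ?thesis using point_derivs[OF famQ D(3) p] unfolding Suc pderiv_funpow_Suc D(2) by simp
    qed (simp add: Da)
    show "0 \<le> of_int s * d ^ j * poly ((pderiv ^^ j) D) a"
    proof (cases j)
      case (Suc i)
      then have i: "i \<le> degree (pderiv P)" using j D(1,5) by simp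
      have "poly ((pderiv ^^ j) D) x \<noteq> 0" if "x \<in> ival lo hi" for x
        using cell_derivs[OF famQ D(3) cell] that i D(4) unfolding Suc pderiv_funpow_Suc D(2)
        by (metis sign_eq_0_iff)
      then show ?thesis using s(2)[OF j] by blast
    qed (simp add: Da)
  qed
  \<comment> \<open>The term of index 0 is absent, because \<open>D\<close> vanishes at
    \<open>a\<close> and is recorded there without a value.\<close>
  have k: "1 \<le> k" if "(e, k) \<in> set (unbounded_terms ?A)" for e k
    using that by (cases k) (auto simp: unbounded_terms_def split: option.splits)
  have "poly D (a + d * t) = - ev P a" using y by (simp add: D_def)
  then have "pl (unbounded_terms ?A) (w t) = veval \<nu> (the (snd Pa))"
    using val sval_ok_the[OF Pa] by simp
  then have \<tau>w: "veval \<nu> \<tau> = w t" unfolding \<tau> using val k by (intro veval_solve_terms) auto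
  have yi: "a + d * t \<in> ival lo hi" using h t by (auto simp: half_line_def ival_def)
  have "point_ok Qs (a + d * t) es"
    unfolding point_ok_def list_all2_conv_all_nth
  proof (intro conjI allI impI)
    have len: "length cell = length Qs" using cell yi by (auto simp: cell_ok_def)
    then show "length Qs = length es" by (simp add: es)
    fix i assume i: "i < length Qs"
    let ?F = "Qs ! i"
    have F: "?F \<in> set Qs" using i by simp
    have ci: "cell ! i = sign (ev ?F (a + d * t))" using cell yi i by (auto simp: cell_ok_def)
    show "sval_ok (es ! i) (ev ?F (a + d * t))"
    proof -
      have "es ! i = sval (cell ! i) (min_terms \<tau> (unbounded_terms (derivs_data Qs p ?F)))"
        using i len by (simp add: es)
      moreover have "veval \<nu> (min_terms \<tau> (unbounded_terms (derivs_data Qs p ?F))) = w (ev ?F (a + d * t))"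
        if "ev ?F (a + d * t) \<noteq> 0"
      proof -
        have "specialize \<rho> ?F \<noteq> 0" using that by auto
        from unbounded_member_value[OF famQ F this h cell p t] show ?thesis
          by (simp add: veval_min_terms \<tau>w)
      qed
      ultimately show ?thesis using ci by (simp add: sval_okI)
    qed
  qed
  then show ?thesis using \<tau>w by blast
qed

text \<open>\<open>L\<close> selects the end \<open>c\<close>. On the interval
  \<open>P - P(a)\<close> has the sign of \<open>P'\<close> and \<open>P - P(b)\<close> the opposite
  one; with this sign in front, the formula is based at \<open>c\<close>, where the difference
  vanishes.\<close>

lemma root_position:
  assumes fam: "family_ok Z sg (Qs @ [P])" and P: "1 \<le> degree P"
    and cell: "cell_ok Qs (Some a) (Some b) cell" and p: "point_ok Qs a pa" "point_ok Qs b pb"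
    and \<delta>: "veval \<nu> \<delta> = w (b - a)" and y: "a < y" "y < b" "ev P y = 0"
    and c: "c = (if L then a else b)" and Pc: "sval_ok Pc (ev P c)" "ev P c \<noteq> 0"
  defines "\<sigma> \<equiv> derivs_data Qs cell (pderiv P)"
  shows "veval \<nu> (solve_terms (the (snd Pc)) (taylor_terms ((if L then hd \<sigma> else - hd \<sigma>) # \<sigma>)
      ((0, None) # derivs_data Qs pa (pderiv P)) ((0, None) # derivs_data Qs pb (pderiv P)) \<delta>))
    = w ((if L then y - a else b - y) / (b - a))"
proof -
  note famQ = family_ok_prefix[OF fam]
  define D where "D = specialize \<rho> P - [:ev P c:]"
  note D = difference_derivs(1,2)[OF fam P, of "ev P c", folded D_def] difference_derivs(3-5)[OF fam P]
  have ab: "a < b" using y by simp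
  let ?A = "(0, None) # derivs_data Qs pa (pderiv P)" and ?B = "(0, None) # derivs_data Qs pb (pderiv P)"
  let ?s = "if L then hd \<sigma> else - hd \<sigma>"
  let ?ts = "taylor_terms (?s # \<sigma>) ?A ?B \<delta>"
  let ?u = "(if L then y - a else b - y) / (b - a)"
  have S': "signs_on a b (pderiv D) \<sigma>"
    unfolding D(2) \<sigma>_def by (rule signs_on_cell[OF famQ D(3,4) cell])
  obtain s0 \<sigma>0 where \<sigma>0: "\<sigma> = s0 # \<sigma>0" by (cases \<sigma>) (use S' in \<open>auto simp: signs_on_def\<close>)
  have s0: "s0 \<noteq> 0" "\<And>x. a < x \<Longrightarrow> x < b \<Longrightarrow> sign (poly (pderiv D) x) = s0"
    using S' unfolding signs_on_def \<sigma>0 by (metis funpow_0 length_Cons nth_Cons_0 zero_less_Suc)+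
  have Dc: "poly D c = 0" by (simp add: D_def)
  have S: "signs_on a b D (?s # \<sigma>)"
  proof (rule signs_on_extend[OF S'])
    show "1 \<le> degree D" using D(1) P by simp
    show "?s \<noteq> 0" using s0 \<sigma>0 by simp
    fix x assume x: "a < x" "x < b"
    show "sign (poly D x) = ?s"
    proof (cases L)
      case True
      obtain z where z: "a < z" "z < x" "poly D x - poly D a = (x - a) * poly (pderiv D) z"
        using rcf_mvt[OF rc x(1)] by blast
      have "sign (x - a) = 1" using x by (simp add: sign_def)
      then show ?thesis using z x s0(2)[of z] Dc True by (simp add: c \<sigma>0 sign_mult)
    next
      case False
      obtain z where z: "x < z" "z < b" "poly D b - poly D x = (b - x) * poly (pderiv D) z"
        using rcf_mvt[OF rc x(2)] by blast
      have "sign (b - x) = 1" using x by (simp add: sign_def)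
      moreover have "poly D x = - ((b - x) * poly (pderiv D) z)" using z(3) Dc False by (simp add: c)
      ultimately show ?thesis using z x s0(2)[of z] False by (simp only: sign_minus_field sign_mult) (simp add: \<sigma>0)
    qed
  qed
  have side0: "sides (?s # \<sigma>) ! 0 = L" "sides (?s # \<sigma>) \<noteq> []" using s0(1) by (auto simp: \<sigma>0 sides_Cons)
  have u: "0 < ?u" "?u < 1" using y by auto
  have at0: "(if j < length (sides (?s # \<sigma>)) \<and> \<not> sides (?s # \<sigma>) ! j then ?B ! j else ?A ! j) = (0, None)" if "j = 0" for j
    using that by simp
  have val: "?ts \<noteq> [] \<and> w (poly D (from_end a b (left_based (?s # \<sigma>)) ?u)) = pl ?ts (w ?u)"
  proof (rule taylor_value[OF ab S _ \<delta> u])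
    fix j assume j: "j < length (?s # \<sigma>)"
    show "sval_ok (if j < length (sides (?s # \<sigma>)) \<and> \<not> sides (?s # \<sigma>) ! j then ?B ! j else ?A ! j)
        (poly ((pderiv ^^ j) D) (base_end (?s # \<sigma>) a b j))"
    proof (cases j)
      case 0
      have "base_end (?s # \<sigma>) a b 0 = c" using side0 by (simp add: base_end_def c \<sigma>0)
      then show ?thesis using 0 Dc by simp
    next
      case (Suc i)
      then have i: "i \<le> degree (pderiv P)" using j by (simp add: \<sigma>_def)
      show ?thesis
        using point_derivs[OF famQ D(3) p(1) i] point_derivs[OF famQ D(3) p(2) i]
        unfolding Suc pderiv_funpow_Suc D(2) by (simp add: base_end_def del: funpow.simps)
    qed
  qed
  \<comment> \<open>For \<open>j >= 1\<close> the slope \<open>min j run_length\<close> is at least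
    1, and index 0 carries no term since \<open>D\<close> vanishes at \<open>c\<close>; so the
    equation determines the position.\<close>
  have "1 \<le> run_length (?s # \<sigma>)" unfolding \<sigma>0 run_length_Cons by simp
  then have k: "1 \<le> k" if ek: "(e, k) \<in> set ?ts" for e k
  proof -
    let ?at = "\<lambda>j. if j < length (sides (?s # \<sigma>)) \<and> \<not> sides (?s # \<sigma>) ! j then ?B ! j else ?A ! j"
    obtain j where j: "map_option (\<lambda>e. (VAdd e (VScale (of_nat j) \<delta>), min j (run_length (?s # \<sigma>)))) (snd (?at j)) = Some (e, k)"
      using ek unfolding set_taylor_terms by blast
    have "j \<noteq> 0"
    proof
      assume "j = 0"
      then have "snd (?at j) = None" using at0 by (simp only: snd_conv)
      then show False using j by (simp only: option.map option.distinct)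
    qed
    moreover have "k = min j (run_length (?s # \<sigma>))"
      using j by (cases "snd (?at j)") (simp_all only: option.map option.distinct option.inject prod.inject)
    ultimately show ?thesis using \<open>1 \<le> run_length (?s # \<sigma>)\<close> by simp
  qed
  have lb: "left_based (?s # \<sigma>) = L" using s0(1) unfolding \<sigma>0 left_based_Cons by simp
  have "?u * (b - a) = (if L then y - a else b - y)" using ab by simp
  then have "from_end a b L ?u = y" by (cases L) (simp_all add: from_end_def)
  then have "poly D (from_end a b (left_based (?s # \<sigma>)) ?u) = - ev P c" unfolding lb using y(3) by (simp add: D_def)
  then have "pl ?ts (w ?u) = veval \<nu> (the (snd Pc))" using val sval_ok_the[OF Pc] by simp
  then show ?thesis using val k by (intro veval_solve_terms) auto
qed

lemma root_in_gap_ok: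
  assumes fam: "family_ok Z sg (Qs @ [P])" and P: "1 \<le> degree P"
    and cell: "cell_ok Qs (Some a) (Some b) cell" and p: "point_ok Qs a pa" "point_ok Qs b pb"
    and Pa: "sval_ok Pa (ev P a)" "ev P a \<noteq> 0" and Pb: "sval_ok Pb (ev P b)" "ev P b \<noteq> 0"
    and \<delta>: "veval \<nu> \<delta> = w (b - a)" and y: "a < y" "y < b" "ev P y = 0"
    and R: "root_in_gap Qs P pa pb Pa Pb cell \<delta> = (\<tau>a, \<tau>b, es)"
  shows "gap_ok a y (VAdd \<delta> \<tau>a) \<and> gap_ok y b (VAdd \<delta> \<tau>b) \<and> point_ok Qs y es"
proof -
  note famQ = family_ok_prefix[OF fam]
  have ab: "a < b" using y by simp
  define s where "s L = (if L then y - a else b - y) / (b - a)" for L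
  have s: "0 < s L" "s L < 1" for L using y by (auto simp: s_def)
  have \<tau>: "veval \<nu> \<tau>a = w (s True)" "veval \<nu> \<tau>b = w (s False)"
    using root_position[OF fam P cell p \<delta> y, of a True Pa] root_position[OF fam P cell p \<delta> y, of b False Pb] Pa Pb R
    by (auto simp: root_in_gap_def Let_def s_def)
  have es: "es = map (\<lambda>F. let \<sigma> = derivs_data Qs cell F in
                 sval (hd \<sigma>) (min_terms (if left_based \<sigma> then \<tau>a else \<tau>b)
                   (taylor_terms \<sigma> (derivs_data Qs pa F) (derivs_data Qs pb F) \<delta>))) Qs"
    using R by (auto simp: root_in_gap_def Let_def)
  have "gap_ok a y (VAdd \<delta> \<tau>a)"
    using w_divide[of "y - a" "b - a"] y by (simp add: gap_ok_def \<tau> \<delta> s_def)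
  moreover have "gap_ok y b (VAdd \<delta> \<tau>b)"
    using w_divide[of "b - y" "b - a"] y by (simp add: gap_ok_def \<tau> \<delta> s_def)
  moreover have "point_ok Qs y es"
    unfolding point_ok_def list_all2_conv_all_nth
  proof (intro conjI allI impI)
    show "length Qs = length es" by (simp add: es)
    fix i assume i: "i < length Qs"
    let ?F = "Qs ! i"
    have F: "?F \<in> set Qs" using i by simp
    let ?\<sigma> = "derivs_data Qs cell ?F"
    have yi: "y \<in> ival (Some a) (Some b)" using y by (simp add: ival_def)
    have "veval \<nu> (min_terms (if left_based ?\<sigma> then \<tau>a else \<tau>b)
        (taylor_terms ?\<sigma> (derivs_data Qs pa ?F) (derivs_data Qs pb ?F) \<delta>)) = w (ev ?F y)" if "ev ?F y \<noteq> 0"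
    proof -
      have nz: "specialize \<rho> ?F \<noteq> 0" using that by auto
      have "s (left_based ?\<sigma>) * (b - a) = (if left_based ?\<sigma> then y - a else b - y)" using ab by (simp add: s_def)
      then have fe: "from_end a b (left_based ?\<sigma>) (s (left_based ?\<sigma>)) = y"
        by (cases "left_based ?\<sigma>") (simp_all add: from_end_def)
      have tv: "veval \<nu> (if left_based ?\<sigma> then \<tau>a else \<tau>b) = w (s (left_based ?\<sigma>))" by (simp add: \<tau>)
      note g = gap_value[OF famQ F nz cell p \<delta> s[of "left_based ?\<sigma>"], unfolded fe]
      show ?thesis unfolding veval_min_terms[OF conjunct1[OF g]] tv by (rule conjunct2[OF g, symmetric])
    qed
    then show "sval_ok (es ! i) (ev ?F y)"
      using hd_derivs_data[OF famQ F cell yi] i by (simp add: es Let_def sval_okI)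
  qed
  ultimately show ?thesis by blast
qed

text \<open>At a root of \<open>Q\<close> the pseudodivision identity becomes
  \<open>lc(Q)^e P(x) = R(x)\<close>, where \<open>R\<close> is a member and \<open>lc(Q)\<close>
  does not vanish; up to a factorial, \<open>lc(Q)\<close> is a constant of the family.\<close>

lemma sval_at_root_ok:
  assumes fam: "family_ok Z sg (Qs @ [P])" and P: "1 \<le> degree P"
    and x: "x \<in> roots Qs" and p: "point_ok Qs x p"
  shows "sval_ok (sval_at_root Z sg Qs P p) (ev P x)"
proof -
  note famQ = family_ok_prefix[OF fam]
  have cl: "closed_family Z (Qs @ [P])" using fam by (simp add: family_ok_def)
  have lenp: "length p = length Qs" using p by (simp add: point_ok_def list_all2_lengthD)
  let ?test = "\<lambda>(Q :: 'r coef poly, s :: int, _). 1 \<le> degree Q \<and> s = 0"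
  obtain F where F: "F \<in> set Qs" "specialize \<rho> F \<noteq> 0" "ev F x = 0" using x by (auto simp: roots_def)
  \<comment> \<open>A nonzero constant has no root, so some member of positive degree vanishes at
    \<open>x\<close> and the search for \<open>Q\<close> succeeds. The \<open>Q\<close> it finds may
    differ from \<open>F\<close>.\<close>
  have "1 \<le> degree F"
  proof (rule ccontr)
    assume "\<not> 1 \<le> degree F"
    then have "degree (specialize \<rho> F) = 0" using degree_specialize_le[of F] by simp
    then show False using F(2,3) by (auto elim!: degree_eq_zeroE)
  qed
  moreover obtain i where i: "i < length Qs" "Qs ! i = F" using F(1) by (metis in_set_conv_nth)
  moreover have "fst (p ! i) = 0"
    using p i F(3) by (auto simp: point_ok_def list_all2_conv_all_nth sval_ok_def sign_def)
  moreover have "(Qs ! i, p ! i) \<in> set (zip Qs p)" using i lenp by (auto simp: set_zip)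
  ultimately have "\<exists>u\<in>set (zip Qs p). ?test u"
    by (intro bexI[of _ "(Qs ! i, p ! i)"]) (auto simp: case_prod_unfold)
  then have "find ?test (zip Qs p) \<noteq> None" unfolding find_None_iff by blast
  then obtain Q s1 e1 where Qf: "find ?test (zip Qs p) = Some (Q, s1, e1)" by auto
  then have Q: "(Q, s1, e1) \<in> set (zip Qs p)" "1 \<le> degree Q" "s1 = 0"
    by (auto simp: find_Some_iff set_conv_nth)
  obtain i where i: "i < length Qs" "Q = Qs ! i" "(s1, e1) = p ! i" using Q(1) lenp by (auto simp: set_zip)
  have QQ: "Q \<in> set Qs" using i by simp
  have "sval_ok (p ! i) (ev Q x)" using p i by (auto simp: point_ok_def list_all2_conv_all_nth)
  then have Qx: "ev Q x = 0" using i(3) Q(3) by (metis fst_conv sign_eq_0_iff sval_ok_def)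
  define R0 where "R0 = pseudo_mod P Q"
  define e where "e = Suc (degree P) - degree Q"
  have Q0: "Q \<noteq> 0" using Q(2) by auto
  obtain q where q: "smult (lead_coeff Q ^ e) P = Q * q + R0"
    using pseudo_divmod(1)[OF Q0, of P "fst (pseudo_divmod P Q)" R0] by (auto simp: e_def R0_def pseudo_mod_def)
  have "ev (smult (lead_coeff Q ^ e) P) x = ev (Q * q + R0) x" by (simp only: q)
  then have eq: "eval_coef \<rho> (lead_coeff Q) ^ e * ev P x = ev R0 x"
    by (simp add: specialize_smult specialize_add specialize_mult eval_coef_power Qx)
  let ?R = "reduce Z R0"
  have R: "?R \<in> set Qs" unfolding R0_def by (rule closed_family_snoc(3)[OF cl QQ Q(2)])
  have "ev ?R x = ev R0 x" using fam specialize_reduce[of Z \<rho> R0] by (simp add: family_ok_def)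
  then have eqR: "eval_coef \<rho> (lead_coeff Q) ^ e * ev P x = ev ?R x" using eq by simp
  obtain s2 e2 where se: "map_of (zip Qs p) ?R = Some (s2, e2)" "sval_ok (s2, e2) (ev ?R x)"
    using map_of_zip_list_all2[OF p[unfolded point_ok_def] R] by auto
  note top = top_constant_facts[OF famQ QQ Q(2)]
  let ?l = "eval_coef \<rho> (lead_coeff Q)"
  have def: "sval_at_root Z sg Qs P p =
      sval (s2 * sg (top_constant Q) ^ e) (VAdd (the e2) (VScale (- of_nat e) (Val (top_constant Q))))"
    unfolding sval_at_root_def Qf by (simp add: se(1)[unfolded R0_def] e_def Let_def)
  show ?thesis unfolding def
  proof (rule sval_okI)
    \<comment> \<open>The algorithm multiplies by the power of this sign instead of dividing, which
      is the same since a nonzero sign is its own inverse.\<close>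
    have "sign ?l = 1 \<or> sign ?l = -1" using top(4) by (simp add: sign_def)
    then have "sign ?l ^ e * sign ?l ^ e = 1" by (auto simp flip: power_mult_distrib)
    moreover have "s2 = sign ?l ^ e * sign (ev P x)"
      using se(2) unfolding eqR[symmetric] by (simp add: sval_ok_def sign_mult sign_power)
    ultimately show "s2 * sg (top_constant Q) ^ e = sign (ev P x)" by (simp add: top(1))
    assume nz: "ev P x \<noteq> 0"
    then have Rnz: "ev ?R x \<noteq> 0" using eqR top(4) by auto
    then have "veval \<nu> (the e2) = w (ev ?R x)" using sval_ok_the[OF se(2)] by simp
    also have "\<dots> = zmult (int e) (w ?l) + w (ev P x)"
      using top(4) nz by (simp add: w_mult w_power flip: eqR)
    finally show "veval \<nu> (VAdd (the e2) (VScale (- of_nat e) (Val (top_constant Q)))) = w (ev P x)"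
      by (simp add: top(2) zmult_of_nat)
  qed
qed

section \<open>Refinement of the tableau by one polynomial\<close>

lemma chain_one_root:
  assumes "C lo (Some y) c1" "C (Some y) hi c2" "P y p" "gap_list G lo (Some y) g1" "gap_list G (Some y) hi g2"
  shows "chain C P G [y] lo hi [c1, c2] [p] (g1 @ g2)"
  using assms by auto

text \<open>A member of positive degree has an iterated derivative of degree 1 in the family, which
  has a root.\<close>

lemma roots_empty_degree_0:
  assumes fam: "family_ok Z sg Qs" and e: "roots Qs = {}" and F: "F \<in> set Qs"
  shows "degree F = 0"
proof (rule ccontr)
  assume d: "degree F \<noteq> 0"
  let ?G = "(pderiv ^^ (degree F - 1)) F"
  have G: "?G \<in> set Qs" using fam F by (intro pderiv_funpow_in_family) (auto simp: family_ok_def)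
  have "degree ?G = 1" using d by (simp add: degree_pderiv_funpow)
  then have dG: "degree (specialize \<rho> ?G) = 1" using degree_specialize[OF fam G] by simp
  let ?a = "coeff (specialize \<rho> ?G) 0" and ?b = "coeff (specialize \<rho> ?G) 1"
  have b: "?b \<noteq> 0" using dG by (metis leading_coeff_0_iff degree_0 zero_neq_one)
  have "poly (specialize \<rho> ?G) (- ?a / ?b) = (\<Sum>i\<le>1. coeff (specialize \<rho> ?G) i * (- ?a / ?b) ^ i)"
    by (simp only: poly_altdef dG)
  then have "poly (specialize \<rho> ?G) (- ?a / ?b) = 0" using b by (simp del: coeff_specialize)
  moreover have "specialize \<rho> ?G \<noteq> 0" using dG by auto
  ultimately show False using e G by (auto simp: roots_def)
qed

text \<open>The computed \<open>sl\<close> and \<open>sr\<close> are the end signs of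
  \<open>P\<close>, taken from the leading coefficient at an infinite end. As \<open>P'\<close> has
  constant nonzero sign on the interval, they decide whether \<open>P\<close> has one root there or
  none.\<close>

lemma refine_interval_ok:
  assumes tab: "tab_ok Qs tab xs" and fam: "family_ok Z sg (Qs @ [P])" and P: "1 \<le> degree P"
    and Pat: "\<And>k. k < length xs \<Longrightarrow> sval_ok (P_at ! k) (ev P (xs ! k))" and k: "k \<le> length xs"
  defines "lo \<equiv> lower None xs k" and "hi \<equiv> upper xs None k" and "R \<equiv> refine_interval sg Qs tab P P_at k"
  shows "\<exists>ns. chain (cell_ok (Qs @ [P])) (point_ok (Qs @ [P])) gap_ok ns lo hi (fst R) (fst (snd R)) (snd (snd R)) \<and>
    set ns = {y \<in> ival lo hi. ev P y = 0}"
proof -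
  note famQ = family_ok_prefix[OF fam]
  have ch: "chain (cell_ok Qs) (point_ok Qs) gap_ok xs None None (cells tab) (points tab) (gaps tab)"
    and xs: "set xs = roots Qs" using tab by (auto simp: tab_ok_def)
  have r: "length (points tab) = length xs" using chain_lengths[OF ch] by simp
  define cell where "cell = cells tab ! k"
  have cell: "cell_ok Qs lo hi cell" unfolding cell_def lo_def hi_def by (rule chain_cell[OF ch k])
  note bd = cell_bounds[OF cell]
  note D = difference_derivs(1,2)[OF fam P, of 0] difference_derivs(3-5)[OF fam P]
  have PQ: "P \<in> set (Qs @ [P])" by simp
  note top = top_constant_facts[OF fam PQ P]
  define sl where "sl = (if k = 0 then sg (top_constant P) * (- 1) ^ degree P else fst (P_at ! (k - 1)))"
  define sr where "sr = (if k = length xs then sg (top_constant P) else fst (P_at ! k))"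
  have degP: "degree (specialize \<rho> P) = degree P" using degree_specialize[OF fam PQ] .
  have lsgn: "sign (lead_coeff (specialize \<rho> P)) = sg (top_constant P)" by (simp only: top(1,3))
  have left: "left_sign (specialize \<rho> P) lo sl"
  proof (cases "k = 0")
    case True
    then show ?thesis using sign_at_bot[of "specialize \<rho> P"] unfolding lsgn degP
      by (simp add: left_sign_def lo_def sl_def top(1))
  next
    case False
    then show ?thesis using Pat[of "k - 1"] k by (simp add: left_sign_def lo_def lower_def sl_def sval_ok_def)
  qed
  have right: "right_sign (specialize \<rho> P) hi sr"
  proof (cases "k = length xs")
    case True
    then show ?thesis using sign_at_top[of "specialize \<rho> P"] unfolding lsgn
      by (simp add: right_sign_def hi_def upper_def sr_def top(1))
  next
    case False
    then show ?thesis using Pat[of k] k by (simp add: right_sign_def hi_def upper_def sr_def sval_ok_def)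
  qed
  define t where "t = derivs_data Qs cell (pderiv P) ! 0"
  have t: "sign (poly (pderiv (specialize \<rho> P)) x) = t" if "x \<in> ival lo hi" for x
    using cell_derivs(1)[OF famQ D(3) cell, of 0 x] that by (simp add: t_def specialize_pderiv)
  have t0: "t \<noteq> 0" using cell_derivs(2)[OF famQ D(3) cell, of 0] D(4) by (simp add: t_def)
  have mono1: "\<exists>y\<in>ival lo hi. ev P y = 0 \<and>
      (\<forall>x\<in>ival lo hi. (x < y \<longrightarrow> sign (ev P x) = sl) \<and> (y < x \<longrightarrow> sign (ev P x) = sr))" if "sl * sr < 0"
    by (rule monotonic_on_ival(1)[OF rc bd _ t0 left right that]) (rule t)
  have mono2: "\<forall>x\<in>ival lo hi. ev P x \<noteq> 0 \<and> sign (ev P x) = (if sl \<noteq> 0 then sl else sr)" if "\<not> sl * sr < 0"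
    by (rule monotonic_on_ival(2)[OF rc bd _ t0 left right that]) (rule t)
  have pt: "point_ok Qs (xs ! j) (points tab ! j)" if "j < length xs" for j by (rule chain_point[OF ch that])
  show ?thesis
  proof (cases "sl * sr < 0")
    case True
    obtain y where y: "y \<in> ival lo hi" "ev P y = 0"
      "\<And>x. x \<in> ival lo hi \<Longrightarrow> x < y \<Longrightarrow> sign (ev P x) = sl" "\<And>x. x \<in> ival lo hi \<Longrightarrow> y < x \<Longrightarrow> sign (ev P x) = sr"
      using mono1[OF True] by blast
    have slr: "sl \<noteq> 0" "sr \<noteq> 0" using True by auto
    have uniq: "{y \<in> ival lo hi. ev P y = 0} = {y}"
    proof -
      have "z = y" if "z \<in> ival lo hi" "ev P z = 0" for z
        using y(3)[OF that(1)] y(4)[OF that(1)] that(2) slr by (cases z y rule: linorder_cases) (auto simp: sign_def)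
      then show ?thesis using y(1,2) by blast
    qed
    have c1: "cell_ok (Qs @ [P]) lo (Some y) (cell @ [sl])"
    proof (rule cell_ok_snoc[OF cell])
      show "bounds_ok lo (Some y)" using y(1) by (auto simp: bounds_ok_def ival_def)
      show sub: "ival lo (Some y) \<subseteq> ival lo hi" using y(1) by (auto simp: ival_def)
      show "sign (ev P x) = sl" if "x \<in> ival lo (Some y)" for x
        using y(3)[of x] sub that by (auto simp: ival_def)
    qed
    have c2: "cell_ok (Qs @ [P]) (Some y) hi (cell @ [sr])"
    proof (rule cell_ok_snoc[OF cell])
      show "bounds_ok (Some y) hi" using y(1) by (auto simp: bounds_ok_def ival_def)
      show sub: "ival (Some y) hi \<subseteq> ival lo hi" using y(1) by (auto simp: ival_def)
      show "sign (ev P x) = sr" if "x \<in> ival (Some y) hi" for x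
        using y(4)[of x] sub that by (auto simp: ival_def)
    qed
    have newpt: "point_ok (Qs @ [P]) y (es @ [(0, None)])" if "point_ok Qs y es" for es
      by (rule point_ok_snoc[OF that]) (simp add: y(2))
    \<comment> \<open>Shared by the four positions of the interval. The new gaps are split as
      \<open>g1 @ g2\<close> at the root; the part towards an infinite end is empty.\<close>
    have goal: ?thesis if R1: "fst R = [cell @ [sl], cell @ [sr]]" "fst (snd R) = [es @ [(0, None)]]" "snd (snd R) = g1 @ g2"
      and R2: "point_ok Qs y es" "gap_list gap_ok lo (Some y) g1" "gap_list gap_ok (Some y) hi g2" for es g1 g2
    proof -
      have "chain (cell_ok (Qs @ [P])) (point_ok (Qs @ [P])) gap_ok [y] lo hi
          [cell @ [sl], cell @ [sr]] [es @ [(0, None)]] (g1 @ g2)"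
        by (rule chain_one_root) (fact c1 c2 newpt[OF R2(1)] R2(2,3))+
      then show ?thesis unfolding R1 uniq by (intro exI[of _ "[y]"] conjI) simp_all
    qed
    have Rdef: "R = (let new_cells = [cell @ [sl], cell @ [sr]] in
      if length xs = 0 then (new_cells, [svals_of_constants sg Qs @ [(0, None)]], [])
      else if k = 0 then
        (let (\<tau>, es) = root_unbounded Qs P (points tab ! 0) (P_at ! 0) cell in (new_cells, [es @ [(0, None)]], [\<tau>]))
      else if k = length xs then
        (let (\<tau>, es) = root_unbounded Qs P (points tab ! (length xs - 1)) (P_at ! (length xs - 1)) cell
         in (new_cells, [es @ [(0, None)]], [\<tau>]))
      else
        (let \<delta> = gaps tab ! (k - 1);
             (\<tau>\<^sub>a, \<tau>\<^sub>b, es) = root_in_gap Qs P (points tab ! (k - 1)) (points tab ! k) (P_at ! (k - 1)) (P_at ! k) cell \<delta>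
         in (new_cells, [es @ [(0, None)]], [VAdd \<delta> \<tau>\<^sub>a, VAdd \<delta> \<tau>\<^sub>b])))"
      using True unfolding R_def refine_interval_def Let_def r cell_def[symmetric] sl_def[symmetric] sr_def[symmetric]
      by (simp only: if_True)
    consider "length xs = 0" | "length xs \<noteq> 0" "k = 0" | "length xs \<noteq> 0" "k \<noteq> 0" "k = length xs" | "0 < k" "k < length xs"
      using k by linarith
    then show ?thesis
    proof cases
      case 1
      then have "roots Qs = {}" using xs by simp
      then have d0: "degree F = 0" if "F \<in> set Qs" for F using roots_empty_degree_0[OF famQ] that by blast
      have "point_ok Qs y (svals_of_constants sg Qs)"
        unfolding point_ok_def svals_of_constants_def list_all2_map2
      proof (rule list.rel_refl_strong)
        fix F assume F: "F \<in> set Qs"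
        have "sg (coeff F 0) = sign (ev F y)" "\<nu> (coeff F 0) = w (ev F y)"
          using famQ F d0[OF F] by (auto simp: family_ok_def ev_degree_0)
        then show "sval_ok (if degree F = 0 then sval (sg (coeff F 0)) (Val (coeff F 0)) else (0, None)) (ev F y)"
          using d0[OF F] by (simp add: sval_okI)
      qed
      moreover have "lo = None" "hi = None" using 1 k by (auto simp: lo_def hi_def lower_def upper_def)
      ultimately show ?thesis
        using 1 Rdef by (intro goal[of "svals_of_constants sg Qs" "[]" "[]"]) (simp_all add: gap_list_def)
    next
      case 2
      define a where "a = xs ! 0"
      have lh: "lo = None" "hi = Some a" using 2 by (auto simp: lo_def hi_def upper_def a_def)
      obtain \<tau> es where ru: "root_unbounded Qs P (points tab ! 0) (P_at ! 0) cell = (\<tau>, es)" by fastforce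
      have Pa: "sval_ok (P_at ! 0) (ev P a)" using Pat[of 0] 2 by (simp add: a_def)
      have Pa0: "ev P a \<noteq> 0" using slr(2) 2 Pa by (auto simp: sr_def sval_ok_def)
      have ya: "0 < a - y" "a + (- 1) * (a - y) = y" using y(1) by (auto simp: lh ival_def)
      have "veval \<nu> \<tau> = w (a - y) \<and> point_ok Qs (a + (- 1) * (a - y)) es"
        by (rule root_unbounded_ok[OF fam P _ cell _ Pa Pa0 ya(1) _ ru])
          (use lh pt[of 0] 2 y(2) ya in \<open>auto simp: half_line_def a_def\<close>)
      then show ?thesis
        using 2 Rdef ru ya by (intro goal[of es "[]" "[\<tau>]"]) (simp_all add: gap_list_def lh gap_ok_def)
    next
      case 3
      define a where "a = xs ! (length xs - 1)"
      have lh: "lo = Some a" "hi = None" using 3 by (auto simp: lo_def hi_def upper_def lower_def a_def)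
      obtain \<tau> es where ru: "root_unbounded Qs P (points tab ! (length xs - 1)) (P_at ! (length xs - 1)) cell = (\<tau>, es)" by fastforce
      have Pa: "sval_ok (P_at ! (length xs - 1)) (ev P a)" using Pat[of "length xs - 1"] 3 by (simp add: a_def)
      have Pa0: "ev P a \<noteq> 0" using slr(1) 3 Pa by (auto simp: sl_def sval_ok_def)
      have ya: "0 < y - a" "a + 1 * (y - a) = y" using y(1) by (auto simp: lh ival_def)
      have "veval \<nu> \<tau> = w (y - a) \<and> point_ok Qs (a + 1 * (y - a)) es"
        by (rule root_unbounded_ok[OF fam P _ cell _ Pa Pa0 ya(1) _ ru])
          (use lh pt[of "length xs - 1"] 3 y(2) ya in \<open>auto simp: half_line_def a_def\<close>)
      then show ?thesis
        using 3 Rdef ru ya by (intro goal[of es "[\<tau>]" "[]"]) (simp_all add: gap_list_def lh gap_ok_def)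
    next
      case 4
      define a b where "a = xs ! (k - 1)" and "b = xs ! k"
      have lh: "lo = Some a" "hi = Some b" using 4 by (auto simp: lo_def hi_def upper_def lower_def a_def b_def)
      define \<delta> where "\<delta> = gaps tab ! (k - 1)"
      have \<delta>: "veval \<nu> \<delta> = w (b - a)"
      proof -
        have "gap_ok (xs ! (k - 1)) (xs ! Suc (k - 1)) (gaps tab ! (k - 1))"
          by (rule conjunct2[OF chain_gap[OF ch], rule_format]) (use 4 in linarith)
        then show ?thesis using 4 by (simp add: gap_ok_def a_def b_def \<delta>_def)
      qed
      obtain \<tau>a \<tau>b es where rg: "root_in_gap Qs P (points tab ! (k - 1)) (points tab ! k) (P_at ! (k - 1)) (P_at ! k) cell \<delta> = (\<tau>a, \<tau>b, es)"
        using prod_cases3 by blast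
      have Pa: "sval_ok (P_at ! (k - 1)) (ev P a)" "sval_ok (P_at ! k) (ev P b)"
        using Pat[of "k - 1"] Pat[of k] 4 by (auto simp: a_def b_def)
      have Pa0: "ev P a \<noteq> 0" "ev P b \<noteq> 0" using slr 4 Pa by (auto simp: sl_def sr_def sval_ok_def)
      have yab: "a < y" "y < b" using y(1) by (auto simp: lh ival_def)
      have "gap_ok a y (VAdd \<delta> \<tau>a) \<and> gap_ok y b (VAdd \<delta> \<tau>b) \<and> point_ok Qs y es"
        by (rule root_in_gap_ok[OF fam P cell[unfolded lh] _ _ Pa(1) Pa0(1) Pa(2) Pa0(2) \<delta> yab y(2) rg])
          (use pt[of "k - 1"] pt[of k] 4 in \<open>auto simp: a_def b_def\<close>)
      moreover have ks: "length xs \<noteq> 0" "k \<noteq> 0" "k \<noteq> length xs" using 4 by auto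
      have "R = ([cell @ [sl], cell @ [sr]], [es @ [(0, None)]], [VAdd \<delta> \<tau>a, VAdd \<delta> \<tau>b])"
        using Rdef unfolding Let_def \<delta>_def[symmetric] rg by (simp only: ks if_False prod.case)
      ultimately show ?thesis
        by (intro goal[of es "[VAdd \<delta> \<tau>a]" "[VAdd \<delta> \<tau>b]"]) (simp_all add: gap_list_def lh)
    qed
  next
    case False
    define s where "s = (if sl \<noteq> 0 then sl else sr)"
    have sx: "ev P x \<noteq> 0 \<and> sign (ev P x) = s" if "x \<in> ival lo hi" for x
      using mono2[OF False] that by (simp add: s_def)
    have "cell_ok (Qs @ [P]) lo hi (cell @ [s])" by (rule cell_ok_snoc[OF cell bd order_refl]) (use sx in blast)
    moreover have "gap_list gap_ok lo hi (if 0 < k \<and> k < length xs then [gaps tab ! (k - 1)] else [])"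
    proof (cases "0 < k \<and> k < length xs")
      case True
      then have "gap_ok (xs ! (k - 1)) (xs ! Suc (k - 1)) (gaps tab ! (k - 1))"
        by (intro conjunct2[OF chain_gap[OF ch], rule_format]) linarith
      then show ?thesis using True by (simp add: gap_list_def lo_def hi_def lower_def upper_def)
    next
      case no: False
      then show ?thesis using k by (auto simp: gap_list_def lo_def hi_def lower_def upper_def split: option.splits)
    qed
    moreover have "R = ([cell @ [s]], [], if 0 < k \<and> k < length xs then [gaps tab ! (k - 1)] else [])"
      using False unfolding R_def refine_interval_def Let_def r cell_def[symmetric] sl_def[symmetric] sr_def[symmetric] s_def
      by (simp only: if_False)
    ultimately show ?thesis using sx by (intro exI[of _ "[]"]) auto
  qed
qed

lemma add_poly_ok:
  assumes tab: "tab_ok Qs tab xs" and fam: "family_ok Z sg (Qs @ [P])"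
  shows "\<exists>ys. tab_ok (Qs @ [P]) (add_poly Z sg Qs tab P) ys"
proof -
  have ch: "chain (cell_ok Qs) (point_ok Qs) gap_ok xs None None (cells tab) (points tab) (gaps tab)"
    and xs: "set xs = roots Qs" using tab by (auto simp: tab_ok_def)
  have len: "length (points tab) = length xs" using chain_lengths[OF ch] by simp
  show ?thesis
  proof (cases "degree P = 0")
    case True
    let ?c = "coeff P 0"
    have sg: "sg ?c = sign (eval_coef \<rho> ?c)" using fam True by (auto simp: family_ok_def)
    have "chain (cell_ok (Qs @ [P])) (point_ok (Qs @ [P])) gap_ok xs None None
        (map (\<lambda>cell. cell @ [sg ?c]) (cells tab)) (map (\<lambda>pt. pt @ [sval (sg ?c) (Val ?c)]) (points tab)) (gaps tab)"
    proof (rule chain_map[OF ch])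
      show "cell_ok (Qs @ [P]) lo hi (c @ [sg ?c])" if "cell_ok Qs lo hi c" for lo hi c
        by (rule cell_ok_snoc[OF that cell_bounds[OF that] order_refl]) (simp add: ev_degree_0[OF True] sg)
      show "point_ok (Qs @ [P]) x (p @ [sval (sg ?c) (Val ?c)])" if "point_ok Qs x p" for x p
        by (rule point_ok_snoc[OF that]) (simp add: ev_degree_0[OF True] sg sval_okI)
    qed
    moreover have "roots (Qs @ [P]) = roots Qs"
    proof -
      have "specialize \<rho> P = 0" if "ev P x = 0" for x
        using that degree_specialize_le[of P] True by (auto elim!: degree_eq_zeroE)
      then show ?thesis by (auto simp: roots_def)
    qed
    ultimately show ?thesis using xs True by (intro exI[of _ xs]) (simp add: tab_ok_def add_poly_def Let_def)
  next
    case False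
    then have P: "1 \<le> degree P" by simp
    define P_at where "P_at = map (sval_at_root Z sg Qs P) (points tab)"
    define f where "f = refine_interval sg Qs tab P P_at"
    have Pat: "sval_ok (P_at ! k) (ev P (xs ! k))" if "k < length xs" for k
    proof -
      have "xs ! k \<in> roots Qs" using xs that nth_mem by blast
      then show ?thesis
        using sval_at_root_ok[OF fam P _ chain_point[OF ch that]] that len by (simp add: P_at_def)
    qed
    \<comment> \<open>Chooses the new points of every interval at once, in the functional form
      expected by \<open>chain_concat\<close>.\<close>
    define ns where "ns k = (SOME ns. chain (cell_ok (Qs @ [P])) (point_ok (Qs @ [P])) gap_ok ns
        (lower None xs k) (upper xs None k) (fst (f k)) (fst (snd (f k))) (snd (snd (f k))) \<and>
        set ns = {y \<in> ival (lower None xs k) (upper xs None k). ev P y = 0})" for k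
    have ns: "chain (cell_ok (Qs @ [P])) (point_ok (Qs @ [P])) gap_ok (ns k)
        (lower None xs k) (upper xs None k) (fst (f k)) (fst (snd (f k))) (snd (snd (f k)))"
      "set (ns k) = {y \<in> ival (lower None xs k) (upper xs None k). ev P y = 0}" if k: "k \<le> length xs" for k
    proof -
      have "\<exists>ns. chain (cell_ok (Qs @ [P])) (point_ok (Qs @ [P])) gap_ok ns
        (lower None xs k) (upper xs None k) (fst (f k)) (fst (snd (f k))) (snd (snd (f k))) \<and>
        set ns = {y \<in> ival (lower None xs k) (upper xs None k). ev P y = 0}"
        unfolding f_def by (rule refine_interval_ok[OF tab fam P]) (use Pat k in auto)
      from someI_ex[OF this] show "chain (cell_ok (Qs @ [P])) (point_ok (Qs @ [P])) gap_ok (ns k)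
        (lower None xs k) (upper xs None k) (fst (f k)) (fst (snd (f k))) (snd (snd (f k)))"
        "set (ns k) = {y \<in> ival (lower None xs k) (upper xs None k). ev P y = 0}"
        unfolding ns_def by blast+
    qed
    let ?olds = "map2 (\<lambda>pt e. pt @ [e]) (points tab) P_at"
    have lenP: "length P_at = length xs" by (simp add: P_at_def len)
    have "\<exists>ys. chain (cell_ok (Qs @ [P])) (point_ok (Qs @ [P])) gap_ok ys None None
        (concat (map (\<lambda>k. fst (f k)) [0..<Suc (length xs)]))
        (concat (map2 (@) ([] # map (\<lambda>p. [p]) ?olds) (map (\<lambda>k. fst (snd (f k))) [0..<Suc (length xs)])))
        (concat (map (\<lambda>k. snd (snd (f k))) [0..<Suc (length xs)])) \<and>
      set ys = set xs \<union> (\<Union>k\<le>length xs. set (ns k))"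
    proof (rule chain_concat)
      show "point_ok (Qs @ [P]) (xs ! k) (?olds ! k)" if "k < length xs" for k
        using point_ok_snoc[OF chain_point[OF ch that] Pat[OF that]] that len lenP by simp
    qed (use ns(1) len lenP in auto)
    then obtain ys where ys: "chain (cell_ok (Qs @ [P])) (point_ok (Qs @ [P])) gap_ok ys None None
        (concat (map (\<lambda>k. fst (f k)) [0..<Suc (length xs)]))
        (concat (map2 (@) ([] # map (\<lambda>p. [p]) ?olds) (map (\<lambda>k. fst (snd (f k))) [0..<Suc (length xs)])))
        (concat (map (\<lambda>k. snd (snd (f k))) [0..<Suc (length xs)]))"
      "set ys = set xs \<union> (\<Union>k\<le>length xs. set (ns k))" by blast
    have old: "map (\<lambda>p. [p]) ?olds = map2 (\<lambda>pt e. [pt @ [e]]) (points tab) P_at" by (simp add: case_prod_unfold)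
    have tabdef: "add_poly Z sg Qs tab P = VTab (concat (map (\<lambda>k. fst (f k)) [0..<Suc (length xs)]))
        (concat (map2 (@) ([] # map (\<lambda>p. [p]) ?olds) (map (\<lambda>k. fst (snd (f k))) [0..<Suc (length xs)])))
        (concat (map (\<lambda>k. snd (snd (f k))) [0..<Suc (length xs)]))"
      unfolding add_poly_def Let_def old using False
      by (simp add: len f_def P_at_def comp_def del: upt_Suc)
    have "set ys = roots (Qs @ [P])"
    proof -
      have P0: "specialize \<rho> P \<noteq> 0" using specialize_nonzero[OF fam _ P] by simp
      have "x \<in> set xs \<union> (\<Union>k\<le>length xs. set (ns k))" if "ev P x = 0" for x
        using ival_cover[of x None None xs] that ns(2) by (auto simp: ival_def[of None None])
      moreover have "ev P x = 0" if "x \<in> set (ns k)" "k \<le> length xs" for x k using ns(2)[OF that(2)] that(1) by auto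
      moreover have "roots (Qs @ [P]) = set xs \<union> {x. ev P x = 0}" unfolding xs using P0 by (auto simp: roots_def)
      ultimately show ?thesis unfolding ys(2) by blast
    qed
    then show ?thesis using ys(1) by (auto simp: tab_ok_def tabdef)
  qed
qed

lemma rcvf2_ok: "family_ok Z sg Ps \<Longrightarrow> \<exists>xs. tab_ok Ps (rcvf2 Z sg Ps) xs"
proof (induction Ps rule: rev_induct)
  case Nil
  show ?case
    by (rule exI[of _ "[]"]) (simp add: tab_ok_def rcvf2_def roots_def cell_ok_def bounds_ok_def gap_list_def)
next
  case (snoc P Ps)
  then obtain xs where "tab_ok Ps (rcvf2 Z sg Ps) xs" using family_ok_prefix by blast
  then show ?case using add_poly_ok snoc.prems by (simp add: rcvf2_snoc)
qed

end

section \<open>The constants occurring in the computed valuations\<close>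

text \<open>Branches whose sign assignment is not realized by any parameter point also belong to the tree, so
  the bookkeeping of constants cannot refer to a parameter point.\<close>

primrec vkeys :: "'c vexp \<Rightarrow> 'c set" where
  "vkeys (Lin l) = Poly_Mapping.keys l"
| "vkeys (VAdd e f) = vkeys e \<union> vkeys f"
| "vkeys (VScale q e) = vkeys e"
| "vkeys (VMin e f) = vkeys e \<union> vkeys f"
| "vkeys (VMax e f) = vkeys e \<union> vkeys f"

text \<open>The equivalence ensures that a value is present wherever the sign is nonzero, so that
  \<open>the\<close> yields an expression over \<open>B\<close>
  (\<open>sval_wf_the\<close>).\<close>

definition sval_wf :: "'c set \<Rightarrow> 'c sval \<Rightarrow> bool" where
  "sval_wf B s \<longleftrightarrow> (fst s = 0 \<longleftrightarrow> snd s = None) \<and> (\<forall>e. snd s = Some e \<longrightarrow> vkeys e \<subseteq> B)"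

lemma sval_wf_zero [simp]: "sval_wf B (0, None)"
  by (simp add: sval_wf_def)

lemma sval_wf_sval: "(s \<noteq> 0 \<Longrightarrow> vkeys e \<subseteq> B) \<Longrightarrow> sval_wf B (sval s e)"
  by (auto simp: sval_wf_def sval_def)

lemma sval_wf_the: "sval_wf B s \<Longrightarrow> fst s \<noteq> 0 \<Longrightarrow> vkeys (the (snd s)) \<subseteq> B"
  by (auto simp: sval_wf_def)

definition terms_wf :: "'c set \<Rightarrow> ('c vexp \<times> nat) list \<Rightarrow> bool" where
  "terms_wf B ts \<longleftrightarrow> (\<forall>(e, k)\<in>set ts. vkeys e \<subseteq> B)"

lemma vkeys_vmin_list: "(\<And>e. e \<in> set es \<Longrightarrow> vkeys e \<subseteq> B) \<Longrightarrow> vkeys (vmin_list es) \<subseteq> B"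
  by (induction es rule: vmin_list.induct) auto

lemma vkeys_vmax_list: "(\<And>e. e \<in> set es \<Longrightarrow> vkeys e \<subseteq> B) \<Longrightarrow> vkeys (vmax_list es) \<subseteq> B"
  by (induction es rule: vmax_list.induct) auto

lemma vkeys_min_terms: "terms_wf B ts \<Longrightarrow> vkeys \<tau> \<subseteq> B \<Longrightarrow> vkeys (min_terms \<tau> ts) \<subseteq> B"
  unfolding min_terms_def by (rule vkeys_vmin_list) (fastforce simp: terms_wf_def)

lemma vkeys_solve_terms: "terms_wf B ts \<Longrightarrow> vkeys \<gamma> \<subseteq> B \<Longrightarrow> vkeys (solve_terms \<gamma> ts) \<subseteq> B"
  unfolding solve_terms_def by (rule vkeys_vmax_list) (fastforce simp: terms_wf_def)

lemma terms_wf_taylor: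
  assumes "\<And>j. j < length \<sigma> \<Longrightarrow> sval_wf B (at_a ! j) \<and> sval_wf B (at_b ! j)" "vkeys \<delta> \<subseteq> B"
  shows "terms_wf B (taylor_terms \<sigma> at_a at_b \<delta>)"
proof -
  have "vkeys e \<subseteq> B" if ek: "(e, k) \<in> set (taylor_terms \<sigma> at_a at_b \<delta>)" for e k
  proof -
    let ?s = "\<lambda>j. if j < length (sides \<sigma>) \<and> \<not> sides \<sigma> ! j then at_b ! j else at_a ! j"
    obtain j where j: "j < length \<sigma>"
      "map_option (\<lambda>e. (VAdd e (VScale (of_nat j) \<delta>), min j (run_length \<sigma>))) (snd (?s j)) = Some (e, k)"
      using ek unfolding set_taylor_terms by blast
    then obtain e0 where e0: "snd (?s j) = Some e0" "e = VAdd e0 (VScale (of_nat j) \<delta>)"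
      by (auto simp only: map_option_eq_Some)
    have "sval_wf B (?s j)" using assms(1)[OF j(1)] by simp
    then have "vkeys e0 \<subseteq> B" using e0(1) by (simp add: sval_wf_def)
    then show ?thesis using assms(2) e0(2) by simp
  qed
  then show ?thesis by (auto simp: terms_wf_def)
qed

lemma terms_wf_unbounded:
  assumes "\<And>s. s \<in> set at_a \<Longrightarrow> sval_wf B s"
  shows "terms_wf B (unbounded_terms at_a)"
proof -
  have "vkeys e \<subseteq> B" if "(e, k) \<in> set (unbounded_terms at_a)" for e k
  proof -
    have "k < length at_a \<and> snd (at_a ! k) = Some e"
      using that by (auto simp: unbounded_terms_def split: option.splits)
    then show ?thesis using assms[of "at_a ! k"] by (simp add: sval_wf_def)
  qed
  then show ?thesis by (auto simp: terms_wf_def)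
qed

text \<open>The last clause makes the search for \<open>Q\<close> in \<open>sval_at_root\<close>
  succeed even where the point corresponds to no actual root.\<close>

definition point_wf :: "'c set \<Rightarrow> 'c::zero poly list \<Rightarrow> 'c sval list \<Rightarrow> bool" where
  "point_wf B Qs p \<longleftrightarrow> length p = length Qs \<and> (\<forall>s\<in>set p. sval_wf B s) \<and>
     (\<exists>j<length Qs. 1 \<le> degree (Qs ! j) \<and> fst (p ! j) = 0)"

text \<open>Without a parameter point there are no positions, so the points of the chain are of type
  \<open>unit\<close> and only their number is kept.\<close>

definition tab_wf :: "'c set \<Rightarrow> 'c::zero poly list \<Rightarrow> 'c vtab \<Rightarrow> unit list \<Rightarrow> bool" where
  "tab_wf B Qs tab xs \<longleftrightarrow> chain (\<lambda>_ _ cell. length cell = length Qs) (\<lambda>_. point_wf B Qs) (\<lambda>_ _ g. vkeys g \<subseteq> B)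
     xs None None (cells tab) (points tab) (gaps tab)"

text \<open>Only constants of nonzero sign have a finite value and may enter a valuation
  test.\<close>

definition active_constants :: "('c::zero \<Rightarrow> int) \<Rightarrow> 'c poly list \<Rightarrow> 'c set" where
  "active_constants sg Ps = {c. sg c \<noteq> 0 \<and> (\<exists>F\<in>set Ps. degree F = 0 \<and> c = coeff F 0)}"

lemma active_constants_prefix: "active_constants sg Qs \<subseteq> active_constants sg (Qs @ Rs)"
  by (auto simp: active_constants_def)

lemma point_wf_derivs:
  assumes "closed_family Z Qs" "F \<in> set Qs" "length p = length Qs" "\<forall>s\<in>set p. sval_wf B s"
  shows "\<forall>s\<in>set (derivs_data Qs p F). sval_wf B s"
proof -
  have "list_all2 (\<lambda>F s. sval_wf B s) Qs p"
    using assms(3,4) by (auto simp: list_all2_conv_all_nth)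
  note nth = derivs_data_nth[OF assms(1,2) this]
  show ?thesis
  proof
    fix s assume "s \<in> set (derivs_data Qs p F)"
    then obtain j where "j \<le> degree F" "s = derivs_data Qs p F ! j" by (auto simp: in_set_conv_nth less_Suc_eq_le)
    then show "sval_wf B s" using nth by blast
  qed
qed

lemma derivs_data_wf_nth:
  assumes "closed_family Z Qs" "F \<in> set Qs" "length p = length Qs" "\<forall>s\<in>set p. sval_wf B s" "j < Suc (degree F)"
  shows "sval_wf B (derivs_data Qs p F ! j)"
  using point_wf_derivs[OF assms(1-4)] assms(5) by simp

lemma sval_wf_Cons_nth:
  "\<forall>s\<in>set p. sval_wf B s \<Longrightarrow> j < Suc (length p) \<Longrightarrow> sval_wf B (((0, None) # p) ! j)"
  by (cases j) auto

lemma top_constant_active: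
  "closed_family Z Qs \<Longrightarrow> Q \<in> set Qs \<Longrightarrow> sg (top_constant Q) \<noteq> 0 \<Longrightarrow> top_constant Q \<in> active_constants sg Qs"
  using pderiv_funpow_in_family[of Z Qs Q "degree Q"]
  by (force simp: active_constants_def top_constant_def degree_pderiv_funpow)

lemma sval_at_root_wf:
  assumes cl: "closed_family Z (Qs @ [P])" and B: "active_constants sg Qs \<subseteq> B" and p: "point_wf B Qs p"
  shows "sval_wf B (sval_at_root Z sg Qs P p)"
proof -
  let ?test = "\<lambda>(Q :: 'a coef poly, s :: int, _). 1 \<le> degree Q \<and> s = 0"
  have lenp: "length p = length Qs" using p by (simp add: point_wf_def)
  obtain i where "i < length Qs" "1 \<le> degree (Qs ! i)" "fst (p ! i) = 0" using p by (auto simp: point_wf_def)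
  moreover from this have "(Qs ! i, p ! i) \<in> set (zip Qs p)" using lenp by (auto simp: set_zip)
  ultimately have "\<exists>u\<in>set (zip Qs p). ?test u"
    by (intro bexI[of _ "(Qs ! i, p ! i)"]) (auto simp: case_prod_unfold)
  then have "find ?test (zip Qs p) \<noteq> None" unfolding find_None_iff by blast
  then obtain Q s1 e1 where Qf: "find ?test (zip Qs p) = Some (Q, s1, e1)" by auto
  then have Q: "(Q, s1, e1) \<in> set (zip Qs p)" "1 \<le> degree Q" by (auto simp: find_Some_iff set_conv_nth)
  have QQ: "Q \<in> set Qs" using set_zip_leftD[OF Q(1)] .
  have R: "reduce Z (pseudo_mod P Q) \<in> set Qs" by (rule closed_family_snoc(3)[OF cl QQ Q(2)])
  have "list_all2 (\<lambda>F s. sval_wf B s) Qs p" using p by (auto simp: point_wf_def list_all2_conv_all_nth)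
  then obtain s2 e2 where se: "map_of (zip Qs p) (reduce Z (pseudo_mod P Q)) = Some (s2, e2)" "sval_wf B (s2, e2)"
    using map_of_zip_list_all2[OF _ R] by (metis surj_pair)
  define e where "e = Suc (degree P) - degree Q"
  \<comment> \<open>With exponent 0 the power would be 1 even for
    \<open>sg (top_constant Q) = 0\<close>; positivity makes a nonzero product imply that this
    constant is active.\<close>
  have e: "0 < e" using closed_family_snoc(2)[OF cl QQ Q(2)] by (simp add: e_def)
  have eq: "sval_at_root Z sg Qs P p =
      sval (s2 * sg (top_constant Q) ^ e) (VAdd (the e2) (VScale (- of_nat e) (Val (top_constant Q))))"
    unfolding sval_at_root_def Qf by (simp add: se(1) e_def Let_def)
  have "vkeys (the e2) \<subseteq> B" "top_constant Q \<in> B" if "s2 * sg (top_constant Q) ^ e \<noteq> 0"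
  proof -
    show "vkeys (the e2) \<subseteq> B" using sval_wf_the[OF se(2)] that by simp
    have "sg (top_constant Q) \<noteq> 0" using that e by auto
    then show "top_constant Q \<in> B" using top_constant_active[OF closed_family_prefix[OF cl] QQ] B by blast
  qed
  then show ?thesis unfolding eq by (intro sval_wf_sval) auto
qed

lemma root_unbounded_wf:
  assumes cl: "closed_family Z (Qs @ [P])" and P: "1 \<le> degree P" and p: "point_wf B Qs p"
    and Pa: "sval_wf B Pa" "fst Pa \<noteq> 0" and cell: "length cell = length Qs"
    and R: "root_unbounded Qs P p Pa cell = (\<tau>, es)"
  shows "vkeys \<tau> \<subseteq> B \<and> length es = length Qs \<and> (\<forall>s\<in>set es. sval_wf B s)"
proof -
  note clQ = closed_family_prefix[OF cl]
  have wf: "length p = length Qs" "\<forall>s\<in>set p. sval_wf B s" using p by (auto simp: point_wf_def)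
  have \<tau>: "\<tau> = solve_terms (the (snd Pa)) (unbounded_terms ((0, None) # derivs_data Qs p (pderiv P)))"
    using R by (simp add: root_unbounded_def Let_def)
  have es: "es = map2 (\<lambda>F s. sval s (min_terms \<tau> (unbounded_terms (derivs_data Qs p F)))) Qs cell"
    using R unfolding \<tau> by (simp add: root_unbounded_def Let_def)
  have "\<forall>s\<in>set (derivs_data Qs p (pderiv P)). sval_wf B s"
    by (rule point_wf_derivs[OF clQ closed_family_snoc(1)[OF cl P] wf])
  then have \<tau>w: "vkeys \<tau> \<subseteq> B" unfolding \<tau>
    by (intro vkeys_solve_terms terms_wf_unbounded sval_wf_the[OF Pa]) auto
  have "sval_wf B (sval s (min_terms \<tau> (unbounded_terms (derivs_data Qs p F))))" if "F \<in> set Qs" for F s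
    using point_wf_derivs[OF clQ that wf] by (intro sval_wf_sval vkeys_min_terms \<tau>w terms_wf_unbounded) auto
  then have "\<forall>s\<in>set es. sval_wf B s" unfolding es by (auto dest: set_zip_leftD)
  then show ?thesis using \<tau>w cell by (simp add: es)
qed

lemma root_in_gap_wf:
  assumes cl: "closed_family Z (Qs @ [P])" and P: "1 \<le> degree P" and p: "point_wf B Qs pa" "point_wf B Qs pb"
    and Pa: "sval_wf B Pa" "fst Pa \<noteq> 0" and Pb: "sval_wf B Pb" "fst Pb \<noteq> 0" and \<delta>: "vkeys \<delta> \<subseteq> B"
    and R: "root_in_gap Qs P pa pb Pa Pb cell \<delta> = (\<tau>a, \<tau>b, es)"
  shows "vkeys \<tau>a \<subseteq> B \<and> vkeys \<tau>b \<subseteq> B \<and> length es = length Qs \<and> (\<forall>s\<in>set es. sval_wf B s)"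
proof -
  note clQ = closed_family_prefix[OF cl]
  have wf: "length pa = length Qs" "\<forall>s\<in>set pa. sval_wf B s" "length pb = length Qs" "\<forall>s\<in>set pb. sval_wf B s"
    using p by (auto simp: point_wf_def)
  note P' = closed_family_snoc(1)[OF cl P]
  let ?\<sigma> = "derivs_data Qs cell (pderiv P)"
  have AB: "terms_wf B (taylor_terms (s # ?\<sigma>) ((0, None) # derivs_data Qs pa (pderiv P)) ((0, None) # derivs_data Qs pb (pderiv P)) \<delta>)" for s
  proof (rule terms_wf_taylor[OF _ \<delta>])
    fix j assume "j < length (s # ?\<sigma>)"
    then have "j < Suc (length (derivs_data Qs pa (pderiv P)))" "j < Suc (length (derivs_data Qs pb (pderiv P)))" by simp_all
    then show "sval_wf B (((0, None) # derivs_data Qs pa (pderiv P)) ! j) \<and> sval_wf B (((0, None) # derivs_data Qs pb (pderiv P)) ! j)"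
      using sval_wf_Cons_nth point_wf_derivs[OF clQ P' wf(1,2)] point_wf_derivs[OF clQ P' wf(3,4)] by blast
  qed
  have \<tau>: "vkeys \<tau>a \<subseteq> B" "vkeys \<tau>b \<subseteq> B"
    using R vkeys_solve_terms[OF AB sval_wf_the[OF Pa]] vkeys_solve_terms[OF AB sval_wf_the[OF Pb]]
    by (auto simp: root_in_gap_def Let_def)
  have es: "es = map (\<lambda>F. let \<sigma> = derivs_data Qs cell F in
                 sval (hd \<sigma>) (min_terms (if left_based \<sigma> then \<tau>a else \<tau>b)
                   (taylor_terms \<sigma> (derivs_data Qs pa F) (derivs_data Qs pb F) \<delta>))) Qs"
    using R by (auto simp: root_in_gap_def Let_def)
  have "sval_wf B (sval s (min_terms (if b then \<tau>a else \<tau>b)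
      (taylor_terms (derivs_data Qs cell F) (derivs_data Qs pa F) (derivs_data Qs pb F) \<delta>)))" if "F \<in> set Qs" for F s b
  proof (intro sval_wf_sval vkeys_min_terms terms_wf_taylor \<delta>)
    show "sval_wf B (derivs_data Qs pa F ! j) \<and> sval_wf B (derivs_data Qs pb F ! j)"
      if "j < length (derivs_data Qs cell F)" for j
      using derivs_data_wf_nth[OF clQ \<open>F \<in> set Qs\<close> wf(1,2)] derivs_data_wf_nth[OF clQ \<open>F \<in> set Qs\<close> wf(3,4)] that by simp
  qed (use \<tau> in auto)
  then show ?thesis using \<tau> unfolding es by (auto simp: Let_def)
qed

lemma point_wf_snoc:
  "length es = length Qs \<Longrightarrow> \<forall>s\<in>set es. sval_wf B s \<Longrightarrow> 1 \<le> degree P \<Longrightarrow> point_wf B (Qs @ [P]) (es @ [(0, None)])"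
  unfolding point_wf_def by (auto simp: nth_append intro!: exI[of _ "length Qs"])

lemma point_wf_extend: "point_wf B Qs p \<Longrightarrow> sval_wf B s \<Longrightarrow> point_wf B (Qs @ [P]) (p @ [s])"
  unfolding point_wf_def by (auto simp: nth_append less_Suc_eq)

text \<open>Syntactic counterpart of \<open>refine_interval_ok\<close>: the same cases, followed by
  tracking constants rather than values.\<close>

lemma refine_interval_wf:
  assumes tab: "tab_wf B Qs tab xs" and cl: "closed_family Z (Qs @ [P])" and P: "1 \<le> degree P"
    and B: "active_constants sg Qs \<subseteq> B"
    and Pat: "\<And>k. k < length xs \<Longrightarrow> sval_wf B (P_at ! k)" and k: "k \<le> length xs"
  defines "lo \<equiv> lower None xs k" and "hi \<equiv> upper xs None k" and "R \<equiv> refine_interval sg Qs tab P P_at k"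
  shows "\<exists>ns. chain (\<lambda>_ _ cell. length cell = length (Qs @ [P])) (\<lambda>_. point_wf B (Qs @ [P])) (\<lambda>_ _ g. vkeys g \<subseteq> B)
     ns lo hi (fst R) (fst (snd R)) (snd (snd R))"
proof -
  have ch: "chain (\<lambda>_ _ cell. length cell = length Qs) (\<lambda>_. point_wf B Qs) (\<lambda>_ _ g. vkeys g \<subseteq> B)
     xs None None (cells tab) (points tab) (gaps tab)" using tab by (simp add: tab_wf_def)
  have r: "length (points tab) = length xs" using chain_lengths[OF ch] by simp
  define cell where "cell = cells tab ! k"
  have cell: "length cell = length Qs" unfolding cell_def by (rule chain_cell[OF ch k])
  have pt: "point_wf B Qs (points tab ! j)" if "j < length xs" for j by (rule chain_point[OF ch that])
  have gap: "vkeys (gaps tab ! j) \<subseteq> B" if "j < length xs - 1" for j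
    using chain_gap[OF ch] that by blast
  define sl where "sl = (if k = 0 then sg (top_constant P) * (- 1) ^ degree P else fst (P_at ! (k - 1)))"
  define sr where "sr = (if k = length xs then sg (top_constant P) else fst (P_at ! k))"
  show ?thesis
  proof (cases "sl * sr < 0")
    case True
    \<comment> \<open>Nonzero end signs guarantee that the values of \<open>P\<close> at the finite
      ends are present.\<close>
    then have slr: "sl \<noteq> 0" "sr \<noteq> 0" by auto
    have goal: ?thesis if R1: "R = ([cell @ [sl], cell @ [sr]], [es @ [(0, None)]], g1 @ g2)"
      and R2: "length es = length Qs" "\<forall>s\<in>set es. sval_wf B s"
        "gap_list (\<lambda>_ _ g. vkeys g \<subseteq> B) lo (Some ()) g1" "gap_list (\<lambda>_ _ g. vkeys g \<subseteq> B) (Some ()) hi g2" for es g1 g2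
    proof -
      have "chain (\<lambda>_ _ cell. length cell = length (Qs @ [P])) (\<lambda>_. point_wf B (Qs @ [P])) (\<lambda>_ _ g. vkeys g \<subseteq> B)
        [()] lo hi [cell @ [sl], cell @ [sr]] [es @ [(0, None)]] (g1 @ g2)"
        using cell point_wf_snoc[OF R2(1,2) P] R2(3,4) by auto
      then show ?thesis unfolding R1 fst_conv snd_conv by blast
    qed
    have Rdef: "R = (let new_cells = [cell @ [sl], cell @ [sr]] in
      if length xs = 0 then (new_cells, [svals_of_constants sg Qs @ [(0, None)]], [])
      else if k = 0 then
        (let (\<tau>, es) = root_unbounded Qs P (points tab ! 0) (P_at ! 0) cell in (new_cells, [es @ [(0, None)]], [\<tau>]))
      else if k = length xs then
        (let (\<tau>, es) = root_unbounded Qs P (points tab ! (length xs - 1)) (P_at ! (length xs - 1)) cell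
         in (new_cells, [es @ [(0, None)]], [\<tau>]))
      else
        (let \<delta> = gaps tab ! (k - 1);
             (\<tau>\<^sub>a, \<tau>\<^sub>b, es) = root_in_gap Qs P (points tab ! (k - 1)) (points tab ! k) (P_at ! (k - 1)) (P_at ! k) cell \<delta>
         in (new_cells, [es @ [(0, None)]], [VAdd \<delta> \<tau>\<^sub>a, VAdd \<delta> \<tau>\<^sub>b])))"
      using True unfolding R_def refine_interval_def Let_def r cell_def[symmetric] sl_def[symmetric] sr_def[symmetric]
      by (simp only: if_True)
    consider "length xs = 0" | "length xs \<noteq> 0" "k = 0" | "length xs \<noteq> 0" "k \<noteq> 0" "k = length xs"
      | "length xs \<noteq> 0" "k \<noteq> 0" "k \<noteq> length xs" by blast
    then show ?thesis
    proof cases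
      case 1
      have "sval_wf B s" if s: "s \<in> set (svals_of_constants sg Qs)" for s
      proof -
        obtain F where F: "F \<in> set Qs" "s = (if degree F = 0 then sval (sg (coeff F 0)) (Val (coeff F 0)) else (0, None))"
          using s by (auto simp: svals_of_constants_def)
        have "coeff F 0 \<in> B" if "degree F = 0" "sg (coeff F 0) \<noteq> 0" using B F(1) that by (auto simp: active_constants_def)
        then show ?thesis unfolding F(2) by (auto intro!: sval_wf_sval)
      qed
      moreover have "lo = None" "hi = None" using 1 k by (auto simp: lo_def hi_def lower_def upper_def)
      moreover have "length (svals_of_constants sg Qs) = length Qs" by (simp add: svals_of_constants_def)
      ultimately show ?thesis
        using 1 Rdef by (intro goal[of "svals_of_constants sg Qs" "[]" "[]"]) (simp_all add: gap_list_def)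
    next
      case 2
      have lh: "lo = None" "hi = Some ()" using 2 by (auto simp: lo_def hi_def upper_def)
      obtain \<tau> es where ru: "root_unbounded Qs P (points tab ! 0) (P_at ! 0) cell = (\<tau>, es)" by fastforce
      have w: "vkeys \<tau> \<subseteq> B \<and> length es = length Qs \<and> (\<forall>s\<in>set es. sval_wf B s)"
        by (rule root_unbounded_wf[OF cl P pt Pat _ cell ru]) (use 2 slr in \<open>auto simp: sr_def\<close>)
      have "R = ([cell @ [sl], cell @ [sr]], [es @ [(0, None)]], [\<tau>])"
        using Rdef 2 unfolding Let_def ru by (simp only: simp_thms if_False if_True prod.case)
      then show ?thesis
        using w by (intro goal[of es "[]" "[\<tau>]"]) (simp_all add: gap_list_def lh)
    next
      case 3
      have lh: "lo = Some ()" "hi = None" using 3 by (auto simp: lo_def hi_def upper_def lower_def)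
      obtain \<tau> es where ru: "root_unbounded Qs P (points tab ! (length xs - 1)) (P_at ! (length xs - 1)) cell = (\<tau>, es)" by fastforce
      have w: "vkeys \<tau> \<subseteq> B \<and> length es = length Qs \<and> (\<forall>s\<in>set es. sval_wf B s)"
        by (rule root_unbounded_wf[OF cl P pt Pat _ cell ru]) (use 3 slr in \<open>auto simp: sl_def\<close>)
      have "R = ([cell @ [sl], cell @ [sr]], [es @ [(0, None)]], [\<tau>])"
        using Rdef 3 unfolding Let_def ru by (simp only: simp_thms if_False if_True prod.case)
      then show ?thesis
        using w by (intro goal[of es "[\<tau>]" "[]"]) (simp_all add: gap_list_def lh)
    next
      case 4
      have k4: "0 < k" "k < length xs" using 4 k by auto
      have lh: "lo = Some ()" "hi = Some ()" using k4 by (auto simp: lo_def hi_def upper_def lower_def)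
      define \<delta> where "\<delta> = gaps tab ! (k - 1)"
      have \<delta>: "vkeys \<delta> \<subseteq> B" unfolding \<delta>_def by (rule gap) (use k4 in linarith)
      obtain \<tau>a \<tau>b es where rg: "root_in_gap Qs P (points tab ! (k - 1)) (points tab ! k) (P_at ! (k - 1)) (P_at ! k) cell \<delta> = (\<tau>a, \<tau>b, es)"
        using prod_cases3 by blast
      have w: "vkeys \<tau>a \<subseteq> B \<and> vkeys \<tau>b \<subseteq> B \<and> length es = length Qs \<and> (\<forall>s\<in>set es. sval_wf B s)"
        by (rule root_in_gap_wf[OF cl P pt pt Pat _ Pat _ \<delta> rg]) (use k4 slr in \<open>auto simp: sl_def sr_def\<close>)
      have "R = ([cell @ [sl], cell @ [sr]], [es @ [(0, None)]], [VAdd \<delta> \<tau>a, VAdd \<delta> \<tau>b])"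
        using Rdef unfolding Let_def \<delta>_def[symmetric] rg by (simp only: 4 if_False prod.case)
      then show ?thesis
        using w \<delta> by (intro goal[of es "[VAdd \<delta> \<tau>a]" "[VAdd \<delta> \<tau>b]"]) (simp_all add: gap_list_def lh)
    qed
  next
    case False
    have "R = ([cell @ [if sl \<noteq> 0 then sl else sr]], [], if 0 < k \<and> k < length xs then [gaps tab ! (k - 1)] else [])"
      using False unfolding R_def refine_interval_def Let_def r cell_def[symmetric] sl_def[symmetric] sr_def[symmetric]
      by (simp only: if_False)
    moreover have "gap_list (\<lambda>_ _ g. vkeys g \<subseteq> B) lo hi (if 0 < k \<and> k < length xs then [gaps tab ! (k - 1)] else [])"
    proof (cases "0 < k \<and> k < length xs")
      case True
      then have "vkeys (gaps tab ! (k - 1)) \<subseteq> B" by (intro gap) linarith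
      then show ?thesis using True by (simp add: gap_list_def lo_def hi_def lower_def upper_def)
    next
      case no: False
      then show ?thesis using k by (auto simp: gap_list_def lo_def hi_def lower_def upper_def split: option.splits)
    qed
    ultimately show ?thesis using cell by (intro exI[of _ "[]"]) simp
  qed
qed

lemma add_poly_wf:
  assumes tab: "tab_wf B Qs tab xs" and cl: "closed_family Z (Qs @ [P])" and B: "active_constants sg (Qs @ [P]) \<subseteq> B"
  shows "\<exists>ys. tab_wf B (Qs @ [P]) (add_poly Z sg Qs tab P) ys"
proof -
  have ch: "chain (\<lambda>_ _ cell. length cell = length Qs) (\<lambda>_. point_wf B Qs) (\<lambda>_ _ g. vkeys g \<subseteq> B)
     xs None None (cells tab) (points tab) (gaps tab)" using tab by (simp add: tab_wf_def)
  have len: "length (points tab) = length xs" using chain_lengths[OF ch] by simp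
  have BQ: "active_constants sg Qs \<subseteq> B" using B active_constants_prefix by blast
  show ?thesis
  proof (cases "degree P = 0")
    case True
    let ?c = "coeff P 0"
    have "sval_wf B (sval (sg ?c) (Val ?c))"
      by (rule sval_wf_sval) (use B True in \<open>auto simp: active_constants_def\<close>)
    then have "chain (\<lambda>_ _ cell. length cell = length (Qs @ [P])) (\<lambda>_. point_wf B (Qs @ [P])) (\<lambda>_ _ g. vkeys g \<subseteq> B) xs None None
        (map (\<lambda>cell. cell @ [sg ?c]) (cells tab)) (map (\<lambda>pt. pt @ [sval (sg ?c) (Val ?c)]) (points tab)) (gaps tab)"
      by (intro chain_map[OF ch]) (auto intro: point_wf_extend)
    then show ?thesis using True by (intro exI[of _ xs]) (simp add: tab_wf_def add_poly_def Let_def)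
  next
    case False
    then have P: "1 \<le> degree P" by simp
    define P_at where "P_at = map (sval_at_root Z sg Qs P) (points tab)"
    define f where "f = refine_interval sg Qs tab P P_at"
    have Pat: "sval_wf B (P_at ! k)" if "k < length xs" for k
      using sval_at_root_wf[OF cl BQ chain_point[OF ch that]] that len by (simp add: P_at_def)
    define ns where "ns k = (SOME ns. chain (\<lambda>_ _ cell. length cell = length (Qs @ [P])) (\<lambda>_. point_wf B (Qs @ [P])) (\<lambda>_ _ g. vkeys g \<subseteq> B)
       ns (lower None xs k) (upper xs None k) (fst (f k)) (fst (snd (f k))) (snd (snd (f k))))" for k
    have ns: "chain (\<lambda>_ _ cell. length cell = length (Qs @ [P])) (\<lambda>_. point_wf B (Qs @ [P])) (\<lambda>_ _ g. vkeys g \<subseteq> B)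
       (ns k) (lower None xs k) (upper xs None k) (fst (f k)) (fst (snd (f k))) (snd (snd (f k)))" if k: "k \<le> length xs" for k
    proof -
      have "\<exists>ns. chain (\<lambda>_ _ cell. length cell = length (Qs @ [P])) (\<lambda>_. point_wf B (Qs @ [P])) (\<lambda>_ _ g. vkeys g \<subseteq> B)
         ns (lower None xs k) (upper xs None k) (fst (f k)) (fst (snd (f k))) (snd (snd (f k)))"
        unfolding f_def by (rule refine_interval_wf[OF tab cl P BQ]) (use Pat k in auto)
      from someI_ex[OF this] show ?thesis unfolding ns_def .
    qed
    let ?olds = "map2 (\<lambda>pt e. pt @ [e]) (points tab) P_at"
    have lenP: "length P_at = length xs" by (simp add: P_at_def len)
    have "\<exists>ys. chain (\<lambda>_ _ cell. length cell = length (Qs @ [P])) (\<lambda>_. point_wf B (Qs @ [P])) (\<lambda>_ _ g. vkeys g \<subseteq> B) ys None None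
        (concat (map (\<lambda>k. fst (f k)) [0..<Suc (length xs)]))
        (concat (map2 (@) ([] # map (\<lambda>p. [p]) ?olds) (map (\<lambda>k. fst (snd (f k))) [0..<Suc (length xs)])))
        (concat (map (\<lambda>k. snd (snd (f k))) [0..<Suc (length xs)])) \<and>
      set ys = set xs \<union> (\<Union>k\<le>length xs. set (ns k))"
    proof (rule chain_concat)
      show "point_wf B (Qs @ [P]) (?olds ! k)" if "k < length xs" for k
        using point_wf_extend[OF chain_point[OF ch that] Pat[OF that]] that len lenP by simp
    qed (use ns len lenP in auto)
    moreover have old: "map (\<lambda>p. [p]) ?olds = map2 (\<lambda>pt e. [pt @ [e]]) (points tab) P_at" by (simp add: case_prod_unfold)
    have tabdef: "add_poly Z sg Qs tab P = VTab (concat (map (\<lambda>k. fst (f k)) [0..<Suc (length xs)]))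
        (concat (map2 (@) ([] # map (\<lambda>p. [p]) ?olds) (map (\<lambda>k. fst (snd (f k))) [0..<Suc (length xs)])))
        (concat (map (\<lambda>k. snd (snd (f k))) [0..<Suc (length xs)]))"
      unfolding add_poly_def Let_def old using False
      by (simp add: len f_def P_at_def comp_def del: upt_Suc)
    ultimately show ?thesis unfolding tab_wf_def tabdef vtab.sel by blast
  qed
qed

lemma rcvf2_wf:
  "closed_family Z Ps \<Longrightarrow> active_constants sg Ps \<subseteq> B \<Longrightarrow> \<exists>xs. tab_wf B Ps (rcvf2 Z sg Ps) xs"
proof (induction Ps rule: rev_induct)
  case Nil
  show ?case by (rule exI[of _ "[]"]) (simp add: tab_wf_def rcvf2_def gap_list_def)
next
  case (snoc P Ps)
  have "active_constants sg Ps \<subseteq> B" using snoc.prems(2) active_constants_prefix by blast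
  then obtain xs where "tab_wf B Ps (rcvf2 Z sg Ps) xs"
    using snoc.IH[OF closed_family_prefix[OF snoc.prems(1)]] by blast
  then show ?case using add_poly_wf snoc.prems unfolding rcvf2_snoc by blast
qed

text \<open>A postcondition \<open>Q\<close> on the results combined with a bound \<open>B\<close>
  on the constants tested. It excludes nodes of the other kinds and is composed along the program by
  \<open>val_tree_bind\<close>.\<close>

primrec val_tree :: "'c set \<Rightarrow> ('a \<Rightarrow> bool) \<Rightarrow> ('c, 'a) dtree \<Rightarrow> bool" where
  "val_tree B Q (Result x) = Q x"
| "val_tree B Q (IfZero c t u) = False"
| "val_tree B Q (CaseSign c t u s) = False"
| "val_tree B Q (CaseVal \<mu> t u s) =
     (Poly_Mapping.keys \<mu> \<subseteq> B \<and> val_tree B Q t \<and> val_tree B Q u \<and> val_tree B Q s)"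

lemma val_tree_bind:
  "val_tree B Q t \<Longrightarrow> (\<And>x. Q x \<Longrightarrow> val_tree B Q' (f x)) \<Longrightarrow> val_tree B Q' (bind_dtree t f)"
  by (induction t) auto

lemma val_tree_weaken: "val_tree B Q t \<Longrightarrow> (\<And>x. Q x \<Longrightarrow> Q' x) \<Longrightarrow> val_tree B Q' t"
  by (induction t) auto

lemma val_tree_mapT:
  "(\<And>x. x \<in> set xs \<Longrightarrow> val_tree B Q (f x)) \<Longrightarrow> val_tree B (\<lambda>ys. \<forall>y\<in>set ys. Q y) (mapT f xs)"
proof (induction xs)
  case (Cons x xs)
  have x: "val_tree B Q (f x)" by (rule Cons.prems) simp
  have xs: "val_tree B (\<lambda>ys. \<forall>y\<in>set ys. Q y) (mapT f xs)" by (rule Cons.IH) (simp add: Cons.prems)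
  show ?case unfolding mapT.simps by (rule val_tree_bind[OF x], rule val_tree_bind[OF xs]) simp
qed simp

lemma val_tree_val_tests: "val_tree B Q t \<Longrightarrow> \<mu> \<in> val_tests t \<Longrightarrow> Poly_Mapping.keys \<mu> \<subseteq> B"
  by (induction t) auto

lemma val_tree_run_cong:
  "val_tree B Q t \<Longrightarrow> (\<And>\<mu>. \<mu> \<in> val_tests t \<Longrightarrow> sign (value_comb v \<rho> \<mu>) = sign (value_comb v \<rho>' \<mu>)) \<Longrightarrow>
    run v \<rho> t = run v \<rho>' t"
proof (induction t)
  case (CaseVal \<mu> t1 t2 t3)
  have "sign (value_comb v \<rho> \<mu>) = sign (value_comb v \<rho>' \<mu>)" by (rule CaseVal.prems(2)) simp
  then have "value_comb v \<rho> \<mu> < 0 \<longleftrightarrow> value_comb v \<rho>' \<mu> < 0" "value_comb v \<rho> \<mu> = 0 \<longleftrightarrow> value_comb v \<rho>' \<mu> = 0"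
    by (metis sign_eq_iffs(2), metis sign_eq_0_iff)
  moreover have "run v \<rho> t1 = run v \<rho>' t1" "run v \<rho> t2 = run v \<rho>' t2" "run v \<rho> t3 = run v \<rho>' t3"
    using CaseVal by auto
  ultimately show ?case by simp
qed auto

section \<open>Constants tested by RCVF3\<close>

lemma keys_plus_subset: "Poly_Mapping.keys l \<subseteq> B \<Longrightarrow> Poly_Mapping.keys m \<subseteq> B \<Longrightarrow> Poly_Mapping.keys (l + m) \<subseteq> B"
  using keys_add[of l m] by blast

lemma keys_minus_subset:
  fixes l m :: "'a \<Rightarrow>\<^sub>0 'b::ab_group_add"
  shows "Poly_Mapping.keys l \<subseteq> B \<Longrightarrow> Poly_Mapping.keys m \<subseteq> B \<Longrightarrow> Poly_Mapping.keys (l - m) \<subseteq> B"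
proof
  fix t assume *: "Poly_Mapping.keys l \<subseteq> B" "Poly_Mapping.keys m \<subseteq> B" "t \<in> Poly_Mapping.keys (l - m)"
  then have "t \<in> Poly_Mapping.keys l \<or> t \<in> Poly_Mapping.keys m"
    unfolding in_keys_iff lookup_minus by (metis diff_0_right)
  then show "t \<in> B" using * by blast
qed

lemma keys_scale_subset: "Poly_Mapping.keys l \<subseteq> B \<Longrightarrow> Poly_Mapping.keys (scale_lin q l) \<subseteq> B"
  by (auto simp: in_keys_iff subset_iff Poly_Mapping.map.rep_eq when_def split: if_splits)

definition lin_in :: "'c set \<Rightarrow> 'c lin \<Rightarrow> bool" where
  "lin_in B l \<longleftrightarrow> Poly_Mapping.keys l \<subseteq> B"

definition xlin_in :: "'c set \<Rightarrow> 'c xlin \<Rightarrow> bool" where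
  "xlin_in B x \<longleftrightarrow> lin_in B (fst x)"

lemma lin_in_intros:
  "lin_in B 0" "lin_in B l \<Longrightarrow> lin_in B m \<Longrightarrow> lin_in B (l + m)" "lin_in B l \<Longrightarrow> lin_in B m \<Longrightarrow> lin_in B (l - m)"
  "lin_in B l \<Longrightarrow> lin_in B (scale_lin q l)"
  by (auto simp: lin_in_def keys_plus_subset keys_minus_subset keys_scale_subset)

lemma xlin_in_pair: "lin_in B l \<Longrightarrow> xlin_in B (l, q)"
  by (simp add: xlin_in_def)

lemma xlin_in_intros:
  "xlin_in B 0" "xlin_in B x \<Longrightarrow> xlin_in B y \<Longrightarrow> xlin_in B (x + y)"
  "xlin_in B x \<Longrightarrow> xlin_in B y \<Longrightarrow> xlin_in B (x - y)" "xlin_in B x \<Longrightarrow> xlin_in B (scale_xlin q x)"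
  "xlin_in B f \<Longrightarrow> xlin_in B x \<Longrightarrow> xlin_in B (apply_affine f x)"
  by (auto simp: xlin_in_def apply_affine_def lin_in_intros)

lemma xlin_in_sum_list: "(\<And>x. x \<in> set xs \<Longrightarrow> xlin_in B x) \<Longrightarrow> xlin_in B (sum_list xs)"
  by (induction xs) (auto intro: xlin_in_intros)

lemma xlin_in_comb:
  "\<forall>x\<in>set xs. xlin_in B x \<Longrightarrow> xlin_in B (\<Sum>(l, x)\<leftarrow>zip \<mu> xs. scale_xlin (of_int l) x)"
  by (rule xlin_in_sum_list) (auto dest!: set_zip_rightD intro: xlin_in_intros(4))

lemma keys_clear_denominators: "Poly_Mapping.keys (clear_denominators l) \<subseteq> Poly_Mapping.keys l"
  unfolding clear_denominators_def Let_def by (auto simp: in_keys_iff Poly_Mapping.map.rep_eq when_def split: if_splits)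

lemma val_tree_ask: "lin_in B l \<Longrightarrow> val_tree B (\<lambda>_. True) (ask l)"
  using keys_clear_denominators[of l] by (auto simp: ask_def lin_in_def)

lemma val_tree_ask_ext: "xlin_in B x \<Longrightarrow> val_tree B (\<lambda>_. True) (ask_ext x)"
  by (simp add: ask_ext_def val_tree_ask xlin_in_def)

lemma val_tree_resolve: "vkeys e \<subseteq> B \<Longrightarrow> val_tree B (lin_in B) (resolve e)"
proof (induction e)
  case (VMin e f)
  then have e: "val_tree B (lin_in B) (resolve e)" and f: "val_tree B (lin_in B) (resolve f)" by auto
  show ?case unfolding resolve.simps
    by (rule val_tree_bind[OF e], rule val_tree_bind[OF f], rule val_tree_bind[OF val_tree_ask])
      (auto intro: lin_in_intros)
next
  case (VMax e f)
  then have e: "val_tree B (lin_in B) (resolve e)" and f: "val_tree B (lin_in B) (resolve f)" by auto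
  show ?case unfolding resolve.simps
    by (rule val_tree_bind[OF e], rule val_tree_bind[OF f], rule val_tree_bind[OF val_tree_ask])
      (auto intro: lin_in_intros)
next
  case (VAdd e f)
  then have e: "val_tree B (lin_in B) (resolve e)" and f: "val_tree B (lin_in B) (resolve f)" by auto
  show ?case unfolding resolve.simps
    by (rule val_tree_bind[OF e], rule val_tree_bind[OF f]) (auto intro: lin_in_intros)
next
  case (VScale q e)
  then have e: "val_tree B (lin_in B) (resolve e)" by auto
  show ?case unfolding resolve.simps by (rule val_tree_bind[OF e]) (auto intro: lin_in_intros)
qed (simp add: lin_in_def)

lemma val_tree_active_piece:
  "\<forall>f\<in>set fs. xlin_in B f \<Longrightarrow> xlin_in B \<tau> \<Longrightarrow> val_tree B (xlin_in B) (active_piece \<tau> fs)"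
proof (induction \<tau> fs rule: active_piece.induct)
  case (3 \<tau> f f' fs)
  have IH: "val_tree B (xlin_in B) (active_piece \<tau> (f' # fs))" using 3 by simp
  show ?case unfolding active_piece.simps
    by (rule val_tree_bind[OF IH], rule val_tree_bind[OF val_tree_ask_ext]) (use 3 in \<open>auto intro: xlin_in_intros\<close>)
qed (auto simp: xlin_in_def lin_in_def)

lemma val_tree_system_of: "\<forall>x\<in>set xs. xlin_in B x \<Longrightarrow> val_tree B (\<lambda>_. True) (system_of M signs xs)"
proof -
  assume xs: "\<forall>x\<in>set xs. xlin_in B x"
  have "val_tree B (\<lambda>ys. \<forall>y\<in>set ys. True)
      (mapT (\<lambda>\<mu>. ask_ext (\<Sum>(l, x)\<leftarrow>zip \<mu> xs. scale_xlin (of_int l) x)) (exponent_vectors M (length xs)))"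
    by (rule val_tree_mapT, rule val_tree_ask_ext, rule xlin_in_comb[OF xs])
  then show ?thesis unfolding system_of_def by (rule val_tree_bind) simp
qed

lemma val_tree_system_at_point:
  assumes "\<forall>s\<in>set svs. sval_wf B s" shows "val_tree B (\<lambda>_. True) (system_at_point M svs)"
proof -
  have "vkeys e \<subseteq> B" if e: "e \<in> set (List.map_filter snd svs)" for e
  proof -
    obtain s where "s \<in> set svs" "snd s = Some e" using e by (fastforce simp: List.map_filter_def)
    then show ?thesis using assms by (auto simp: sval_wf_def)
  qed
  then have "val_tree B (\<lambda>ys. \<forall>y\<in>set ys. lin_in B y) (mapT resolve (List.map_filter snd svs))"
    by (intro val_tree_mapT val_tree_resolve)
  then show ?thesis unfolding system_at_point_def
    by (rule val_tree_bind) (auto intro!: val_tree_system_of xlin_in_pair)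
qed

lemma val_tree_system_at_sample:
  assumes "\<forall>f\<in>set fs. \<forall>g\<in>set f. xlin_in B g" "xlin_in B \<tau>"
  shows "val_tree B (\<lambda>_. True) (system_at_sample M signs fs \<tau>)"
proof -
  have "val_tree B (\<lambda>ys. \<forall>y\<in>set ys. xlin_in B y) (mapT (active_piece \<tau>) fs)"
    by (rule val_tree_mapT, rule val_tree_active_piece) (use assms in auto)
  then show ?thesis unfolding system_at_sample_def
    by (rule val_tree_bind) (auto intro!: val_tree_system_of xlin_in_intros assms(2))
qed

lemma val_tree_break_points:
  assumes fs: "\<forall>f\<in>set fs. xlin_in B f"
  shows "val_tree B (\<lambda>bs. \<forall>b\<in>set bs. lin_in B b) (break_points fs)"
proof -
  let ?P = "[(f, g). f \<leftarrow> fs, g \<leftarrow> fs, snd f < snd g]"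
  let ?\<beta> = "\<lambda>f g. scale_lin (1 / (snd g - snd f)) (fst f - fst g)"
  let ?body = "\<lambda>(f, g). let \<beta> = ?\<beta> f g in
           bind_dtree (active_piece (\<beta>, 0) fs) (\<lambda>h.
             bind_dtree (ask_ext (apply_affine f (\<beta>, 0) - apply_affine h (\<beta>, 0))) (\<lambda>s. Result (if s = 0 then [\<beta>] else [])))"
  have "val_tree B (\<lambda>bs. \<forall>b\<in>set bs. lin_in B b) (?body p)" if p: "p \<in> set ?P" for p
  proof -
    obtain f g where fg: "p = (f, g)" "xlin_in B f" "xlin_in B g" using p fs by auto
    have \<beta>: "lin_in B (?\<beta> f g)" using fg by (auto simp: xlin_in_def intro: lin_in_intros)
    show ?thesis unfolding fg(1) prod.case Let_def
      by (rule val_tree_bind[OF val_tree_active_piece[OF fs xlin_in_pair[OF \<beta>]]],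
          rule val_tree_bind[OF val_tree_ask_ext]) (auto intro: xlin_in_intros xlin_in_pair \<beta> fg)
  qed
  then have "val_tree B (\<lambda>bss. \<forall>bs\<in>set bss. \<forall>b\<in>set bs. lin_in B b) (mapT ?body ?P)"
    by (rule val_tree_mapT)
  then show ?thesis unfolding break_points_def by (rule val_tree_bind) auto
qed

lemma val_tree_insert_point:
  "lin_in B b \<Longrightarrow> \<forall>c\<in>set cs. lin_in B c \<Longrightarrow> val_tree B (\<lambda>bs. \<forall>b\<in>set bs. lin_in B b) (insert_point b cs)"
proof (induction cs)
  case (Cons c cs)
  have IH: "val_tree B (\<lambda>bs. \<forall>b\<in>set bs. lin_in B b) (insert_point b cs)" using Cons by simp
  have ask: "val_tree B (\<lambda>_. True) (ask (b - c))" using Cons.prems by (intro val_tree_ask lin_in_intros) auto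
  have "val_tree B (\<lambda>bs. \<forall>b\<in>set bs. lin_in B b) (bind_dtree (insert_point b cs) (\<lambda>cs'. Result (c # cs')))"
    by (rule val_tree_bind[OF IH]) (use Cons.prems in auto)
  then show ?case unfolding insert_point.simps
    by (intro val_tree_bind[OF ask]) (use Cons.prems in auto)
qed simp

abbreviation opt_in :: "'c set \<Rightarrow> 'c lin option \<Rightarrow> bool" where
  "opt_in B lo \<equiv> (\<forall>a. lo = Some a \<longrightarrow> lin_in B a)"

lemma val_tree_sort_between:
  "opt_in B lo \<Longrightarrow> opt_in B hi \<Longrightarrow> \<forall>b\<in>set bs. lin_in B b \<Longrightarrow>
    val_tree B (\<lambda>bs. \<forall>b\<in>set bs. lin_in B b) (sort_between lo hi bs)"
proof (induction bs)
  case (Cons b bs)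
  have IH: "val_tree B (\<lambda>bs. \<forall>b\<in>set bs. lin_in B b) (sort_between lo hi bs)" using Cons by simp
  have b: "lin_in B b" using Cons.prems by simp
  have l: "val_tree B (\<lambda>_. True) (case lo of None \<Rightarrow> Result 1 | Some a \<Rightarrow> ask (b - a))"
    using Cons.prems by (auto split: option.split intro!: val_tree_ask lin_in_intros)
  have h: "val_tree B (\<lambda>_. True) (case hi of None \<Rightarrow> Result 1 | Some c \<Rightarrow> ask (c - b))"
    using Cons.prems by (auto split: option.split intro!: val_tree_ask lin_in_intros)
  show ?case unfolding sort_between.simps
    by (rule val_tree_bind[OF IH], rule val_tree_bind[OF l], rule val_tree_bind[OF h])
      (auto intro: val_tree_insert_point b)
qed simp

lemma xlin_in_sample_between: "opt_in B lo \<Longrightarrow> opt_in B hi \<Longrightarrow> xlin_in B (sample_between lo hi)"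
  by (cases "(lo, hi)" rule: sample_between.cases) (auto intro!: xlin_in_pair lin_in_intros)

lemma xlin_in_samples:
  "opt_in B lo \<Longrightarrow> \<forall>b\<in>set bs. lin_in B b \<Longrightarrow> x \<in> set (samples lo bs) \<Longrightarrow> xlin_in B x"
proof (induction lo bs rule: samples.induct)
  case (2 lo b bs)
  then show ?case using xlin_in_sample_between[of lo B "Some b"] by (auto intro: xlin_in_pair)
qed (auto intro: xlin_in_sample_between)

lemma lin_in_zeros_of_combinations:
  assumes "\<forall>f\<in>set fs. xlin_in B f" "z \<in> set (zeros_of_combinations M fs)" shows "lin_in B z"
proof -
  obtain \<mu> where "z = scale_lin (- 1 / snd (\<Sum>(l, f)\<leftarrow>zip \<mu> fs. scale_xlin (of_int l) f)) (fst (\<Sum>(l, f)\<leftarrow>zip \<mu> fs. scale_xlin (of_int l) f))"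
    using assms(2) by (auto simp: zeros_of_combinations_def split: if_splits)
  then show ?thesis using xlin_in_comb[OF assms(1), of \<mu>] by (simp add: xlin_in_def lin_in_intros)
qed

text \<open>Break points, zeros and samples are built from linear forms over \<open>B\<close> by
  rational operations, so all comparisons among them are tests over \<open>B\<close>.\<close>

lemma val_tree_partition_of:
  assumes fs: "\<forall>f\<in>set fs. \<forall>g\<in>set f. xlin_in B g" and lo: "opt_in B lo"
  shows "val_tree B (\<lambda>_. True) (partition_of M lo signs fs)"
proof -
  have 1: "val_tree B (\<lambda>bss. \<forall>bs\<in>set bss. \<forall>b\<in>set bs. lin_in B b) (mapT break_points fs)"
    by (rule val_tree_mapT, rule val_tree_break_points) (use fs in auto)
  have 3: "val_tree B (\<lambda>zss. \<forall>zs\<in>set zss. \<forall>z\<in>set zs. lin_in B z)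
      (mapT (\<lambda>(l, h). bind_dtree (mapT (active_piece (sample_between l h)) fs)
          (\<lambda>gs. sort_between l h (zeros_of_combinations M gs))) (open_pieces lo bs))"
    if bs: "\<forall>b\<in>set bs. lin_in B b" for bs
  proof (rule val_tree_mapT)
    fix p assume p: "p \<in> set (open_pieces lo bs)"
    obtain l h where lh: "p = (l, h)" by (cases p)
    have l: "opt_in B l" "opt_in B h"
    proof -
      have "l \<in> set (lo # map Some bs)" "h \<in> set (map Some bs @ [None])"
        using p unfolding lh open_pieces_def by (rule set_zip_leftD, rule set_zip_rightD)
      then show "opt_in B l" "opt_in B h" using lo bs by auto
    qed
    have "val_tree B (\<lambda>ys. \<forall>y\<in>set ys. xlin_in B y) (mapT (active_piece (sample_between l h)) fs)"
      by (rule val_tree_mapT, rule val_tree_active_piece) (use fs xlin_in_sample_between[OF l] in auto)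
    then show "val_tree B (\<lambda>zs. \<forall>z\<in>set zs. lin_in B z) ((\<lambda>(l, h). bind_dtree (mapT (active_piece (sample_between l h)) fs)
          (\<lambda>gs. sort_between l h (zeros_of_combinations M gs))) p)"
      unfolding lh prod.case
      by (rule val_tree_bind) (intro val_tree_sort_between l ballI lin_in_zeros_of_combinations; blast)
  qed
  have 4: "val_tree B (\<lambda>_. True) (mapT (system_at_sample M signs fs) (samples lo bs'))" if "\<forall>b\<in>set bs'. lin_in B b" for bs'
    by (rule val_tree_weaken[OF val_tree_mapT[of _ B "\<lambda>_. True"]], rule val_tree_system_at_sample[OF fs])
      (use xlin_in_samples[OF lo that] in auto)
  have 5: "\<forall>b\<in>set (concat (map2 (\<lambda>z b. z @ b) zs (map (\<lambda>b. [b]) bs @ [[]]))). lin_in B b"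
    if bz: "\<forall>b\<in>set bs. lin_in B b" "\<forall>z\<in>set zs. \<forall>b\<in>set z. lin_in B b" for zs bs
  proof
    fix c assume "c \<in> set (concat (map2 (\<lambda>z b. z @ b) zs (map (\<lambda>b. [b]) bs @ [[]])))"
    then obtain z b where zb: "(z, b) \<in> set (zip zs (map (\<lambda>b. [b]) bs @ [[]]))" "c \<in> set z \<or> c \<in> set b" by auto
    have "z \<in> set zs" "b \<in> set (map (\<lambda>b. [b]) bs @ [[]])"
      using set_zip_leftD[OF zb(1)] set_zip_rightD[OF zb(1)] by auto
    then show "lin_in B c" using zb(2) bz by auto
  qed
  show ?thesis unfolding partition_of_def Let_def
  proof (rule val_tree_bind[OF 1])
    fix cands assume "\<forall>bs\<in>set cands. \<forall>b\<in>set bs. lin_in B b"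
    then have c: "\<forall>b\<in>set (concat cands). lin_in B b" by simp
    have 2: "val_tree B (\<lambda>bs. \<forall>b\<in>set bs. lin_in B b) (sort_between lo None (concat cands))"
      by (rule val_tree_sort_between[OF lo _ c]) simp
    show "val_tree B (\<lambda>_. True) (bind_dtree (sort_between lo None (concat cands)) (\<lambda>bs.
        bind_dtree (mapT (\<lambda>(l, h). bind_dtree (mapT (active_piece (sample_between l h)) fs)
          (\<lambda>gs. sort_between l h (zeros_of_combinations M gs))) (open_pieces lo bs))
        (\<lambda>zs. mapT (system_at_sample M signs fs) (samples lo (concat (map2 (\<lambda>z b. z @ b) zs (map (\<lambda>b. [b]) bs @ [[]])))))))"
      by (rule val_tree_bind[OF 2], rule val_tree_bind[OF 3], assumption, rule 4, rule 5)
  qed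
qed

lemma val_tree_resolve_terms:
  assumes "\<forall>ts\<in>set tss. terms_wf B ts"
  shows "val_tree B (\<lambda>fs. \<forall>f\<in>set fs. \<forall>g\<in>set f. xlin_in B g) (resolve_terms tss)"
  unfolding resolve_terms_def
proof (rule val_tree_mapT, rule val_tree_mapT)
  fix ts t assume t: "ts \<in> set tss" "t \<in> set ts"
  obtain e k where ek: "t = (e, k)" by (cases t)
  have "vkeys e \<subseteq> B" using assms t unfolding ek terms_wf_def by blast
  then show "val_tree B (xlin_in B) ((\<lambda>(e, k). bind_dtree (resolve e) (\<lambda>l. Result (l, of_nat k))) t)"
    unfolding ek prod.case by (intro val_tree_bind[OF val_tree_resolve]) (auto intro: xlin_in_pair)
qed

lemma val_tree_bounded_interval:
  assumes cl: "closed_family Z Ps" and pa: "length pa = length Ps" "\<forall>s\<in>set pa. sval_wf B s"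
    and pb: "length pb = length Ps" "\<forall>s\<in>set pb. sval_wf B s" and \<delta>: "vkeys \<delta> \<subseteq> B"
  shows "val_tree B (\<lambda>_. True) (bounded_interval M Ps cell pa pb \<delta>)"
proof -
  let ?Fs = "filter (\<lambda>F. hd (derivs_data Ps cell F) \<noteq> 0) Ps"
  let ?terms = "\<lambda>F. taylor_terms (derivs_data Ps cell F) (derivs_data Ps pa F) (derivs_data Ps pb F) \<delta>"
  have "terms_wf B (?terms F)" if "F \<in> set Ps" for F
    by (rule terms_wf_taylor[OF _ \<delta>]) (use derivs_data_wf_nth[OF cl that pa] derivs_data_wf_nth[OF cl that pb] in simp)
  then have rt: "val_tree B (\<lambda>fs. \<forall>f\<in>set fs. \<forall>g\<in>set f. xlin_in B g) (resolve_terms (map ?terms ?Fs))"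
    by (intro val_tree_resolve_terms) auto
  have zero: "xlin_in B (0, 0)" "opt_in B (Some 0)" by (auto intro: xlin_in_pair lin_in_intros)
  have m2: "\<forall>f\<in>set (map2 (\<lambda>l f. if l then f else map (\<lambda>(e, k). (e, 0)) f) bs fs). \<forall>g\<in>set f. xlin_in B g"
    "\<forall>f\<in>set (map2 (\<lambda>l f. if l then map (\<lambda>(e, k). (e, 0)) f else f) bs fs). \<forall>g\<in>set f. xlin_in B g"
    if "\<forall>f\<in>set fs. \<forall>g\<in>set f. xlin_in B g" for fs bs
    using that by (auto simp: xlin_in_def dest!: set_zip_rightD split: if_splits) fastforce+
  show ?thesis unfolding bounded_interval_def Let_def
    by (rule val_tree_bind[OF rt], rule val_tree_bind[OF val_tree_system_at_sample[OF _ zero(1)]], assumption,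
        rule val_tree_bind[OF val_tree_partition_of[OF m2(1) zero(2)]], assumption,
        rule val_tree_bind[OF val_tree_partition_of[OF m2(2) zero(2)]], assumption) simp
qed

lemma val_tree_unbounded_interval:
  assumes cl: "closed_family Z Ps" and pa: "length pa = length Ps" "\<forall>s\<in>set pa. sval_wf B s"
  shows "val_tree B (\<lambda>_. True) (unbounded_interval M Ps cell pa)"
proof -
  let ?Fs = "filter (\<lambda>F. hd (derivs_data Ps cell F) \<noteq> 0) Ps"
  have "terms_wf B (unbounded_terms (derivs_data Ps pa F))" if "F \<in> set Ps" for F
    by (rule terms_wf_unbounded) (use point_wf_derivs[OF cl that pa] in blast)
  then have rt: "val_tree B (\<lambda>fs. \<forall>f\<in>set fs. \<forall>g\<in>set f. xlin_in B g)
      (resolve_terms (map (\<lambda>F. unbounded_terms (derivs_data Ps pa F)) ?Fs))"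
    by (intro val_tree_resolve_terms) auto
  show ?thesis unfolding unbounded_interval_def Let_def
    by (rule val_tree_bind[OF rt], rule val_tree_partition_of) auto
qed

lemma val_tree_complete_tableau:
  assumes cl: "closed_family Z Ps" and B: "active_constants sg Ps \<subseteq> B" and tab: "tab_wf B Ps tab xs"
  shows "val_tree B (\<lambda>_. True) (complete_tableau_tree M sg Ps tab)"
proof (cases "length (points tab) = 0")
  case True
  have "sval_wf B s" if s: "s \<in> set (svals_of_constants sg Ps)" for s
  proof -
    obtain F where F: "F \<in> set Ps" "s = (if degree F = 0 then sval (sg (coeff F 0)) (Val (coeff F 0)) else (0, None))"
      using s by (auto simp: svals_of_constants_def)
    have "coeff F 0 \<in> B" if "degree F = 0" "sg (coeff F 0) \<noteq> 0" using B F(1) that by (auto simp: active_constants_def)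
    then show ?thesis unfolding F(2) by (auto intro!: sval_wf_sval)
  qed
  then have "val_tree B (\<lambda>_. True) (system_at_point M (svals_of_constants sg Ps))"
    by (intro val_tree_system_at_point) blast
  then show ?thesis unfolding complete_tableau_tree_def Let_def using True
    by (simp add: val_tree_bind)
next
  case False
  have ch: "chain (\<lambda>_ _ cell. length cell = length Ps) (\<lambda>_. point_wf B Ps) (\<lambda>_ _ g. vkeys g \<subseteq> B)
     xs None None (cells tab) (points tab) (gaps tab)" using tab by (simp add: tab_wf_def)
  have len: "length (points tab) = length xs" using chain_lengths[OF ch] by simp
  have pt: "length p = length Ps \<and> (\<forall>s\<in>set p. sval_wf B s)" if "p \<in> set (points tab)" for p
    using that chain_point[OF ch] len by (auto simp: in_set_conv_nth point_wf_def)
  have gap: "vkeys (gaps tab ! k) \<subseteq> B" if "k < length (points tab) - 1" for k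
    using chain_gap[OF ch] that len by auto
  have 1: "val_tree B (\<lambda>_. True) (mapT (system_at_point M) (points tab))"
    by (rule val_tree_weaken[OF val_tree_mapT[of _ B "\<lambda>_. True"]], rule val_tree_system_at_point) (use pt in auto)
  have 2: "val_tree B (\<lambda>_. True) (mapT (\<lambda>k. bounded_interval M Ps (cells tab ! Suc k) (points tab ! k) (points tab ! Suc k)
      (gaps tab ! k)) [0..<length (points tab) - 1])"
  proof (rule val_tree_weaken[OF val_tree_mapT[of _ B "\<lambda>_. True"]])
    fix k assume "k \<in> set [0..<length (points tab) - 1]"
    then have k: "k < length (points tab) - 1" "points tab ! k \<in> set (points tab)" "points tab ! Suc k \<in> set (points tab)" by auto
    show "val_tree B (\<lambda>_. True) (bounded_interval M Ps (cells tab ! Suc k) (points tab ! k) (points tab ! Suc k) (gaps tab ! k))"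
      by (rule val_tree_bounded_interval[OF cl]) (use pt[OF k(2)] pt[OF k(3)] gap[OF k(1)] in auto)
  qed simp
  have ends: "hd (points tab) \<in> set (points tab)" "last (points tab) \<in> set (points tab)" using False by auto
  have 3: "val_tree B (\<lambda>_. True) (unbounded_interval M Ps c (hd (points tab)))"
    "val_tree B (\<lambda>_. True) (unbounded_interval M Ps c (last (points tab)))" for c
    using val_tree_unbounded_interval[OF cl] pt[OF ends(1)] pt[OF ends(2)] by auto
  show ?thesis unfolding complete_tableau_tree_def Let_def if_not_P[OF False]
    by (rule val_tree_bind[OF 1], rule val_tree_bind[OF 2], rule val_tree_bind[OF 3(1)], rule val_tree_bind[OF 3(2)]) simp
qed

section \<open>Piecewise linear functions\<close>

lemma run_bind: "run v \<rho> (bind_dtree t f) = run v \<rho> (f (run v \<rho> t))"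
  by (induction t) auto

lemma run_mapT: "run v \<rho> (mapT f xs) = map (\<lambda>x. run v \<rho> (f x)) xs"
  by (induction xs) (auto simp: run_bind)

lemma length_samples: "length (samples lo bs) = 2 * length bs + 1"
  by (induction lo bs rule: samples.induct) auto

lemma samples_even: "i \<le> length bs \<Longrightarrow> samples lo bs ! (2 * i) = sample_between (lower lo bs i) (upper bs None i)"
proof (induction lo bs arbitrary: i rule: samples.induct)
  case (2 lo b bs)
  then show ?case by (cases i) auto
qed simp

lemma samples_odd: "i < length bs \<Longrightarrow> samples lo bs ! (2 * i + 1) = (bs ! i, 0)"
proof (induction lo bs arbitrary: i rule: samples.induct)
  case (2 lo b bs)
  then show ?case by (cases i) auto
qed simp

text \<open>Recursive form of the interleaving of zeros and break points in
  \<open>partition_of\<close> (\<open>refined_eq\<close>), suited to induction.\<close>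

primrec refined :: "('p option \<Rightarrow> 'p option \<Rightarrow> 'p list) \<Rightarrow> 'p list \<Rightarrow> 'p option \<Rightarrow> 'p list" where
  "refined F [] lo = F lo None"
| "refined F (b # bs) lo = F lo (Some b) @ b # refined F bs (Some b)"

lemma refined_eq:
  "concat (map2 (\<lambda>z b. z @ b) (map (\<lambda>p. F (fst p) (snd p)) (open_pieces lo bs)) (map (\<lambda>b. [b]) bs @ [[]])) = refined F bs lo"
  by (induction bs arbitrary: lo) (auto simp: open_pieces_def)

definition comb :: "int list \<Rightarrow> 'g::ab_group_add list \<Rightarrow> 'g" where
  "comb \<mu> us = (\<Sum>(l, u)\<leftarrow>zip \<mu> us. zmult l u)"

lemma comb_map: "(\<Sum>(l, y)\<leftarrow>zip \<mu> ys. zmult l (h y)) = comb \<mu> (map h ys)"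
  by (simp add: comb_def zip_map2 comp_def case_prod_unfold)

context rcvf_point
begin

section \<open>Runs of the tests at a parameter point\<close>

abbreviation lv :: "'r coef lin \<Rightarrow> 'g" where "lv \<equiv> lval \<nu>"

abbreviation R :: "('r coef, 'a) dtree \<Rightarrow> 'a" where "R \<equiv> run v \<rho>"

lemma run_ask: "R (ask l) = sign (lv l)"
proof (cases "l = 0")
  case False
  have "sign (value_comb v \<rho> (clear_denominators l)) = sign (lv l)"
    unfolding value_comb_def by (rule sign_clear_denominators)
  then show ?thesis using False by (auto simp: ask_def sign_def split: if_splits)
qed (simp add: ask_def sign_def)

lemma lv_resolve: "lv (R (resolve e)) = veval \<nu> e"
  by (induction e) (auto simp: run_bind run_ask lval_add lval_diff lval_scale sign_eq_iffs min_def max_def)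

text \<open>One evaluation for both readings of a pair \<open>(l, k)\<close>: the element
  \<open>l + k \<Omega>\<close> with \<open>\<tau>\<close> for \<open>\<Omega>\<close>, and the
  affine function of slope \<open>k\<close> at \<open>\<tau>\<close>.\<close>

definition xval :: "'g \<Rightarrow> 'r coef xlin \<Rightarrow> 'g" where
  "xval \<tau> x = lv (fst x) + qmult (snd x) \<tau>"

lemma xval_add: "xval \<tau> (x + y) = xval \<tau> x + xval \<tau> y"
  by (simp add: xval_def lval_add qmult_add_left)

lemma xval_diff: "xval \<tau> (x - y) = xval \<tau> x - xval \<tau> y"
  by (simp add: xval_def lval_diff scale_left_diff_distrib)

lemma xval_scale: "xval \<tau> (scale_xlin q x) = qmult q (xval \<tau> x)"
  by (simp add: xval_def lval_scale qmult_add_right)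

lemma xval_apply: "xval \<tau> (apply_affine f x) = xval (xval \<tau> x) f"
  by (simp add: apply_affine_def xval_def lval_add lval_scale qmult_add_right)

lemma xval_const [simp]: "xval \<tau> (l, 0) = lv l"
  by (simp add: xval_def)

lemma xval_comb: "xval \<tau> (\<Sum>(l, x)\<leftarrow>zip \<mu> xs. scale_xlin (of_int l) x) = comb \<mu> (map (xval \<tau>) xs)"
proof -
  have "xval \<tau> (sum_list ys) = sum_list (map (xval \<tau>) ys)" for ys
    by (induction ys) (simp_all add: xval_add, simp add: xval_def)
  then show ?thesis
    by (simp add: comb_def zip_map2 comp_def case_prod_unfold xval_scale qmult_of_int)
qed

text \<open>Strictness needs a positive element of the group, supplied by
  \<open>ex_pos\<close>.\<close>

lemma eventually_greater: "\<forall>\<^sub>F \<Omega> in at_top. (c::'g) < \<Omega>"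
proof -
  obtain g :: 'g where g: "0 < g" using ex_pos by blast
  show ?thesis
    using eventually_ge_at_top[of "c + g"] by eventually_elim (use g in \<open>simp add: less_le_trans[of c "c + g"]\<close>)
qed

lemma at_top_witness: "\<forall>\<^sub>F \<Omega> in at_top. P (\<Omega>::'g) \<Longrightarrow> \<exists>\<Omega>. P \<Omega>"
  by (auto simp: eventually_at_top_linorder)

text \<open>The formal comparison looks first at the coefficient of \<open>\<Omega>\<close>. This is
  the sign taken by the expression once \<open>\<Omega>\<close> passes its zero, which is the
  threshold used in each case.\<close>

lemma run_ask_ext: "\<forall>\<^sub>F \<Omega> in at_top. R (ask_ext x) = sign (xval \<Omega> x)"
proof (cases "snd x" "0::rat" rule: linorder_cases)
  case equal
  then show ?thesis by (simp add: ask_ext_def run_ask xval_def)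
next
  case greater
  show ?thesis using eventually_greater[of "qmult (1 / snd x) (- lv (fst x))"]
  proof eventually_elim
    case (elim \<Omega>)
    then have "qmult (snd x) (qmult (1 / snd x) (- lv (fst x))) < qmult (snd x) \<Omega>"
      using qmult_less_cancel[OF greater] by blast
    then have "- lv (fst x) < qmult (snd x) \<Omega>" using greater by simp
    from add_strict_left_mono[OF this, of "lv (fst x)"] have "0 < xval \<Omega> x" by (simp add: xval_def)
    then show ?case using greater by (auto simp: ask_ext_def sign_def)
  qed
next
  case less
  show ?thesis using eventually_greater[of "qmult (1 / (- snd x)) (lv (fst x))"]
  proof eventually_elim
    case (elim \<Omega>)
    have "0 < - snd x" using less by simp
    then have "qmult (- snd x) (qmult (1 / (- snd x)) (lv (fst x))) < qmult (- snd x) \<Omega>"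
      using qmult_less_cancel elim by blast
    then have "lv (fst x) < - qmult (snd x) \<Omega>" using less by simp
    from add_strict_right_mono[OF this, of "qmult (snd x) \<Omega>"] have "xval \<Omega> x < 0" by (simp add: xval_def)
    then show ?case using less by (auto simp: ask_ext_def sign_def)
  qed
qed

definition mn :: "('r coef lin \<times> rat) list \<Rightarrow> 'g \<Rightarrow> 'g" where
  "mn fs \<tau> = Min (xval \<tau> ` set fs)"

lemma mn_le: "f \<in> set fs \<Longrightarrow> mn fs \<tau> \<le> xval \<tau> f"
  by (simp add: mn_def)

lemma mn_eqI: "f \<in> set fs \<Longrightarrow> (\<And>g. g \<in> set fs \<Longrightarrow> xval \<tau> f \<le> xval \<tau> g) \<Longrightarrow> xval \<tau> f = mn fs \<tau>"
  unfolding mn_def by (rule sym, rule Min_eqI) auto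

text \<open>The piece is selected by finitely many formal comparisons, each valid for large
  \<open>\<Omega>\<close>, hence all valid together for large \<open>\<Omega>\<close>.\<close>

lemma run_active_piece:
  "fs \<noteq> [] \<Longrightarrow> R (active_piece x fs) \<in> set fs \<and>
     (\<forall>\<^sub>F \<Omega> in at_top. xval (xval \<Omega> x) (R (active_piece x fs)) = mn fs (xval \<Omega> x))"
proof (induction x fs rule: active_piece.induct)
  case (3 x f f' fs)
  let ?g = "R (active_piece x (f' # fs))"
  have IH: "?g \<in> set (f' # fs)" "\<forall>\<^sub>F \<Omega> in at_top. xval (xval \<Omega> x) ?g = mn (f' # fs) (xval \<Omega> x)" using 3 by auto
  let ?s = "R (ask_ext (apply_affine f x - apply_affine ?g x))"
  have run: "R (active_piece x (f # f' # fs)) = (if ?s \<le> 0 then f else ?g)" by (simp add: run_bind)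
  have "\<forall>\<^sub>F \<Omega> in at_top. xval (xval \<Omega> x) (R (active_piece x (f # f' # fs))) = mn (f # f' # fs) (xval \<Omega> x)"
    using IH(2) run_ask_ext[of "apply_affine f x - apply_affine ?g x"]
  proof eventually_elim
    case (elim \<Omega>)
    have "mn (f # f' # fs) (xval \<Omega> x) = min (xval (xval \<Omega> x) f) (mn (f' # fs) (xval \<Omega> x))" by (simp add: mn_def)
    moreover have "?s \<le> 0 \<longleftrightarrow> xval (xval \<Omega> x) f \<le> xval (xval \<Omega> x) ?g"
      unfolding elim(2) sign_eq_iffs by (simp add: xval_diff xval_apply)
    ultimately show ?case unfolding run using elim(1) by (auto simp: min_def)
  qed
  then show ?case unfolding run using IH(1) by auto
qed (auto simp: mn_def)

lemma run_active_piece_const: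
  "fs \<noteq> [] \<Longrightarrow> xval (lv b) (R (active_piece (b, 0) fs)) = mn fs (lv b)"
  using at_top_witness[OF conjunct2[OF run_active_piece[of fs "(b, 0)"]]] by simp

definition sysv :: "nat \<Rightarrow> int list \<Rightarrow> ('r coef lin \<times> rat) list list \<Rightarrow> 'g \<Rightarrow> vsc" where
  "sysv M signs fs \<tau> = (signs, map (\<lambda>\<mu>. sign (comb \<mu> (map (\<lambda>f. mn f \<tau>) fs))) (exponent_vectors M (length fs)))"

lemma run_system_of:
  "\<forall>\<^sub>F \<Omega> in at_top. R (system_of M signs xs) =
     (signs, map (\<lambda>\<mu>. sign (comb \<mu> (map (xval \<Omega>) xs))) (exponent_vectors M (length xs)))"
proof -
  have "\<forall>\<^sub>F \<Omega> in at_top. \<forall>\<mu>\<in>set (exponent_vectors M (length xs)).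
      R (ask_ext (\<Sum>(l, x)\<leftarrow>zip \<mu> xs. scale_xlin (of_int l) x)) = sign (comb \<mu> (map (xval \<Omega>) xs))"
    using run_ask_ext by (intro eventually_ball_finite) (auto simp flip: xval_comb)
  then show ?thesis by eventually_elim (simp add: system_of_def run_bind run_mapT)
qed

lemma run_system_of_const:
  assumes "\<And>x. x \<in> set xs \<Longrightarrow> snd x = 0"
  shows "R (system_of M signs xs) =
     (signs, map (\<lambda>\<mu>. sign (comb \<mu> (map (\<lambda>x. lv (fst x)) xs))) (exponent_vectors M (length xs)))"
proof -
  have eq: "map (xval \<Omega>) xs = map (\<lambda>x. lv (fst x)) xs" for \<Omega>
    using assms by (simp add: xval_def)
  show ?thesis using at_top_witness[OF run_system_of[of M signs xs]] unfolding eq by blast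
qed

lemma run_system_at_sample:
  assumes "\<forall>f\<in>set fs. f \<noteq> []"
  shows "\<forall>\<^sub>F \<Omega> in at_top. R (system_at_sample M signs fs x) = sysv M signs fs (xval \<Omega> x)"
proof -
  have "\<forall>\<^sub>F \<Omega> in at_top. \<forall>f\<in>set fs. xval (xval \<Omega> x) (R (active_piece x f)) = mn f (xval \<Omega> x)"
    using run_active_piece assms by (intro eventually_ball_finite) auto
  then show ?thesis
    using run_system_of[of M signs "map (\<lambda>g. apply_affine g x) (map (\<lambda>f. R (active_piece x f)) fs)"]
  proof eventually_elim
    case (elim \<Omega>)
    have eq: "map (xval \<Omega>) (map (\<lambda>g. apply_affine g x) (map (\<lambda>f. R (active_piece x f)) fs)) = map (\<lambda>f. mn f (xval \<Omega> x)) fs"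
      using elim(1) by (simp add: xval_apply)
    show ?case unfolding system_at_sample_def run_bind run_mapT elim(2) eq sysv_def by simp
  qed
qed

lemma vsc_system_eq:
  "vsc_system v M ys = (map sign ys, map (\<lambda>\<mu>. sign (comb \<mu> (map w (filter (\<lambda>y. y \<noteq> 0) ys))))
     (exponent_vectors M (length (filter (\<lambda>y. y \<noteq> 0) ys))))"
  by (simp add: vsc_system_def Let_def comb_map)

lemma run_system_at_point:
  assumes "list_all2 sval_ok svs ys"
  shows "R (system_at_point M svs) = vsc_system v M ys"
proof -
  let ?es = "List.map_filter snd svs"
  have es: "map (veval \<nu>) ?es = map w (filter (\<lambda>y. y \<noteq> 0) ys)"
    using assms by (induction rule: list_all2_induct) (auto simp: sval_ok_def List.map_filter_simps)
  have sg: "map fst svs = map sign ys"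
    using assms by (induction rule: list_all2_induct) (auto simp: sval_ok_def)
  let ?xs = "map (\<lambda>l. (l, 0 :: rat)) (map (\<lambda>e. R (resolve e)) ?es)"
  have "R (system_of M (map fst svs) ?xs) =
     (map fst svs, map (\<lambda>\<mu>. sign (comb \<mu> (map (\<lambda>x. lv (fst x)) ?xs))) (exponent_vectors M (length ?xs)))"
    by (rule run_system_of_const) auto
  moreover have "map (\<lambda>x. lv (fst x)) ?xs = map w (filter (\<lambda>y. y \<noteq> 0) ys)"
    unfolding es[symmetric] by (simp add: lv_resolve)
  moreover have "length ?xs = length (filter (\<lambda>y. y \<noteq> 0) ys)" using arg_cong[OF es, of length] by simp
  ultimately show ?thesis by (simp add: system_at_point_def run_bind run_mapT vsc_system_eq sg)
qed

text \<open>The crossing \<open>\<beta>\<close> of the two functions has value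
  \<open>\<tau>\<close>; as both attain the minimum there, it passes the test of
  \<open>break_points\<close>.\<close>

lemma break_points_complete:
  assumes fg: "f \<in> set fs" "g \<in> set fs" "snd f < snd g" and \<tau>: "xval \<tau> f = mn fs \<tau>" "xval \<tau> g = mn fs \<tau>"
  shows "\<exists>b\<in>set (R (break_points fs)). lv b = \<tau>"
proof -
  define \<beta> where "\<beta> = scale_lin (1 / (snd g - snd f)) (fst f - fst g)"
  have "lv (fst f) - lv (fst g) = qmult (snd g - snd f) \<tau>"
    using \<tau> by (simp add: xval_def scale_left_diff_distrib algebra_simps)
  then have \<beta>\<tau>: "lv \<beta> = \<tau>" using fg(3) by (simp add: \<beta>_def lval_scale lval_diff)
  have ne: "fs \<noteq> []" using fg(1) by auto
  let ?h = "R (active_piece (\<beta>, 0) fs)"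
  have h: "xval \<tau> ?h = mn fs \<tau>" using run_active_piece_const[OF ne, of \<beta>] by (simp add: \<beta>\<tau>)
  obtain \<Omega> where "R (ask_ext (apply_affine f (\<beta>, 0) - apply_affine ?h (\<beta>, 0))) =
      sign (xval \<Omega> (apply_affine f (\<beta>, 0) - apply_affine ?h (\<beta>, 0)))"
    using at_top_witness[OF run_ask_ext] by blast
  then have s: "R (ask_ext (apply_affine f (\<beta>, 0) - apply_affine ?h (\<beta>, 0))) = 0"
    by (simp add: xval_diff xval_apply \<beta>\<tau> h \<tau>)
  have "(f, g) \<in> set [(f, g). f \<leftarrow> fs, g \<leftarrow> fs, snd f < snd g]" using fg by auto
  moreover have "\<beta> \<in> set (R ((\<lambda>(f, g). let \<beta> = scale_lin (1 / (snd g - snd f)) (fst f - fst g) in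
           bind_dtree (active_piece (\<beta>, 0) fs) (\<lambda>h.
             bind_dtree (ask_ext (apply_affine f (\<beta>, 0) - apply_affine h (\<beta>, 0))) (\<lambda>s. Result (if s = 0 then [\<beta>] else [])))) (f, g)))"
    unfolding prod.case Let_def \<beta>_def[symmetric] by (simp add: run_bind s)
  ultimately have "\<beta> \<in> set (R (break_points fs))"
    unfolding break_points_def run_bind run_mapT run.simps set_concat set_map by blast
  then show ?thesis using \<beta>\<tau> by blast
qed

text \<open>Moving away from a point \<open>s\<close> where \<open>f\<close> attains the minimum, \<open>f\<close> ceases to do so only at the nearest
  of its crossings with other functions, and there the minimum is attained with two slopes.\<close>

lemma minimal_piece_persists:
  assumes fs: "f \<in> set fs" and s: "s \<in> I" "xval s f = mn fs s"
    and convex: "\<And>x y z. x \<in> I \<Longrightarrow> z \<in> I \<Longrightarrow> x \<le> y \<Longrightarrow> y \<le> z \<Longrightarrow> y \<in> I"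
    and nobreak: "\<And>\<tau> g h. \<tau> \<in> I \<Longrightarrow> g \<in> set fs \<Longrightarrow> h \<in> set fs \<Longrightarrow> snd g < snd h \<Longrightarrow>
      xval \<tau> g = mn fs \<tau> \<Longrightarrow> xval \<tau> h = mn fs \<tau> \<Longrightarrow> False"
    and t: "t \<in> I"
  shows "xval t f = mn fs t"
proof (rule ccontr)
  assume neq: "xval t f \<noteq> mn fs t"
  \<comment> \<open>The way from \<open>s\<close> to \<open>t\<close> is parametrized by the
    distance \<open>y\<close> from \<open>s\<close>, so that both directions are covered by one
    argument; \<open>b h\<close> is the rate of change of \<open>h - f\<close> along it.\<close>
  define \<epsilon> :: rat where "\<epsilon> = (if s \<le> t then 1 else -1)"
  define d where "d h x = xval x h - xval x f" for h x
  define b where "b h = \<epsilon> * (snd h - snd f)" for h :: "'r coef lin \<times> rat"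
  define pos where "pos y = s + qmult \<epsilon> y" for y
  have d: "d h (pos y) = d h s + qmult (b h) y" for h y
    unfolding d_def pos_def b_def xval_def
    by (simp add: qmult_add_right scale_left_diff_distrib right_diff_distrib algebra_simps)
  define T where "T = (if s \<le> t then t - s else s - t)"
  have tT: "pos T = t" by (auto simp: pos_def T_def \<epsilon>_def)
  have ds: "0 \<le> d h s" if "h \<in> set fs" for h using mn_le[OF that, of s] s(2) by (simp add: d_def)
  define G where "G = {h \<in> set fs. d h t < 0}"
  have "G \<noteq> {}"
  proof
    assume "G = {}"
    then have "\<not> d g t < 0" if "g \<in> set fs" for g using that unfolding G_def by blast
    then have "xval t f \<le> xval t g" if "g \<in> set fs" for g using that by (simp add: d_def not_less)
    then show False using neq mn_eqI[OF fs] by blast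
  qed
  \<comment> \<open>The distance at which \<open>h\<close> crosses \<open>f\<close>, for the
    functions in \<open>G\<close>, which lie below \<open>f\<close> at \<open>t\<close>.\<close>
  define c where "c h = qmult (- 1 / b h) (d h s)" for h
  have G: "b h < 0" "0 \<le> c h" "c h \<le> T" "d h (pos (c h)) = 0" "\<And>y. y \<le> c h \<Longrightarrow> 0 \<le> d h (pos y)" if h: "h \<in> G" for h
  proof -
    have hf: "h \<in> set fs" and neg: "d h s + qmult (b h) T < 0" using h d[of h T] by (auto simp: G_def tT)
    have T0: "0 \<le> T" by (auto simp: T_def)
    show b: "b h < 0"
    proof (rule ccontr)
      assume "\<not> b h < 0"
      then have "0 \<le> qmult (b h) T" using qmult_mono_left[of 0 "b h" T] T0 by simp
      then show False using neg ds[OF hf] by (simp add: add_nonneg_nonneg leD)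
    qed
    have p: "0 < - b h" "0 < - 1 / b h" using b by (simp_all add: field_simps)
    have bc: "qmult (b h) (c h) = - d h s" using b by (simp add: c_def)
    show "0 \<le> c h" using qmult_le_cancel[OF p(2), of 0 "d h s"] ds[OF hf] by (simp add: c_def)
    show "d h (pos (c h)) = 0" by (simp add: d bc)
    have mono: "0 \<le> d h (pos y)" if "y \<le> c h" for y
    proof -
      have "qmult (- b h) y \<le> qmult (- b h) (c h)" using qmult_le_cancel[OF p(1)] that by blast
      then have "- qmult (b h) y \<le> d h s" by (simp add: bc)
      from add_right_mono[OF this, of "qmult (b h) y"] show ?thesis by (simp add: d)
    qed
    then show "\<And>y. y \<le> c h \<Longrightarrow> 0 \<le> d h (pos y)" .
    show "c h \<le> T"
    proof (rule ccontr)
      assume "\<not> c h \<le> T"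
      then have "0 \<le> d h (pos T)" by (intro mono) simp
      then show False using neg by (simp add: d)
    qed
  qed
  have finG: "finite G" by (simp add: G_def)
  obtain g where g: "g \<in> G" "\<And>h. h \<in> G \<Longrightarrow> c g \<le> c h"
    using arg_min_if_finite[OF finG \<open>G \<noteq> {}\<close>, of c] by (metis not_le)
  let ?y = "c g" let ?x = "pos ?y"
  have xI: "?x \<in> I"
  proof (cases "s \<le> t")
    case True
    then have "T = t - s" "\<epsilon> = 1" by (auto simp: T_def \<epsilon>_def)
    then have x: "?x = s + c g" and "s + T = t" by (auto simp: pos_def)
    then have "s + c g \<le> t" using add_left_mono[OF G(3)[OF g(1)], of s] by simp
    then show ?thesis unfolding x using G(2)[OF g(1)] by (intro convex[OF s(1) t]) simp_all
  next
    case False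
    then have "T = s - t" "\<epsilon> = -1" by (auto simp: T_def \<epsilon>_def)
    then have x: "?x = s - c g" and "s - T = t" by (auto simp: pos_def)
    then have "t \<le> s - c g" using diff_left_mono[OF G(3)[OF g(1)], of s] by simp
    then show ?thesis unfolding x using G(2)[OF g(1)] by (intro convex[OF t s(1)]) simp_all
  qed
  \<comment> \<open>Before its own crossing a function of \<open>G\<close> is still above
    \<open>f\<close>. For \<open>h\<close> outside \<open>G\<close> the difference is affine along
    the way and nonnegative at both ends, hence in between.\<close>
  have "0 \<le> d h ?x" if h: "h \<in> set fs" for h
  proof (cases "h \<in> G")
    case True
    then show ?thesis using G(5) g(2) by blast
  next
    case False
    then have "0 \<le> d h s + qmult (b h) T" using h d[of h T] by (auto simp: G_def tT)
    moreover have "qmult (b h) T \<le> qmult (b h) ?y \<or> 0 \<le> qmult (b h) ?y"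
    proof (cases "b h < 0")
      case True
      then have "qmult (- b h) ?y \<le> qmult (- b h) T" using qmult_le_cancel[of "- b h" ?y T] G(3)[OF g(1)] by simp
      then show ?thesis by simp
    next
      case False
      then show ?thesis using qmult_mono_left[of 0 "b h" ?y] G(2)[OF g(1)] by simp
    qed
    ultimately show ?thesis unfolding d using ds[OF h]
      by (meson add_left_mono add_nonneg_nonneg order_trans)
  qed
  then have min: "xval ?x f = mn fs ?x" by (intro mn_eqI[OF fs]) (simp add: d_def)
  moreover have gmin: "xval ?x g = mn fs ?x" using min G(4)[OF g(1)] by (simp add: d_def)
  moreover have "snd f \<noteq> snd g" using G(1)[OF g(1)] by (auto simp: b_def)
  moreover have "g \<in> set fs" using g(1) by (simp add: G_def)
  ultimately show False using nobreak[OF xI fs, of g] nobreak[OF xI _ fs, of g] by (metis linorder_neqE)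
qed

abbreviation lvo :: "'r coef lin option \<Rightarrow> 'g option" where "lvo \<equiv> map_option lv"

section \<open>Sorting and refining the break points\<close>

lemma run_insert_point:
  "sorted_wrt (\<lambda>a b. lv a < lv b) cs \<Longrightarrow>
    sorted_wrt (\<lambda>a b. lv a < lv b) (R (insert_point b cs)) \<and> lv ` set (R (insert_point b cs)) = insert (lv b) (lv ` set cs)"
proof (induction cs)
  case (Cons c cs)
  have s: "R (ask (b - c)) = sign (lv b - lv c)" by (simp add: run_ask lval_diff)
  have IH: "sorted_wrt (\<lambda>a b. lv a < lv b) (R (insert_point b cs))"
    "lv ` set (R (insert_point b cs)) = insert (lv b) (lv ` set cs)" using Cons by auto
  consider "lv b < lv c" | "lv b = lv c" | "lv c < lv b" by (rule linorder_cases)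
  then show ?case
  proof cases
    case 1
    then have "R (insert_point b (c # cs)) = b # c # cs" by (simp add: run_bind s sign_eq_iffs)
    then show ?thesis using 1 Cons.prems by auto
  next
    case 2
    then have "R (insert_point b (c # cs)) = c # cs" by (simp add: run_bind s sign_def)
    then show ?thesis using 2 Cons.prems by auto
  next
    case 3
    then have "R (insert_point b (c # cs)) = c # R (insert_point b cs)"
      by (auto simp: run_bind s sign_eq_iffs)
    moreover have "lv c < lv a" if "a \<in> set (R (insert_point b cs))" for a
    proof -
      have "lv a \<in> insert (lv b) (lv ` set cs)" using that IH(2) by blast
      then show ?thesis using 3 Cons.prems by auto
    qed
    ultimately show ?thesis using IH by auto
  qed
qed simp

lemma run_sort_between:
  "sorted_wrt (\<lambda>a b. lv a < lv b) (R (sort_between lo hi bs)) \<and>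
    lv ` set (R (sort_between lo hi bs)) = {\<tau> \<in> lv ` set bs. \<tau> \<in> ival (lvo lo) (lvo hi)}"
proof (induction bs)
  case (Cons b bs)
  let ?cs = "R (sort_between lo hi bs)"
  have l: "0 < R (case lo of None \<Rightarrow> Result 1 | Some a \<Rightarrow> ask (b - a)) \<longleftrightarrow> (\<forall>a. lo = Some a \<longrightarrow> lv a < lv b)"
    by (cases lo) (auto simp: run_ask lval_diff sign_eq_iffs)
  have h: "0 < R (case hi of None \<Rightarrow> Result 1 | Some c \<Rightarrow> ask (c - b)) \<longleftrightarrow> (\<forall>c. hi = Some c \<longrightarrow> lv b < lv c)"
    by (cases hi) (auto simp: run_ask lval_diff sign_eq_iffs)
  have inb: "lv b \<in> ival (lvo lo) (lvo hi) \<longleftrightarrow> (\<forall>a. lo = Some a \<longrightarrow> lv a < lv b) \<and> (\<forall>c. hi = Some c \<longrightarrow> lv b < lv c)"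
    by (auto simp: ival_def)
  have run: "R (sort_between lo hi (b # bs)) = (if lv b \<in> ival (lvo lo) (lvo hi) then R (insert_point b ?cs) else ?cs)"
  proof (cases "lv b \<in> ival (lvo lo) (lvo hi)")
    case True
    then have "0 < R (case lo of None \<Rightarrow> Result 1 | Some a \<Rightarrow> ask (b - a))"
      "0 < R (case hi of None \<Rightarrow> Result 1 | Some c \<Rightarrow> ask (c - b))" using inb l h by blast+
    then show ?thesis using True by (simp add: run_bind)
  next
    case False
    then have "\<not> (0 < R (case lo of None \<Rightarrow> Result 1 | Some a \<Rightarrow> ask (b - a)) \<and>
      0 < R (case hi of None \<Rightarrow> Result 1 | Some c \<Rightarrow> ask (c - b)))" using inb l h by blast
    then show ?thesis using False by (auto simp: run_bind)
  qed
  show ?case unfolding run using Cons run_insert_point[of ?cs b] by auto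
qed simp

lemma sorted_refined:
  assumes F: "\<And>l h. sorted_wrt (\<lambda>a b. lv a < lv b) (F l h) \<and> lv ` set (F l h) \<subseteq> ival (lvo l) (lvo h)"
    and bs: "sorted_wrt (\<lambda>a b. lv a < lv b) bs" "lv ` set bs \<subseteq> ival (lvo lo) None"
  shows "sorted_wrt (\<lambda>a b. lv a < lv b) (refined F bs lo) \<and> lv ` set (refined F bs lo) \<subseteq> ival (lvo lo) None"
  using bs
proof (induction bs arbitrary: lo)
  case Nil
  then show ?case using F[of lo None] by simp
next
  case (Cons b bs)
  have b: "lv b \<in> ival (lvo lo) None" using Cons.prems by simp
  have IH: "sorted_wrt (\<lambda>a b. lv a < lv b) (refined F bs (Some b)) \<and> lv ` set (refined F bs (Some b)) \<subseteq> ival (lvo (Some b)) None"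
    by (rule Cons.IH) (use Cons.prems in \<open>auto simp: ival_def\<close>)
  have hi: "lv b < lv x" if "x \<in> set (refined F bs (Some b))" for x using IH that by (auto simp: ival_def)
  have lo: "lv x < lv b \<and> lv x \<in> ival (lvo lo) None" if "x \<in> set (F lo (Some b))" for x
    using F[of lo "Some b"] that by (auto simp: ival_def)
  have "lv x < lv y" if "x \<in> set (F lo (Some b))" "y \<in> set (refined F bs (Some b))" for x y
    using lo[OF that(1)] hi[OF that(2)] by (blast intro: less_trans)
  moreover have "lv x \<in> ival (lvo lo) None" if "x \<in> set (refined F bs (Some b))" for x
    using hi[OF that] b by (auto simp: ival_def)
  ultimately show ?case using IH F[of lo "Some b"] lo hi b by (auto simp: sorted_wrt_append)
qed

lemma set_refined:
  "set bs \<subseteq> set (refined F bs lo)"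
  "k \<le> length bs \<Longrightarrow> set (F (lower lo bs k) (upper bs None k)) \<subseteq> set (refined F bs lo)"
proof -
  show "set bs \<subseteq> set (refined F bs lo)" by (induction bs arbitrary: lo) auto
  show "k \<le> length bs \<Longrightarrow> set (F (lower lo bs k) (upper bs None k)) \<subseteq> set (refined F bs lo)"
  proof (induction bs arbitrary: lo k)
    case (Cons b bs)
    then show ?case by (cases k) fastforce+
  qed simp
qed

lemma lower_map: "k \<le> length bs \<Longrightarrow> map_option f (lower lo bs k) = lower (map_option f lo) (map f bs) k"
  by (auto simp: lower_def)

lemma upper_map: "k \<le> length bs \<Longrightarrow> map_option f (upper bs hi k) = upper (map f bs) (map_option f hi) k"
  by (auto simp: upper_def)

lemma no_point_in_piece:
  fixes xs :: "'b::linorder list"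
  assumes "sorted_wrt (<) xs" "k \<le> length xs" "x \<in> ival (lower lo xs k) (upper xs None k)"
  shows "x \<notin> set xs"
proof
  assume "x \<in> set xs"
  then obtain j where j: "j < length xs" "x = xs ! j" by (metis in_set_conv_nth)
  show False
  proof (cases "j < k")
    case True
    then have "xs ! (k - 1) < xs ! j" using assms(3) j by (auto simp: ival_def lower_def)
    moreover have "xs ! j \<le> xs ! (k - 1)"
    proof (cases "j = k - 1")
      case False
      then have "j < k - 1" "k - 1 < length xs" using True assms(2) by auto
      then show ?thesis using assms(1) by (simp add: sorted_wrt_iff_nth_less less_imp_le)
    qed simp
    ultimately show False by simp
  next
    case False
    then have k: "k < length xs" using j by simp
    then have "xs ! j < xs ! k" using assms(3) j by (auto simp: ival_def upper_def)
    moreover have "xs ! k \<le> xs ! j"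
    proof (cases "j = k")
      case neq: False
      then have "k < j" using False by simp
      then show ?thesis using assms(1) j by (simp add: sorted_wrt_iff_nth_less less_imp_le)
    qed simp
    ultimately show False by simp
  qed
qed

text \<open>A bounded piece is sampled at its midpoint; on an unbounded one any positive
  \<open>\<Omega>\<close> gives a point of the piece.\<close>

lemma sample_in_piece:
  assumes "\<And>a b. l = Some a \<Longrightarrow> h = Some b \<Longrightarrow> lv a < lv b"
  shows "\<forall>\<^sub>F \<Omega> in at_top. xval \<Omega> (sample_between l h) \<in> ival (lvo l) (lvo h)"
proof (cases l; cases h)
  fix a assume lh: "l = Some a" "h = None"
  show ?thesis using eventually_greater[of 0]
    by eventually_elim (simp add: lh ival_def xval_def)
next
  fix b assume lh: "l = None" "h = Some b"
  show ?thesis using eventually_greater[of 0]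
    by eventually_elim (simp add: lh ival_def xval_def)
next
  fix a b assume lh: "l = Some a" "h = Some b"
  have ab: "lv a < lv b" using assms lh by blast
  have half: "(0::rat) < 1 / 2" by simp
  have dbl: "qmult (1 / 2) (g + g) = g" for g :: 'g
  proof -
    have "g + g = qmult 2 g" using qmult_add_left[of 1 1 g] by simp
    then show ?thesis by simp
  qed
  have "lv a + lv a < lv a + lv b" "lv a + lv b < lv b + lv b" using ab by auto
  then have "lv a < qmult (1 / 2) (lv a + lv b)" "qmult (1 / 2) (lv a + lv b) < lv b"
    using qmult_less_cancel[OF half, of "lv a + lv a" "lv a + lv b"] qmult_less_cancel[OF half, of "lv a + lv b" "lv b + lv b"]
    by (simp_all only: dbl)
  then show ?thesis by (simp add: lh ival_def lval_scale lval_add)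
qed (simp add: ival_def)

end

context rcvf_point
begin

text \<open>A nonconstant affine function is its slope times \<open>\<tau> - z\<close>, and its zero
  \<open>z\<close> lies outside the convex set \<open>I\<close>.\<close>

lemma affine_constant_sign:
  assumes convex: "\<And>x y z. x \<in> I \<Longrightarrow> z \<in> I \<Longrightarrow> x < y \<Longrightarrow> y < z \<Longrightarrow> y \<in> I"
    and nz: "snd H \<noteq> 0 \<Longrightarrow> lv (scale_lin (- 1 / snd H) (fst H)) \<notin> I" and st: "s \<in> I" "t \<in> I"
  shows "sign (xval s H) = sign (xval t H)"
proof (cases "snd H = 0")
  case False
  define z where "z = lv (scale_lin (- 1 / snd H) (fst H))"
  have xz: "xval \<tau> H = qmult (snd H) (\<tau> - z)" for \<tau>
    using False by (simp add: z_def xval_def lval_scale scale_right_diff_distrib scale_right_distrib)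
  have zI: "z \<notin> I" using nz[OF False] by (simp add: z_def)
  have ne: "s \<noteq> z" "t \<noteq> z" using zI st by blast+
  have "\<not> (s < z \<and> z < t)" "\<not> (t < z \<and> z < s)" using convex[OF st] convex[OF st(2,1)] zI by blast+
  with ne have "s < z \<longleftrightarrow> t < z" by (meson linorder_neqE)
  with ne have sst: "sign (s - z) = sign (t - z)" by (auto simp: sign_def)
  show ?thesis
  proof (cases "0 < snd H")
    case True
    then show ?thesis unfolding xz using sst by (simp add: sign_qmult)
  next
    case neg: False
    have flip: "sign (qmult (snd H) g) = - sign g" for g :: 'g
    proof -
      have "sign (qmult (- snd H) g) = sign g" using neg False by (intro sign_qmult) simp
      then have "- sign (qmult (snd H) g) = sign g" by (simp add: sign_minus)
      then show ?thesis by simp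
    qed
    show ?thesis unfolding xz flip sst ..
  qed
qed (simp add: xval_def)

text \<open>On the coarse piece \<open>I\<close>, free of break points, each minimum is one affine
  function, the one found at \<open>s0\<close>. On the finer piece \<open>J\<close> no combination
  of these functions vanishes unless its slope is 0. The sample \<open>s0\<close> need only lie in
  \<open>I\<close>.\<close>

lemma sysv_constant:
  assumes G: "\<And>f. f \<in> set fs \<Longrightarrow> G f \<in> set f \<and> xval s0 (G f) = mn f s0" and s0: "s0 \<in> I"
    and I: "I = ival l h" and nobreak: "\<And>f \<tau> g k. f \<in> set fs \<Longrightarrow> \<tau> \<in> I \<Longrightarrow> g \<in> set f \<Longrightarrow> k \<in> set f \<Longrightarrow> snd g < snd k \<Longrightarrow>
      xval \<tau> g = mn f \<tau> \<Longrightarrow> xval \<tau> k = mn f \<tau> \<Longrightarrow> False"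
    and J: "J = ival l' h'" "J \<subseteq> I" and zeros: "\<And>z. z \<in> set (zeros_of_combinations M (map G fs)) \<Longrightarrow> lv z \<notin> J"
    and st: "s \<in> J" "t \<in> J"
  shows "sysv M signs fs s = sysv M signs fs t"
proof -
  have min: "mn f \<tau> = xval \<tau> (G f)" if "f \<in> set fs" "\<tau> \<in> I" for f \<tau>
  proof (rule sym, rule minimal_piece_persists[where s = s0 and I = I])
    show "G f \<in> set f" "xval s0 (G f) = mn f s0" using G[OF that(1)] by auto
    show "y \<in> I" if "x \<in> I" "z \<in> I" "x \<le> y" "y \<le> z" for x y z
      using that ival_convex[of x l h z y] unfolding I by (cases "x = y \<or> y = z") auto
  qed (use s0 that nobreak in blast)+
  have "sign (comb \<mu> (map (\<lambda>f. mn f s) fs)) = sign (comb \<mu> (map (\<lambda>f. mn f t) fs))"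
    if \<mu>: "\<mu> \<in> set (exponent_vectors M (length fs))" for \<mu>
  proof -
    define H where "H = (\<Sum>(l, x)\<leftarrow>zip \<mu> (map G fs). scale_xlin (of_int l) x)"
    have c: "comb \<mu> (map (\<lambda>f. mn f \<tau>) fs) = xval \<tau> H" if "\<tau> \<in> J" for \<tau>
    proof -
      have "map (\<lambda>f. mn f \<tau>) fs = map (xval \<tau>) (map G fs)" using min that J(2) by auto
      then show ?thesis unfolding H_def xval_comb by (simp only:)
    qed
    have "sign (xval s H) = sign (xval t H)"
    proof (rule affine_constant_sign[OF _ _ st])
      show "y \<in> J" if "x \<in> J" "z \<in> J" "x < y" "y < z" for x y z
        using ival_convex that unfolding J(1) by blast
      assume "snd H \<noteq> 0"
      then have "scale_lin (- 1 / snd H) (fst H) \<in> set (zeros_of_combinations M (map G fs))"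
        using \<mu> unfolding zeros_of_combinations_def H_def by force
      then show "lv (scale_lin (- 1 / snd H) (fst H)) \<notin> J" by (rule zeros)
    qed
    then show ?thesis using c st by simp
  qed
  then show ?thesis by (simp add: sysv_def)
qed

text \<open>An interval avoiding the points \<open>xs\<close> cannot leave the piece that it meets:
  it would contain an end of this piece.\<close>

lemma ival_subset_piece:
  fixes xs :: "'b::linorder list"
  assumes s: "s \<in> J" "s \<in> ival (lower lo xs k) (upper xs None k)" and k: "k \<le> length xs"
    and J: "J = ival l h" "J \<subseteq> ival lo None" and disj: "\<And>x. x \<in> set xs \<Longrightarrow> x \<notin> J"
  shows "J \<subseteq> ival (lower lo xs k) (upper xs None k)"
proof
  fix t assume t: "t \<in> J"
  have "a < t" if a: "lower lo xs k = Some a" for a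
  proof (cases "k = 0")
    case True
    then show ?thesis using a t J(2) by (auto simp: ival_def)
  next
    case False
    then have ax: "a \<in> set xs" using a k by (auto simp: lower_def)
    have "a < s" using s(2) a by (simp add: ival_def)
    show ?thesis
    proof (rule ccontr)
      assume "\<not> a < t"
      then have "a \<in> J" using ival_convex[of t l h s a] t s(1) \<open>a < s\<close> J(1) by (cases "t = a") auto
      then show False using disj[OF ax] by blast
    qed
  qed
  moreover have "t < b" if b: "upper xs None k = Some b" for b
  proof -
    have bx: "b \<in> set xs" using b k by (auto simp: upper_def split: if_splits)
    have "s < b" using s(2) b by (simp add: ival_def)
    show ?thesis
    proof (rule ccontr)
      assume "\<not> t < b"
      then have "b \<in> J" using ival_convex[of s l h t b] t s(1) \<open>s < b\<close> J(1) by (cases "t = b") auto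
      then show False using disj[OF bx] by blast
    qed
  qed
  ultimately show "t \<in> ival (lower lo xs k) (upper xs None k)" by (simp add: ival_def)
qed

lemma ival_piece_subset:
  fixes xs :: "'b::linorder list"
  assumes "set xs \<subseteq> ival lo None" "k \<le> length xs"
  shows "ival (lower lo xs k) (upper xs None k) \<subseteq> ival lo None"
proof
  fix x assume x: "x \<in> ival (lower lo xs k) (upper xs None k)"
  show "x \<in> ival lo None"
  proof (cases "k = 0")
    case False
    then have "xs ! (k - 1) \<in> ival lo None" using assms by (auto intro: nth_mem)
    then show ?thesis using x False by (auto simp: ival_def lower_def)
  qed (use x in \<open>auto simp: ival_def\<close>)
qed

text \<open>\<open>cs\<close> are the break points within the range and \<open>F\<close> the zeros
  added between two of them. A final piece lies in a single piece of \<open>cs\<close>, where the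
  zeros were computed from the active affine functions, so \<open>sysv_constant\<close>
  applies.\<close>

lemma run_partition_of:
  assumes fs: "\<forall>f\<in>set fs. f \<noteq> []"
  shows "\<exists>bs. R (partition_of M lo signs fs) = map (\<lambda>x. R (system_at_sample M signs fs x)) (samples lo bs) \<and>
    sorted_wrt (\<lambda>a b. lv a < lv b) bs \<and> lv ` set bs \<subseteq> ival (lvo lo) None \<and>
    (\<forall>k\<le>length bs. \<forall>s\<in>ival (lower (lvo lo) (map lv bs) k) (upper (map lv bs) None k).
      \<forall>t\<in>ival (lower (lvo lo) (map lv bs) k) (upper (map lv bs) None k). sysv M signs fs s = sysv M signs fs t)"
proof -
  define cs where "cs = R (sort_between lo None (concat (map (\<lambda>f. R (break_points f)) fs)))"
  define F where "F l h = R (sort_between l h (zeros_of_combinations M (map (\<lambda>f. R (active_piece (sample_between l h) f)) fs)))" for l h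
  define bs where "bs = refined F cs lo"
  have run: "R (partition_of M lo signs fs) = map (\<lambda>x. R (system_at_sample M signs fs x)) (samples lo bs)"
  proof -
    have "R ((\<lambda>(l, h). bind_dtree (mapT (active_piece (sample_between l h)) fs)
        (\<lambda>gs. sort_between l h (zeros_of_combinations M gs))) p) = F (fst p) (snd p)" for p
      by (simp add: case_prod_unfold run_bind run_mapT F_def)
    then show ?thesis
      unfolding partition_of_def Let_def run_bind run_mapT cs_def[symmetric] bs_def
      by (simp only: refined_eq)
  qed
  have cs: "sorted_wrt (\<lambda>a b. lv a < lv b) cs"
    "lv ` set cs = {\<tau> \<in> lv ` set (concat (map (\<lambda>f. R (break_points f)) fs)). \<tau> \<in> ival (lvo lo) None}"
    using run_sort_between[of lo None "concat (map (\<lambda>f. R (break_points f)) fs)"] by (auto simp: cs_def)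
  have F: "sorted_wrt (\<lambda>a b. lv a < lv b) (F l h) \<and> lv ` set (F l h) \<subseteq> ival (lvo l) (lvo h)" for l h
    unfolding F_def using run_sort_between by blast
  have bs: "sorted_wrt (\<lambda>a b. lv a < lv b) bs" "lv ` set bs \<subseteq> ival (lvo lo) None"
    using sorted_refined[OF F cs(1), of lo] cs(2) by (auto simp: bs_def)
  have sbs: "sorted_wrt (<) (map lv bs)" and scs: "sorted_wrt (<) (map lv cs)"
    using bs(1) cs(1) by (simp_all add: sorted_wrt_map)
  have cs_sub: "lv ` set cs \<subseteq> lv ` set bs" unfolding bs_def by (rule image_mono) (rule set_refined(1))
  have const: "sysv M signs fs s = sysv M signs fs t"
    if k: "k \<le> length bs" and J: "J = ival (lower (lvo lo) (map lv bs) k) (upper (map lv bs) None k)" and st: "s \<in> J" "t \<in> J"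
    for k J s t
  proof -
    have k': "k \<le> length (map lv bs)" using k by simp
    have Jlo: "J \<subseteq> ival (lvo lo) None" unfolding J by (rule ival_piece_subset[OF _ k']) (use bs(2) in simp)
    have Jdisj: "x \<notin> J" if "x \<in> lv ` set bs" for x
      using no_point_in_piece[OF sbs k'] that unfolding J by auto
    have "s \<in> ival (lvo lo) None" using st(1) Jlo by blast
    moreover have "s \<notin> set (map lv cs)" using Jdisj st(1) cs_sub by auto
    \<comment> \<open>\<open>J\<close> is a piece of the final partition; \<open>I\<close> below is
      the piece between break points that contains it.\<close>
    ultimately obtain j where j: "j \<le> length (map lv cs)"
      "s \<in> ival (lower (lvo lo) (map lv cs) j) (upper (map lv cs) None j)"
      using ival_cover[of s "lvo lo" None "map lv cs"] by blast
    define l h where "l = lower lo cs j" and "h = upper cs None j"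
    have lh: "lvo l = lower (lvo lo) (map lv cs) j" "lvo h = upper (map lv cs) None j"
      using lower_map[of j cs lv lo] upper_map[of j cs lv None] j(1) by (simp_all add: l_def h_def)
    define I where "I = ival (lvo l) (lvo h)"
    have sI: "s \<in> I" using j(2) by (simp add: I_def lh)
    have JI: "J \<subseteq> I" unfolding I_def lh
      by (rule ival_subset_piece[OF st(1) j(2,1) J Jlo]) (use Jdisj cs_sub in auto)
    have Ilo: "I \<subseteq> ival (lvo lo) None" unfolding I_def lh
      by (rule ival_piece_subset[OF _ j(1)]) (use cs(2) in auto)
    have Idisj: "x \<notin> I" if "x \<in> lv ` set cs" for x
      using no_point_in_piece[OF scs j(1)] that unfolding I_def lh by auto
    let ?x = "sample_between l h"
    have "\<forall>\<^sub>F \<Omega> in at_top. xval \<Omega> ?x \<in> I" unfolding I_def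
      by (rule sample_in_piece) (use sI in \<open>auto simp: I_def ival_def\<close>)
    moreover have "\<forall>\<^sub>F \<Omega> in at_top. \<forall>f\<in>set fs. xval (xval \<Omega> ?x) (R (active_piece ?x f)) = mn f (xval \<Omega> ?x)"
      using run_active_piece fs by (intro eventually_ball_finite) auto
    \<comment> \<open>One value of \<open>\<Omega>\<close> large enough both for the sample to lie
      in \<open>I\<close> and for all selected pieces to attain their minima there.\<close>
    ultimately obtain \<Omega> where \<Omega>: "xval \<Omega> ?x \<in> I"
      "\<forall>f\<in>set fs. xval (xval \<Omega> ?x) (R (active_piece ?x f)) = mn f (xval \<Omega> ?x)"
      using at_top_witness[OF eventually_conj] by blast
    show ?thesis
    proof (rule sysv_constant[where G = "\<lambda>f. R (active_piece ?x f)", OF _ \<Omega>(1) I_def _ J JI _ st])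
      show "R (active_piece ?x f) \<in> set f \<and> xval (xval \<Omega> ?x) (R (active_piece ?x f)) = mn f (xval \<Omega> ?x)"
        if "f \<in> set fs" for f
        using \<Omega>(2) run_active_piece fs that by blast
      show False if "f \<in> set fs" "\<tau> \<in> I" "g \<in> set f" "k \<in> set f" "snd g < snd k"
        "xval \<tau> g = mn f \<tau>" "xval \<tau> k = mn f \<tau>" for f \<tau> g k
      proof -
        have "\<exists>b\<in>set (R (break_points f)). lv b = \<tau>" using break_points_complete that by blast
        then have "\<tau> \<in> lv ` set (concat (map (\<lambda>f. R (break_points f)) fs))" using that(1) by auto
        then have "\<tau> \<in> lv ` set cs" unfolding cs(2) using that(2) Ilo by blast
        then show False using Idisj that(2) by blast
      qed
      show "lv z \<notin> J" if z: "z \<in> set (zeros_of_combinations M (map (\<lambda>f. R (active_piece ?x f)) fs))" for z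
      proof
        assume zJ: "lv z \<in> J"
        then have "lv z \<in> ival (lvo l) (lvo h)" using JI by (auto simp: I_def)
        then have "lv z \<in> lv ` set (F l h)" unfolding F_def using run_sort_between z by blast
        moreover have "set (F l h) \<subseteq> set bs"
          unfolding bs_def l_def h_def by (rule set_refined(2)) (use j(1) in simp)
        ultimately show False using Jdisj zJ by blast
      qed
    qed
  qed
  show ?thesis
  proof (rule exI[of _ bs], intro conjI allI impI ballI)
    fix k s t
    let ?J = "ival (lower (lvo lo) (map lv bs) k) (upper (map lv bs) None k)"
    assume k: "k \<le> length bs" and s: "s \<in> ?J" and t: "t \<in> ?J"
    show "sysv M signs fs s = sysv M signs fs t" by (rule const[OF k refl s t])
  qed (fact run bs)+
qed

text \<open>Abstracts from the four kinds of partitioned intervals. All that matters is that the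
  system at a point depends only on the value \<open>\<tau>\<close> of its distance to an end, in
  the form \<open>sysv\<close>.\<close>

lemma partition_data_run:
  assumes fs: "\<forall>f\<in>set fs. f \<noteq> []"
    and lob: "lob = (case lo of None \<Rightarrow> -\<infinity> | Some a \<Rightarrow> Fin (lv a))"
    and between: "\<And>\<alpha> \<beta> x. x \<in> piece_between \<alpha> \<beta> \<Longrightarrow> \<exists>\<tau>. \<alpha> < Fin \<tau> \<and> Fin \<tau> < \<beta> \<and> x \<in> piece_at (Fin \<tau>)"
    and sys: "\<And>x \<tau>. x \<in> piece_at (Fin \<tau>) \<Longrightarrow> lob < Fin \<tau> \<Longrightarrow> sys x = sysv M signs fs \<tau>"
  shows "partition_data sys piece_at piece_between lob (R (partition_of M lo signs fs))"
proof -
  from run_partition_of[OF fs, of M lo signs]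
  obtain bs where all: "R (partition_of M lo signs fs) = map (\<lambda>x. R (system_at_sample M signs fs x)) (samples lo bs) \<and>
    sorted_wrt (\<lambda>a b. lv a < lv b) bs \<and> lv ` set bs \<subseteq> ival (lvo lo) None \<and>
    (\<forall>k\<le>length bs. \<forall>s\<in>ival (lower (lvo lo) (map lv bs) k) (upper (map lv bs) None k).
      \<forall>t\<in>ival (lower (lvo lo) (map lv bs) k) (upper (map lv bs) None k). sysv M signs fs s = sysv M signs fs t)"
    by (rule exE)
  note run = conjunct1[OF all] and bs = conjunct1[OF conjunct2[OF all]] conjunct1[OF conjunct2[OF conjunct2[OF all]]]
  note const = conjunct2[OF conjunct2[OF conjunct2[OF all]], rule_format]
  let ?B = "lob # map Fin (map lv bs) @ [\<infinity>]"
  have lo_less: "lob < Fin \<tau>" if "\<tau> \<in> ival (lvo lo) None" for \<tau>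
    using that by (auto simp: lob ival_def split: option.splits)
  have sorted: "sorted_wrt (<) ?B"
    using bs(1) lo_less bs(2) by (auto simp: sorted_wrt_append sorted_wrt_map lob split: option.splits)
  have len: "length (R (partition_of M lo signs fs)) = 2 * length (map lv bs) + 1"
    by (simp add: run length_samples)
  have B: "?B ! k = (if k = 0 then lob else Fin (lv (bs ! (k - 1))))"
    "?B ! Suc k = (if k = length bs then \<infinity> else Fin (lv (bs ! k)))" if "k \<le> length bs" for k
    using that by (auto simp: nth_Cons nth_append split: nat.split)
  have open_piece: "sys x = R (partition_of M lo signs fs) ! (2 * k)"
    if k: "k \<le> length bs" and x: "x \<in> piece_between (?B ! k) (?B ! Suc k)" for k x
  proof -
    obtain \<tau> where \<tau>: "?B ! k < Fin \<tau>" "Fin \<tau> < ?B ! Suc k" "x \<in> piece_at (Fin \<tau>)" using between[OF x] by blast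
    let ?J = "ival (lower (lvo lo) (map lv bs) k) (upper (map lv bs) None k)"
    have \<tau>J: "\<tau> \<in> ?J"
      using \<tau>(1,2) k unfolding B[OF k]
      by (auto simp: ival_def lower_def upper_def lob split: if_splits option.splits)
    have sub: "?J \<subseteq> ival (lvo lo) None" by (rule ival_piece_subset) (use bs(2) k in auto)
    have "sys x = sysv M signs fs \<tau>" using sys[OF \<tau>(3)] lo_less \<tau>J sub by blast
    let ?l = "lower lo bs k" and ?h = "upper bs None k"
    have J: "ival (lvo ?l) (lvo ?h) = ?J" using lower_map[of k bs lv lo] upper_map[of k bs lv None] k by simp
    have "\<forall>\<^sub>F \<Omega> in at_top. xval \<Omega> (sample_between ?l ?h) \<in> ival (lvo ?l) (lvo ?h)"
    proof (rule sample_in_piece)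
      fix a b assume "?l = Some a" "?h = Some b"
      then have "lv a < \<tau>" "\<tau> < lv b" using \<tau>J unfolding J[symmetric] by (auto simp: ival_def)
      then show "lv a < lv b" by simp
    qed
    then obtain \<Omega> where \<Omega>: "xval \<Omega> (sample_between ?l ?h) \<in> ?J"
      "R (system_at_sample M signs fs (sample_between ?l ?h)) = sysv M signs fs (xval \<Omega> (sample_between ?l ?h))"
      unfolding J using at_top_witness[OF eventually_conj[OF _ run_system_at_sample[OF fs, of M signs "sample_between ?l ?h"]]] by blast
    have "R (partition_of M lo signs fs) ! (2 * k) = sysv M signs fs (xval \<Omega> (sample_between ?l ?h))"
      unfolding run using k by (subst nth_map) (simp_all add: length_samples samples_even \<Omega>(2))
    also have "\<dots> = sysv M signs fs \<tau>" by (rule const[OF k \<Omega>(1) \<tau>J])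
    finally show ?thesis using \<open>sys x = sysv M signs fs \<tau>\<close> by simp
  qed
  have point: "sys x = R (partition_of M lo signs fs) ! (2 * i - 1)"
    if i: "1 \<le> i" "i \<le> length bs" and x: "x \<in> piece_at (?B ! i)" for i x
  proof -
    let ?b = "bs ! (i - 1)"
    have bset: "?b \<in> set bs" using i by (intro nth_mem) simp
    have "sys x = sysv M signs fs (lv ?b)"
      using sys[of x "lv ?b"] x B(1)[OF i(2)] i(1) lo_less bs(2) bset by auto
    moreover have "R (system_at_sample M signs fs (?b, 0)) = sysv M signs fs (lv ?b)"
      using at_top_witness[OF run_system_at_sample[OF fs, of M signs "(?b, 0)"]] by simp
    moreover have "2 * i - 1 = 2 * (i - 1) + 1" using i by simp
    then have "R (partition_of M lo signs fs) ! (2 * i - 1) = R (system_at_sample M signs fs (?b, 0))"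
      unfolding run using i samples_odd[of "i - 1" bs lo] by (subst nth_map) (simp_all add: length_samples)
    ultimately show ?thesis by simp
  qed
  show ?thesis unfolding partition_data_def Let_def
    by (rule exI[of _ "map lv bs"]) (use sorted len open_piece point in simp)
qed

abbreviation sys :: "nat \<Rightarrow> 'r coef poly list \<Rightarrow> 'r \<Rightarrow> vsc" where
  "sys M Ps x \<equiv> vsc_system v M (map (\<lambda>F. poly F x) (map (specialize \<rho>) Ps))"

section \<open>Correctness of RCVF3 on the intervals\<close>

lemma sys_eq_sysv:
  assumes fam: "family_ok Z sg Ps" and cell: "cell_ok Ps lo hi cell" and x: "x \<in> ival lo hi"
    and g: "\<And>F. F \<in> set Ps \<Longrightarrow> specialize \<rho> F \<noteq> 0 \<Longrightarrow> w (ev F x) = mn (g F) \<tau>"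
  shows "sys M Ps x = sysv M cell (map g (filter (\<lambda>F. hd (derivs_data Ps cell F) \<noteq> 0) Ps)) \<tau>"
proof -
  let ?Fs = "filter (\<lambda>F. hd (derivs_data Ps cell F) \<noteq> 0) Ps"
  have sg: "map sign (map (\<lambda>F. ev F x) Ps) = cell" using cell x by (auto simp: cell_ok_def)
  have "filter (\<lambda>F. ev F x \<noteq> 0) Ps = ?Fs"
    using hd_derivs_data[OF fam _ cell x] by (intro filter_cong) auto
  then have fl: "filter (\<lambda>y. y \<noteq> 0) (map (\<lambda>F. ev F x) Ps) = map (\<lambda>F. ev F x) ?Fs"
    by (simp add: filter_map comp_def)
  have wm: "map w (map (\<lambda>F. ev F x) ?Fs) = map (\<lambda>f. mn f \<tau>) (map g ?Fs)"
    using g cell_hd_zero[OF fam _ cell] by auto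
  have "map (\<lambda>F. poly F x) (map (specialize \<rho>) Ps) = map (\<lambda>F. ev F x) Ps" by simp
  then show ?thesis unfolding vsc_system_eq sysv_def by (simp only: sg fl wm length_map)
qed

definition resolved :: "('r coef vexp \<times> nat) list \<Rightarrow> ('r coef lin \<times> rat) list" where
  "resolved ts = map (\<lambda>(e, k). (R (resolve e), of_nat k)) ts"

lemma run_resolve_terms: "R (resolve_terms tss) = map resolved tss"
  by (simp add: resolve_terms_def run_mapT resolved_def run_bind case_prod_unfold)

lemma mn_resolved: "mn (resolved ts) \<tau> = pl ts \<tau>"
proof -
  have "xval \<tau> ` set (resolved ts) = (\<lambda>(e, k). veval \<nu> e + qmult (of_nat k) \<tau>) ` set ts"
    unfolding resolved_def set_map image_image by (rule image_cong) (auto simp: xval_def lv_resolve)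
  then show ?thesis by (simp add: mn_def pl_def)
qed

lemma mn_flat: "mn (map (\<lambda>(e, k). (e, 0)) (resolved ts)) \<tau> = pl ts 0"
proof -
  have "xval \<tau> ` set (map (\<lambda>(e, k). (e, 0)) (resolved ts)) = (\<lambda>(e, k). veval \<nu> e + qmult (of_nat k) 0) ` set ts"
    unfolding resolved_def set_map image_image by (rule image_cong) (auto simp: xval_def lv_resolve)
  then show ?thesis by (simp add: mn_def pl_def)
qed

text \<open>An element \<open>t >= 1\<close> has value at most 0, so \<open>t < 1\<close>; then
  \<open>1 = t + (1 - t)\<close> is a sum of positive elements of value 0, and the minimum must be
  attained by \<open>1 - t\<close>.\<close>

lemma w_complement: "0 < t \<Longrightarrow> 0 < w t \<Longrightarrow> t < 1 \<and> w (1 - t) = 0"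
proof -
  assume t: "0 < t" "0 < w t"
  have "t < 1" using w_antimono[of 1 t] t(2) w_one zero_less_one by (metis leD le_less_linear)
  then show ?thesis using w_add[of t "1 - t"] t by (auto simp: min_def split: if_splits)
qed

lemma v_Fin_iff: "x \<noteq> 0 \<Longrightarrow> v x = Fin g \<longleftrightarrow> w x = g"
  by (simp add: v_nonzero)

lemma bounded_interval_ok:
  assumes fam: "family_ok Z sg Ps" and cell: "cell_ok Ps (Some a) (Some b) cell"
    and p: "point_ok Ps a pa" "point_ok Ps b pb" and \<delta>: "gap_ok a b \<delta>"
    and run: "R (bounded_interval M Ps cell pa pb \<delta>) = (mid, na, nb)"
  shows "(\<forall>x\<in>J_mid v a b. sys M Ps x = mid) \<and>
    partition_data (sys M Ps) (Jplus_at v a b) (Jplus_between v a b) 0 na \<and>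
    partition_data (sys M Ps) (Jminus_at v a b) (Jminus_between v a b) 0 nb"
proof -
  have ab: "a < b" using cell_bounds[OF cell] by (simp add: bounds_ok_def)
  let ?Fs = "filter (\<lambda>F. hd (derivs_data Ps cell F) \<noteq> 0) Ps"
  define terms where "terms F = taylor_terms (derivs_data Ps cell F) (derivs_data Ps pa F) (derivs_data Ps pb F) \<delta>" for F
  define based where "based F = left_based (derivs_data Ps cell F)" for F
  define g0 where "g0 F = resolved (terms F)" for F
  define flat where "flat = map (\<lambda>(e :: 'r coef lin, k :: rat). (e, 0 :: rat))"
  have rt: "R (resolve_terms (map terms ?Fs)) = map g0 ?Fs" by (simp add: run_resolve_terms g0_def)
  \<comment> \<open>For a point near \<open>a\<close>, \<open>w (1 - t) = 0\<close>, so a function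
    based at \<open>b\<close> is evaluated at 0, which is the effect of \<open>flat\<close>;
    \<open>gb\<close> is the mirror image.\<close>
  define ga where "ga F = (if based F then g0 F else flat (g0 F))" for F
  define gb where "gb F = (if based F then flat (g0 F) else g0 F)" for F
  have m2: "map2 (\<lambda>l f. if l then f else flat f) (map based ?Fs) (map g0 ?Fs) = map ga ?Fs"
    "map2 (\<lambda>l f. if l then flat f else f) (map based ?Fs) (map g0 ?Fs) = map gb ?Fs"
    by (simp_all add: map2_map_map ga_def gb_def)
  have parts: "mid = R (system_at_sample M cell (map g0 ?Fs) (0, 0))"
    "na = R (partition_of M (Some 0) cell (map ga ?Fs))" "nb = R (partition_of M (Some 0) cell (map gb ?Fs))"
    using run unfolding bounded_interval_def Let_def run_bind run.simps terms_def[symmetric] based_def[symmetric]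
      flat_def[symmetric] rt m2 by simp_all
  have val: "terms F \<noteq> [] \<and> w (ev F (a + t * (b - a))) = pl (terms F) (w (if based F then t else 1 - t))"
    if F: "F \<in> set Ps" "specialize \<rho> F \<noteq> 0" and t: "0 < t" "t < 1" for F t
  proof -
    let ?s = "if based F then t else 1 - t"
    have s: "0 < ?s" "?s < 1" using t by auto
    have e: "from_end a b (based F) ?s = a + t * (b - a)" by (simp add: from_end_def algebra_simps)
    show ?thesis
      using gap_value[OF fam F cell p \<delta>[unfolded gap_ok_def] s[unfolded based_def]]
      unfolding terms_def[symmetric] based_def[symmetric] e .
  qed
  have ne: "g0 F \<noteq> []" if F: "F \<in> set ?Fs" for F
  proof -
    have "specialize \<rho> F \<noteq> 0" using F cell_hd_zero[OF fam _ cell] by auto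
    moreover obtain t :: 'r where "0 < t" "t < 1" using dense[of "0 :: 'r" 1] zero_less_one by blast
    ultimately show ?thesis using val[of F t] F by (simp add: g0_def resolved_def)
  qed
  have nes: "\<forall>f\<in>set (map g0 ?Fs). f \<noteq> []" "\<forall>f\<in>set (map ga ?Fs). f \<noteq> []" "\<forall>f\<in>set (map gb ?Fs). f \<noteq> []"
    unfolding set_map ball_simps ga_def gb_def flat_def by (simp_all add: ne del: set_filter)
  have xi: "a + t * (b - a) \<in> ival (Some a) (Some b)" if "0 < t" "t < 1" for t
  proof -
    have "0 < t * (b - a)" "t * (b - a) < 1 * (b - a)" using that ab by (auto intro: mult_strict_right_mono)
    then show ?thesis by (auto simp: ival_def)
  qed
  have sys0: "sys M Ps (a + t * (b - a)) = sysv M cell (map g0 ?Fs) 0" if t: "0 < t" "t < 1" "w t = 0" "w (1 - t) = 0" for t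
    by (rule sys_eq_sysv[OF fam cell xi[OF t(1,2)]]) (use val t in \<open>simp add: g0_def mn_resolved\<close>)
  have sysa: "sys M Ps (a + t * (b - a)) = sysv M cell (map ga ?Fs) (w t)" if t: "0 < t" "0 < w t" for t
  proof -
    note c = w_complement[OF t]
    show ?thesis
      by (rule sys_eq_sysv[OF fam cell xi]) (use val t c in \<open>auto simp: ga_def g0_def flat_def mn_resolved mn_flat\<close>)
  qed
  have sysb: "sys M Ps (b - t * (b - a)) = sysv M cell (map gb ?Fs) (w t)" if t: "0 < t" "0 < w t" for t
  proof -
    note c = w_complement[OF t]
    \<comment> \<open>Here \<open>t\<close> is measured from \<open>b\<close>; measured from
      \<open>a\<close>, the parameter of the point is \<open>1 - t\<close>.\<close>
    have u: "0 < 1 - t" "1 - t < 1" using c t by auto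
    have "sys M Ps (a + (1 - t) * (b - a)) = sysv M cell (map gb ?Fs) (w t)"
      by (rule sys_eq_sysv[OF fam cell xi[OF u]]) (use val[OF _ _ u] c in \<open>auto simp: gb_def g0_def flat_def mn_resolved mn_flat\<close>)
    moreover have "a + (1 - t) * (b - a) = b - t * (b - a)" by (simp add: algebra_simps)
    ultimately show ?thesis by simp
  qed
  have "sys M Ps x = mid" if "x \<in> J_mid v a b" for x
  proof -
    obtain t where t: "x = a + t * (b - a)" "0 < t" "t < 1" "v t = 0" "v (1 - t) = 0" using \<open>x \<in> J_mid v a b\<close> by (auto simp: J_mid_def)
    then have "w t = 0" "w (1 - t) = 0" by (simp_all add: finite_value_def zero_extended_def)
    moreover have "mid = sysv M cell (map g0 ?Fs) 0"
      unfolding parts using at_top_witness[OF run_system_at_sample[OF nes(1), of M cell "(0, 0)"]] by simp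
    ultimately show ?thesis using sys0 t by simp
  qed
  moreover have "partition_data (sys M Ps) (Jplus_at v a b) (Jplus_between v a b) 0 na"
    unfolding parts
  proof (rule partition_data_run[OF nes(2)])
    show "(0 :: 'g extended) = (case Some 0 of None \<Rightarrow> -\<infinity> | Some a \<Rightarrow> Fin (lv a))" by (simp add: zero_extended_def)
    show "\<exists>\<tau>. \<alpha> < Fin \<tau> \<and> Fin \<tau> < \<beta> \<and> x \<in> Jplus_at v a b (Fin \<tau>)" if x: "x \<in> Jplus_between v a b \<alpha> \<beta>" for \<alpha> \<beta> x
    proof -
      obtain t where t: "x = a + t * (b - a)" "0 < t" "\<alpha> < v t" "v t < \<beta>" using x by (auto simp: Jplus_between_def)
      then have "v t = Fin (w t)" by (simp add: v_nonzero)
      then show ?thesis using t by (intro exI[of _ "w t"]) (auto simp: Jplus_at_def)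
    qed
    show "sys M Ps x = sysv M cell (map ga ?Fs) \<tau>" if x: "x \<in> Jplus_at v a b (Fin \<tau>)" "0 < Fin \<tau>" for x \<tau>
    proof -
      obtain t where t: "x = a + t * (b - a)" "0 < t" "v t = Fin \<tau>" using x(1) by (auto simp: Jplus_at_def)
      then have "w t = \<tau>" by (simp add: v_Fin_iff)
      then show ?thesis using sysa[OF t(2)] x(2) t(1) by (simp add: zero_extended_def)
    qed
  qed
  moreover have "partition_data (sys M Ps) (Jminus_at v a b) (Jminus_between v a b) 0 nb"
    unfolding parts
  proof (rule partition_data_run[OF nes(3)])
    show "(0 :: 'g extended) = (case Some 0 of None \<Rightarrow> -\<infinity> | Some a \<Rightarrow> Fin (lv a))" by (simp add: zero_extended_def)
    show "\<exists>\<tau>. \<alpha> < Fin \<tau> \<and> Fin \<tau> < \<beta> \<and> x \<in> Jminus_at v a b (Fin \<tau>)" if x: "x \<in> Jminus_between v a b \<alpha> \<beta>" for \<alpha> \<beta> x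
    proof -
      obtain t where t: "x = b - t * (b - a)" "0 < t" "\<alpha> < v t" "v t < \<beta>" using x by (auto simp: Jminus_between_def)
      then have "v t = Fin (w t)" by (simp add: v_nonzero)
      then show ?thesis using t by (intro exI[of _ "w t"]) (auto simp: Jminus_at_def)
    qed
    show "sys M Ps x = sysv M cell (map gb ?Fs) \<tau>" if x: "x \<in> Jminus_at v a b (Fin \<tau>)" "0 < Fin \<tau>" for x \<tau>
    proof -
      obtain t where t: "x = b - t * (b - a)" "0 < t" "v t = Fin \<tau>" using x(1) by (auto simp: Jminus_at_def)
      then have "w t = \<tau>" by (simp add: v_Fin_iff)
      then show ?thesis using sysb[OF t(2)] x(2) t(1) by (simp add: zero_extended_def)
    qed
  qed
  ultimately show ?thesis by blast
qed

lemma unbounded_interval_ok: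
  assumes fam: "family_ok Z sg Ps" and h: "half_line d a lo hi" and cell: "cell_ok Ps lo hi cell" and p: "point_ok Ps a pa"
    and at: "\<And>\<tau>. piece_at (Fin \<tau>) = {a + d * t | t. 0 < t \<and> v t = Fin \<tau>}"
    and between: "\<And>\<alpha> \<beta>. piece_between \<alpha> \<beta> = {a + d * t | t. 0 < t \<and> \<alpha> < v t \<and> v t < \<beta>}"
  shows "partition_data (sys M Ps) piece_at piece_between (-\<infinity>) (R (unbounded_interval M Ps cell pa))"
proof -
  let ?Fs = "filter (\<lambda>F. hd (derivs_data Ps cell F) \<noteq> 0) Ps"
  define terms where "terms F = unbounded_terms (derivs_data Ps pa F)" for F
  have run: "R (unbounded_interval M Ps cell pa) = R (partition_of M None cell (map (\<lambda>F. resolved (terms F)) ?Fs))"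
    unfolding unbounded_interval_def Let_def run_bind terms_def[symmetric] run_resolve_terms by (simp add: comp_def)
  have val: "terms F \<noteq> [] \<and> w (ev F (a + d * t)) = pl (terms F) (w t)"
    if "F \<in> set Ps" "specialize \<rho> F \<noteq> 0" "0 < t" for F t
    unfolding terms_def by (rule unbounded_member_value[OF fam that(1,2) h cell p that(3)])
  have nes: "\<forall>f\<in>set (map (\<lambda>F. resolved (terms F)) ?Fs). f \<noteq> []"
    using val[of _ 1] cell_hd_zero[OF fam _ cell] by (auto simp: resolved_def)
  have xi: "a + d * t \<in> ival lo hi" if "0 < t" for t using h that by (auto simp: half_line_def ival_def)
  show ?thesis unfolding run
  proof (rule partition_data_run[OF nes])
    show "\<exists>\<tau>. \<alpha> < Fin \<tau> \<and> Fin \<tau> < \<beta> \<and> x \<in> piece_at (Fin \<tau>)" if x: "x \<in> piece_between \<alpha> \<beta>" for \<alpha> \<beta> x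
    proof -
      obtain t where t: "x = a + d * t" "0 < t" "\<alpha> < v t" "v t < \<beta>" using x by (auto simp: between)
      then have "v t = Fin (w t)" by (simp add: v_nonzero)
      then show ?thesis using t by (intro exI[of _ "w t"]) (auto simp: at)
    qed
    show "sys M Ps x = sysv M cell (map (\<lambda>F. resolved (terms F)) ?Fs) \<tau>" if x: "x \<in> piece_at (Fin \<tau>)" for x \<tau>
    proof -
      obtain t where t: "x = a + d * t" "0 < t" "v t = Fin \<tau>" using x by (auto simp: at)
      then have wt: "w t = \<tau>" by (simp add: v_Fin_iff)
      show ?thesis unfolding t(1)
        by (rule sys_eq_sysv[OF fam cell xi[OF t(2)]]) (use val t(2) wt in \<open>simp add: mn_resolved\<close>)
    qed
  qed simp
qed

lemma tab_ok_sorted: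
  assumes "tab_ok Ps tab xs" shows "sorted_wrt (<) xs"
proof -
  have ch: "chain (cell_ok Ps) (point_ok Ps) gap_ok xs None None (cells tab) (points tab) (gaps tab)"
    using assms by (simp add: tab_ok_def)
  have "xs ! i < xs ! Suc i" if "Suc i < length xs" for i
    using cell_bounds[OF chain_cell[OF ch, of "Suc i"]] that by (simp add: lower_def upper_def bounds_ok_def)
  then show ?thesis by (simp add: sorted_wrt_iff_nth_Suc_transp)
qed

lemma point_system:
  "point_ok Ps x p \<Longrightarrow> R (system_at_point M p) = sys M Ps x"
  by (rule run_system_at_point) (auto simp: point_ok_def list_all2_conv_all_nth)

text \<open>The points of the chain are sorted and form the set of all roots, so they are the list
  \<open>all_roots\<close>. Without roots all members are constant and one system serves the whole
  line.\<close>

lemma complete_tableau_ok: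
  assumes tab: "tab_ok Ps tab xs" and fam: "family_ok Z sg Ps"
  shows "is_complete_tableau v M (map (specialize \<rho>) Ps) (R (complete_tableau_tree M sg Ps tab))"
proof -
  have ch: "chain (cell_ok Ps) (point_ok Ps) gap_ok xs None None (cells tab) (points tab) (gaps tab)"
    and xs: "set xs = roots Ps" using tab by (auto simp: tab_ok_def)
  have len: "length (points tab) = length xs" "length (cells tab) = Suc (length xs)" using chain_lengths[OF ch] by simp_all
  have sorted: "sorted_wrt (<) xs" by (rule tab_ok_sorted[OF tab])
  have "{x. \<exists>F\<in>set (map (specialize \<rho>) Ps). F \<noteq> 0 \<and> poly F x = 0} = set xs" unfolding xs roots_def by auto
  then have ar: "all_roots (map (specialize \<rho>) Ps) = xs"
    unfolding all_roots_def using sorted by (simp add: sorted_list_of_set.idem_if_sorted_distinct strict_sorted_iff)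
  show ?thesis
  proof (cases "xs = []")
    case True
    then have d0: "degree F = 0" if "F \<in> set Ps" for F using roots_empty_degree_0[OF fam] that xs by auto
    have "point_ok Ps x (svals_of_constants sg Ps)" for x
      unfolding point_ok_def svals_of_constants_def list_all2_map2
    proof (rule list.rel_refl_strong)
      fix F assume F: "F \<in> set Ps"
      have "sg (coeff F 0) = sign (ev F x)" "\<nu> (coeff F 0) = w (ev F x)"
        using fam F d0[OF F] by (auto simp: family_ok_def ev_degree_0)
      then show "sval_ok (if degree F = 0 then sval (sg (coeff F 0)) (Val (coeff F 0)) else (0, None)) (ev F x)"
        using d0[OF F] by (simp add: sval_okI)
    qed
    then have "sys M Ps x = R (system_at_point M (svals_of_constants sg Ps))" for x by (rule point_system[symmetric])
    moreover have "R (complete_tableau_tree M sg Ps tab) = Rootless (R (system_at_point M (svals_of_constants sg Ps)))"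
      using True len by (simp add: complete_tableau_tree_def Let_def run_bind)
    ultimately show ?thesis unfolding is_complete_tableau_def Let_def ar using True by simp
  next
    case False
    let ?r = "length xs"
    have r: "0 < ?r" using False by simp
    have "length (points tab) \<noteq> 0" using r len by linarith
    then have pne: "points tab \<noteq> []" by (simp only: length_0_conv not_False_eq_True)
    have run: "R (complete_tableau_tree M sg Ps tab) = Tableau (map (\<lambda>p. R (system_at_point M p)) (points tab))
       (map (\<lambda>k. R (bounded_interval M Ps (cells tab ! Suc k) (points tab ! k) (points tab ! Suc k) (gaps tab ! k))) [0..<?r - 1])
       (R (unbounded_interval M Ps (hd (cells tab)) (hd (points tab))))
       (R (unbounded_interval M Ps (last (cells tab)) (last (points tab))))"
      using len by (simp add: complete_tableau_tree_def Let_def run_bind run_mapT pne)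
    have cell: "cell_ok Ps (lower None xs k) (upper xs None k) (cells tab ! k)" if "k \<le> ?r" for k
      by (rule chain_cell[OF ch that])
    have pt: "point_ok Ps (xs ! k) (points tab ! k)" if "k < ?r" for k by (rule chain_point[OF ch that])
    have at_roots: "map (\<lambda>p. R (system_at_point M p)) (points tab) = map (sys M Ps) xs"
      by (rule nth_equalityI) (use len point_system pt in auto)
    have gaps: "case map (\<lambda>k. R (bounded_interval M Ps (cells tab ! Suc k) (points tab ! k) (points tab ! Suc k) (gaps tab ! k))) [0..<?r - 1] ! k of
        (mid, near_left, near_right) \<Rightarrow> (\<forall>x\<in>J_mid v (xs ! k) (xs ! Suc k). sys M Ps x = mid) \<and>
        partition_data (sys M Ps) (Jplus_at v (xs ! k) (xs ! Suc k)) (Jplus_between v (xs ! k) (xs ! Suc k)) 0 near_left \<and>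
        partition_data (sys M Ps) (Jminus_at v (xs ! k) (xs ! Suc k)) (Jminus_between v (xs ! k) (xs ! Suc k)) 0 near_right"
      if k: "k < ?r - 1" for k
    proof -
      have k1: "Suc k < ?r" using k by linarith
      obtain mid na nb where R: "R (bounded_interval M Ps (cells tab ! Suc k) (points tab ! k) (points tab ! Suc k) (gaps tab ! k)) = (mid, na, nb)"
        using prod_cases3 by blast
      have c: "cell_ok Ps (Some (xs ! k)) (Some (xs ! Suc k)) (cells tab ! Suc k)"
        using cell[of "Suc k"] k1 by (simp add: lower_def upper_def)
      have "gap_ok (xs ! k) (xs ! Suc k) (gaps tab ! k)" using chain_gap[OF ch] k by blast
      from bounded_interval_ok[OF fam c _ _ this R] have "(\<forall>x\<in>J_mid v (xs ! k) (xs ! Suc k). sys M Ps x = mid) \<and>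
        partition_data (sys M Ps) (Jplus_at v (xs ! k) (xs ! Suc k)) (Jplus_between v (xs ! k) (xs ! Suc k)) 0 na \<and>
        partition_data (sys M Ps) (Jminus_at v (xs ! k) (xs ! Suc k)) (Jminus_between v (xs ! k) (xs ! Suc k)) 0 nb"
        using pt[of k] pt[of "Suc k"] k1 by simp
      moreover have "map (\<lambda>k. R (bounded_interval M Ps (cells tab ! Suc k) (points tab ! k) (points tab ! Suc k) (gaps tab ! k))) [0..<?r - 1] ! k = (mid, na, nb)"
        using k R by simp
      ultimately show ?thesis by simp
    qed
    have left: "partition_data (sys M Ps) (Iminus_at v (hd xs)) (Iminus_between v (hd xs)) (-\<infinity>)
        (R (unbounded_interval M Ps (hd (cells tab)) (hd (points tab))))"
    proof (rule unbounded_interval_ok[OF fam, of "-1" "hd xs" None "Some (hd xs)"])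
      have e: "hd xs = xs ! 0" "hd (cells tab) = cells tab ! 0" "hd (points tab) = points tab ! 0"
        using pne False len by (simp_all add: hd_conv_nth flip: length_greater_0_conv)
      show "half_line (- 1) (hd xs) None (Some (hd xs))" by (simp add: half_line_def)
      show "cell_ok Ps None (Some (hd xs)) (hd (cells tab))" unfolding e using cell[of 0] r by (simp add: upper_def)
      show "point_ok Ps (hd xs) (hd (points tab))" unfolding e using pt[of 0] r by simp
    qed (simp_all add: Iminus_at_def Iminus_between_def)
    have right: "partition_data (sys M Ps) (Iplus_at v (last xs)) (Iplus_between v (last xs)) (-\<infinity>)
        (R (unbounded_interval M Ps (last (cells tab)) (last (points tab))))"
    proof (rule unbounded_interval_ok[OF fam, of 1 "last xs" "Some (last xs)" None])
      have e: "last xs = xs ! (?r - 1)" "last (cells tab) = cells tab ! ?r" "last (points tab) = points tab ! (?r - 1)"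
        using pne False len by (simp_all add: last_conv_nth flip: length_greater_0_conv)
      show "half_line 1 (last xs) (Some (last xs)) None" by (simp add: half_line_def)
      show "cell_ok Ps (Some (last xs)) None (last (cells tab))" unfolding e using cell[of ?r] r by (simp add: lower_def upper_def)
      show "point_ok Ps (last xs) (last (points tab))" unfolding e using pt[of "?r - 1"] r by simp
    qed (simp_all add: Iplus_at_def Iplus_between_def)
    show ?thesis
      unfolding is_complete_tableau_def Let_def ar run tableau.case
      using r at_roots gaps left right by simp
  qed
qed

end

section \<open>The global algorithm\<close>

lemma (in rcvf) w_prod:
  "finite A \<Longrightarrow> \<forall>c\<in>A. f c \<noteq> 0 \<Longrightarrow> w (\<Prod>c\<in>A. f c) = (\<Sum>c\<in>A. w (f c))"
  by (induction A rule: finite_induct) (auto simp: w_mult)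

text \<open>Separates positive and negative exponents, \<open>k = nat k - nat (- k)\<close>; one of
  the two is always 0.\<close>

lemma (in rcvf) value_comb_eq:
  assumes "\<forall>c\<in>Poly_Mapping.keys \<mu>. eval_coef \<rho> c \<noteq> 0"
  shows "value_comb v \<rho> \<mu> = w (pos_monomial \<rho> \<mu>) - w (neg_monomial \<rho> \<mu>)"
proof -
  have z: "zmult k g = zmult (int (nat k)) g - zmult (int (nat (- k))) g" for k and g :: 'g
    by (simp add: zmult_def)
  show ?thesis
    unfolding value_comb_def pos_monomial_def neg_monomial_def using assms
    by (subst z) (simp add: w_prod w_power sum_subtractf)
qed

text \<open>The only candidate for \<open>u\<close> is \<open>p / q\<close>, whose value is the
  difference of the values.\<close>

lemma (in rcvf) divides_iff_value_le:
  assumes "p \<noteq> 0" "q \<noteq> 0"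
  shows "(\<exists>u\<in>V. p = u * q) \<longleftrightarrow> w q \<le> w p"
proof
  assume "\<exists>u\<in>V. p = u * q"
  then obtain u where u: "u \<in> V" "p = u * q" by blast
  then have "u \<noteq> 0" using assms by auto
  then show "w q \<le> w p" using u assms by (simp add: in_V_iff w_mult)
next
  assume "w q \<le> w p"
  then have "p / q \<in> V" using assms by (simp add: in_V_iff w_divide)
  then show "\<exists>u\<in>V. p = u * q" using assms by (intro bexI[of _ "p / q"]) auto
qed

lemma val_tests_bind: "val_tests (bind_dtree t f) = val_tests t \<union> (\<Union>x\<in>results t. val_tests (f x))"
  by (induction t) auto

lemma finite_val_tests: "finite (val_tests t)"
  by (induction t) auto

lemma val_tests_rem_tree: "rem_tree Z N Fs T \<Longrightarrow> val_tests T = {}"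
  by (induction rule: rem_tree.induct) auto

lemma val_tests_ask_signs: "val_tests (ask_signs cs) = {}"
  by (induction cs) (auto simp: val_tests_bind)

lemma run_ask_signs:
  "run v \<rho> (ask_signs cs) = (\<lambda>c. if c \<in> set cs then sign (eval_coef \<rho> c) else 0)"
  by (induction cs) (auto simp: run_bind sign_def)

abbreviation family_constants :: "'r::linordered_field coef poly list \<Rightarrow> 'r coef list" where
  "family_constants Ps \<equiv> map (\<lambda>P. coeff P 0) (filter (\<lambda>P. degree P = 0) Ps)"

lemma run_global_tree:
  assumes "run v \<rho> T = (Z, Ps)" "run v \<rho> (ask_signs (family_constants Ps)) = sg"
  shows "run v \<rho> (global_tree M T) = (Ps, run v \<rho> (complete_tableau_tree M sg Ps (rcvf2 Z sg Ps)))"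
  by (simp add: global_tree_def rcvf3_def run_bind assms)

lemma val_tests_global_tree:
  assumes "rem_tree Z\<^sub>0 N Fs T"
  shows "val_tests (global_tree M T) = (\<Union>(Z, Ps)\<in>results T. \<Union>sg\<in>results (ask_signs (family_constants Ps)).
    val_tests (complete_tableau_tree M sg Ps (rcvf2 Z sg Ps)))"
  by (simp add: global_tree_def rcvf3_def val_tests_bind val_tests_rem_tree[OF assms] val_tests_ask_signs case_prod_unfold)

text \<open>With nothing decided, only 0 is known to be zero and only scalar multiples of 1 are
  known to be nonzero.\<close>

lemma state_ok_initial: "state_ok {} {} (remdups (L :: 'r::linordered_field coef poly list))"
proof -
  have "Poly_Mapping.single (0 :: nat \<Rightarrow>\<^sub>0 nat) a \<noteq> 0" if "a \<noteq> 0" for a :: 'r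
    using that by (metis lookup_single_eq lookup_zero)
  then show ?thesis
    by (auto simp: state_ok_def consistent_def reduced_def known_zero_def proportional_def)
qed

lemma active_constants_subset:
  assumes "(Z, Ps) \<in> results T"
  shows "active_constants sg Ps \<subseteq> constants T"
  using assms unfolding active_constants_def constants_def by blast

lemma tableau_val_tree:
  assumes "closed_family Z Ps"
  shows "val_tree (active_constants sg Ps) (\<lambda>_. True) (complete_tableau_tree M sg Ps (rcvf2 Z sg Ps))"
  using rcvf2_wf[OF assms order_refl] val_tree_complete_tableau[OF assms order_refl] by blast

lemma finite_constants: "finite (constants T)"
proof -
  have "constants T \<subseteq> (\<Union>(Z, Fs)\<in>results T. (\<lambda>P. coeff P 0) ` set Fs)"
    unfolding constants_def by auto
  then show ?thesis by (rule finite_subset) (auto simp: finite_results)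
qed

lemma (in rcvf_point) run_global_tree_ok:
  assumes T: "rem_tree {} {} Fs T" and ok: "state_ok {} {} Fs" and run: "run v \<rho> T = (Z, Ps)"
  shows "\<exists>tab. run v \<rho> (global_tree M T) = (Ps, tab) \<and> is_complete_tableau v M (map (specialize \<rho>) Ps) tab"
proof -
  define sg where "sg = run v \<rho> (ask_signs (family_constants Ps))"
  have "closed_family Z Ps" using rem_tree_closed_family[OF T ok] run_in_results[of v \<rho> T] run by simp
  moreover have "sg (coeff F 0) = sign (eval_coef \<rho> (coeff F 0))" if "F \<in> set Ps" "degree F = 0" for F
    using that by (auto simp: sg_def run_ask_signs)
  ultimately have fam: "family_ok Z sg Ps"
    using rem_tree_run[OF T _ _ run] by (auto simp: family_ok_def)
  obtain xs where "tab_ok Ps (rcvf2 Z sg Ps) xs" using rcvf2_ok[OF fam] by blast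
  from complete_tableau_ok[OF this fam] show ?thesis
    using run_global_tree[OF run sg_def[symmetric]] by blast
qed

text \<open>Three layers: the zero tests depend on the vanishing of constants by
  \<open>rem_tree_run_cong\<close>, the sign tests concern constants of the leaf reached, and the
  valuation tests of the resulting tableau tree involve active constants only.\<close>

lemma run_global_tree_cong:
  assumes T: "rem_tree {} {} Fs T" and ok: "state_ok {} {} Fs"
    and signs: "\<forall>c\<in>constants T. sign (eval_coef \<rho> c) = sign (eval_coef \<rho>' c)"
    and vals: "\<forall>\<mu>\<in>val_tests (global_tree M T). (\<forall>c\<in>Poly_Mapping.keys \<mu>. eval_coef \<rho> c \<noteq> 0) \<longrightarrow>
      sign (value_comb v \<rho> \<mu>) = sign (value_comb v \<rho>' \<mu>)"
  shows "run v \<rho> (global_tree M T) = run v \<rho>' (global_tree M T)"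
proof -
  obtain Z Ps where run: "run v \<rho> T = (Z, Ps)" by fastforce
  have "eval_coef \<rho> c = 0 \<longleftrightarrow> eval_coef \<rho>' c = 0" if "c \<in> constants T" for c
    using signs that by (metis sign_eq_0_iff)
  then have run': "run v \<rho>' T = (Z, Ps)" using rem_tree_run_cong[OF T ok] run by metis
  have leaf: "(Z, Ps) \<in> results T" using run_in_results[of v \<rho> T] run by simp
  define sg where "sg = run v \<rho> (ask_signs (family_constants Ps))"
  have "set (family_constants Ps) \<subseteq> constants T" unfolding constants_def using leaf by auto
  then have sg': "run v \<rho>' (ask_signs (family_constants Ps)) = sg"
    using signs unfolding sg_def run_ask_signs by (intro ext) auto
  have "run v \<rho> (complete_tableau_tree M sg Ps (rcvf2 Z sg Ps)) =
    run v \<rho>' (complete_tableau_tree M sg Ps (rcvf2 Z sg Ps))"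
  proof (rule val_tree_run_cong[OF tableau_val_tree[OF rem_tree_closed_family[OF T ok leaf]]])
    fix \<mu> assume \<mu>: "\<mu> \<in> val_tests (complete_tableau_tree M sg Ps (rcvf2 Z sg Ps))"
    have "sg \<in> results (ask_signs (family_constants Ps))" unfolding sg_def by (rule run_in_results)
    then have "\<mu> \<in> val_tests (global_tree M T)" unfolding val_tests_global_tree[OF T] using leaf \<mu> by blast
    moreover have "Poly_Mapping.keys \<mu> \<subseteq> active_constants sg Ps"
      by (rule val_tree_val_tests[OF tableau_val_tree[OF rem_tree_closed_family[OF T ok leaf]] \<mu>])
    \<comment> \<open>Active constants have nonzero sign at \<open>\<rho>\<close>, so the hypothesis
      on the tests applies to \<open>\<mu>\<close>.\<close>
    then have "\<forall>c\<in>Poly_Mapping.keys \<mu>. eval_coef \<rho> c \<noteq> 0"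
      unfolding active_constants_def sg_def run_ask_signs by (auto split: if_splits)
    ultimately show "sign (value_comb v \<rho> \<mu>) = sign (value_comb v \<rho>' \<mu>)" using vals by blast
  qed
  then show ?thesis
    unfolding run_global_tree[OF run sg_def[symmetric]] run_global_tree[OF run' sg'] by simp
qed

text \<open>The agreement of valuation tests is asked only where all constants concerned are
  nonzero. Elsewhere \<open>value_comb\<close> would use the default 0 of
  \<open>finite_value\<close>, and such a test is met on no branch followed by the parameter
  point.\<close>

theorem theorem3p1p3:
  fixes K V V\<^sub>R :: "'r::linordered_field set"
    and v :: "'r \<Rightarrow> 'g::linordered_ab_group_add extended"
    and L :: "'r coef poly list"
    and M :: nat
  assumes "real_closed_valued_field V\<^sub>R"
    and "ordered_valued_subfield K V V\<^sub>R"
    and "is_valuation v V\<^sub>R"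
    and "\<forall>F\<in>set L. \<forall>i. coef_over K (coeff F i)"
    and "0 < M"
  shows "\<exists>T. rem_tree {} {} (remdups L) T \<and>
    (let C = constants T; A = global_tree M T; S = val_tests A in
      finite C \<and> (\<forall>c\<in>C. coef_over K c) \<and>
      finite (results A) \<and>
      (\<forall>\<rho>. run v \<rho> A \<in> results A \<and>
        (case run v \<rho> A of (Fs, tab) \<Rightarrow>
          (\<exists>Z. (Z, Fs) \<in> results T) \<and> is_complete_tableau v M (map (specialize \<rho>) Fs) tab)) \<and>
      finite S \<and> (\<forall>\<mu>\<in>S. Poly_Mapping.keys \<mu> \<subseteq> C) \<and>
      (\<forall>\<rho> \<rho>'.
        (\<forall>c\<in>C. sign (eval_coef \<rho> c) = sign (eval_coef \<rho>' c)) \<and>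
        (\<forall>\<mu>\<in>S. (\<forall>c\<in>Poly_Mapping.keys \<mu>. eval_coef \<rho> c \<noteq> 0) \<longrightarrow>
           sign (value_comb v \<rho> \<mu>) = sign (value_comb v \<rho>' \<mu>)) \<longrightarrow>
        run v \<rho> A = run v \<rho>' A) \<and>
      (\<forall>\<rho>. \<forall>\<mu>\<in>S. (\<forall>c\<in>Poly_Mapping.keys \<mu>. eval_coef \<rho> c \<noteq> 0) \<longrightarrow>
        (0 \<le> value_comb v \<rho> \<mu> \<longleftrightarrow>
           (\<exists>w\<in>V\<^sub>R. pos_monomial \<rho> \<mu> = w * neg_monomial \<rho> \<mu>)) \<and>
        (value_comb v \<rho> \<mu> \<le> 0 \<longleftrightarrow>
           (\<exists>w\<in>V\<^sub>R. neg_monomial \<rho> \<mu> = w * pos_monomial \<rho> \<mu>))))"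
proof -
  have rcvf: "rcvf v V\<^sub>R" using assms(1,3) by (simp add: rcvf_def)
  have K: "is_subfield K" using assms(2) by (simp add: ordered_valued_subfield_def ordered_valued_field_def)
  have ok: "state_ok {} {} (remdups L)" by (rule state_ok_initial)
  obtain T where T: "rem_tree {} {} (remdups L) T" using rem_tree_exists[OF ok] by blast
  have "\<forall>P\<in>set (remdups L). poly_over K P" using assms(4) by (simp add: poly_over_def)
  then have over: "\<forall>c\<in>constants T. coef_over K c"
    using rem_tree_poly_over[OF K T] unfolding constants_def poly_over_def by blast
  have out: "run v \<rho> (global_tree M T) \<in> results (global_tree M T) \<and>
    (case run v \<rho> (global_tree M T) of (Fs, tab) \<Rightarrow>
      (\<exists>Z. (Z, Fs) \<in> results T) \<and> is_complete_tableau v M (map (specialize \<rho>) Fs) tab)" for \<rho>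
  proof -
    interpret rcvf_point v V\<^sub>R \<rho> using rcvf by (simp add: rcvf_point_def)
    obtain Z Ps where run: "run v \<rho> T = (Z, Ps)" by fastforce
    obtain tab where "run v \<rho> (global_tree M T) = (Ps, tab)"
      "is_complete_tableau v M (map (specialize \<rho>) Ps) tab"
      using run_global_tree_ok[OF T ok run] by blast
    moreover have "(Z, Ps) \<in> results T" using run_in_results[of v \<rho> T] run by simp
    ultimately show ?thesis using run_in_results[of v \<rho> "global_tree M T"] by auto
  qed
  have keys: "Poly_Mapping.keys \<mu> \<subseteq> constants T" if \<mu>: "\<mu> \<in> val_tests (global_tree M T)" for \<mu>
  proof -
    obtain Z Ps sg where leaf: "(Z, Ps) \<in> results T"
      and \<mu>': "\<mu> \<in> val_tests (complete_tableau_tree M sg Ps (rcvf2 Z sg Ps))"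
      using \<mu> unfolding val_tests_global_tree[OF T] by blast
    have "Poly_Mapping.keys \<mu> \<subseteq> active_constants sg Ps"
      by (rule val_tree_val_tests[OF tableau_val_tree[OF rem_tree_closed_family[OF T ok leaf]] \<mu>'])
    then show ?thesis using active_constants_subset[OF leaf] by blast
  qed
  have monomials: "(0 \<le> value_comb v \<rho> \<mu> \<longleftrightarrow> (\<exists>w\<in>V\<^sub>R. pos_monomial \<rho> \<mu> = w * neg_monomial \<rho> \<mu>)) \<and>
    (value_comb v \<rho> \<mu> \<le> 0 \<longleftrightarrow> (\<exists>w\<in>V\<^sub>R. neg_monomial \<rho> \<mu> = w * pos_monomial \<rho> \<mu>))"
    if nz: "\<forall>c\<in>Poly_Mapping.keys \<mu>. eval_coef \<rho> c \<noteq> 0" for \<rho> \<mu>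
  proof -
    interpret rcvf v V\<^sub>R by (rule rcvf)
    have "pos_monomial \<rho> \<mu> \<noteq> 0" "neg_monomial \<rho> \<mu> \<noteq> 0"
      using nz by (simp_all add: pos_monomial_def neg_monomial_def)
    then show ?thesis unfolding value_comb_eq[OF nz] by (simp add: divides_iff_value_le)
  qed
  show ?thesis
    unfolding Let_def
  proof (rule exI[of _ T], intro conjI)
    show "rem_tree {} {} (remdups L) T" by (rule T)
    show "\<forall>\<rho> \<rho>'. (\<forall>c\<in>constants T. sign (eval_coef \<rho> c) = sign (eval_coef \<rho>' c)) \<and>
        (\<forall>\<mu>\<in>val_tests (global_tree M T). (\<forall>c\<in>Poly_Mapping.keys \<mu>. eval_coef \<rho> c \<noteq> 0) \<longrightarrow>
          sign (value_comb v \<rho> \<mu>) = sign (value_comb v \<rho>' \<mu>)) \<longrightarrow>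
        run v \<rho> (global_tree M T) = run v \<rho>' (global_tree M T)"
      using run_global_tree_cong[OF T ok] by metis
    show "\<forall>\<rho>. \<forall>\<mu>\<in>val_tests (global_tree M T). (\<forall>c\<in>Poly_Mapping.keys \<mu>. eval_coef \<rho> c \<noteq> 0) \<longrightarrow>
        (0 \<le> value_comb v \<rho> \<mu> \<longleftrightarrow> (\<exists>w\<in>V\<^sub>R. pos_monomial \<rho> \<mu> = w * neg_monomial \<rho> \<mu>)) \<and>
        (value_comb v \<rho> \<mu> \<le> 0 \<longleftrightarrow> (\<exists>w\<in>V\<^sub>R. neg_monomial \<rho> \<mu> = w * pos_monomial \<rho> \<mu>))"
      by (intro allI ballI impI) (rule monomials)
  qed (use over out keys in \<open>simp_all add: finite_constants finite_results finite_val_tests\<close>)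
qed

end
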